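(* Let $G$ be a compact Lie group and $0<r\leq 1$. Let $A$ be a linear continuous operator from $C^\infty(G)$ to $\mathcal D'(G)$ with matrix symbol $\sigma_A(x,\xi)$. Let $1\leq p_1,p_2<\infty$ and $\widetilde{p_1}=\min\{2,p_1\}$. Suppose that $$\sum_{[\xi]\in\widehat G}d_{\xi}^{\,2+\frac{r}{\widetilde{p_1}}}\,\Big\|\,\|(\sigma_A(x,\xi))^t\|_{op(\ell^{\infty},\ell^{\infty})}\Big\|_{L^{p_2}(G)}^r<\infty,$$ where the $L^{p_2}(G)$-norm is taken with respect to $x$. Then $A$ extends to an $r$-nuclear operator $A:L^{p_1}(G)\to L^{p_2}(G)$.
   Context: $G$ carries its normalised Haar measure. $\widehat G$ is the set of equivalence classes of continuous irreducible unitary representations of $G$; for each $[\xi]\in\widehat G$ one fixes a representative viewed, via an orthonormal basis of its representation space, as a unitary-matrix-valued function $\xi:G\to\mathbb C^{d_\xi\times d_\xi}$, where $d_\xi$ is its dimension. The matrix-valued symbol of a linear continuous operator $A$ from $C^\infty(G)$ to $\mathcal D'(G)$ is $\sigma_A(x,\xi):=\xi(x)^*(A\xi)(x)\in\mathbb C^{d_\xi\times d_\xi}$, where $(A\xi)_{ij}=A(\xi_{ij})$; then $Af(x)=\sum_{[\xi]\in\widehat G}d_\xi\operatorname{Tr}(\xi(x)\sigma_A(x,\xi)\widehat f(\xi))$ (in the sense of distributions, for $f\in C^\infty(G)$) with $\widehat f(\xi)=\int_G f(x)\xi(x)^*dx$. The hypothesis implicitly includes that the entries of $\sigma_A(\cdot,\xi)$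 are functions in $L^{p_2}(G)$; no further regularity in $x$ is assumed. $M^t$ is the transpose of $M$. For $B\in\mathbb C^{d\times d}$, $\|B\|_{op(\ell^\infty,\ell^\infty)}:=\max_{1\le i\le d}\sum_{j=1}^d|B_{ij}|$. For $0<r\le1$ and Banach spaces $E,F$, a linear operator $T:E\to F$ is $r$-nuclear if there are sequences $(x_n')$ in $E'$ and $(y_n)$ in $F$ with $Tx=\sum_{n=1}^\infty\langle x,x_n'\rangle y_n$ for all $x\in E$ and $\sum_{n=1}^\infty\|x_n'\|_{E'}^r\|y_n\|_F^r<\infty$. *)

theory Defs
  imports
    "HOL-Analysis.Analysis"
    "HOL-Probability.Probability_Measure"
    "Jordan_Normal_Form.Schur_Decomposition"
begin

section \<open>Smooth manifolds\<close>

text \<open>Charts take values in the library's \<^term>\<open>Euclidean_space n\<close>, that is, in sequences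
  vanishing from index \<open>n\<close> on. Unlike a Euclidean type class this allows \<open>n = 0\<close>, so that finite
  groups are compact Lie groups.\<close>

definition partial_deriv :: "nat \<Rightarrow> ((nat \<Rightarrow> real) \<Rightarrow> 'b::real_normed_vector) \<Rightarrow> (nat \<Rightarrow> real) \<Rightarrow> 'b"
  where "partial_deriv i f z = vector_derivative (\<lambda>t. f (z(i := t))) (at (z i))"

definition partial_derivs :: "nat list \<Rightarrow> ((nat \<Rightarrow> real) \<Rightarrow> 'b::real_normed_vector) \<Rightarrow> (nat \<Rightarrow> real) \<Rightarrow> 'b"
  where "partial_derivs is f = foldr partial_deriv is f"

text \<open>\<open>C\<^sup>\<infinity>\<close> on a set \<open>V\<close> that is open in \<^term>\<open>Euclidean_space n\<close>: all iterated partial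
  derivatives exist and are continuous.\<close>

definition smooth_on :: "nat \<Rightarrow> (nat \<Rightarrow> real) set \<Rightarrow> ((nat \<Rightarrow> real) \<Rightarrow> 'b::real_normed_vector) \<Rightarrow> bool"
  where "smooth_on n V f \<longleftrightarrow>
    (\<forall>is. set is \<subseteq> {..<n} \<longrightarrow>
      continuous_on V (partial_derivs is f) \<and>
      (\<forall>i<n. \<forall>z\<in>V. (\<lambda>t. partial_derivs is f (z(i := t))) differentiable (at (z i))))"

type_synonym 'm atlas = "('m set \<times> ('m \<Rightarrow> nat \<Rightarrow> real)) set"

definition smooth_atlas :: "nat \<Rightarrow> 'm::topological_space atlas \<Rightarrow> bool"
  where "smooth_atlas n \<A> \<longleftrightarrow>
    (\<forall>(U,\<phi>)\<in>\<A>. open U \<and> openin (Euclidean_space n) (\<phi> ` U) \<and>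
        homeomorphism U (\<phi> ` U) \<phi> (inv_into U \<phi>)) \<and>
    (\<Union>(U,\<phi>)\<in>\<A>. U) = UNIV \<and>
    (\<forall>(U,\<phi>)\<in>\<A>. \<forall>(V,\<psi>)\<in>\<A>. \<forall>j<n. smooth_on n (\<phi> ` (U \<inter> V)) (\<lambda>z. \<psi> (inv_into U \<phi> z) j))"

definition prod_atlas :: "nat \<Rightarrow> 'm atlas \<Rightarrow> 'k atlas \<Rightarrow> ('m \<times> 'k) atlas"
  where "prod_atlas n \<A> \<B> =
    {(U \<times> V, \<lambda>(x,y) i. if i < n then \<phi> x i else \<psi> y (i - n)) | U \<phi> V \<psi>. (U,\<phi>) \<in> \<A> \<and> (V,\<psi>) \<in> \<B>}"

definition smooth_map ::
    "nat \<Rightarrow> 'm::topological_space atlas \<Rightarrow> nat \<Rightarrow> 'k::topological_space atlas \<Rightarrow> ('m \<Rightarrow> 'k) \<Rightarrow> bool"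
  where "smooth_map m \<A> n \<B> f \<longleftrightarrow>
    continuous_on UNIV f \<and>
    (\<forall>(U,\<phi>)\<in>\<A>. \<forall>(V,\<psi>)\<in>\<B>. \<forall>j<n.
        smooth_on m (\<phi> ` (U \<inter> f -` V)) (\<lambda>z. \<psi> (f (inv_into U \<phi> z)) j))"

section \<open>Compact Lie groups\<close>

locale compact_lie_group = Groups.group mul e iv
  for mul :: "'g::{t2_space, second_countable_topology} \<Rightarrow> 'g \<Rightarrow> 'g" and e :: 'g and iv :: "'g \<Rightarrow> 'g" +
  fixes n :: nat and \<A> :: "'g atlas"
  assumes compact_UNIV: "compact (UNIV :: 'g set)"
    and atlas: "smooth_atlas n \<A>"
    and smooth_mul: "smooth_map (n + n) (prod_atlas n \<A> \<A>) n \<A> (\<lambda>(x,y). mul x y)"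
    and smooth_iv: "smooth_map n \<A> n \<A> iv"

definition normalised_haar :: "('g::topological_space \<Rightarrow> 'g \<Rightarrow> 'g) \<Rightarrow> 'g measure \<Rightarrow> bool"
  where "normalised_haar mul \<mu> \<longleftrightarrow>
    sets \<mu> = sets borel \<and> prob_space \<mu> \<and> (\<forall>a. distr \<mu> \<mu> (mul a) = \<mu>)"

section \<open>Test functions and distributions\<close>

definition smooth_funs :: "nat \<Rightarrow> 'm::topological_space atlas \<Rightarrow> ('m \<Rightarrow> complex) set"
  where "smooth_funs n \<A> = {f. \<forall>(U,\<phi>)\<in>\<A>. smooth_on n (\<phi> ` U) (f \<circ> inv_into U \<phi>)}"

text \<open>The Frechet topology: uniform convergence of every iterated partial derivative on compact
  subsets of chart images. (An open ball of one of the defining seminorms may be written pointwise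
  because a continuous function attains its maximum on \<open>K\<close>.)\<close>

definition smooth_topology :: "nat \<Rightarrow> 'm::topological_space atlas \<Rightarrow> ('m \<Rightarrow> complex) topology"
  where "smooth_topology n \<A> = topology_generated_by
    {{g \<in> smooth_funs n \<A>. \<forall>z\<in>K.
        cmod (partial_derivs is (g \<circ> inv_into U \<phi>) z - partial_derivs is (f \<circ> inv_into U \<phi>) z) < \<epsilon>}
     | f U \<phi> K is \<epsilon>. f \<in> smooth_funs n \<A> \<and> (U,\<phi>) \<in> \<A> \<and> compact K \<and> K \<subseteq> \<phi> ` U \<and>
         set is \<subseteq> {..<n} \<and> \<epsilon> > 0}"

text \<open>Distributions are the continuous linear functionals on \<^const>\<open>smooth_funs\<close>; their values at
  non-smooth arguments are irrelevant. The space of distributions carries the weak-* topology.\<close>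

definition distributions :: "nat \<Rightarrow> 'm::topological_space atlas \<Rightarrow> (('m \<Rightarrow> complex) \<Rightarrow> complex) set"
  where "distributions n \<A> = {u.
    (\<forall>f\<in>smooth_funs n \<A>. \<forall>g\<in>smooth_funs n \<A>. \<forall>a b.
        u (\<lambda>x. a * f x + b * g x) = a * u f + b * u g) \<and>
    continuous_map (smooth_topology n \<A>) euclidean u}"

definition distribution_topology ::
    "nat \<Rightarrow> 'm::topological_space atlas \<Rightarrow> (('m \<Rightarrow> complex) \<Rightarrow> complex) topology"
  where "distribution_topology n \<A> = topology_generated_by
    {{u \<in> distributions n \<A>. u \<phi> \<in> V} | \<phi> V. \<phi> \<in> smooth_funs n \<A> \<and> open V}"

definition fun_distribution :: "'m measure \<Rightarrow> ('m \<Rightarrow> complex) \<Rightarrow> ('m \<Rightarrow> complex) \<Rightarrow> complex"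
  where "fun_distribution \<mu> f \<phi> = (\<integral>x. f x * \<phi> x \<partial>\<mu>)"

definition mult_distribution ::
    "('m \<Rightarrow> complex) \<Rightarrow> (('m \<Rightarrow> complex) \<Rightarrow> complex) \<Rightarrow> ('m \<Rightarrow> complex) \<Rightarrow> complex"
  where "mult_distribution \<psi> u \<phi> = u (\<lambda>x. \<psi> x * \<phi> x)"

definition continuous_linear_operator ::
    "nat \<Rightarrow> 'm::topological_space atlas \<Rightarrow> (('m \<Rightarrow> complex) \<Rightarrow> ('m \<Rightarrow> complex) \<Rightarrow> complex) \<Rightarrow> bool"
  where "continuous_linear_operator n \<A> A \<longleftrightarrow>
    (\<forall>f\<in>smooth_funs n \<A>. A f \<in> distributions n \<A>) \<and>
    (\<forall>f\<in>smooth_funs n \<A>. \<forall>g\<in>smooth_funs n \<A>. \<forall>a b. \<forall>\<phi>\<in>smooth_funs n \<A>.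
        A (\<lambda>x. a * f x + b * g x) \<phi> = a * A f \<phi> + b * A g \<phi>) \<and>
    continuous_map (smooth_topology n \<A>) (distribution_topology n \<A>) A"

section \<open>The unitary dual and matrix-valued symbols\<close>

definition unitary_rep :: "('g::topological_space \<Rightarrow> 'g \<Rightarrow> 'g) \<Rightarrow> nat \<Rightarrow> ('g \<Rightarrow> complex mat) \<Rightarrow> bool"
  where "unitary_rep mul d \<xi> \<longleftrightarrow>
    (\<forall>x. \<xi> x \<in> carrier_mat d d \<and> mat_adjoint (\<xi> x) * \<xi> x = 1\<^sub>m d) \<and>
    (\<forall>x y. \<xi> (mul x y) = \<xi> x * \<xi> y) \<and>
    (\<forall>i<d. \<forall>j<d. continuous_on UNIV (\<lambda>x. \<xi> x $$ (i,j)))"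

definition irreducible_rep :: "nat \<Rightarrow> ('g \<Rightarrow> complex mat) \<Rightarrow> bool"
  where "irreducible_rep d \<xi> \<longleftrightarrow> d > 0 \<and>
    (\<forall>W. VectorSpace.subspace class_ring W (module_vec TYPE(complex) d) \<and>
        (\<forall>x. \<forall>w\<in>W. \<xi> x *\<^sub>v w \<in> W) \<longrightarrow> W = {0\<^sub>v d} \<or> W = carrier_vec d)"

definition equivalent_reps :: "nat \<Rightarrow> ('g \<Rightarrow> complex mat) \<Rightarrow> ('g \<Rightarrow> complex mat) \<Rightarrow> bool"
  where "equivalent_reps d \<xi> \<eta> \<longleftrightarrow>
    (\<exists>S \<in> carrier_mat d d. mat_adjoint S * S = 1\<^sub>m d \<and> (\<forall>x. S * \<xi> x = \<eta> x * S))"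

definition rep_dim :: "'g \<Rightarrow> ('g \<Rightarrow> complex mat) \<Rightarrow> nat"
  where "rep_dim e \<xi> = dim_row (\<xi> e)"

text \<open>\<open>D\<close> consists of exactly one matrix representative of each equivalence class of continuous
  irreducible unitary representations. Irreducible unitary representations of a compact group are
  finite-dimensional, hence given by matrices in an orthonormal basis.\<close>

definition unitary_dual :: "('g::topological_space \<Rightarrow> 'g \<Rightarrow> 'g) \<Rightarrow> 'g \<Rightarrow> ('g \<Rightarrow> complex mat) set \<Rightarrow> bool"
  where "unitary_dual mul e D \<longleftrightarrow>
    (\<forall>\<xi>\<in>D. unitary_rep mul (rep_dim e \<xi>) \<xi> \<and> irreducible_rep (rep_dim e \<xi>) \<xi>) \<and>
    (\<forall>d \<eta>. unitary_rep mul d \<eta> \<and> irreducible_rep d \<eta> \<longrightarrow>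
        (\<exists>!\<xi>. \<xi> \<in> D \<and> rep_dim e \<xi> = d \<and> equivalent_reps d \<xi> \<eta>))"

text \<open>\<open>\<sigma>(x,\<xi>) = \<xi>(x)\<^sup>* (A\<xi>)(x)\<close> with \<open>(A\<xi>)\<^sub>k\<^sub>j = A(\<xi>\<^sub>k\<^sub>j)\<close>, an identity of distributions whose
  left-hand side is a function.\<close>

definition matrix_symbol ::
    "'g::topological_space measure \<Rightarrow> nat \<Rightarrow> 'g atlas \<Rightarrow> 'g \<Rightarrow> ('g \<Rightarrow> complex mat) set \<Rightarrow>
     (('g \<Rightarrow> complex) \<Rightarrow> ('g \<Rightarrow> complex) \<Rightarrow> complex) \<Rightarrow> ('g \<Rightarrow> ('g \<Rightarrow> complex mat) \<Rightarrow> complex mat) \<Rightarrow> bool"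
  where "matrix_symbol \<mu> n \<A> e D A \<sigma> \<longleftrightarrow>
    (\<forall>\<xi>\<in>D. (\<forall>x. \<sigma> x \<xi> \<in> carrier_mat (rep_dim e \<xi>) (rep_dim e \<xi>)) \<and>
      (\<forall>i<rep_dim e \<xi>. \<forall>j<rep_dim e \<xi>.
        integrable \<mu> (\<lambda>x. \<sigma> x \<xi> $$ (i,j)) \<and>
        (\<forall>\<phi>\<in>smooth_funs n \<A>.
          fun_distribution \<mu> (\<lambda>x. \<sigma> x \<xi> $$ (i,j)) \<phi> =
          (\<Sum>k<rep_dim e \<xi>.
            mult_distribution (\<lambda>x. mat_adjoint (\<xi> x) $$ (i,k)) (A (\<lambda>x. \<xi> x $$ (k,j))) \<phi>))))"

definition op_norm_inf :: "complex mat \<Rightarrow> real"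
  where "op_norm_inf B = Max ((\<lambda>i. \<Sum>j<dim_col B. cmod (B $$ (i,j))) ` {..<dim_row B})"

section \<open>Lebesgue spaces and nuclear operators\<close>

text \<open>\<open>L\<^sup>p\<close> is handled through its representatives: the space of \<open>p\<close>-integrable functions with the
  \<open>L\<^sup>p\<close>-seminorm, whose quotient by the null functions is the Banach space. Accordingly identities
  between vectors are required up to vectors of seminorm 0, and a bounded functional on the
  seminormed space is the same as an element of the dual of the quotient.\<close>

definition Lp_space :: "'a measure \<Rightarrow> real \<Rightarrow> ('a \<Rightarrow> complex) set"
  where "Lp_space M p = {f \<in> borel_measurable M. integrable M (\<lambda>x. cmod (f x) powr p)}"

definition Lp_norm :: "'a measure \<Rightarrow> real \<Rightarrow> ('a \<Rightarrow> 'b::real_normed_vector) \<Rightarrow> real"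
  where "Lp_norm M p f = (\<integral>x. norm (f x) powr p \<partial>M) powr (1 / p)"

definition dual_space ::
    "('a \<Rightarrow> complex) set \<Rightarrow> (('a \<Rightarrow> complex) \<Rightarrow> real) \<Rightarrow> (('a \<Rightarrow> complex) \<Rightarrow> complex) set"
  where "dual_space E N = {u.
    (\<forall>f\<in>E. \<forall>g\<in>E. \<forall>a b. u (\<lambda>x. a * f x + b * g x) = a * u f + b * u g) \<and>
    (\<exists>C. \<forall>f\<in>E. cmod (u f) \<le> C * N f)}"

definition dual_norm ::
    "('a \<Rightarrow> complex) set \<Rightarrow> (('a \<Rightarrow> complex) \<Rightarrow> real) \<Rightarrow> (('a \<Rightarrow> complex) \<Rightarrow> complex) \<Rightarrow> real"
  where "dual_norm E N u = (SUP f\<in>{f \<in> E. N f \<le> 1}. cmod (u f))"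

definition linear_operator ::
    "('a \<Rightarrow> complex) set \<Rightarrow> (('a \<Rightarrow> complex) \<Rightarrow> real) \<Rightarrow> ('b \<Rightarrow> complex) set \<Rightarrow> (('b \<Rightarrow> complex) \<Rightarrow> real) \<Rightarrow>
     (('a \<Rightarrow> complex) \<Rightarrow> ('b \<Rightarrow> complex)) \<Rightarrow> bool"
  where "linear_operator E N F N' T \<longleftrightarrow>
    (\<forall>f\<in>E. T f \<in> F) \<and>
    (\<forall>f\<in>E. \<forall>g\<in>E. N (\<lambda>x. f x - g x) = 0 \<longrightarrow> N' (\<lambda>x. T f x - T g x) = 0) \<and>
    (\<forall>f\<in>E. \<forall>g\<in>E. \<forall>a b. N' (\<lambda>y. T (\<lambda>x. a * f x + b * g x) y - (a * T f y + b * T g y)) = 0)"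

definition r_nuclear ::
    "real \<Rightarrow> ('a \<Rightarrow> complex) set \<Rightarrow> (('a \<Rightarrow> complex) \<Rightarrow> real) \<Rightarrow>
     ('b \<Rightarrow> complex) set \<Rightarrow> (('b \<Rightarrow> complex) \<Rightarrow> real) \<Rightarrow> (('a \<Rightarrow> complex) \<Rightarrow> ('b \<Rightarrow> complex)) \<Rightarrow> bool"
  where "r_nuclear r E N F N' T \<longleftrightarrow>
    linear_operator E N F N' T \<and>
    (\<exists>u v. (\<forall>k::nat. u k \<in> dual_space E N \<and> v k \<in> F) \<and>
      (\<forall>f\<in>E. (\<lambda>m. N' (\<lambda>y. T f y - (\<Sum>k<m. u k f * v k y))) \<longlonglongrightarrow> 0) \<and>
      summable (\<lambda>k. dual_norm E N (u k) powr r * N' (v k) powr r))"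

end

theory Submission
  imports Defs
begin

text \<open>The extension is the Fourier series \<open>T f = \<Sum>\<^sub>\<xi> \<Sum>\<^sub>i\<^sub>j \<langle>f, \<xi>\<^sub>i\<^sub>j\<rangle> d\<^sub>\<xi> (\<xi> \<sigma>(\<cdot>,\<xi>))\<^sub>i\<^sub>j\<close>. Schur
  orthogonality and Hoelder's inequality bound the functional \<open>\<langle>\<cdot>, \<xi>\<^sub>i\<^sub>j\<rangle>\<close> on \<open>L\<close>-\<open>p\<^sub>1\<close> by
  \<open>d\<^sub>\<xi>\<close> to the power \<open>1 / min 2 p\<^sub>1 - 1\<close>, and unitarity bounds \<open>(\<xi> \<sigma>)\<^sub>i\<^sub>j\<close> by the operator norm of the
  transposed symbol; the \<open>d\<^sub>\<xi>\<close>-squared many terms belonging to \<open>\<xi>\<close> then contribute at most the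
  summand of the hypothesis. On matrix coefficients \<open>T\<close> agrees with \<open>A\<close> by the definition of the symbol.
  To pass to all smooth \<open>f\<close>, approximate \<open>f\<close> in the Frechet topology by \<open>(g * g) * f\<close> with a bump function
  \<open>g\<close>: the Fourier series of \<open>g * g\<close> converges uniformly, so \<open>(g * g) * f\<close> is a limit of combinations of
  matrix coefficients, again in the Frechet topology.

  Completeness of the matrix coefficients is obtained without the spectral theorem for compact operators.
  If \<open>h \<noteq> 0\<close> is orthogonal to all coefficients, then suitably rescaled convolution powers of the positive
  definite function \<open>k = h * h\<^sup>*\<close> converge uniformly to an idempotent \<open>p \<noteq> 0\<close>, which is still orthogonal
  to all coefficients. But \<open>{f. f * p = f}\<close> is a finite-dimensional translation-invariant space, and a
  minimal invariant subspace carries an irreducible representation whose coefficients are not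
  orthogonal to \<open>p\<close>.\<close>

section \<open>Harmonic analysis on a compact group\<close>

text \<open>Three obstacles shape the proof. Representations are only assumed continuous while
  \<open>A\<close> acts on smooth functions, so a coefficient may be fed to \<open>A\<close> only
  once it is known to be smooth. This is proved for exactly those \<xi> at which some smooth
  function has a nonzero Fourier coefficient; in the expansion of a given smooth function the blocks
  of all other \<xi> vanish. Next, \<open>A\<close> is continuous only for the Frechet topology. In
  a convolution t * f all derivatives fall on the smooth factor f, so uniform convergence of t
  already gives Frechet convergence of t * f. Finally, nothing says that \<open>D\<close> is
  countable: Fourier series run over the net of finite subsets of \<open>D\<close>, and the nuclear
  series keeps only those \<xi> whose summand in the hypothesis is nonzero, because a summable real
  family has countable support.

  In the exponent \<open>2 + r / min 2 p1\<close> the 2 pays for the number of entries of a block,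
  and the dimension factor of Fourier inversion cancels the -1 in the exponent of the
  functionals.\<close>

locale haar_group = Groups.group mul e iv
  for mul :: "'g::{t2_space, second_countable_topology} \<Rightarrow> 'g \<Rightarrow> 'g" and e :: 'g and iv :: "'g \<Rightarrow> 'g" +
  fixes \<mu> :: "'g measure"
  assumes compact_UNIV: "compact (UNIV :: 'g set)"
    and cont_mul: "continuous_on UNIV (\<lambda>(x,y). mul x y)"
    and cont_iv: "continuous_on UNIV iv"
    and sets_mu: "sets \<mu> = sets borel"
    and prob: "prob_space \<mu>"
    and left_inv: "\<And>a. distr \<mu> \<mu> (mul a) = \<mu>"
begin

interpretation prob_space \<mu> by (rule prob)

lemma cont_mul' [continuous_intros]:
  "continuous_on S f \<Longrightarrow> continuous_on S g \<Longrightarrow> continuous_on S (\<lambda>x. mul (f x) (g x))"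
  using continuous_on_compose2[OF cont_mul, of S "\<lambda>x. (f x, g x)"]
  by (auto intro: continuous_intros)

lemma cont_iv' [continuous_intros]: "continuous_on S f \<Longrightarrow> continuous_on S (\<lambda>x. iv (f x))"
  using continuous_on_compose2[OF cont_iv] by blast

lemma cont_comp:
  "continuous_on UNIV f \<Longrightarrow> continuous_on S h \<Longrightarrow> continuous_on S (\<lambda>x. f (h x))"
  using continuous_on_compose2 by blast

lemma space_mu [simp]: "space \<mu> = UNIV"
  using sets_eq_imp_space_eq[OF sets_mu] by simp

lemma measure_UNIV [simp]: "measure \<mu> UNIV = 1"
  using prob_space by simp

lemma borel_measurable_mu: "borel_measurable \<mu> = borel_measurable borel"
  by (rule measurable_cong_sets) (simp_all add: sets_mu)

lemma cont_measurable: "continuous_on UNIV f \<Longrightarrow> f \<in> borel_measurable \<mu>"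
  by (simp add: borel_measurable_mu borel_measurable_continuous_onI)

lemma cont_bound:
  fixes f :: "'g \<Rightarrow> 'b::real_normed_vector"
  assumes "continuous_on UNIV f"
  obtains B where "B > 0" "\<And>x. norm (f x) \<le> B"
proof -
  have "bounded (range f)"
    using compact_continuous_image[OF assms compact_UNIV] compact_imp_bounded by auto
  then obtain B where "B > 0" "\<forall>x\<in>range f. norm x \<le> B" unfolding bounded_pos by blast
  then show ?thesis using that[of B] by simp
qed

lemma cont_integrable:
  fixes f :: "'g \<Rightarrow> 'b::{banach, second_countable_topology}"
  assumes "continuous_on UNIV f"
  shows "integrable \<mu> f"
proof -
  obtain B where "\<And>x. norm (f x) \<le> B" using cont_bound[OF assms] by blast
  then show ?thesis
    by (intro integrable_const_bound[where B=B]) (auto simp: cont_measurable assms)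
qed

lemma integral_norm_le:
  fixes f :: "'g \<Rightarrow> 'b::{banach, second_countable_topology}"
  assumes "\<And>x. norm (f x) \<le> B"
  shows "norm (\<integral>x. f x \<partial>\<mu>) \<le> B"
proof (cases "integrable \<mu> f")
  case True
  have "norm (\<integral>x. f x \<partial>\<mu>) \<le> (\<integral>x. norm (f x) \<partial>\<mu>)" by simp
  also have "\<dots> \<le> (\<integral>x. B \<partial>\<mu>)" by (intro integral_mono) (auto simp: assms True)
  also have "\<dots> = B" by (simp add: prob_space)
  finally show ?thesis .
next
  \<comment> \<open>Integrals of non-integrable functions are 0 by convention, and \<open>B\<close>
    is nonnegative because it bounds a norm at \<open>e\<close>.\<close>
  case False
  then show ?thesis using assms[of e] norm_ge_zero[of "f e"] by (simp add: not_integrable_integral_eq del: norm_ge_zero)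
qed

lemma integral_left:
  fixes f :: "'g \<Rightarrow> 'b::{banach, second_countable_topology}"
  assumes "continuous_on UNIV f"
  shows "(\<integral>x. f (mul a x) \<partial>\<mu>) = (\<integral>x. f x \<partial>\<mu>)"
proof -
  have "(\<integral>x. f x \<partial>\<mu>) = (\<integral>x. f x \<partial>distr \<mu> \<mu> (mul a))" by (simp add: left_inv)
  also have "\<dots> = (\<integral>x. f (mul a x) \<partial>\<mu>)"
  proof (rule integral_distr)
    have "mul a \<in> borel_measurable borel"
      by (intro borel_measurable_continuous_onI continuous_intros)
    then show "mul a \<in> measurable \<mu> \<mu>" by (simp add: measurable_def sets_mu)
  qed (simp add: cont_measurable assms)
  finally show ?thesis by simp
qed

text \<open>Second countability makes the product of the two Borel algebras the Borel algebra of the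
  product space, so a continuous \<open>F\<close> is measurable for the product measure; compactness
  makes it bounded.\<close>

lemma Fubini_cont:
  fixes F :: "'g \<Rightarrow> 'g \<Rightarrow> complex"
  assumes "continuous_on UNIV (\<lambda>(x,y). F x y)"
  shows "(\<integral>x. (\<integral>y. F x y \<partial>\<mu>) \<partial>\<mu>) = (\<integral>y. (\<integral>x. F x y \<partial>\<mu>) \<partial>\<mu>)"
proof -
  interpret P: pair_prob_space \<mu> \<mu> ..
  have s: "sets (\<mu> \<Otimes>\<^sub>M \<mu>) = sets borel"
    by (subst borel_prod[symmetric]) (intro sets_pair_measure_cong sets_mu)
  have "bounded (range (\<lambda>(x,y). F x y))"
    using compact_continuous_image[OF assms] compact_UNIV compact_imp_bounded compact_Times[OF compact_UNIV compact_UNIV] by auto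
  then obtain B where B: "\<And>x. norm ((\<lambda>(x,y). F x y) x) \<le> B" by (meson bounded_iff rangeI)
  have "(\<lambda>(x,y). F x y) \<in> borel_measurable (\<mu> \<Otimes>\<^sub>M \<mu>)"
    using borel_measurable_continuous_onI[OF assms] measurable_cong_sets[OF s refl] by blast
  then have "integrable (\<mu> \<Otimes>\<^sub>M \<mu>) (\<lambda>(x,y). F x y)"
    using B by (intro P.P.integrable_const_bound[where B=B]) auto
  from P.Fubini_integral[OF this] show ?thesis by simp
qed

text \<open>Left invariance alone suffices: averaging \<open>f (x\<inverse> y)\<close> over both variables gives either side.\<close>

lemma integral_inv:
  assumes f: "continuous_on UNIV f"
  shows "(\<integral>x. f (iv x) \<partial>\<mu>) = (\<integral>x. (f x :: complex) \<partial>\<mu>)"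
proof -
  have "(\<integral>x. f x \<partial>\<mu>) = (\<integral>x. (\<integral>y. f (mul (iv x) y) \<partial>\<mu>) \<partial>\<mu>)"
    by (simp add: integral_left f prob_space)
  also have "\<dots> = (\<integral>y. (\<integral>x. f (mul (iv x) y) \<partial>\<mu>) \<partial>\<mu>)"
    by (rule Fubini_cont) (auto simp: case_prod_unfold intro!: cont_comp[OF f] continuous_intros)
  also have "\<dots> = (\<integral>y. (\<integral>x. f (iv x) \<partial>\<mu>) \<partial>\<mu>)"
  proof (rule Bochner_Integration.integral_cong[OF refl])
    fix y
    have "(\<integral>x. f (mul (iv x) y) \<partial>\<mu>) = (\<integral>x. f (iv (mul (iv y) x)) \<partial>\<mu>)"
      by (simp add: inverse_distrib_swap)
    also have "\<dots> = (\<integral>x. f (iv x) \<partial>\<mu>)"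
      using integral_left[of "\<lambda>x. f (iv x)" "iv y"] by (simp add: cont_comp[OF f cont_iv])
    finally show "(\<integral>x. f (mul (iv x) y) \<partial>\<mu>) = (\<integral>x. f (iv x) \<partial>\<mu>)" .
  qed
  finally show ?thesis by (simp add: prob_space)
qed

text \<open>Inversion turns right translation by \<open>a\<close> into left translation by
  \<open>iv a\<close>.\<close>

lemma integral_right:
  assumes f: "continuous_on UNIV f"
  shows "(\<integral>x. f (mul x a) \<partial>\<mu>) = (\<integral>x. (f x :: complex) \<partial>\<mu>)"
proof -
  have "(\<integral>x. f (mul x a) \<partial>\<mu>) = (\<integral>x. f (mul (iv x) a) \<partial>\<mu>)"
    by (subst integral_inv[symmetric]) (auto intro!: cont_comp[OF f] continuous_intros)
  also have "\<dots> = (\<integral>x. f (iv (mul (iv a) x)) \<partial>\<mu>)"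
    by (simp add: inverse_distrib_swap)
  also have "\<dots> = (\<integral>x. f (iv x) \<partial>\<mu>)"
    using integral_left[of "\<lambda>x. f (iv x)" "iv a"] by (simp add: cont_comp[OF f cont_iv])
  finally show ?thesis by (simp add: integral_inv f)
qed

text \<open>The integration variable runs over a compact space, so continuity in the parameter is
  uniform in \<open>y\<close>. The parameter space stays arbitrary because it is later a chart image
  as well as the group.\<close>

lemma cont_param_integral:
  fixes F :: "'g \<Rightarrow> 'c::topological_space \<Rightarrow> complex"
  assumes F: "continuous_on (UNIV \<times> S) (\<lambda>(y,x). F y x)"
  shows "continuous_on S (\<lambda>x. \<integral>y. F y x \<partial>\<mu>)"
proof -
  have F': "continuous_on (S \<times> UNIV) (\<lambda>p. F (snd p) (fst p))"
  proof -
    have "continuous_on (S \<times> UNIV) (\<lambda>p::'c \<times> 'g. (snd p, fst p))" by (intro continuous_intros)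
    from continuous_on_compose2[OF F this] show ?thesis by (simp add: case_prod_unfold image_subset_iff)
  qed
  have int: "integrable \<mu> (\<lambda>y. F y x)" if "x \<in> S" for x
  proof -
    have "continuous_on UNIV (\<lambda>y::'g. (y,x))" by (intro continuous_intros)
    from continuous_on_compose2[OF F this] that show ?thesis by (intro cont_integrable) (simp add: image_subset_iff)
  qed
  show ?thesis
    unfolding continuous_on_def tendsto_iff
  proof (intro ballI allI impI)
    fix x0 and \<epsilon> :: real assume x0: "x0 \<in> S" and \<epsilon>: "\<epsilon> > 0"
    have "\<epsilon>/2 > 0" using \<epsilon> by simp
    from continuous_on_prod_compactE[OF F' compact_UNIV x0 this]
    obtain X where X: "x0 \<in> X" "open X" "\<And>x y. x \<in> X \<Longrightarrow> x \<in> S \<Longrightarrow> dist (F y x) (F y x0) \<le> \<epsilon>/2"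
      by (metis IntI UNIV_I fst_conv snd_conv)
    have "dist (\<integral>y. F y x \<partial>\<mu>) (\<integral>y. F y x0 \<partial>\<mu>) < \<epsilon>" if "x \<in> X" "x \<in> S" for x
    proof -
      have "dist (\<integral>y. F y x \<partial>\<mu>) (\<integral>y. F y x0 \<partial>\<mu>) = norm (\<integral>y. F y x - F y x0 \<partial>\<mu>)"
        using int x0 that by (simp add: dist_norm)
      also have "\<dots> \<le> \<epsilon>/2" using X(3)[OF that] by (intro integral_norm_le) (simp add: dist_norm)
      finally show ?thesis using \<epsilon> by simp
    qed
    then show "\<forall>\<^sub>F x in at x0 within S. dist (\<integral>y. F y x \<partial>\<mu>) (\<integral>y. F y x0 \<partial>\<mu>) < \<epsilon>"
      unfolding eventually_at_topological by (intro exI[of _ X]) (simp add: X(1,2))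
  qed
qed

section \<open>Inner products, Cauchy-Schwarz and Bessel's inequality\<close>

definition ip :: "('g \<Rightarrow> complex) \<Rightarrow> ('g \<Rightarrow> complex) \<Rightarrow> complex"
  where "ip f g = (\<integral>x. f x * cnj (g x) \<partial>\<mu>)"

definition sq :: "('g \<Rightarrow> complex) \<Rightarrow> real"
  where "sq f = (\<integral>x. (cmod (f x))\<^sup>2 \<partial>\<mu>)"

definition conv :: "('g \<Rightarrow> complex) \<Rightarrow> ('g \<Rightarrow> complex) \<Rightarrow> 'g \<Rightarrow> complex"
  where "conv f g x = (\<integral>y. f y * g (mul (iv y) x) \<partial>\<mu>)"

lemma cnj_integral: "cnj (\<integral>x. f x \<partial>\<mu>) = (\<integral>x. cnj (f x) \<partial>\<mu>)"
  by simp

lemma ip_self: "ip f f = complex_of_real (sq f)"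
  unfolding ip_def sq_def
  by (simp only: complex_norm_square[symmetric] integral_complex_of_real)

lemma sq_nonneg [simp]: "sq f \<ge> 0"
  by (simp add: sq_def)

lemma ip_cnj: "cnj (ip f g) = ip g f"
  unfolding ip_def cnj_integral by (simp add: mult.commute)

lemma ip_scale_left: "ip (\<lambda>x. c * f x) h = c * ip f h"
  unfolding ip_def by (simp add: mult.assoc)

lemma ip_sum_left:
  "(\<And>i. i \<in> I \<Longrightarrow> continuous_on UNIV (f i)) \<Longrightarrow> continuous_on UNIV h \<Longrightarrow>
    ip (\<lambda>x. \<Sum>i\<in>I. f i x) h = (\<Sum>i\<in>I. ip (f i) h)"
  unfolding ip_def sum_distrib_right
  by (intro Bochner_Integration.integral_sum cont_integrable continuous_intros)

lemma ip_diff_left: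
  "continuous_on UNIV f \<Longrightarrow> continuous_on UNIV g \<Longrightarrow> continuous_on UNIV h \<Longrightarrow>
    ip (\<lambda>x. f x - g x) h = ip f h - ip g h"
  unfolding ip_def left_diff_distrib
  by (intro Bochner_Integration.integral_diff cont_integrable continuous_intros)

lemma ip_scale_right: "ip h (\<lambda>x. c * f x) = cnj c * ip h f"
  using ip_scale_left[of c f h] by (metis complex_cnj_mult ip_cnj)

lemma ip_diff_right:
  "continuous_on UNIV f \<Longrightarrow> continuous_on UNIV g \<Longrightarrow> continuous_on UNIV h \<Longrightarrow>
    ip h (\<lambda>x. f x - g x) = ip h f - ip h g"
  using ip_diff_left[of f g h] by (metis complex_cnj_diff ip_cnj)

lemma ip_sum_right:
  "(\<And>i. i \<in> I \<Longrightarrow> continuous_on UNIV (f i)) \<Longrightarrow> continuous_on UNIV h \<Longrightarrow>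
    ip h (\<lambda>x. \<Sum>i\<in>I. f i x) = (\<Sum>i\<in>I. ip h (f i))"
  by (subst ip_cnj[symmetric]) (simp add: ip_sum_left ip_cnj)

lemma sq_diff:
  assumes "continuous_on UNIV f" "continuous_on UNIV g"
  shows "sq (\<lambda>x. f x - g x) = sq f + sq g - 2 * Re (ip f g)"
proof -
  have "complex_of_real (sq (\<lambda>x. f x - g x)) = complex_of_real (sq f) + complex_of_real (sq g) - (ip f g + cnj (ip f g))"
  proof -
    have "continuous_on UNIV (\<lambda>x. f x - g x)" by (intro continuous_intros assms)
    then show ?thesis
      unfolding ip_self[symmetric] by (simp add: ip_diff_left ip_diff_right assms ip_cnj)
  qed
  also have "ip f g + cnj (ip f g) = complex_of_real (2 * Re (ip f g))"
    by (simp add: complex_add_cnj)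
  finally show ?thesis by (simp only: of_real_add[symmetric] of_real_diff[symmetric] of_real_eq_iff)
qed

lemma Cauchy_Schwarz:
  assumes f: "continuous_on UNIV f" and g: "continuous_on UNIV g"
  shows "(cmod (ip f g))\<^sup>2 \<le> sq f * sq g"
proof -
  define c where "c = ip f g"
  \<comment> \<open>Expand the square norm of f - t c g with c = \<open>ip f g\<close>. The choice t
    = 1 / \<open>sq g\<close> gives the inequality. If \<open>sq g = 0\<close>, the choice t =
    (\<open>sq f\<close> + 1) / |c|^2 makes the right-hand side negative, a contradiction.\<close>
  have *: "0 \<le> sq f + t\<^sup>2 * (cmod c)\<^sup>2 * sq g - 2 * t * (cmod c)\<^sup>2" for t :: real
  proof -
    have "0 \<le> sq (\<lambda>x. f x - (of_real t * c) * g x)" by simp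
    also have "\<dots> = sq f + sq (\<lambda>x. (of_real t * c) * g x) - 2 * Re (ip f (\<lambda>x. (of_real t * c) * g x))"
      by (intro sq_diff f continuous_intros g)
    also have "ip f (\<lambda>x. (of_real t * c) * g x) = of_real (t * (cmod c)\<^sup>2)"
      unfolding ip_scale_right c_def[symmetric]
      by (simp add: complex_norm_square[symmetric] mult.commute mult.left_commute)
    also have "sq (\<lambda>x. (of_real t * c) * g x) = t\<^sup>2 * (cmod c)\<^sup>2 * sq g"
      unfolding sq_def by (simp add: norm_mult power_mult_distrib)
    finally show ?thesis by simp
  qed
  show ?thesis
  proof (cases "c = 0")
    case False
    show ?thesis
    proof (cases "sq g = 0")
      case True
      have "(cmod c)\<^sup>2 > 0" using False by simp
      then have eq: "(sq f + 1) / (cmod c)\<^sup>2 * (cmod c)\<^sup>2 = sq f + 1" by simp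
      have "sq f + 0 - 2 * ((sq f + 1) / (cmod c)\<^sup>2) * (cmod c)\<^sup>2
          = sq f - 2 * ((sq f + 1) / (cmod c)\<^sup>2 * (cmod c)\<^sup>2)" by simp
      also have "\<dots> = - sq f - 2" unfolding eq by simp
      also have "\<dots> < 0" using sq_nonneg[of f] by (simp del: sq_nonneg)
      finally have "sq f + 0 - 2 * ((sq f + 1) / (cmod c)\<^sup>2) * (cmod c)\<^sup>2 < 0" .
      moreover have "0 \<le> sq f + 0 - 2 * ((sq f + 1) / (cmod c)\<^sup>2) * (cmod c)\<^sup>2"
        using *[of "(sq f + 1) / (cmod c)\<^sup>2"] True by simp
      ultimately show ?thesis by linarith
    next
      case nz: False
      then have pos: "sq g > 0" using sq_nonneg[of g] by linarith
      have "0 \<le> sq f - (cmod c)\<^sup>2 / sq g"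
        using *[of "1 / sq g"] pos by (simp add: field_simps power2_eq_square)
      then show ?thesis using pos by (simp add: field_simps c_def)
    qed
  qed (simp add: c_def[symmetric])
qed

lemma Bessel:
  assumes "finite I" and f: "\<And>i. i \<in> I \<Longrightarrow> continuous_on UNIV (f i)" and g: "continuous_on UNIV g"
    and on: "\<And>i j. i \<in> I \<Longrightarrow> j \<in> I \<Longrightarrow> ip (f i) (f j) = (if i = j then 1 else 0)"
  shows "(\<Sum>i\<in>I. (cmod (ip g (f i)))\<^sup>2) \<le> sq g"
proof -
  define c where "c i = ip g (f i)" for i
  \<comment> \<open>\<open>s\<close> is the orthogonal projection of \<open>g\<close> onto the span
    of the family; the claim is that g - s has nonnegative square norm.\<close>
  define s where "s = (\<lambda>x. \<Sum>i\<in>I. c i * f i x)"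
  have s: "continuous_on UNIV s" unfolding s_def by (intro continuous_intros f)
  have cf: "continuous_on UNIV (\<lambda>x. c i * f i x)" if "i \<in> I" for i
    by (intro continuous_intros f that)
  have right: "ip h s = (\<Sum>i\<in>I. cnj (c i) * ip h (f i))" if "continuous_on UNIV h" for h
    unfolding s_def by (subst ip_sum_right) (simp_all add: cf that ip_scale_right)
  have gs: "ip g s = of_real (\<Sum>i\<in>I. (cmod (c i))\<^sup>2)"
    by (simp only: right[OF g] c_def[symmetric] of_real_sum complex_norm_square mult.commute)
  have "ip s (f j) = c j" if "j \<in> I" for j
  proof -
    have "ip s (f j) = (\<Sum>i\<in>I. c i * ip (f i) (f j))"
      unfolding s_def by (subst ip_sum_left) (simp_all add: cf f that ip_scale_left)
    also have "\<dots> = (\<Sum>i\<in>I. if i = j then c i else 0)"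
      by (rule sum.cong) (auto simp: on that)
    finally show ?thesis using that \<open>finite I\<close> by simp
  qed
  then have "ip s s = of_real (\<Sum>i\<in>I. (cmod (c i))\<^sup>2)"
    by (simp only: right[OF s] of_real_sum complex_norm_square mult.commute cong: sum.cong)
  then have ss: "sq s = (\<Sum>i\<in>I. (cmod (c i))\<^sup>2)"
    unfolding ip_self by (metis of_real_eq_iff)
  have "0 \<le> sq (\<lambda>x. g x - s x)" by simp
  also have "\<dots> = sq g - (\<Sum>i\<in>I. (cmod (c i))\<^sup>2)"
    using gs ss by (subst sq_diff[OF g s]) simp
  finally show ?thesis by (simp add: c_def)
qed

end

text \<open>\<open>L\<close> is the limit of the increasing ratios \<open>a (n + 1) / a n\<close>; for \<open>a n = sq (conv_power k n)\<close> it is the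
  largest eigenvalue of the square of convolution by \<open>k\<close>.\<close>

lemma log_convex_submultiplicative_normalise:
  fixes a :: "nat \<Rightarrow> real"
  assumes pos: "\<And>n. a n > 0"
    and lc: "\<And>n. (a (Suc n))\<^sup>2 \<le> a n * a (Suc (Suc n))"
    and sm: "\<And>m n. a (Suc (m + n)) \<le> a m * a n"
  obtains L where "L > 0" "decseq (\<lambda>n. a n / L ^ Suc n)" "\<And>n. a n / L ^ Suc n \<ge> 1"
proof -
  define \<rho> where "\<rho> n = a (Suc n) / a n" for n
  have \<rho>pos: "\<rho> n > 0" for n by (simp add: \<rho>_def pos)
  \<comment> \<open>Log-convexity says exactly that the ratios increase; submultiplicativity with
    second index 0 bounds them by \<open>a 0\<close>.\<close>
  have inc: "incseq \<rho>"
  proof (rule incseq_SucI)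
    fix n
    have "a (Suc n) * a (Suc n) \<le> a (Suc (Suc n)) * a n"
      using lc[of n] by (simp add: power2_eq_square mult.commute)
    then show "\<rho> n \<le> \<rho> (Suc n)"
      unfolding \<rho>_def using pos[of n] pos[of "Suc n"] by (simp add: frac_le_eq divide_le_eq field_simps)
  qed
  have "\<rho> n \<le> a 0" for n
    using sm[of n 0] pos[of n] by (simp add: \<rho>_def field_simps)
  then obtain L where L: "\<rho> \<longlonglongrightarrow> L" "\<And>n. \<rho> n \<le> L"
    using incseq_convergent[OF inc] by blast
  have Lpos: "L > 0" using L(2)[of 0] \<rho>pos[of 0] by linarith
  \<comment> \<open>The exponent \<open>Suc n\<close> absorbs the index shift in \<open>sm\<close>,
    so that \<open>b\<close> satisfies the same submultiplicative inequality as
    \<open>a\<close>.\<close>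
  define b where "b n = a n / L ^ Suc n" for n
  have bpos: "b n > 0" for n by (simp add: b_def pos Lpos)
  have bS: "b (Suc n) = b n * (\<rho> n / L)" for n
    unfolding b_def \<rho>_def using pos[of n] Lpos by (simp add: field_simps)
  have dec: "decseq b"
  proof (rule decseq_SucI)
    fix n
    have "\<rho> n / L \<le> 1" using L(2)[of n] Lpos by (simp add: field_simps)
    then show "b (Suc n) \<le> b n" unfolding bS using bpos[of n] by (intro mult_left_le) simp_all
  qed
  have "b m \<ge> 1" for m
  proof -
    \<comment> \<open>Increasing ratios make \<open>b\<close> decay at most geometrically after
      \<open>j\<close>. Comparing with \<open>b (j + Suc m) \<le> b j * b m\<close> and cancelling
      \<open>b j\<close> leaves a lower bound for \<open>b m\<close> that tends to 1 as
      \<open>j\<close> grows.\<close>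
    have low: "b j * (\<rho> j / L) ^ t \<le> b (j + t)" for j t
    proof (induction t)
      case (Suc t)
      have "b j * (\<rho> j / L) ^ Suc t = (b j * (\<rho> j / L) ^ t) * (\<rho> j / L)" by simp
      also have "\<dots> \<le> b (j + t) * (\<rho> (j + t) / L)"
      proof (rule mult_mono)
        show "\<rho> j / L \<le> \<rho> (j + t) / L"
          using Lpos incseqD[OF inc, of j "j + t"] by (simp add: divide_right_mono)
        show "0 \<le> b (j + t)" "0 \<le> \<rho> j / L"
          using bpos[of "j + t"] Lpos \<rho>pos[of j] by auto
      qed (rule Suc)
      finally show ?case by (simp add: bS)
    qed simp
    have "(\<rho> j / L) ^ Suc m \<le> b m" for j
    proof -
      have "b j * (\<rho> j / L) ^ Suc m \<le> b (j + Suc m)" by (rule low)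
      also have "\<dots> \<le> b j * b m"
        using sm[of j m] Lpos unfolding b_def
        by (simp add: power_add field_simps)
      finally show ?thesis using mult_le_cancel_left_pos[OF bpos[of j]] by blast
    qed
    moreover have "(\<lambda>j. (\<rho> j / L) ^ Suc m) \<longlonglongrightarrow> (L / L) ^ Suc m"
      by (intro tendsto_intros L) (use Lpos in simp)
    ultimately show ?thesis
      using Lpos LIMSEQ_le_const2[of "\<lambda>j. (\<rho> j / L) ^ Suc m" 1 "b m"] by auto
  qed
  then show ?thesis using that[OF Lpos] dec unfolding b_def by blast
qed

section \<open>Strict positivity of Haar measure and the convolution algebra\<close>

context haar_group begin

interpretation prob_space \<mu> by (rule prob)

text \<open>Finitely many translates of \<open>S\<close> cover the compact group and all have the
  measure of \<open>S\<close>, so a null set \<open>S\<close> would make the whole group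
  null.\<close>

lemma measure_open_pos:
  assumes S: "open S" "x \<in> S"
  shows "measure \<mu> S > 0"
proof (rule ccontr)
  assume "\<not> ?thesis"
  then have 0: "measure \<mu> S = 0" using measure_nonneg[of \<mu> S] by linarith
  have bor: "mul a -` S \<in> sets \<mu>" "open (mul a -` S)" for a
  proof -
    have "continuous_on UNIV (mul a)" by (intro continuous_intros)
    then show "open (mul a -` S)" using S(1) by (rule open_vimage[rotated])
    then show "mul a -` S \<in> sets \<mu>" by (simp add: sets_mu)
  qed
  have meas: "mul a \<in> measurable \<mu> \<mu>" for a
  proof -
    have "mul a \<in> borel_measurable borel"
      by (intro borel_measurable_continuous_onI continuous_intros)
    then show ?thesis by (simp add: measurable_def sets_mu)
  qed
  have tr: "measure \<mu> (mul a -` S) = 0" for a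
    using measure_distr[OF meas, of S a] S(1) 0 by (simp add: sets_mu left_inv)
  have "UNIV \<subseteq> \<Union> (range (\<lambda>a. mul a -` S))"
  proof
    fix y
    have "mul (mul x (iv y)) y = x" by (simp add: assoc)
    then show "y \<in> \<Union> (range (\<lambda>a. mul a -` S))" using S(2) by (intro UnionI[of "mul (mul x (iv y)) -` S"]) auto
  qed
  from compactE_image[OF compact_UNIV, of UNIV "\<lambda>a. mul a -` S"] bor(2) this
  obtain C where C: "finite C" "UNIV \<subseteq> (\<Union>a\<in>C. mul a -` S)" by auto
  have "measure \<mu> UNIV \<le> measure \<mu> (\<Union>a\<in>C. mul a -` S)"
    using C bor by (intro finite_measure_mono) auto
  also have "\<dots> \<le> (\<Sum>a\<in>C. measure \<mu> (mul a -` S))"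
    using C bor by (intro measure_UNION_le) auto
  also have "\<dots> = 0" by (simp add: tr)
  finally show False by simp
qed

text \<open>Near \<open>x\<close> the function exceeds \<open>f x / 2\<close> on an open set, which
  has positive measure.\<close>

lemma integral_pos:
  fixes f :: "'g \<Rightarrow> real"
  assumes f: "continuous_on UNIV f" and nn: "\<And>x. f x \<ge> 0" and x: "f x > 0"
  shows "(\<integral>x. f x \<partial>\<mu>) > 0"
proof -
  define S where "S = {y. f x / 2 < f y}"
  have S: "open S" unfolding S_def by (intro open_Collect_less continuous_intros f)
  have "x \<in> S" using x by (simp add: S_def)
  have "0 < (f x / 2) * measure \<mu> S"
    using measure_open_pos[OF S \<open>x \<in> S\<close>] x by simp
  also have "\<dots> = (\<integral>y. (f x / 2) * indicator S y \<partial>\<mu>)"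
    using S by (simp add: sets_mu)
  also have "\<dots> \<le> (\<integral>y. f y \<partial>\<mu>)"
  proof (rule integral_mono)
    show "integrable \<mu> (\<lambda>y. (f x / 2) * indicator S y)"
      using S by (simp add: sets_mu emeasure_eq_measure)
    show "(f x / 2) * indicator S y \<le> f y" for y
      using nn[of y] by (auto simp: S_def indicator_def)
  qed (simp add: cont_integrable f)
  finally show ?thesis .
qed

lemma sq_eq_0:
  assumes f: "continuous_on UNIV f" and "sq f = 0"
  shows "f x = 0"
proof (rule ccontr)
  assume "f x \<noteq> 0"
  then have "(\<integral>x. (cmod (f x))\<^sup>2 \<partial>\<mu>) > 0"
    by (intro integral_pos[of _ x] continuous_intros f) auto
  then show False using assms(2) by (simp add: sq_def)
qed

lemma sq_pos: "sq f \<noteq> 0 \<Longrightarrow> sq f > 0"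
  using sq_nonneg[of f] by (simp add: less_le del: sq_nonneg)

lemma sq_zero [simp]: "sq (\<lambda>x. 0) = 0"
  by (simp add: sq_def)

lemma sq_le_bound:
  assumes "\<And>x. cmod (f x) \<le> B"
  shows "sq f \<le> B\<^sup>2"
proof -
  have "norm (\<integral>x. (cmod (f x))\<^sup>2 \<partial>\<mu>) \<le> B\<^sup>2"
    using assms by (intro integral_norm_le) (simp add: power_mono)
  then show ?thesis by (simp add: sq_def)
qed

text \<open>Inversion and right translation both preserve the measure, hence so does the reflection
  sending y to y^-1 x.\<close>

lemma sq_cnj_reflect:
  assumes g: "continuous_on UNIV g"
  shows "sq (\<lambda>y. cnj (g (mul (iv y) x))) = sq g"
proof -
  have "complex_of_real (sq (\<lambda>y. cnj (g (mul (iv y) x)))) = (\<integral>y. g (mul (iv y) x) * cnj (g (mul (iv y) x)) \<partial>\<mu>)"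
    by (simp only: ip_self[symmetric] ip_def complex_cnj_cnj mult.commute)
  also have "\<dots> = (\<integral>y. g (mul y x) * cnj (g (mul y x)) \<partial>\<mu>)"
    by (rule integral_inv[of "\<lambda>y. g (mul y x) * cnj (g (mul y x))"]) (intro continuous_intros cont_comp[OF g])
  also have "\<dots> = (\<integral>y. g y * cnj (g y) \<partial>\<mu>)"
    by (rule integral_right[of "\<lambda>y. g y * cnj (g y)"]) (intro continuous_intros g)
  also have "\<dots> = complex_of_real (sq g)" by (simp only: ip_self[symmetric] ip_def)
  finally show ?thesis by (simp only: of_real_eq_iff)
qed

lemma conv_eq_ip: "conv f g x = ip f (\<lambda>y. cnj (g (mul (iv y) x)))"
  by (simp add: conv_def ip_def)

text \<open>Cauchy-Schwarz for \<open>conv_eq_ip\<close>. This pointwise bound by mean-square norms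
  is what later upgrades mean-square convergence of a factor to uniform convergence of a
  convolution.\<close>

lemma conv_bound:
  assumes "continuous_on UNIV f" "continuous_on UNIV g"
  shows "(cmod (conv f g x))\<^sup>2 \<le> sq f * sq g"
proof -
  have "continuous_on UNIV (\<lambda>y. cnj (g (mul (iv y) x)))"
    by (intro continuous_intros cont_comp[OF assms(2)])
  from Cauchy_Schwarz[OF assms(1) this] show ?thesis
    unfolding conv_eq_ip sq_cnj_reflect[OF assms(2)] .
qed

lemma conv_cont:
  assumes "continuous_on UNIV f" "continuous_on UNIV g"
  shows "continuous_on UNIV (conv f g)"
  unfolding conv_def[abs_def]
  by (rule cont_param_integral)
     (auto simp: case_prod_unfold intro!: continuous_intros cont_comp[OF assms(1)] cont_comp[OF assms(2)])

lemma conv_assoc: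
  assumes f: "continuous_on UNIV f" and g: "continuous_on UNIV g" and h: "continuous_on UNIV h"
  shows "conv (conv f g) h = conv f (conv g h)"
proof
  fix x
  have "conv (conv f g) h x = (\<integral>y. (\<integral>z. f z * g (mul (iv z) y) * h (mul (iv y) x) \<partial>\<mu>) \<partial>\<mu>)"
    unfolding conv_def by simp
  also have "\<dots> = (\<integral>z. (\<integral>y. f z * g (mul (iv z) y) * h (mul (iv y) x) \<partial>\<mu>) \<partial>\<mu>)"
    by (rule Fubini_cont)
       (auto simp: case_prod_unfold intro!: continuous_intros cont_comp[OF f] cont_comp[OF g] cont_comp[OF h])
  also have "\<dots> = (\<integral>z. f z * conv g h (mul (iv z) x) \<partial>\<mu>)"
  proof (rule Bochner_Integration.integral_cong[OF refl])
    fix z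
    have "(\<integral>y. f z * g (mul (iv z) y) * h (mul (iv y) x) \<partial>\<mu>) = f z * (\<integral>y. g (mul (iv z) y) * h (mul (iv y) x) \<partial>\<mu>)"
      by (simp add: mult.assoc)
    also have "(\<integral>y. g (mul (iv z) y) * h (mul (iv y) x) \<partial>\<mu>)
        = (\<integral>y. g (mul (iv z) (mul z y)) * h (mul (iv (mul z y)) x) \<partial>\<mu>)"
      by (rule integral_left[symmetric, of "\<lambda>y. g (mul (iv z) y) * h (mul (iv y) x)"])
         (intro continuous_intros cont_comp[OF g] cont_comp[OF h])
    also have "\<dots> = conv g h (mul (iv z) x)"
      by (simp add: conv_def inverse_distrib_swap assoc[symmetric])
    finally show "(\<integral>y. f z * g (mul (iv z) y) * h (mul (iv y) x) \<partial>\<mu>) = f z * conv g h (mul (iv z) x)" .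
  qed
  finally show "conv (conv f g) h x = conv f (conv g h) x" by (simp add: conv_def[of f])
qed

lemma conv_integrable:
  fixes f g :: "'g \<Rightarrow> complex"
  assumes "continuous_on UNIV f" "continuous_on UNIV g"
  shows "integrable \<mu> (\<lambda>y. f y * g (mul (iv y) x))"
  by (rule cont_integrable) (intro continuous_intros cont_comp[OF assms(2)] assms(1))

lemma conv_diff_left:
  assumes "continuous_on UNIV f" "continuous_on UNIV f'" "continuous_on UNIV g"
  shows "conv (\<lambda>x. f x - f' x) g x = conv f g x - conv f' g x"
  unfolding conv_def using conv_integrable[OF assms(1,3)] conv_integrable[OF assms(2,3)]
  by (simp add: left_diff_distrib)

lemma conv_add_left:
  assumes "continuous_on UNIV f" "continuous_on UNIV f'" "continuous_on UNIV g"
  shows "conv (\<lambda>x. f x + f' x) g x = conv f g x + conv f' g x"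
  unfolding conv_def using conv_integrable[OF assms(1,3)] conv_integrable[OF assms(2,3)]
  by (simp add: distrib_right)

lemma conv_diff_right:
  assumes "continuous_on UNIV f" "continuous_on UNIV g'" "continuous_on UNIV g"
  shows "conv f (\<lambda>x. g x - g' x) x = conv f g x - conv f g' x"
  unfolding conv_def using conv_integrable[OF assms(1,2)] conv_integrable[OF assms(1,3)]
  by (simp add: right_diff_distrib)

lemma conv_scale_left: "conv (\<lambda>x. c * f x) g x = c * conv f g x"
  by (simp add: conv_def mult.assoc)

lemma conv_scale_right: "conv f (\<lambda>x. c * g x) x = c * conv f g x"
  by (simp add: conv_def mult.left_commute)

lemma conv_sum_left:
  assumes "\<And>i. i \<in> I \<Longrightarrow> continuous_on UNIV (f i)" "continuous_on UNIV g"
  shows "conv (\<lambda>x. \<Sum>i\<in>I. f i x) g x = (\<Sum>i\<in>I. conv (f i) g x)"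
  unfolding conv_def sum_distrib_right
  by (intro Bochner_Integration.integral_sum conv_integrable assms)

text \<open>The map sending f to \<open>\<lambda>x. cnj (f (iv x))\<close> is the involution of the
  convolution algebra, and it reverses products.\<close>

lemma conv_cnj_reflect:
  assumes f: "continuous_on UNIV f" and g: "continuous_on UNIV g"
  shows "cnj (conv f g (iv x)) = conv (\<lambda>x. cnj (g (iv x))) (\<lambda>x. cnj (f (iv x))) x"
proof -
  have "conv (\<lambda>x. cnj (g (iv x))) (\<lambda>x. cnj (f (iv x))) x = (\<integral>y. cnj (g (iv y)) * cnj (f (mul (iv x) y)) \<partial>\<mu>)"
    by (simp add: conv_def inverse_distrib_swap)
  also have "\<dots> = (\<integral>y. cnj (g (iv (mul x y))) * cnj (f (mul (iv x) (mul x y))) \<partial>\<mu>)"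
    by (rule integral_left[symmetric, of "\<lambda>y. cnj (g (iv y)) * cnj (f (mul (iv x) y))"])
       (intro continuous_intros cont_comp[OF f] cont_comp[OF g])
  also have "\<dots> = (\<integral>y. cnj (f y * g (mul (iv y) (iv x))) \<partial>\<mu>)"
    by (simp add: inverse_distrib_swap assoc[symmetric] mult.commute)
  finally show ?thesis unfolding conv_def cnj_integral by simp
qed

text \<open>Index \<open>n\<close> means n + 1 factors: the convolution algebra of continuous
  functions has no unit in general, so the powers start with \<open>k\<close> itself.\<close>

primrec conv_power :: "('g \<Rightarrow> complex) \<Rightarrow> nat \<Rightarrow> 'g \<Rightarrow> complex" where
  "conv_power k 0 = k"
| "conv_power k (Suc n) = conv k (conv_power k n)"

lemma conv_power_cont: "continuous_on UNIV k \<Longrightarrow> continuous_on UNIV (conv_power k n)"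
  by (induction n) (auto intro: conv_cont)

lemma conv_power_add:
  assumes k: "continuous_on UNIV k"
  shows "conv (conv_power k m) (conv_power k n) = conv_power k (Suc (m + n))"
proof (induction m)
  case (Suc m)
  then show ?case by (simp add: conv_assoc[OF k conv_power_cont[OF k] conv_power_cont[OF k]])
qed simp

text \<open>The involution reverses the order of the factors, which is harmless because all factors
  are powers of the same hermitian \<open>k\<close>.\<close>

lemma conv_power_cnj:
  assumes k: "continuous_on UNIV k" and sym: "\<And>x. k (iv x) = cnj (k x)"
  shows "conv_power k n (iv x) = cnj (conv_power k n x)"
proof (induction n arbitrary: x)
  case (Suc n)
  have "cnj (conv_power k (Suc n) (iv x)) = conv (\<lambda>x. cnj (conv_power k n (iv x))) (\<lambda>x. cnj (k (iv x))) x"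
    by (simp add: conv_cnj_reflect[OF k conv_power_cont[OF k]])
  also have "\<dots> = conv (conv_power k n) (conv_power k 0) x" by (simp add: Suc sym)
  also have "\<dots> = conv_power k (Suc n) x" by (simp only: conv_power_add[OF k] add_0_right)
  finally show ?case by (metis complex_cnj_cnj)
qed (simp add: sym)

lemma ip_cont_bound:
  assumes "continuous_on UNIV f" "continuous_on UNIV g" "\<And>x. cmod (f x) \<le> B" "\<And>x. cmod (g x) \<le> C"
  shows "cmod (ip f g) \<le> B * C"
  unfolding ip_def
proof (rule integral_norm_le)
  show "norm (f x * cnj (g x)) \<le> B * C" for x
    using mult_mono[OF assms(3,4), of x x] order_trans[OF norm_ge_zero assms(3)] by (simp add: norm_mult)
qed

text \<open>Convolution by the hermitian \<open>k\<close> is a self-adjoint Hilbert-Schmidt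
  operator, and \<open>p\<close> is the kernel of the projection onto the top eigenspace of its
  square. The last conclusion keeps what is needed of \<open>p\<close> being a limit of powers: a
  test function that annihilates all powers of \<open>k\<close> annihilates
  \<open>p\<close>.\<close>

lemma idempotent_limit:
  assumes k: "continuous_on UNIV k" and sym: "\<And>x. k (iv x) = cnj (k x)" and nz: "k z \<noteq> 0"
  obtains p where "continuous_on UNIV p" "p e \<noteq> 0" "conv p p = p"
    "\<forall>\<psi>. continuous_on UNIV \<psi> \<longrightarrow> (\<forall>n. (\<integral>x. conv_power k n x * \<psi> x \<partial>\<mu>) = 0) \<longrightarrow> (\<integral>x. p x * \<psi> x \<partial>\<mu>) = 0"
proof -
  define c where "c = conv_power k"
  have cc [simp]: "continuous_on UNIV (c n)" for n unfolding c_def by (rule conv_power_cont[OF k])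
  have cadd: "conv (c m) (c n) = c (Suc (m + n))" for m n unfolding c_def by (rule conv_power_add[OF k])
  have csym: "c n (iv x) = cnj (c n x)" for n x unfolding c_def by (rule conv_power_cnj[OF k sym])
  \<comment> \<open>By hermitian symmetry the inner product of two powers depends only on the sum of
    the indices, so the scalar sequence \<open>a\<close> controls all distances between
    powers.\<close>
  have ipc: "ip (c m) (c n) = c (Suc (m + n)) e" for m n
    unfolding cadd[symmetric] by (simp add: conv_eq_ip csym)
  define a where "a n = sq (c n)" for n
  have a_eq: "complex_of_real (a n) = c (Suc (n + n)) e" for n
    by (simp only: a_def ip_self[symmetric] ipc)
  have apos: "a n > 0" for n
  proof (induction n)
    case 0
    have "a 0 \<noteq> 0" using sq_eq_0[OF cc[of 0]] nz by (auto simp: a_def c_def)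
    then show ?case by (simp add: a_def sq_pos)
  next
    case (Suc n)
    have zero: "c (m + j) x = 0" if "\<And>x. c m x = 0" for m j x
      using that
    proof (induction j arbitrary: x)
      case (Suc j)
      have "c (m + Suc j) x = conv k (c (m + j)) x" by (simp add: c_def)
      also have "\<dots> = 0" unfolding conv_def by (simp add: Suc)
      finally show ?case .
    qed simp
    \<comment> \<open>If the power of index n + 1 vanished, so would all later ones, among them
      \<open>c (Suc n + n)\<close>, whose value at \<open>e\<close> is \<open>a n\<close>.\<close>
    have "a (Suc n) \<noteq> 0"
    proof
      assume "a (Suc n) = 0"
      then have "\<And>x. c (Suc n) x = 0" using sq_eq_0[OF cc] by (simp add: a_def)
      then have "c (Suc n + n) e = 0" by (rule zero)
      then show False using a_eq[of n] Suc by simp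
    qed
    then show ?case by (simp add: a_def sq_pos)
  qed
  \<comment> \<open>Cauchy-Schwarz for the powers of index n and n + 2: their inner product is
    \<open>a (Suc n)\<close> because n + (n + 2) = 2 (n + 1).\<close>
  have lc: "(a (Suc n))\<^sup>2 \<le> a n * a (Suc (Suc n))" for n
  proof -
    have "ip (c n) (c (Suc (Suc n))) = complex_of_real (a (Suc n))" by (simp add: ipc a_eq)
    then show ?thesis using Cauchy_Schwarz[OF cc cc, of n "Suc (Suc n)"] by (simp add: a_def)
  qed
  have sm: "a (Suc (m + n)) \<le> a m * a n" for m n
  proof -
    have "cmod (c (Suc (m + n)) x) \<le> sqrt (a m * a n)" for x
      using conv_bound[OF cc cc, of m n x] unfolding cadd a_def by (rule real_le_rsqrt)
    from sq_le_bound[OF this] show ?thesis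
      using apos[of m] apos[of n] by (simp add: a_def)
  qed
  obtain L where L: "L > 0" "decseq (\<lambda>n. a n / L ^ Suc n)" "\<And>n. a n / L ^ Suc n \<ge> 1"
    using log_convex_submultiplicative_normalise[OF apos lc sm] by blast
  define b where "b n = a n / L ^ Suc n" for n
  have b1: "b n \<ge> 1" for n unfolding b_def by (rule L(3))
  obtain B where B: "b \<longlonglongrightarrow> B"
    using decseq_convergent[OF L(2), of 1] L(3) unfolding b_def by blast
  \<comment> \<open>Only powers with an even number 2n + 2 of factors enter: an eigenvalue -sqrt L
    of convolution by \<open>k\<close> would make the sequence of all rescaled powers
    oscillate.\<close>
  define D where "D n x = c (Suc (n + n)) x / of_real (L ^ Suc n)" for n x
  have D_alt: "D n = (\<lambda>x. (1 / of_real (L ^ Suc n)) * c (Suc (n + n)) x)" for n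
    by (simp add: D_def fun_eq_iff)
  have Dc: "continuous_on UNIV (D n)" for n unfolding D_alt by (intro continuous_intros) simp
  have Dadd: "conv (D m) (D n) = D (Suc (m + n))" for m n
  proof
    fix x
    show "conv (D m) (D n) x = D (Suc (m + n)) x"
      unfolding D_alt conv_scale_left conv_scale_right cadd
      by (simp add: power_add algebra_simps)
  qed
  have Dsym: "D n (iv x) = cnj (D n x)" for n x by (simp add: D_def csym)
  have De: "D n e = of_real (b n)" for n by (simp add: D_def b_def a_eq)
  have ipD: "ip (D m) (D n) = of_real (b (Suc (m + n)))" for m n
  proof -
    have "ip (D m) (D n) = conv (D m) (D n) e" by (simp add: conv_eq_ip Dsym)
    then show ?thesis by (simp add: Dadd De)
  qed
  have sqD: "sq (\<lambda>x. D m x - D n x) = b (Suc (m + m)) + b (Suc (n + n)) - 2 * b (Suc (m + n))" for m n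
  proof -
    have "complex_of_real (sq (D n)) = of_real (b (Suc (n + n)))" for n by (simp only: ip_self[symmetric] ipD)
    then have "sq (D n) = b (Suc (n + n))" for n by (simp only: of_real_eq_iff)
    then show ?thesis by (simp add: sq_diff[OF Dc Dc] ipD)
  qed
  have D0: "sq (D 0) > 0"
  proof (rule sq_pos)
    show "sq (D 0) \<noteq> 0" using sq_eq_0[OF Dc, of 0 e] De[of 0] b1[of 0] by auto
  qed
  have uc: "uniformly_Cauchy_on UNIV (\<lambda>n. D (Suc n))"
    unfolding uniformly_Cauchy_on_def
  proof (intro allI impI)
    fix \<epsilon> :: real assume \<epsilon>: "\<epsilon> > 0"
    \<comment> \<open>Since \<open>D (Suc m)\<close> is the convolution of \<open>D 0\<close> with
      \<open>D m\<close>, mean-square closeness of \<open>D m\<close> and \<open>D n\<close> becomes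
      uniform closeness one step later. The 4 comes from \<open>sqD\<close>: its coefficients 1, 1,
      -2 add up to 0, so values of \<open>b\<close> within \<delta> of \<open>B\<close> leave less
      than 4 \<delta>.\<close>
    define \<delta> where "\<delta> = \<epsilon>\<^sup>2 / (4 * sq (D 0))"
    have \<delta>: "\<delta> > 0" using \<epsilon> D0 by (simp add: \<delta>_def)
    from LIMSEQ_D[OF B \<delta>] obtain N where N: "\<And>n. n \<ge> N \<Longrightarrow> \<bar>b n - B\<bar> < \<delta>" by auto
    have "dist (D (Suc m) x) (D (Suc n) x) < \<epsilon>" if "m \<ge> N" "n \<ge> N" for m n x
    proof -
      have "D (Suc m) x - D (Suc n) x = conv (D 0) (\<lambda>x. D m x - D n x) x"
        by (subst conv_diff_right[OF Dc Dc Dc]) (simp add: Dadd)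
      then have "(cmod (D (Suc m) x - D (Suc n) x))\<^sup>2 \<le> sq (D 0) * sq (\<lambda>x. D m x - D n x)"
        using conv_bound[OF Dc[of 0], of "\<lambda>x. D m x - D n x" x] Dc by (simp add: continuous_on_diff)
      also have "\<dots> < sq (D 0) * (4 * \<delta>)"
      proof (rule mult_strict_left_mono[OF _ D0])
        show "sq (\<lambda>x. D m x - D n x) < 4 * \<delta>"
          unfolding sqD using N[of "Suc (m + m)"] N[of "Suc (n + n)"] N[of "Suc (m + n)"] that
          by (auto simp: abs_less_iff)
      qed
      also have "\<dots> = \<epsilon>\<^sup>2" using D0 by (simp add: \<delta>_def)
      finally show ?thesis using \<epsilon> by (simp add: dist_norm power_less_imp_less_base)
    qed
    then show "\<exists>M. \<forall>x\<in>UNIV. \<forall>m\<ge>M. \<forall>n\<ge>M. dist (D (Suc m) x) (D (Suc n) x) < \<epsilon>" by blast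
  qed
  then obtain p where p: "uniform_limit UNIV (\<lambda>n. D (Suc n)) p sequentially"
    unfolding uniformly_convergent_eq_Cauchy[symmetric] uniformly_convergent_on_def by blast
  have pc: "continuous_on UNIV p"
    by (rule uniform_limit_theorem[OF _ p]) (auto simp: Dc)
  have pt: "(\<lambda>n. D (Suc n) x) \<longlonglongrightarrow> p x" for x using tendsto_uniform_limitI[OF p] by simp
  \<comment> \<open>The normalisation \<open>b n \<ge> 1\<close> keeps the limit from
    vanishing.\<close>
  have pe: "p e \<noteq> 0"
  proof -
    have "(\<lambda>n. Re (D (Suc n) e)) \<longlonglongrightarrow> Re (p e)" by (intro tendsto_intros pt)
    then have "Re (p e) \<ge> 1" using b1 by (intro LIMSEQ_le_const) (auto simp: De)
    then show ?thesis by auto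
  qed
  have sq0: "(\<lambda>n. sq (\<lambda>x. D (Suc n) x - p x)) \<longlonglongrightarrow> 0"
  proof (rule LIMSEQ_I)
    fix r :: real assume r: "r > 0"
    then have "sqrt r / 2 > 0" by simp
    from uniform_limitD[OF p this] obtain N where
      N: "\<And>n x. n \<ge> N \<Longrightarrow> cmod (D (Suc n) x - p x) < sqrt r / 2"
      unfolding eventually_sequentially dist_norm by auto
    have "norm (sq (\<lambda>x. D (Suc n) x - p x) - 0) < r" if "n \<ge> N" for n
    proof -
      have "sq (\<lambda>x. D (Suc n) x - p x) \<le> (sqrt r / 2)\<^sup>2"
        using N[OF that] by (intro sq_le_bound) (simp add: less_imp_le)
      also have "\<dots> < r" using r by (simp add: power_divide)
      finally show ?thesis by simp
    qed
    then show "\<exists>no. \<forall>n\<ge>no. norm (sq (\<lambda>x. D (Suc n) x - p x) - 0) < r" by blast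
  qed
  \<comment> \<open>The factors are exchanged one at a time; \<open>K\<close> bounds the square norm
    of the second factor while the first is exchanged.\<close>
  have lim_conv: "(\<lambda>n. conv (f n) (g n) x) \<longlonglongrightarrow> conv p' q x"
    if "\<And>n. continuous_on UNIV (f n)" "\<And>n. continuous_on UNIV (g n)" "continuous_on UNIV p'" "continuous_on UNIV q"
      "(\<lambda>n. sq (\<lambda>x. f n x - p' x)) \<longlonglongrightarrow> 0" "(\<lambda>n. sq (\<lambda>x. g n x - q x)) \<longlonglongrightarrow> 0"
      "\<And>n. sq (g n) \<le> K" for f g p' q x K
  proof -
    have "(\<lambda>n. conv (f n) (g n) x - conv p' (g n) x) \<longlonglongrightarrow> 0"
    proof (rule Lim_null_comparison)
      have "(cmod (conv (f n) (g n) x - conv p' (g n) x))\<^sup>2 \<le> sq (\<lambda>x. f n x - p' x) * K" for n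
      proof -
        have "(cmod (conv (f n) (g n) x - conv p' (g n) x))\<^sup>2 \<le> sq (\<lambda>x. f n x - p' x) * sq (g n)"
          unfolding conv_diff_left[OF that(1,3,2), symmetric]
          by (intro conv_bound continuous_intros that)
        also have "\<dots> \<le> sq (\<lambda>x. f n x - p' x) * K" by (intro mult_left_mono that) simp
        finally show ?thesis .
      qed
      then show "\<forall>\<^sub>F n in sequentially. norm (conv (f n) (g n) x - conv p' (g n) x) \<le> sqrt (sq (\<lambda>x. f n x - p' x) * K)"
        by (intro always_eventually allI real_le_rsqrt)
      have "(\<lambda>n. sqrt (sq (\<lambda>x. f n x - p' x) * K)) \<longlonglongrightarrow> sqrt (0 * K)"
        by (intro tendsto_intros that)
      then show "(\<lambda>n. sqrt (sq (\<lambda>x. f n x - p' x) * K)) \<longlonglongrightarrow> 0" by simp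
    qed
    moreover have "(\<lambda>n. conv p' (g n) x - conv p' q x) \<longlonglongrightarrow> 0"
    proof (rule Lim_null_comparison)
      have "(cmod (conv p' (g n) x - conv p' q x))\<^sup>2 \<le> sq p' * sq (\<lambda>x. g n x - q x)" for n
        unfolding conv_diff_right[OF that(3,4,2), symmetric]
        by (intro conv_bound continuous_intros that)
      then show "\<forall>\<^sub>F n in sequentially. norm (conv p' (g n) x - conv p' q x) \<le> sqrt (sq p' * sq (\<lambda>x. g n x - q x))"
        by (intro always_eventually allI real_le_rsqrt)
      have "(\<lambda>n. sqrt (sq p' * sq (\<lambda>x. g n x - q x))) \<longlonglongrightarrow> sqrt (sq p' * 0)"
        by (intro tendsto_intros that)
      then show "(\<lambda>n. sqrt (sq p' * sq (\<lambda>x. g n x - q x))) \<longlonglongrightarrow> 0" by simp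
    qed
    ultimately have "(\<lambda>n. (conv (f n) (g n) x - conv p' (g n) x) + (conv p' (g n) x - conv p' q x)) \<longlonglongrightarrow> 0 + 0"
      by (rule tendsto_add)
    then show ?thesis by (simp add: LIM_zero_iff)
  qed
  have "conv p p x = p x" for x
  proof (rule LIMSEQ_unique)
    have "sq (D (Suc n)) = b (Suc (Suc n + Suc n))" for n
    proof -
      have "complex_of_real (sq (D (Suc n))) = of_real (b (Suc (Suc n + Suc n)))" by (simp only: ip_self[symmetric] ipD)
      then show ?thesis by (simp only: of_real_eq_iff)
    qed
    then have "sq (D (Suc n)) \<le> b 0" for n using decseqD[OF L(2), of 0] by (simp only: b_def)
    then show "(\<lambda>n. conv (D (Suc n)) (D (Suc n)) x) \<longlonglongrightarrow> conv p p x"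
      by (intro lim_conv Dc pc sq0)
    \<comment> \<open>By \<open>Dadd\<close> the convolution square of \<open>D (Suc n)\<close> is
      \<open>D (Suc (2 * n + 2))\<close>, a subsequence of the sequence converging to
      \<open>p\<close>.\<close>
    have "strict_mono (\<lambda>n::nat. 2 * n + 2)" by (rule strict_monoI) simp
    from LIMSEQ_subseq_LIMSEQ[OF pt this, of x]
    show "(\<lambda>n. conv (D (Suc n)) (D (Suc n)) x) \<longlonglongrightarrow> p x"
      by (simp add: Dadd o_def mult_2)
  qed
  then have pp: "conv p p = p" by blast
  have "(\<integral>x. p x * \<psi> x \<partial>\<mu>) = 0" if \<psi>: "continuous_on UNIV \<psi>" and z: "\<And>n. (\<integral>x. conv_power k n x * \<psi> x \<partial>\<mu>) = 0" for \<psi>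
  proof -
    have "(\<integral>x. D n x * \<psi> x \<partial>\<mu>) = 0" for n
      using z[of "Suc (n + n)"] unfolding D_alt c_def[symmetric] by (simp add: mult.assoc)
    \<comment> \<open>The pairing with \<psi> is the value at \<open>e\<close> of a convolution, so
      \<open>lim_conv\<close> applies to it.\<close>
    then have "conv (D n) (\<lambda>x. \<psi> (iv x)) e = 0" for n
      by (simp add: conv_def)
    moreover have "(\<lambda>n. conv (D (Suc n)) (\<lambda>x. \<psi> (iv x)) e) \<longlonglongrightarrow> conv p (\<lambda>x. \<psi> (iv x)) e"
      by (rule lim_conv) (auto simp: Dc pc sq0 cont_comp[OF \<psi> cont_iv])
    ultimately have "conv p (\<lambda>x. \<psi> (iv x)) e = 0" by (simp add: LIMSEQ_const_iff)
    then show ?thesis by (simp add: conv_def)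
  qed
  then show ?thesis using that[OF pc pe pp] by blast
qed

end

section \<open>Matrix representations and Schur orthogonality\<close>

lemma mat_adjoint_carrier: "A \<in> carrier_mat m n \<Longrightarrow> mat_adjoint A \<in> carrier_mat n m"
  by (auto simp: mat_adjoint_def)

lemma mat_adjoint_index:
  fixes A :: "complex mat"
  assumes "A \<in> carrier_mat m n" "i < n" "j < m"
  shows "mat_adjoint A $$ (i,j) = cnj (A $$ (j,i))"
  using assms by (simp add: mat_adjoint_def mat_of_rows_index)

lemma mult_mat_index:
  assumes "A \<in> carrier_mat m n" "B \<in> carrier_mat n l" "i < m" "j < l"
  shows "(A * B) $$ (i,j) = (\<Sum>k<n. A $$ (i,k) * B $$ (k,j))"
  using assms by (auto simp: scalar_prod_def atLeast0LessThan)

lemma mult_mat_vec_index: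
  assumes "A \<in> carrier_mat m n" "w \<in> carrier_vec n" "i < m"
  shows "vec_index (A *\<^sub>v w) i = (\<Sum>k<n. A $$ (i,k) * vec_index w k)"
  using assms by (auto simp: scalar_prod_def atLeast0LessThan)

lemma mat_adjoint_mult:
  fixes A B :: "complex mat"
  assumes A: "A \<in> carrier_mat m n" and B: "B \<in> carrier_mat n l"
  shows "mat_adjoint (A * B) = mat_adjoint B * mat_adjoint A"
proof (rule eq_matI)
  have AB: "A * B \<in> carrier_mat m l" using A B by simp
  note c = mat_adjoint_carrier[OF A] mat_adjoint_carrier[OF B] mat_adjoint_carrier[OF AB]
  fix i j assume "i < dim_row (mat_adjoint B * mat_adjoint A)" "j < dim_col (mat_adjoint B * mat_adjoint A)"
  then have ij: "i < l" "j < m" using c by auto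
  have "(mat_adjoint B * mat_adjoint A) $$ (i,j) = (\<Sum>k<n. cnj (B $$ (k,i)) * cnj (A $$ (j,k)))"
    unfolding mult_mat_index[OF c(2,1) ij]
    by (rule sum.cong) (auto simp: mat_adjoint_index[OF A] mat_adjoint_index[OF B] ij)
  also have "\<dots> = mat_adjoint (A * B) $$ (i,j)"
    unfolding mat_adjoint_index[OF AB ij] mult_mat_index[OF A B ij(2,1)] by (simp add: mult.commute)
  finally show "mat_adjoint (A * B) $$ (i,j) = (mat_adjoint B * mat_adjoint A) $$ (i,j)" by simp
qed (use mat_adjoint_carrier[OF A] mat_adjoint_carrier[OF B] mat_adjoint_carrier[of "A * B" m l] A B in auto)

lemma mat_adjoint_adjoint:
  fixes A :: "complex mat"
  assumes "A \<in> carrier_mat m n"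
  shows "mat_adjoint (mat_adjoint A) = A"
  using assms mat_adjoint_carrier[OF assms] mat_adjoint_carrier[OF mat_adjoint_carrier[OF assms]]
  by (intro eq_matI) (auto simp: mat_adjoint_index[of _ n m] mat_adjoint_index[of _ m n])

lemma subspace_vec_iff:
  "VectorSpace.subspace class_ring W (module_vec TYPE(complex) d) \<longleftrightarrow>
    W \<subseteq> carrier_vec d \<and> 0\<^sub>v d \<in> W \<and> (\<forall>v\<in>W. \<forall>w\<in>W. v + w \<in> W) \<and> (\<forall>c. \<forall>v\<in>W. c \<cdot>\<^sub>v v \<in> W)"
proof -
  have vs: "vectorspace class_ring (module_vec TYPE(complex) d)" by (rule vec_vs)
  then have m: "Module.module class_ring (module_vec TYPE(complex) d)" by (simp only: vectorspace_def)
  show ?thesis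
    unfolding submodule_def VectorSpace.subspace_def
    by (simp only: vs m module_vec_simps simp_thms partial_object.simps UNIV_I) (simp only: Ball_def all_simps conj_ac)
qed

lemma irreducible_repD:
  assumes "irreducible_rep d \<xi>" "W \<subseteq> carrier_vec d" "0\<^sub>v d \<in> W"
    "\<And>v w. v \<in> W \<Longrightarrow> w \<in> W \<Longrightarrow> v + w \<in> W" "\<And>c v. v \<in> W \<Longrightarrow> c \<cdot>\<^sub>v v \<in> W"
    "\<And>x w. w \<in> W \<Longrightarrow> \<xi> x *\<^sub>v w \<in> W" "u \<in> W" "u \<noteq> 0\<^sub>v d"
  shows "W = carrier_vec d"
proof -
  have "VectorSpace.subspace class_ring W (module_vec TYPE(complex) d)"
    unfolding subspace_vec_iff by (intro conjI ballI allI assms(2-5))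
  moreover have "\<forall>x. \<forall>w\<in>W. \<xi> x *\<^sub>v w \<in> W" by (simp add: assms(6))
  ultimately have "W = {0\<^sub>v d} \<or> W = carrier_vec d" using assms(1) by (simp only: irreducible_rep_def)
  then show ?thesis using assms(7,8) by auto
qed

text \<open>Schur's lemma: over the complex numbers \<open>M\<close> has an eigenvalue, and because
  \<open>M\<close> commutes with the representation the eigenspace is a nonzero invariant subspace,
  hence everything.\<close>

lemma irreducible_rep_scalar:
  assumes irr: "irreducible_rep d \<xi>" and \<xi>: "\<And>x. \<xi> x \<in> carrier_mat d d"
    and M: "M \<in> carrier_mat d d" and comm: "\<And>x. \<xi> x * M = M * \<xi> x"
  obtains k where "M = k \<cdot>\<^sub>m 1\<^sub>m d"
proof -
  have d: "d > 0" using irr by (simp add: irreducible_rep_def)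
  obtain as where as: "char_poly M = (\<Prod>a\<leftarrow>as. [:- a, 1:])" "length as = d"
    using char_poly_factorized[OF M] by blast
  then obtain k as' where "as = k # as'" using d by (cases as) auto
  then have "poly (char_poly M) k = 0" using as(1) by simp
  then obtain u where u: "u \<in> carrier_vec d" "u \<noteq> 0\<^sub>v d" "M *\<^sub>v u = k \<cdot>\<^sub>v u"
    using M unfolding eigenvalue_root_char_poly[OF M, symmetric] eigenvalue_def eigenvector_def by auto
  define W where "W = {w \<in> carrier_vec d. M *\<^sub>v w = k \<cdot>\<^sub>v w}"
  have "W = carrier_vec d"
  proof (rule irreducible_repD[OF irr])
    fix x w assume "w \<in> W"
    then have w: "w \<in> carrier_vec d" "M *\<^sub>v w = k \<cdot>\<^sub>v w" by (auto simp: W_def)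
    have "M *\<^sub>v (\<xi> x *\<^sub>v w) = (M * \<xi> x) *\<^sub>v w" using M \<xi>[of x] w by simp
    also have "\<dots> = (\<xi> x * M) *\<^sub>v w" by (simp add: comm)
    also have "\<dots> = \<xi> x *\<^sub>v (M *\<^sub>v w)" using M \<xi>[of x] w by (intro assoc_mult_mat_vec)
    also have "\<dots> = k \<cdot>\<^sub>v (\<xi> x *\<^sub>v w)" using \<xi>[of x] w by (simp add: mult_mat_vec)
    finally show "\<xi> x *\<^sub>v w \<in> W" using \<xi>[of x] w by (auto simp: W_def)
  next
    fix c v assume "v \<in> W"
    then have w: "v \<in> carrier_vec d" "M *\<^sub>v v = k \<cdot>\<^sub>v v" by (auto simp: W_def)
    then show "c \<cdot>\<^sub>v v \<in> W"
      using M by (simp add: W_def mult_mat_vec[OF M] smult_smult_assoc mult.commute)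
  next
    show "0\<^sub>v d \<in> W" using M by (auto simp: W_def)
    show "W \<subseteq> carrier_vec d" by (auto simp: W_def)
    show "u \<in> W" using u by (simp add: W_def)
    fix v w assume "v \<in> W" "w \<in> W"
    then show "v + w \<in> W" using M by (auto simp: W_def mult_add_distrib_mat_vec[OF M] smult_add_distrib_vec[of _ d])
  qed (rule u)
  then have ev: "M *\<^sub>v unit_vec d j = k \<cdot>\<^sub>v unit_vec d j" for j
    unfolding W_def using unit_vec_carrier by blast
  have "M = k \<cdot>\<^sub>m 1\<^sub>m d"
  proof (rule eq_matI)
    fix i j assume "i < dim_row (k \<cdot>\<^sub>m 1\<^sub>m d)" "j < dim_col (k \<cdot>\<^sub>m 1\<^sub>m d)"
    then have ij: "i < d" "j < d" by auto
    have "vec_index (M *\<^sub>v unit_vec d j) i = (\<Sum>k<d. if k = j then M $$ (i,k) else 0)"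
      unfolding mult_mat_vec_index[OF M unit_vec_carrier ij(1)] using ij by (intro sum.cong) auto
    then have "M $$ (i,j) = vec_index (M *\<^sub>v unit_vec d j) i" using ij by simp
    then show "M $$ (i,j) = (k \<cdot>\<^sub>m 1\<^sub>m d) $$ (i,j)" using ij by (simp add: ev)
  qed (use M in auto)
  then show ?thesis by (rule that)
qed

context haar_group begin

interpretation prob_space \<mu> by (rule prob)

lemma rep_carrier: "unitary_rep mul d \<xi> \<Longrightarrow> \<xi> x \<in> carrier_mat d d"
  by (simp add: unitary_rep_def)

lemma rep_cont: "unitary_rep mul d \<xi> \<Longrightarrow> i < d \<Longrightarrow> j < d \<Longrightarrow> continuous_on UNIV (\<lambda>x. \<xi> x $$ (i,j))"
  by (simp add: unitary_rep_def)

lemma rep_mul: "unitary_rep mul d \<xi> \<Longrightarrow> \<xi> (mul x y) = \<xi> x * \<xi> y"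
  by (simp add: unitary_rep_def)

lemma rep_mul_index:
  assumes "unitary_rep mul d \<xi>" "i < d" "j < d"
  shows "\<xi> (mul x y) $$ (i,j) = (\<Sum>k<d. \<xi> x $$ (i,k) * \<xi> y $$ (k,j))"
  unfolding rep_mul[OF assms(1)] by (rule mult_mat_index) (rule rep_carrier[OF assms(1)] assms)+

lemma rep_unitary:
  assumes "unitary_rep mul d \<xi>"
  shows "mat_adjoint (\<xi> x) * \<xi> x = 1\<^sub>m d" "\<xi> x * mat_adjoint (\<xi> x) = 1\<^sub>m d"
proof -
  show "mat_adjoint (\<xi> x) * \<xi> x = 1\<^sub>m d" using assms by (simp add: unitary_rep_def)
  from mat_mult_left_right_inverse[OF mat_adjoint_carrier[OF rep_carrier[OF assms]] rep_carrier[OF assms] this]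
  show "\<xi> x * mat_adjoint (\<xi> x) = 1\<^sub>m d" .
qed

lemma rep_cols:
  assumes "unitary_rep mul d \<xi>" "i < d" "j < d"
  shows "(\<Sum>k<d. cnj (\<xi> x $$ (k,i)) * \<xi> x $$ (k,j)) = (if i = j then 1 else 0)"
proof -
  note c = rep_carrier[OF assms(1), of x]
  have "(mat_adjoint (\<xi> x) * \<xi> x) $$ (i,j) = (\<Sum>k<d. cnj (\<xi> x $$ (k,i)) * \<xi> x $$ (k,j))"
    unfolding mult_mat_index[OF mat_adjoint_carrier[OF c] c assms(2,3)]
    by (rule sum.cong) (auto simp: mat_adjoint_index[OF c] assms)
  then show ?thesis using assms by (simp add: rep_unitary(1)[OF assms(1)])
qed

lemma rep_rows:
  assumes "unitary_rep mul d \<xi>" "i < d" "j < d"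
  shows "(\<Sum>k<d. \<xi> x $$ (i,k) * cnj (\<xi> x $$ (j,k))) = (if i = j then 1 else 0)"
proof -
  note c = rep_carrier[OF assms(1), of x]
  have "(\<xi> x * mat_adjoint (\<xi> x)) $$ (i,j) = (\<Sum>k<d. \<xi> x $$ (i,k) * cnj (\<xi> x $$ (j,k)))"
    unfolding mult_mat_index[OF c mat_adjoint_carrier[OF c] assms(2,3)]
    by (rule sum.cong) (auto simp: mat_adjoint_index[OF c] assms)
  then show ?thesis using assms by (simp add: rep_unitary(2)[OF assms(1)])
qed

lemma rep_bound:
  assumes "unitary_rep mul d \<xi>" "i < d" "j < d"
  shows "cmod (\<xi> x $$ (i,j)) \<le> 1"
proof -
  have "complex_of_real (\<Sum>k<d. (cmod (\<xi> x $$ (i,k)))\<^sup>2) = of_real 1"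
    using rep_rows[OF assms(1,2,2), of x] by (simp add: complex_norm_square del: of_real_power)
  then have "(\<Sum>k<d. (cmod (\<xi> x $$ (i,k)))\<^sup>2) = 1" by (simp only: of_real_eq_iff)
  moreover have "(cmod (\<xi> x $$ (i,j)))\<^sup>2 \<le> (\<Sum>k<d. (cmod (\<xi> x $$ (i,k)))\<^sup>2)"
    using assms by (intro member_le_sum) auto
  ultimately have "(cmod (\<xi> x $$ (i,j)))\<^sup>2 \<le> 1" by simp
  then show ?thesis by (simp add: abs_square_le_1)
qed

lemma rep_iv:
  assumes "unitary_rep mul d \<xi>"
  shows "\<xi> (iv x) = mat_adjoint (\<xi> x)"
proof -
  note c = rep_carrier[OF assms] mat_adjoint_carrier[OF rep_carrier[OF assms]]
  \<comment> \<open>That \<open>\<xi> e\<close> is the identity is not part of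
    \<open>unitary_rep\<close>; it follows because \<open>\<xi> e\<close> is both unitary and
    idempotent.\<close>
  have "\<xi> e = (mat_adjoint (\<xi> e) * \<xi> e) * \<xi> e"
    unfolding rep_unitary(1)[OF assms] using c(1)[of e] by simp
  also have "\<dots> = mat_adjoint (\<xi> e) * (\<xi> e * \<xi> e)" by (rule assoc_mult_mat[OF c(2) c(1) c(1)])
  also have "\<xi> e * \<xi> e = \<xi> e" by (simp only: rep_mul[OF assms, symmetric] left_neutral)
  finally have e: "\<xi> e = 1\<^sub>m d" by (simp only: rep_unitary(1)[OF assms])
  have "\<xi> (iv x) = \<xi> (iv x) * (\<xi> x * mat_adjoint (\<xi> x))"
    unfolding rep_unitary(2)[OF assms] using c(1)[of "iv x"] by simp
  also have "\<dots> = \<xi> (iv x) * \<xi> x * mat_adjoint (\<xi> x)" by (rule assoc_mult_mat[OF c(1) c(1) c(2), symmetric])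
  also have "\<xi> (iv x) * \<xi> x = 1\<^sub>m d" by (simp only: rep_mul[OF assms, symmetric] left_inverse e)
  finally show ?thesis using c(2)[of x] by simp
qed

lemma rep_iv_index:
  assumes "unitary_rep mul d \<xi>" "i < d" "j < d"
  shows "\<xi> (iv x) $$ (i,j) = cnj (\<xi> x $$ (j,i))"
  unfolding rep_iv[OF assms(1)] by (rule mat_adjoint_index[OF rep_carrier[OF assms(1)]]) (auto simp: assms)

text \<open>The average over the group of \<xi>(x) E \<eta>(x)^*, where E is the matrix unit with
  its 1 in row \<open>j\<close> and column \<open>l\<close>. Averaging turns E into an
  intertwiner.\<close>

definition schur_mat :: "nat \<Rightarrow> ('g \<Rightarrow> complex mat) \<Rightarrow> nat \<Rightarrow> ('g \<Rightarrow> complex mat) \<Rightarrow> nat \<Rightarrow> nat \<Rightarrow> complex mat"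
  where "schur_mat d \<xi> d' \<eta> j l = mat d d' (\<lambda>(i,k). ip (\<lambda>x. \<xi> x $$ (i,j)) (\<lambda>x. \<eta> x $$ (k,l)))"

lemma schur_mat_intertwines:
  assumes \<xi>: "unitary_rep mul d \<xi>" and \<eta>: "unitary_rep mul d' \<eta>" and jl: "j < d" "l < d'"
  shows "\<xi> y * schur_mat d \<xi> d' \<eta> j l = schur_mat d \<xi> d' \<eta> j l * \<eta> y"
proof (rule eq_matI)
  let ?M = "schur_mat d \<xi> d' \<eta> j l"
  have M: "?M \<in> carrier_mat d d'" by (simp add: schur_mat_def)
  note c = rep_carrier[OF \<xi>, of y] rep_carrier[OF \<eta>, of y]
  fix i k assume "i < dim_row (?M * \<eta> y)" "k < dim_col (?M * \<eta> y)"
  then have ik: "i < d" "k < d'" using M c by auto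
  note cont = rep_cont[OF \<xi>] rep_cont[OF \<eta>]
  have "(\<xi> y * ?M) $$ (i,k) = (\<Sum>m<d. \<xi> y $$ (i,m) * ip (\<lambda>x. \<xi> x $$ (m,j)) (\<lambda>x. \<eta> x $$ (k,l)))"
    unfolding mult_mat_index[OF c(1) M ik] by (simp add: schur_mat_def ik)
  also have "\<dots> = ip (\<lambda>x. \<Sum>m<d. \<xi> y $$ (i,m) * \<xi> x $$ (m,j)) (\<lambda>x. \<eta> x $$ (k,l))"
    using ik jl by (subst ip_sum_left) (auto simp: ip_scale_left intro!: continuous_intros cont)
  also have "\<dots> = ip (\<lambda>x. \<xi> (mul y x) $$ (i,j)) (\<lambda>x. \<eta> x $$ (k,l))"
    by (simp add: rep_mul_index[OF \<xi> ik(1) jl(1)])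
  also have "\<dots> = ip (\<lambda>x. \<xi> x $$ (i,j)) (\<lambda>x. \<eta> (mul (iv y) x) $$ (k,l))"
    using integral_left[of "\<lambda>x. \<xi> x $$ (i,j) * cnj (\<eta> (mul (iv y) x) $$ (k,l))" y] ik jl
    by (simp add: ip_def assoc[symmetric] cont_comp[OF cont(2)[OF ik(2) jl(2)]] continuous_intros cont)
  also have "\<dots> = (\<Sum>m<d'. cnj (\<eta> (iv y) $$ (k,m)) * ip (\<lambda>x. \<xi> x $$ (i,j)) (\<lambda>x. \<eta> x $$ (m,l)))"
    unfolding rep_mul_index[OF \<eta> ik(2) jl(2)] using ik jl
    by (subst ip_sum_right) (auto simp: ip_scale_right intro!: continuous_intros cont)
  also have "\<dots> = (\<Sum>m<d'. ?M $$ (i,m) * \<eta> y $$ (m,k))"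
    by (rule sum.cong) (auto simp: schur_mat_def ik rep_iv_index[OF \<eta>])
  also have "\<dots> = (?M * \<eta> y) $$ (i,k)" by (rule mult_mat_index[OF M c(2) ik, symmetric])
  finally show "(\<xi> y * ?M) $$ (i,k) = (?M * \<eta> y) $$ (i,k)" .
qed (use rep_carrier[OF \<xi>, of y] rep_carrier[OF \<eta>, of y] in \<open>auto simp: schur_mat_def\<close>)

lemma Schur_orthogonality_same:
  assumes \<xi>: "unitary_rep mul d \<xi>" "irreducible_rep d \<xi>" and ij: "i < d" "j < d" "k < d" "l < d"
  shows "ip (\<lambda>x. \<xi> x $$ (i,j)) (\<lambda>x. \<xi> x $$ (k,l)) = (if i = k \<and> j = l then 1 / of_nat d else 0)"
proof -
  let ?M = "schur_mat d \<xi> d \<xi> j l"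
  have M: "?M \<in> carrier_mat d d" by (simp add: schur_mat_def)
  obtain c where c: "?M = c \<cdot>\<^sub>m 1\<^sub>m d"
    using irreducible_rep_scalar[OF \<xi>(2) rep_carrier[OF \<xi>(1)] M schur_mat_intertwines[OF \<xi>(1,1) ij(2,4)]] .
  have entry: "ip (\<lambda>x. \<xi> x $$ (i,j)) (\<lambda>x. \<xi> x $$ (k,l)) = (if i = k then c else 0)" if "i < d" "k < d" for i k
  proof -
    have "ip (\<lambda>x. \<xi> x $$ (i,j)) (\<lambda>x. \<xi> x $$ (k,l)) = ?M $$ (i,k)" using that by (simp add: schur_mat_def)
    then show ?thesis unfolding c using that by simp
  qed
  \<comment> \<open>Taking the trace determines the scalar: summed over \<open>i\<close>, the
    integrand is the inner product of two columns of a unitary matrix.\<close>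
  have "of_nat d * c = (\<Sum>i<d. ip (\<lambda>x. \<xi> x $$ (i,j)) (\<lambda>x. \<xi> x $$ (i,l)))" by (simp add: entry)
  also have "\<dots> = (\<integral>x. (\<Sum>i<d. \<xi> x $$ (i,j) * cnj (\<xi> x $$ (i,l))) \<partial>\<mu>)"
    unfolding ip_def
    by (rule Bochner_Integration.integral_sum[symmetric]) (auto intro!: cont_integrable continuous_intros rep_cont[OF \<xi>(1)] ij)
  also have "\<dots> = (\<integral>x. (if j = l then 1 else 0) \<partial>\<mu>)"
    using rep_cols[OF \<xi>(1) ij(4,2)] by (simp add: mult.commute[of _ "cnj _"] eq_commute[of l j])
  also have "\<dots> = (if j = l then 1 else 0)" by simp
  finally have "c = (if j = l then 1 / of_nat d else 0)" using ij by (auto simp: field_simps)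
  then show ?thesis using entry[OF ij(1,3)] by simp
qed

text \<open>The adjoint of \<open>M\<close> intertwines in the other direction, so both products of
  \<open>M\<close> with its adjoint commute with an irreducible representation and are scalars
  \<open>p\<close> and \<open>q\<close>. They agree because \<open>M\<close> is nonzero, comparing
  traces gives equal dimensions, and dividing \<open>M\<close> by sqrt p makes it unitary.\<close>

lemma Schur_intertwiner:
  assumes \<xi>: "unitary_rep mul d \<xi>" "irreducible_rep d \<xi>" and \<eta>: "unitary_rep mul d' \<eta>" "irreducible_rep d' \<eta>"
    and M: "M \<in> carrier_mat d d'" and int: "\<And>y. \<xi> y * M = M * \<eta> y" and ik: "i < d" "k < d'" "M $$ (i,k) \<noteq> 0"
  shows "d = d' \<and> equivalent_reps d \<eta> \<xi>"
proof -
  let ?A = "mat_adjoint M"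
  have A: "?A \<in> carrier_mat d' d" by (rule mat_adjoint_carrier[OF M])
  note c = rep_carrier[OF \<xi>(1)] rep_carrier[OF \<eta>(1)]
  have int': "?A * \<xi> y = \<eta> y * ?A" for y
  proof -
    have "mat_adjoint (\<xi> (iv y) * M) = mat_adjoint (M * \<eta> (iv y))" by (simp add: int)
    then have "?A * mat_adjoint (\<xi> (iv y)) = mat_adjoint (\<eta> (iv y)) * ?A"
      by (simp add: mat_adjoint_mult[OF c(1) M] mat_adjoint_mult[OF M c(2)])
    then show ?thesis
      by (simp add: rep_iv[OF \<xi>(1)] rep_iv[OF \<eta>(1)] mat_adjoint_adjoint[OF c(1)] mat_adjoint_adjoint[OF c(2)])
  qed
  have 1: "\<eta> y * (?A * M) = (?A * M) * \<eta> y" for y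
  proof -
    have "\<eta> y * (?A * M) = (?A * \<xi> y) * M" unfolding int' using A M c(2)[of y] by (simp add: assoc_mult_mat[of _ d' d' _ d _ d'])
    also have "\<dots> = ?A * (M * \<eta> y)" unfolding int[symmetric] using A M c(1)[of y] by (simp add: assoc_mult_mat[of _ d' d _ d _ d'])
    also have "\<dots> = (?A * M) * \<eta> y" using A M c(2)[of y] by (simp add: assoc_mult_mat[of _ d' d _ d' _ d'])
    finally show ?thesis .
  qed
  have 2: "\<xi> y * (M * ?A) = (M * ?A) * \<xi> y" for y
  proof -
    have "\<xi> y * (M * ?A) = (M * \<eta> y) * ?A" unfolding int[symmetric] using A M c(1)[of y] by (simp add: assoc_mult_mat[of _ d d _ d' _ d])
    also have "\<dots> = M * (?A * \<xi> y)" unfolding int' using A M c(2)[of y] by (simp add: assoc_mult_mat[of _ d d' _ d' _ d])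
    also have "\<dots> = (M * ?A) * \<xi> y" using A M c(1)[of y] by (simp add: assoc_mult_mat[of _ d d' _ d _ d])
    finally show ?thesis .
  qed
  obtain p where p: "?A * M = p \<cdot>\<^sub>m 1\<^sub>m d'"
    using irreducible_rep_scalar[OF \<eta>(2) c(2) mult_carrier_mat[OF A M] 1] .
  obtain q where q: "M * ?A = q \<cdot>\<^sub>m 1\<^sub>m d"
    using irreducible_rep_scalar[OF \<xi>(2) c(1) mult_carrier_mat[OF M A] 2] .
  have pk: "p = of_real (\<Sum>i<d. (cmod (M $$ (i,k)))\<^sup>2)" if k: "k < d'" for k
  proof -
    have "p = (?A * M) $$ (k,k)" using k by (simp add: p)
    also have "\<dots> = (\<Sum>i<d. cnj (M $$ (i,k)) * M $$ (i,k))"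
      unfolding mult_mat_index[OF A M k k] by (rule sum.cong) (auto simp: mat_adjoint_index[OF M] k)
    finally show ?thesis by (simp add: complex_norm_square mult.commute del: of_real_power)
  qed
  have qi: "q = of_real (\<Sum>k<d'. (cmod (M $$ (i,k)))\<^sup>2)" if i: "i < d" for i
  proof -
    have "q = (M * ?A) $$ (i,i)" using i by (simp add: q)
    also have "\<dots> = (\<Sum>k<d'. M $$ (i,k) * cnj (M $$ (i,k)))"
      unfolding mult_mat_index[OF M A i i] by (rule sum.cong) (auto simp: mat_adjoint_index[OF M] i)
    finally show ?thesis by (simp add: complex_norm_square mult.commute del: of_real_power)
  qed
  have pq: "p = q"
  proof -
    have "M * (?A * M) = (M * ?A) * M" using A M by (simp add: assoc_mult_mat[of _ d d' _ d _ d'])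
    then have "M * (p \<cdot>\<^sub>m 1\<^sub>m d') = (q \<cdot>\<^sub>m 1\<^sub>m d) * M" by (simp add: p q)
    moreover have "M * (p \<cdot>\<^sub>m 1\<^sub>m d') = p \<cdot>\<^sub>m M" using M by (simp add: mult_smult_distrib[OF M one_carrier_mat])
    moreover have "(q \<cdot>\<^sub>m 1\<^sub>m d) * M = q \<cdot>\<^sub>m M" using M by (simp add: mult_smult_assoc_mat[OF one_carrier_mat M])
    ultimately have "p \<cdot>\<^sub>m M = q \<cdot>\<^sub>m M" by (simp only:)
    then have "(p \<cdot>\<^sub>m M) $$ (i,k) = (q \<cdot>\<^sub>m M) $$ (i,k)" by simp
    then show ?thesis using ik M by simp
  qed
  define P where "P = (\<Sum>i<d. (cmod (M $$ (i,k)))\<^sup>2)"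
  have P: "P > 0" unfolding P_def using ik by (intro sum_pos2[of _ i]) auto
  have pP: "p = of_real P" unfolding P_def by (rule pk[OF ik(2)])
  \<comment> \<open>Both traces are the sum of the squared moduli of all entries of
    \<open>M\<close>, summed in the two orders.\<close>
  have "of_nat d' * p = (\<Sum>k<d'. p)" by simp
  also have "\<dots> = (\<Sum>k<d'. complex_of_real (\<Sum>i<d. (cmod (M $$ (i,k)))\<^sup>2))"
    by (intro sum.cong refl pk) simp
  also have "\<dots> = (\<Sum>i<d. complex_of_real (\<Sum>k<d'. (cmod (M $$ (i,k)))\<^sup>2))"
    unfolding of_real_sum by (rule sum.swap)
  also have "\<dots> = (\<Sum>i<d. q)"
    by (intro sum.cong refl qi[symmetric]) simp
  also have "\<dots> = of_nat d * q" by simp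
  finally have "of_nat d' * complex_of_real P = of_nat d * of_real P" by (simp only: pq[symmetric] pP)
  then have dd: "d = d'" using P by simp
  define S where "S = of_real (1 / sqrt P) \<cdot>\<^sub>m M"
  have S: "S \<in> carrier_mat d d" using M dd by (simp add: S_def)
  have adjS: "mat_adjoint S = of_real (1 / sqrt P) \<cdot>\<^sub>m ?A"
  proof (rule eq_matI)
    fix i j assume "i < dim_row (of_real (1 / sqrt P) \<cdot>\<^sub>m ?A)" "j < dim_col (of_real (1 / sqrt P) \<cdot>\<^sub>m ?A)"
    then have ij: "i < d'" "j < d" "i < d" "j < d'" using A dd by auto
    show "mat_adjoint S $$ (i,j) = (of_real (1 / sqrt P) \<cdot>\<^sub>m ?A) $$ (i,j)"
      unfolding mat_adjoint_index[OF S ij(3,2)]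
      using A M ij by (simp add: S_def mat_adjoint_index[OF M])
  qed (use mat_adjoint_carrier[OF S] A dd in auto)
  have "mat_adjoint S * S = (of_real (1 / sqrt P) * of_real (1 / sqrt P)) \<cdot>\<^sub>m (?A * M)"
    unfolding adjS unfolding S_def using A M
    by (intro eq_matI) (auto simp: scalar_prod_def sum_distrib_left algebra_simps)
  also have "\<dots> = 1\<^sub>m d"
    unfolding p pP of_real_mult[symmetric] using P dd by (intro eq_matI) (auto simp: real_sqrt_mult_self)
  finally have "mat_adjoint S * S = 1\<^sub>m d" .
  moreover have "S * \<eta> x = \<xi> x * S" for x
    unfolding S_def using M c(1)[of x] c(2)[of x]
    by (simp add: mult_smult_distrib[of _ d d _ d'] mult_smult_assoc_mat[of _ d d' _ d'] int)
  ultimately show ?thesis using S dd by (auto simp: equivalent_reps_def)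
qed

lemma dual_rep:
  assumes "unitary_dual mul e D" "\<xi> \<in> D"
  shows "unitary_rep mul (rep_dim e \<xi>) \<xi>" "irreducible_rep (rep_dim e \<xi>) \<xi>" "rep_dim e \<xi> > 0"
  using assms by (auto simp: unitary_dual_def irreducible_rep_def)

lemma equivalent_reps_refl:
  assumes "unitary_rep mul d \<xi>"
  shows "equivalent_reps d \<xi> \<xi>"
proof -
  have "mat_adjoint (1\<^sub>m d) = (1\<^sub>m d :: complex mat)"
    using mat_adjoint_carrier[of "1\<^sub>m d :: complex mat" d d]
    by (intro eq_matI) (auto simp: mat_adjoint_index[of _ d d])
  then show ?thesis
    unfolding equivalent_reps_def
    by (intro bexI[of _ "1\<^sub>m d"])
       (auto simp: left_mult_one_mat[OF rep_carrier[OF assms]] right_mult_one_mat[OF rep_carrier[OF assms]])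
qed

lemma Schur_orthogonality:
  assumes D: "unitary_dual mul e D" and \<xi>: "\<xi> \<in> D" and \<eta>: "\<eta> \<in> D"
    and ij: "i < rep_dim e \<xi>" "j < rep_dim e \<xi>" "k < rep_dim e \<eta>" "l < rep_dim e \<eta>"
  shows "ip (\<lambda>x. \<xi> x $$ (i,j)) (\<lambda>x. \<eta> x $$ (k,l)) =
    (if \<xi> = \<eta> \<and> i = k \<and> j = l then 1 / of_nat (rep_dim e \<xi>) else 0)"
proof (cases "\<xi> = \<eta>")
  case True
  then show ?thesis using Schur_orthogonality_same[OF dual_rep(1,2)[OF D \<xi>]] ij by simp
next
  case False
  note r = dual_rep(1,2)[OF D \<xi>] dual_rep(1,2)[OF D \<eta>]
  let ?M = "schur_mat (rep_dim e \<xi>) \<xi> (rep_dim e \<eta>) \<eta> j l"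
  have M: "?M \<in> carrier_mat (rep_dim e \<xi>) (rep_dim e \<eta>)" by (simp add: schur_mat_def)
  have "?M $$ (i,k) = 0"
  proof (rule ccontr)
    assume "?M $$ (i,k) \<noteq> 0"
    from Schur_intertwiner[OF r M schur_mat_intertwines[OF r(1,3) ij(2,4)] ij(1,3) this]
    have eq: "rep_dim e \<xi> = rep_dim e \<eta>" "equivalent_reps (rep_dim e \<xi>) \<eta> \<xi>" by auto
    \<comment> \<open>Both \<xi> and \<eta> would be elements of \<open>D\<close> equivalent to
      \<xi>, against uniqueness of representatives.\<close>
    have "\<exists>!\<zeta>. \<zeta> \<in> D \<and> rep_dim e \<zeta> = rep_dim e \<xi> \<and> equivalent_reps (rep_dim e \<xi>) \<zeta> \<xi>"
      using D r unfolding unitary_dual_def by blast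
    then show False using eq \<xi> \<eta> equivalent_reps_refl[OF r(1)] False by metis
  qed
  then show ?thesis using ij False by (simp add: schur_mat_def)
qed

end

section \<open>Completeness of matrix coefficients\<close>

context haar_group begin

interpretation prob_space \<mu> by (rule prob)

definition function_space :: "('g \<Rightarrow> complex) set \<Rightarrow> bool"
  where "function_space V \<longleftrightarrow> (\<forall>f\<in>V. continuous_on UNIV f) \<and> (\<lambda>x. 0) \<in> V \<and>
    (\<forall>f\<in>V. \<forall>g\<in>V. \<forall>c. (\<lambda>x. f x + c * g x) \<in> V)"

definition translation_invariant :: "('g \<Rightarrow> complex) set \<Rightarrow> bool"
  where "translation_invariant V \<longleftrightarrow> (\<forall>f\<in>V. \<forall>a. (\<lambda>x. f (mul (iv a) x)) \<in> V)"

text \<open>Orthonormal families stand in for bases: a space of functions has dimension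
  \<open>d\<close> when it contains such a family of length \<open>d\<close> and none of length
  \<open>Suc d\<close>.\<close>

definition orthonormal :: "('g \<Rightarrow> complex) set \<Rightarrow> nat \<Rightarrow> (nat \<Rightarrow> 'g \<Rightarrow> complex) \<Rightarrow> bool"
  where "orthonormal V d f \<longleftrightarrow> (\<forall>i<d. f i \<in> V) \<and> (\<forall>i<d. \<forall>j<d. ip (f i) (f j) = (if i = j then 1 else 0))"

lemma function_spaceD:
  assumes "function_space V"
  shows "f \<in> V \<Longrightarrow> continuous_on UNIV f" "(\<lambda>x. 0) \<in> V"
    "f \<in> V \<Longrightarrow> g \<in> V \<Longrightarrow> (\<lambda>x. f x + c * g x) \<in> V"
  using assms by (simp_all add: function_space_def)

lemma function_space_scale:
  assumes "function_space V" "f \<in> V"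
  shows "(\<lambda>x. c * f x) \<in> V"
  using function_spaceD(3)[OF assms(1) function_spaceD(2)[OF assms(1)] assms(2), of c] by simp

lemma function_space_sum:
  assumes V: "function_space V" and "finite I" "\<And>i. i \<in> I \<Longrightarrow> f i \<in> V"
  shows "(\<lambda>x. \<Sum>i\<in>I. c i * f i x) \<in> V"
  using assms(2,3)
proof (induction I rule: finite_induct)
  case empty
  then show ?case using function_spaceD(2)[OF V] by simp
next
  case (insert i I)
  have "(\<lambda>x. (\<Sum>i\<in>I. c i * f i x) + c i * f i x) \<in> V"
    using insert by (intro function_spaceD(3)[OF V]) auto
  then show ?case using insert by (simp add: add.commute)
qed

lemma orthonormal_prefix: "orthonormal V d f \<Longrightarrow> m \<le> d \<Longrightarrow> orthonormal V m f"
  by (auto simp: orthonormal_def)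

lemma ip_orthonormal_sum:
  assumes V: "function_space V" and f: "orthonormal V d f" and j: "j < d"
  shows "ip (\<lambda>x. \<Sum>i<d. c i * f i x) (f j) = c j"
proof -
  have fc: "continuous_on UNIV (f i)" if "i < d" for i
    using f that function_spaceD(1)[OF V] by (auto simp: orthonormal_def)
  have "ip (\<lambda>x. \<Sum>i<d. c i * f i x) (f j) = (\<Sum>i<d. c i * ip (f i) (f j))"
    using j by (subst ip_sum_left) (auto simp: ip_scale_left intro!: continuous_intros fc)
  also have "\<dots> = (\<Sum>i<d. if i = j then c i else 0)"
    using f j by (intro sum.cong) (auto simp: orthonormal_def)
  finally show ?thesis using j by simp
qed

text \<open>If \<open>v\<close> differed from its orthogonal projection, the normalised remainder
  would lengthen the family.\<close>

lemma maximal_orthonormal_spans: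
  assumes V: "function_space V" and f: "orthonormal V d f" and max: "\<And>g. \<not> orthonormal V (Suc d) g"
    and v: "v \<in> V"
  shows "v = (\<lambda>x. \<Sum>i<d. ip v (f i) * f i x)"
proof -
  have fV: "f i \<in> V" if "i < d" for i using f that by (simp add: orthonormal_def)
  define s where "s = (\<lambda>x. \<Sum>i<d. ip v (f i) * f i x)"
  have s: "s \<in> V" unfolding s_def by (intro function_space_sum V) (auto simp: fV)
  define w where "w = (\<lambda>x. v x - s x)"
  have w: "w \<in> V" using function_spaceD(3)[OF V v s, of "-1"] by (simp add: w_def)
  note c = function_spaceD(1)[OF V]
  have orth: "ip w (f j) = 0" if "j < d" for j
    unfolding w_def ip_diff_left[OF c[OF v] c[OF s] c[OF fV[OF that]]]
    unfolding s_def ip_orthonormal_sum[OF V f that] by simp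
  have "sq w = 0"
  proof (rule ccontr)
    assume "sq w \<noteq> 0"
    then have pos: "sq w > 0" by (rule sq_pos)
    define k where "k = complex_of_real (1 / sqrt (sq w))"
    define u where "u = (\<lambda>x. k * w x)"
    have kk: "k * (cnj k * of_real (sq w)) = 1"
      unfolding k_def using pos by (simp flip: of_real_mult)
    have uu: "ip u u = 1" unfolding u_def ip_scale_left ip_scale_right ip_self by (rule kk)
    have uf: "ip u (f j) = 0" "ip (f j) u = 0" if "j < d" for j
    proof -
      show "ip u (f j) = 0" by (simp add: u_def ip_scale_left orth that)
      then show "ip (f j) u = 0" by (metis complex_cnj_zero ip_cnj)
    qed
    have "orthonormal V (Suc d) (f(d := u))"
      using f uu uf function_space_scale[OF V w, of k] by (auto simp: orthonormal_def less_Suc_eq u_def[symmetric])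
    then show False using max by blast
  qed
  then have "w x = 0" for x by (rule sq_eq_0[OF c[OF w]])
  then show ?thesis by (simp add: w_def s_def fun_eq_iff)
qed

lemma maximal_orthonormal_exists:
  assumes bound: "\<And>d f. orthonormal V d f \<Longrightarrow> d \<le> N"
  obtains d f where "orthonormal V d f" "\<forall>g. \<not> orthonormal V (Suc d) g"
proof -
  let ?P = "\<lambda>d. \<exists>f. orthonormal V d f"
  have 0: "?P 0" by (simp add: orthonormal_def)
  have le: "\<And>y. ?P y \<Longrightarrow> y \<le> N" using bound by blast
  obtain f where f: "orthonormal V (Greatest ?P) f" using GreatestI_nat[of ?P, OF 0 le] by blast
  have max: "m \<le> Greatest ?P" if "orthonormal V m g" for m g
    using that by (intro Greatest_le_nat[of ?P, OF _ le]) blast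
  show ?thesis
  proof (rule that[OF f])
    show "\<forall>g. \<not> orthonormal V (Suc (Greatest ?P)) g"
      using max[of "Suc (Greatest ?P)"] by auto
  qed
qed

text \<open>Left translation commutes with convolution from the right, which gives invariance. For
  the dimension bound, f = f * p makes each value \<open>f i x\<close> an inner product of
  \<open>f i\<close> with one fixed function of square norm \<open>sq p\<close>; Bessel bounds the
  sum of their squares, and integrating over \<open>x\<close> counts the family.\<close>

lemma fixed_space:
  assumes p: "continuous_on UNIV p"
  defines "V \<equiv> {f. continuous_on UNIV f \<and> conv f p = f}"
  shows "function_space V" "translation_invariant V" "orthonormal V d f \<Longrightarrow> real d \<le> sq p"
proof -
  show V: "function_space V"
    unfolding function_space_def
  proof (intro conjI ballI allI)
    show "(\<lambda>x. 0) \<in> V" by (simp add: V_def conv_def fun_eq_iff)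
    fix f g c assume f: "f \<in> V" and g: "g \<in> V"
    then have "conv (\<lambda>x. f x + c * g x) p x = f x + c * g x" for x
      by (subst conv_add_left) (auto simp: V_def conv_scale_left p intro!: continuous_intros)
    then show "(\<lambda>x. f x + c * g x) \<in> V" using f g by (auto simp: V_def intro!: continuous_intros)
  qed (simp add: V_def)
  show "translation_invariant V"
    unfolding translation_invariant_def
  proof (intro ballI allI)
    fix f a assume "f \<in> V"
    then have f: "continuous_on UNIV f" "\<And>x. conv f p x = f x" by (auto simp: V_def)
    have "conv (\<lambda>x. f (mul (iv a) x)) p x = conv f p (mul (iv a) x)" for x
    proof -
      have "conv (\<lambda>x. f (mul (iv a) x)) p x
          = (\<integral>y. f (mul (iv a) (mul a y)) * p (mul (iv (mul a y)) x) \<partial>\<mu>)"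
        unfolding conv_def
        by (rule integral_left[symmetric, of "\<lambda>y. f (mul (iv a) y) * p (mul (iv y) x)"])
           (intro continuous_intros cont_comp[OF f(1)] cont_comp[OF p])
      also have "\<dots> = conv f p (mul (iv a) x)"
        by (simp add: conv_def inverse_distrib_swap assoc[symmetric])
      finally show ?thesis .
    qed
    then show "(\<lambda>x. f (mul (iv a) x)) \<in> V"
      using f by (auto simp: V_def intro!: cont_comp[OF f(1)] continuous_intros)
  qed
  show "real d \<le> sq p" if f: "orthonormal V d f"
  proof -
    have fc: "continuous_on UNIV (f i)" "conv (f i) p = f i" if "i < d" for i
      using f that by (auto simp: orthonormal_def V_def)
    have pt: "(\<Sum>i<d. (cmod (f i x))\<^sup>2) \<le> sq p" for x
    proof -
      let ?q = "\<lambda>y. cnj (p (mul (iv y) x))"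
      have q: "continuous_on UNIV ?q" by (intro continuous_intros cont_comp[OF p])
      have "cmod (f i x) = cmod (ip ?q (f i))" if "i < d" for i
      proof -
        have "f i x = ip (f i) ?q" using fc(2)[OF that] by (metis conv_eq_ip)
        then show ?thesis by (metis complex_mod_cnj ip_cnj)
      qed
      then have "(\<Sum>i<d. (cmod (f i x))\<^sup>2) = (\<Sum>i\<in>{..<d}. (cmod (ip ?q (f i)))\<^sup>2)" by simp
      also have "\<dots> \<le> sq ?q"
        using f by (intro Bessel q) (auto simp: fc orthonormal_def)
      also have "\<dots> = sq p" by (rule sq_cnj_reflect[OF p])
      finally show ?thesis .
    qed
    have "sq (f i) = 1" if "i < d" for i
    proof -
      have "complex_of_real (sq (f i)) = of_real 1" using f that by (simp add: ip_self[symmetric] orthonormal_def)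
      then show ?thesis by (simp only: of_real_eq_iff)
    qed
    then have "real d = (\<Sum>i<d. sq (f i))" by simp
    also have "\<dots> = (\<integral>x. (\<Sum>i<d. (cmod (f i x))\<^sup>2) \<partial>\<mu>)"
      unfolding sq_def
      by (rule Bochner_Integration.integral_sum[symmetric]) (auto intro!: cont_integrable continuous_intros fc)
    also have "\<dots> \<le> (\<integral>x. sq p \<partial>\<mu>)"
      by (rule integral_mono) (auto intro!: cont_integrable continuous_intros fc pt)
    finally show ?thesis by simp
  qed
qed

text \<open>Minimality is expressed by dimension rather than by inclusion: among the positive
  dimensions of invariant subspaces of \<open>V\<close> there is a least one. A nonzero invariant
  subspace of \<open>U\<close> must then have the full dimension of \<open>U\<close>.\<close>

lemma minimal_invariant_space:
  assumes V: "function_space V" "translation_invariant V" and bound: "\<And>d f. orthonormal V d f \<Longrightarrow> d \<le> N"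
    and nz: "v \<in> V" "v z \<noteq> 0"
  obtains U d f where "function_space U" "U \<subseteq> V" "translation_invariant U" "d > 0" "orthonormal U d f"
    "\<forall>g. \<not> orthonormal U (Suc d) g"
    "\<forall>U' m g. function_space U' \<longrightarrow> U' \<subseteq> V \<longrightarrow> translation_invariant U' \<longrightarrow> m > 0 \<longrightarrow> orthonormal U' m g \<longrightarrow>
       (\<forall>g. \<not> orthonormal U' (Suc m) g) \<longrightarrow> d \<le> m"
proof -
  define Q where "Q d \<longleftrightarrow> (\<exists>U f. function_space U \<and> U \<subseteq> V \<and> translation_invariant U \<and> d > 0 \<and>
     orthonormal U d f \<and> (\<forall>g. \<not> orthonormal U (Suc d) g))" for d
  obtain m f where f: "orthonormal V m f" "\<forall>g. \<not> orthonormal V (Suc m) g"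
    using maximal_orthonormal_exists[OF bound] .
  have "m > 0"
  proof (rule ccontr)
    assume "\<not> m > 0"
    then show False using maximal_orthonormal_spans[OF V(1) f(1) f(2)[rule_format] nz(1)] nz(2) by (simp add: fun_eq_iff)
  qed
  then have "Q m" unfolding Q_def by (intro exI[of _ V] exI[of _ f] conjI V f order_refl)
  then have "Q (LEAST d. Q d)" by (rule LeastI)
  then obtain U f where U: "function_space U" "U \<subseteq> V" "translation_invariant U" "(LEAST d. Q d) > 0"
    "orthonormal U (LEAST d. Q d) f" "\<forall>g. \<not> orthonormal U (Suc (LEAST d. Q d)) g"
    by (subst (asm) (2) Q_def) auto
  show ?thesis
  proof (rule that[OF U], intro allI impI)
    fix U' m g
    assume "function_space U'" "U' \<subseteq> V" "translation_invariant U'" "m > 0" "orthonormal U' m g"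
      "\<forall>g. \<not> orthonormal U' (Suc m) g"
    then have "Q m" unfolding Q_def by (intro exI[of _ U'] exI[of _ g] conjI)
    then show "(LEAST d. Q d) \<le> m" by (rule Least_le)
  qed
qed

text \<open>\<pi>(a) is the matrix of left translation by \<open>a\<close> in the orthonormal basis
  \<open>f\<close>; invariance of the measure makes it unitary. An invariant subspace of coordinate
  vectors corresponds to an invariant space of functions, to which \<open>min\<close>
  applies.\<close>

lemma irreducible_rep_of_minimal_space:
  assumes U: "function_space U" "translation_invariant U" and d: "d > 0" and f: "orthonormal U d f"
    and max: "\<And>g. \<not> orthonormal U (Suc d) g"
    and min: "\<And>U' m g. function_space U' \<Longrightarrow> U' \<subseteq> U \<Longrightarrow> translation_invariant U' \<Longrightarrow> m > 0 \<Longrightarrow>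
       orthonormal U' m g \<Longrightarrow> (\<And>g. \<not> orthonormal U' (Suc m) g) \<Longrightarrow> d \<le> m"
  obtains \<pi> where "unitary_rep mul d \<pi>" "irreducible_rep d \<pi>"
    "\<forall>j a x. j < d \<longrightarrow> f j (mul (iv a) x) = (\<Sum>i<d. \<pi> a $$ (i,j) * f i x)"
proof -
  note c = function_spaceD(1)[OF U(1)]
  have fU: "f i \<in> U" and fc: "continuous_on UNIV (f i)" if "i < d" for i
    using f that c by (auto simp: orthonormal_def)
  have LU: "(\<lambda>x. f j (mul (iv a) x)) \<in> U" if "j < d" for j a
    using U(2) fU[OF that] by (simp add: translation_invariant_def)
  define \<pi> where "\<pi> a = mat d d (\<lambda>(i,j). ip (\<lambda>x. f j (mul (iv a) x)) (f i))" for a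
  have \<pi>c: "\<pi> a \<in> carrier_mat d d" for a by (simp add: \<pi>_def)
  have \<pi>ij: "\<pi> a $$ (i,j) = ip (\<lambda>x. f j (mul (iv a) x)) (f i)" if "i < d" "j < d" for a i j
    using that by (simp add: \<pi>_def)
  have expand: "f j (mul (iv a) x) = (\<Sum>i<d. \<pi> a $$ (i,j) * f i x)" if "j < d" for j a x
    using fun_cong[OF maximal_orthonormal_spans[OF U(1) f max LU[OF that, of a]], of x] that by (simp add: \<pi>ij)
  have rep: "unitary_rep mul d \<pi>"
    unfolding unitary_rep_def
  proof (intro conjI allI impI)
    fix x show "\<pi> x \<in> carrier_mat d d" by (rule \<pi>c)
    show "mat_adjoint (\<pi> x) * \<pi> x = 1\<^sub>m d"
    proof (rule eq_matI)
      fix i j assume "i < dim_row (1\<^sub>m d :: complex mat)" "j < dim_col (1\<^sub>m d :: complex mat)"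
      then have ij: "i < d" "j < d" by auto
      have "(mat_adjoint (\<pi> x) * \<pi> x) $$ (i,j) = (\<Sum>k<d. mat_adjoint (\<pi> x) $$ (i,k) * \<pi> x $$ (k,j))"
        by (rule mult_mat_index[OF mat_adjoint_carrier[OF \<pi>c] \<pi>c ij])
      also have "\<dots> = (\<Sum>k<d. \<pi> x $$ (k,j) * ip (f k) (\<lambda>y. f i (mul (iv x) y)))"
        by (rule sum.cong) (auto simp: mat_adjoint_index[OF \<pi>c] ij \<pi>ij[of _ i] ip_cnj mult.commute)
      also have "\<dots> = ip (\<lambda>y. \<Sum>k<d. \<pi> x $$ (k,j) * f k y) (\<lambda>y. f i (mul (iv x) y))"
        using ij by (subst ip_sum_left) (auto simp: ip_scale_left intro!: continuous_intros fc cont_comp[OF fc])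
      also have "\<dots> = ip (\<lambda>y. f j (mul (iv x) y)) (\<lambda>y. f i (mul (iv x) y))" by (simp add: expand ij)
      also have "\<dots> = ip (f j) (f i)"
        unfolding ip_def by (rule integral_left[of "\<lambda>y. f j y * cnj (f i y)"]) (intro continuous_intros fc ij)
      also have "\<dots> = 1\<^sub>m d $$ (i,j)" using f ij by (auto simp: orthonormal_def)
      finally show "(mat_adjoint (\<pi> x) * \<pi> x) $$ (i,j) = 1\<^sub>m d $$ (i,j)" .
    qed (use \<pi>c[of x] mat_adjoint_carrier[OF \<pi>c[of x]] in auto)
    fix y
    show "\<pi> (mul x y) = \<pi> x * \<pi> y"
    proof (rule eq_matI)
      fix i j assume "i < dim_row (\<pi> x * \<pi> y)" "j < dim_col (\<pi> x * \<pi> y)"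
      then have ij: "i < d" "j < d" using \<pi>c[of x] \<pi>c[of y] by auto
      have "\<pi> (mul x y) $$ (i,j) = ip (\<lambda>z. f j (mul (iv y) (mul (iv x) z))) (f i)"
        by (simp add: \<pi>ij ij inverse_distrib_swap assoc)
      also have "\<dots> = ip (\<lambda>z. \<Sum>k<d. \<pi> y $$ (k,j) * f k (mul (iv x) z)) (f i)"
        by (simp only: expand[OF ij(2)])
      also have "\<dots> = (\<Sum>k<d. \<pi> y $$ (k,j) * ip (\<lambda>z. f k (mul (iv x) z)) (f i))"
        using ij by (subst ip_sum_left) (auto simp: ip_scale_left intro!: continuous_intros fc cont_comp[OF fc])
      also have "\<dots> = (\<Sum>k<d. \<pi> x $$ (i,k) * \<pi> y $$ (k,j))"
        by (rule sum.cong) (auto simp: \<pi>ij ij mult.commute)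
      also have "\<dots> = (\<pi> x * \<pi> y) $$ (i,j)" by (rule mult_mat_index[OF \<pi>c \<pi>c ij, symmetric])
      finally show "\<pi> (mul x y) $$ (i,j) = (\<pi> x * \<pi> y) $$ (i,j)" .
    qed (use \<pi>c[of x] \<pi>c[of y] \<pi>c[of "mul x y"] in auto)
  next
    fix i j assume ij: "i < d" "j < d"
    have "continuous_on UNIV (\<lambda>a. \<integral>x. f j (mul (iv a) x) * cnj (f i x) \<partial>\<mu>)"
      by (rule cont_param_integral)
         (auto simp: case_prod_unfold intro!: continuous_intros cont_comp[OF fc[OF ij(1)]] cont_comp[OF fc[OF ij(2)]])
    then show "continuous_on UNIV (\<lambda>x. \<pi> x $$ (i,j))" by (simp add: \<pi>ij ij ip_def)
  qed
  have "irreducible_rep d \<pi>"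
    unfolding irreducible_rep_def subspace_vec_iff
  proof (intro conjI allI impI d)
    fix W assume "(W \<subseteq> carrier_vec d \<and> 0\<^sub>v d \<in> W \<and> (\<forall>v\<in>W. \<forall>w\<in>W. v + w \<in> W) \<and> (\<forall>c. \<forall>v\<in>W. c \<cdot>\<^sub>v v \<in> W)) \<and>
      (\<forall>x. \<forall>w\<in>W. \<pi> x *\<^sub>v w \<in> W)"
    then have W: "W \<subseteq> carrier_vec d" "0\<^sub>v d \<in> W" "\<And>v w. v \<in> W \<Longrightarrow> w \<in> W \<Longrightarrow> v + w \<in> W"
      "\<And>c v. v \<in> W \<Longrightarrow> c \<cdot>\<^sub>v v \<in> W" "\<And>x w. w \<in> W \<Longrightarrow> \<pi> x *\<^sub>v w \<in> W" by auto
    \<comment> \<open>\<open>F w\<close> is the function with coordinate vector \<open>w\<close>; it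
      carries the invariant subspace \<open>W\<close> to a translation-invariant space inside
      \<open>U\<close>.\<close>
    define F where "F w = (\<lambda>x. \<Sum>j<d. vec_index w j * f j x)" for w
    have FU: "F w \<in> U" for w unfolding F_def by (intro function_space_sum U) (auto simp: fU)
    have Fip: "ip (F w) (f j) = vec_index w j" if "j < d" for w j
      unfolding F_def by (rule ip_orthonormal_sum[OF U(1) f that])
    have Finj: "u = w" if "F u = F w" "u \<in> carrier_vec d" "w \<in> carrier_vec d" for u w
      using that by (intro eq_vecI) (auto simp: Fip[symmetric])
    define U' where "U' = F ` W"
    have U'U: "U' \<subseteq> U" by (auto simp: U'_def FU)
    have U': "function_space U'"
      unfolding function_space_def
    proof (intro conjI ballI allI)
      show "(\<lambda>x. 0) \<in> U'" unfolding U'_def by (rule image_eqI[OF _ W(2)]) (simp add: F_def)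
      fix g h k assume "g \<in> U'" "h \<in> U'"
      then obtain u w where uw: "g = F u" "h = F w" "u \<in> W" "w \<in> W" by (auto simp: U'_def)
      then have uwc: "u \<in> carrier_vec d" "w \<in> carrier_vec d" using W(1) by auto
      have "g x + k * h x = F (u + k \<cdot>\<^sub>v w) x" for x
        unfolding uw F_def sum_distrib_left sum.distrib[symmetric]
        using uwc by (intro sum.cong) (auto simp: distrib_right mult.assoc)
      then have "(\<lambda>x. g x + k * h x) = F (u + k \<cdot>\<^sub>v w)" by blast
      then show "(\<lambda>x. g x + k * h x) \<in> U'" using uw W by (auto simp: U'_def)
    qed (use U'U c in auto)
    have inv: "translation_invariant U'"
      unfolding translation_invariant_def
    proof (intro ballI allI)
      fix g a assume "g \<in> U'"
      then obtain w where w: "g = F w" "w \<in> W" by (auto simp: U'_def)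
      then have wc: "w \<in> carrier_vec d" using W(1) by auto
      have "g (mul (iv a) x) = F (\<pi> a *\<^sub>v w) x" for x
      proof -
        have "g (mul (iv a) x) = (\<Sum>j<d. vec_index w j * (\<Sum>i<d. \<pi> a $$ (i,j) * f i x))"
          unfolding w(1) F_def by (rule sum.cong) (auto simp: expand)
        also have "\<dots> = (\<Sum>j<d. \<Sum>i<d. (\<pi> a $$ (i,j) * vec_index w j) * f i x)"
          by (simp add: sum_distrib_left mult_ac)
        also have "\<dots> = (\<Sum>i<d. \<Sum>j<d. (\<pi> a $$ (i,j) * vec_index w j) * f i x)" by (rule sum.swap)
        also have "\<dots> = (\<Sum>i<d. vec_index (\<pi> a *\<^sub>v w) i * f i x)"
          by (rule sum.cong) (auto simp only: mult_mat_vec_index[OF \<pi>c wc] sum_distrib_right lessThan_iff)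
        finally show ?thesis by (simp only: F_def)
      qed
      then show "(\<lambda>x. g (mul (iv a) x)) \<in> U'" using W(5)[OF w(2), of a] by (auto simp: U'_def)
    qed
    show "W = {0\<^sub>v d} \<or> W = carrier_vec d"
    proof (rule disjCI)
      assume "W \<noteq> carrier_vec d"
      show "W = {0\<^sub>v d}"
      proof (rule ccontr)
        assume "W \<noteq> {0\<^sub>v d}"
        then obtain w where w: "w \<in> W" "w \<noteq> 0\<^sub>v d" using W(2) by blast
        have bound: "\<And>m g. orthonormal U' m g \<Longrightarrow> m \<le> d"
        proof (rule ccontr)
          fix m g assume g: "orthonormal U' m g" "\<not> m \<le> d"
          have "orthonormal U' (Suc d) g" by (rule orthonormal_prefix[OF g(1)]) (use g(2) in simp)
          then have "orthonormal U (Suc d) g" using U'U by (auto simp: orthonormal_def)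
          then show False using max by blast
        qed
        obtain m g where g: "orthonormal U' m g" "\<forall>g. \<not> orthonormal U' (Suc m) g"
          using maximal_orthonormal_exists[OF bound] .
        have "m > 0"
        proof (rule ccontr)
          assume "\<not> m > 0"
          moreover have "F w \<in> U'" using w by (auto simp: U'_def)
          ultimately have "F w = (\<lambda>x. 0)" using maximal_orthonormal_spans[OF U' g(1) g(2)[rule_format], of "F w"] by simp
          then have "F w = F (0\<^sub>v d)" by (simp add: F_def)
          then show False using Finj[of w "0\<^sub>v d"] w W(1) by auto
        qed
        \<comment> \<open>The first \<open>d\<close> members of \<open>g\<close> already form a
          family of maximal length in \<open>U\<close>, so they span \<open>U\<close>; as they lie
          in \<open>U'\<close>, the image of \<open>W\<close> is all of \<open>U\<close>.\<close>
        then have "d \<le> m" by (rule min[OF U' U'U inv _ g(1) g(2)[rule_format]])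
        then have gd: "orthonormal U' d g" by (rule orthonormal_prefix[OF g(1)])
        then have gU: "orthonormal U d g" using U'U by (auto simp: orthonormal_def)
        have "u \<in> W" if u: "u \<in> carrier_vec d" for u
        proof -
          have "F u = (\<lambda>x. \<Sum>i<d. ip (F u) (g i) * g i x)"
            by (rule maximal_orthonormal_spans[OF U(1) gU max FU])
          also have "\<dots> \<in> U'" using gd by (intro function_space_sum U') (auto simp: orthonormal_def)
          finally obtain w where "F u = F w" "w \<in> W" by (auto simp: U'_def)
          then show ?thesis using Finj[of u w] u W(1) by auto
        qed
        then show False using W(1) \<open>W \<noteq> carrier_vec d\<close> by blast
      qed
    qed
  qed
  then show ?thesis using that[OF rep] expand by simp
qed

lemma integral_double_sum:
  fixes F :: "nat \<Rightarrow> nat \<Rightarrow> 'g \<Rightarrow> complex"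
  assumes F: "\<And>i l. i < d \<Longrightarrow> l < d' \<Longrightarrow> continuous_on UNIV (F i l)"
  shows "(\<integral>x. (\<Sum>i<d. \<Sum>l<d'. F i l x * c i l) \<partial>\<mu>) = (\<Sum>i<d. \<Sum>l<d'. (\<integral>x. F i l x \<partial>\<mu>) * c i l)"
proof -
  have "(\<integral>x. (\<Sum>i<d. \<Sum>l<d'. F i l x * c i l) \<partial>\<mu>) = (\<Sum>i<d. (\<integral>x. (\<Sum>l<d'. F i l x * c i l) \<partial>\<mu>))"
    by (rule Bochner_Integration.integral_sum) (auto intro!: cont_integrable continuous_intros F)
  also have "\<dots> = (\<Sum>i<d. \<Sum>l<d'. (\<integral>x. F i l x * c i l \<partial>\<mu>))"
    by (intro sum.cong refl Bochner_Integration.integral_sum) (auto intro!: cont_integrable continuous_intros F)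
  finally show ?thesis by simp
qed

text \<open>A function in the fixed space of \<open>p\<close> equals its convolution with
  \<open>p\<close>. For a basis function of a minimal invariant subspace this convolution is a
  combination of the integrals of \<open>p\<close> against coefficients of an irreducible \<pi>, so
  it would vanish.\<close>

lemma idempotent_has_coefficient:
  assumes p: "continuous_on UNIV p" "conv p p = p" "p e \<noteq> 0"
    and zero: "\<And>d \<pi> i j. unitary_rep mul d \<pi> \<Longrightarrow> irreducible_rep d \<pi> \<Longrightarrow> i < d \<Longrightarrow> j < d \<Longrightarrow>
      (\<integral>x. p x * \<pi> x $$ (i,j) \<partial>\<mu>) = 0"
  shows False
proof -
  let ?V = "{f. continuous_on UNIV f \<and> conv f p = f}"
  note V = fixed_space[OF p(1)]
  have bound: "d \<le> nat \<lceil>sq p\<rceil>" if "orthonormal ?V d f" for d f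
    using V(3)[OF that] by linarith
  have pV: "p \<in> ?V" using p by simp
  obtain U d f where U: "function_space U" "U \<subseteq> ?V" "translation_invariant U" "d > 0" "orthonormal U d f"
    "\<forall>g. \<not> orthonormal U (Suc d) g"
    "\<forall>U' m g. function_space U' \<longrightarrow> U' \<subseteq> ?V \<longrightarrow> translation_invariant U' \<longrightarrow> m > 0 \<longrightarrow> orthonormal U' m g \<longrightarrow>
       (\<forall>g. \<not> orthonormal U' (Suc m) g) \<longrightarrow> d \<le> m"
    using minimal_invariant_space[OF V(1,2) bound pV p(3)] .
  have min: "d \<le> m" if "function_space U'" "U' \<subseteq> U" "translation_invariant U'" "m > 0" "orthonormal U' m g"
      "\<And>g. \<not> orthonormal U' (Suc m) g" for U' m g
  proof -
    have "U' \<subseteq> ?V" using that(2) U(2) by (rule order_trans)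
    then show ?thesis using U(7)[rule_format, of U' m g] that by blast
  qed
  obtain \<pi> where \<pi>: "unitary_rep mul d \<pi>" "irreducible_rep d \<pi>"
    "\<forall>j a x. j < d \<longrightarrow> f j (mul (iv a) x) = (\<Sum>i<d. \<pi> a $$ (i,j) * f i x)"
    using irreducible_rep_of_minimal_space[OF U(1,3,4,5) U(6)[rule_format] min] .
  have f0: "continuous_on UNIV (f 0)" "conv (f 0) p = f 0" using U(2,4,5) by (auto simp: orthonormal_def)
  have "f 0 x = 0" for x
  proof -
    have "f 0 x = conv (f 0) p x" by (simp add: f0(2))
    also have "\<dots> = (\<integral>y. f 0 (mul x y) * p (mul (iv (mul x y)) x) \<partial>\<mu>)"
      unfolding conv_def by (rule integral_left[symmetric, of "\<lambda>y. f 0 y * p (mul (iv y) x)"])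
         (intro continuous_intros cont_comp[OF f0(1)] cont_comp[OF p(1)])
    also have "\<dots> = (\<integral>y. f 0 (mul x y) * p (iv y) \<partial>\<mu>)"
      by (simp add: inverse_distrib_swap assoc)
    also have "\<dots> = (\<integral>y. f 0 (mul x (iv y)) * p (iv (iv y)) \<partial>\<mu>)"
      by (rule integral_inv[symmetric, of "\<lambda>y. f 0 (mul x y) * p (iv y)"])
         (intro continuous_intros cont_comp[OF f0(1)] cont_comp[OF p(1)])
    also have "\<dots> = (\<integral>y. (\<Sum>i<d. \<Sum>l<d. (p y * \<pi> y $$ (i,l)) * (\<pi> (iv x) $$ (l,0) * f i e)) \<partial>\<mu>)"
    proof (rule Bochner_Integration.integral_cong[OF refl])
      fix y
      \<comment> \<open>Writing x y^-1 as the inverse of y x^-1, applied to \<open>e\<close>, moves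
        the dependence on \<open>y\<close> into the entries of \<open>\<pi> y\<close>, without
        inverse or conjugation.\<close>
      have "f 0 (mul x (iv y)) = f 0 (mul (iv (mul y (iv x))) e)" by (simp add: inverse_distrib_swap)
      also have "\<dots> = (\<Sum>i<d. (\<Sum>l<d. \<pi> y $$ (i,l) * \<pi> (iv x) $$ (l,0)) * f i e)"
        using U(4) unfolding \<pi>(3)[rule_format, OF U(4)] by (intro sum.cong) (auto simp: rep_mul_index[OF \<pi>(1)])
      finally show "f 0 (mul x (iv y)) * p (iv (iv y)) =
          (\<Sum>i<d. \<Sum>l<d. (p y * \<pi> y $$ (i,l)) * (\<pi> (iv x) $$ (l,0) * f i e))"
        by (simp add: sum_distrib_left sum_distrib_right mult_ac)
    qed
    also have "\<dots> = (\<Sum>i<d. \<Sum>l<d. (\<integral>y. p y * \<pi> y $$ (i,l) \<partial>\<mu>) * (\<pi> (iv x) $$ (l,0) * f i e))"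
      by (rule integral_double_sum) (intro continuous_intros p(1) rep_cont[OF \<pi>(1)])
    also have "\<dots> = 0" by (simp add: zero[OF \<pi>(1,2)])
    finally show ?thesis .
  qed
  then have "ip (f 0) (f 0) = 0" by (simp add: ip_def)
  then show False using U(4,5) by (simp add: orthonormal_def)
qed

text \<open>Integrating a function against \<xi> extends the representation from the group to its
  convolution algebra, so convolution becomes multiplication of coefficient matrices.\<close>

lemma conv_coefficient:
  assumes \<xi>: "unitary_rep mul d \<xi>" and ij: "i < d" "j < d"
    and a: "continuous_on UNIV a" and b: "continuous_on UNIV b"
  shows "(\<integral>x. conv a b x * \<xi> x $$ (i,j) \<partial>\<mu>)
    = (\<Sum>m<d. (\<integral>x. a x * \<xi> x $$ (i,m) \<partial>\<mu>) * (\<integral>x. b x * \<xi> x $$ (m,j) \<partial>\<mu>))"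
proof -
  note c = rep_cont[OF \<xi>]
  have "(\<integral>x. conv a b x * \<xi> x $$ (i,j) \<partial>\<mu>) = (\<integral>x. (\<integral>y. a y * b (mul (iv y) x) * \<xi> x $$ (i,j) \<partial>\<mu>) \<partial>\<mu>)"
    by (simp add: conv_def)
  also have "\<dots> = (\<integral>y. (\<integral>x. a y * b (mul (iv y) x) * \<xi> x $$ (i,j) \<partial>\<mu>) \<partial>\<mu>)"
    by (rule Fubini_cont)
       (auto simp: case_prod_unfold intro!: continuous_intros cont_comp[OF a] cont_comp[OF b] cont_comp[OF c[OF ij]])
  also have "\<dots> = (\<integral>y. (\<Sum>m<d. (a y * \<xi> y $$ (i,m)) * (\<integral>x. b x * \<xi> x $$ (m,j) \<partial>\<mu>)) \<partial>\<mu>)"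
  proof (rule Bochner_Integration.integral_cong[OF refl])
    fix y
    have "(\<integral>x. a y * b (mul (iv y) x) * \<xi> x $$ (i,j) \<partial>\<mu>)
        = (\<integral>x. a y * b (mul (iv y) (mul y x)) * \<xi> (mul y x) $$ (i,j) \<partial>\<mu>)"
      by (rule integral_left[symmetric, of "\<lambda>x. a y * b (mul (iv y) x) * \<xi> x $$ (i,j)"])
         (intro continuous_intros cont_comp[OF b] c ij)
    also have "\<dots> = (\<integral>x. (\<Sum>m<d. (a y * \<xi> y $$ (i,m)) * (b x * \<xi> x $$ (m,j))) \<partial>\<mu>)"
      by (simp add: assoc[symmetric] rep_mul_index[OF \<xi> ij] sum_distrib_left mult_ac)
    also have "\<dots> = (\<Sum>m<d. (\<integral>x. (a y * \<xi> y $$ (i,m)) * (b x * \<xi> x $$ (m,j)) \<partial>\<mu>))"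
      by (rule Bochner_Integration.integral_sum) (auto intro!: cont_integrable continuous_intros b c ij)
    finally show "(\<integral>x. a y * b (mul (iv y) x) * \<xi> x $$ (i,j) \<partial>\<mu>)
        = (\<Sum>m<d. (a y * \<xi> y $$ (i,m)) * (\<integral>x. b x * \<xi> x $$ (m,j) \<partial>\<mu>))" by simp
  qed
  also have "\<dots> = (\<Sum>m<d. (\<integral>y. (a y * \<xi> y $$ (i,m)) * (\<integral>x. b x * \<xi> x $$ (m,j) \<partial>\<mu>) \<partial>\<mu>))"
    by (rule Bochner_Integration.integral_sum) (auto intro!: cont_integrable continuous_intros a c ij)
  finally show ?thesis by simp
qed

theorem coefficients_complete:
  assumes D: "unitary_dual mul e D" and h: "continuous_on UNIV h"
    and zero: "\<And>\<xi> i j. \<xi> \<in> D \<Longrightarrow> i < rep_dim e \<xi> \<Longrightarrow> j < rep_dim e \<xi> \<Longrightarrow> (\<integral>x. h x * \<xi> x $$ (i,j) \<partial>\<mu>) = 0"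
  shows "h x = 0"
proof (rule ccontr)
  assume "h x \<noteq> 0"
  then have "sq h \<noteq> 0" using sq_eq_0[OF h] by blast
  \<comment> \<open>The hypothesis speaks only of the representatives in \<open>D\<close>. Every
    irreducible \<pi> is conjugate to one of them by a unitary matrix \<open>S\<close>, so its
    entries are combinations of theirs.\<close>
  have zero': "(\<integral>x. h x * \<pi> x $$ (i,j) \<partial>\<mu>) = 0"
    if \<pi>: "unitary_rep mul d \<pi>" "irreducible_rep d \<pi>" and ij: "i < d" "j < d" for d \<pi> i j
  proof -
    obtain \<xi> S where \<xi>: "\<xi> \<in> D" "rep_dim e \<xi> = d" and S: "S \<in> carrier_mat d d" "mat_adjoint S * S = 1\<^sub>m d"
      "\<And>x. S * \<xi> x = \<pi> x * S"
    proof -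
      have "\<exists>!\<xi>. \<xi> \<in> D \<and> rep_dim e \<xi> = d \<and> equivalent_reps d \<xi> \<pi>"
        using D \<pi> unfolding unitary_dual_def by blast
      then obtain \<xi> where \<xi>: "\<xi> \<in> D" "rep_dim e \<xi> = d" "equivalent_reps d \<xi> \<pi>" by (elim ex1E conjE)
      then show ?thesis using that unfolding equivalent_reps_def by blast
    qed
    note r = dual_rep(1)[OF D \<xi>(1), unfolded \<xi>(2)]
    note A = mat_adjoint_carrier[OF S(1)]
    have S': "S * mat_adjoint S = 1\<^sub>m d" by (rule mat_mult_left_right_inverse[OF A S(1,2)])
    have "\<pi> x $$ (i,j) = (\<Sum>l<d. \<Sum>k<d. \<xi> x $$ (k,l) * (S $$ (i,k) * cnj (S $$ (j,l))))" for x
    proof -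
      have "\<pi> x = \<pi> x * (S * mat_adjoint S)" unfolding S' using rep_carrier[OF \<pi>(1), of x] by simp
      also have "\<dots> = (S * \<xi> x) * mat_adjoint S"
        unfolding S(3) by (rule assoc_mult_mat[OF rep_carrier[OF \<pi>(1)] S(1) A, symmetric])
      finally have "\<pi> x $$ (i,j) = ((S * \<xi> x) * mat_adjoint S) $$ (i,j)" by (rule arg_cong)
      also have "\<dots> = (\<Sum>l<d. (\<Sum>k<d. S $$ (i,k) * \<xi> x $$ (k,l)) * cnj (S $$ (j,l)))"
        unfolding mult_mat_index[OF mult_carrier_mat[OF S(1) rep_carrier[OF r]] A ij]
        by (rule sum.cong) (auto simp only: mult_mat_index[OF S(1) rep_carrier[OF r] ij(1)] mat_adjoint_index[OF S(1)] ij lessThan_iff)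
      finally show ?thesis by (simp add: sum_distrib_right sum_distrib_left mult_ac)
    qed
    then have "(\<integral>x. h x * \<pi> x $$ (i,j) \<partial>\<mu>)
        = (\<integral>x. (\<Sum>l<d. \<Sum>k<d. (h x * \<xi> x $$ (k,l)) * (S $$ (i,k) * cnj (S $$ (j,l)))) \<partial>\<mu>)"
      by (simp add: sum_distrib_left mult_ac)
    also have "\<dots> = (\<Sum>l<d. \<Sum>k<d. (\<integral>x. h x * \<xi> x $$ (k,l) \<partial>\<mu>) * (S $$ (i,k) * cnj (S $$ (j,l))))"
      by (rule integral_double_sum[of d d "\<lambda>l k x. h x * \<xi> x $$ (k,l)"]) (intro continuous_intros h rep_cont[OF r])
    also have "\<dots> = 0" using zero[OF \<xi>(1)] \<xi>(2) by simp
    finally show ?thesis .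
  qed
  define h' where "h' = (\<lambda>x. cnj (h (iv x)))"
  have h': "continuous_on UNIV h'" unfolding h'_def by (intro continuous_intros cont_comp[OF h])
  define k where "k = conv h h'"
  have k: "continuous_on UNIV k" unfolding k_def by (rule conv_cont[OF h h'])
  have sym: "k (iv x) = cnj (k x)" for x
  proof -
    have "cnj (k (iv x)) = k x" unfolding k_def conv_cnj_reflect[OF h h'] by (simp add: h'_def)
    then show ?thesis by (metis complex_cnj_cnj)
  qed
  have "k e = ip h h" unfolding k_def conv_eq_ip by (simp add: h'_def)
  then have "k e \<noteq> 0" using \<open>sq h \<noteq> 0\<close> by (simp add: ip_self)
  obtain p where p: "continuous_on UNIV p" "p e \<noteq> 0" "conv p p = p"
    "\<forall>\<psi>. continuous_on UNIV \<psi> \<longrightarrow> (\<forall>n. (\<integral>x. conv_power k n x * \<psi> x \<partial>\<mu>) = 0) \<longrightarrow> (\<integral>x. p x * \<psi> x \<partial>\<mu>) = 0"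
    using idempotent_limit[OF k sym \<open>k e \<noteq> 0\<close>] .
  show False
  proof (rule idempotent_has_coefficient[OF p(1,3,2)])
    fix d \<pi> i j assume \<pi>: "unitary_rep mul d \<pi>" "irreducible_rep d \<pi>" and ij: "i < d" "j < d"
    have k0: "(\<integral>x. k x * \<pi> x $$ (i,j) \<partial>\<mu>) = 0" if "i < d" "j < d" for i j
      unfolding k_def conv_coefficient[OF \<pi>(1) that h h'] by (simp add: zero'[OF \<pi> that(1)])
    have "(\<integral>x. conv_power k n x * \<pi> x $$ (i,j) \<partial>\<mu>) = 0" for n
    proof (cases n)
      case (Suc m)
      show ?thesis
        unfolding Suc conv_power.simps conv_coefficient[OF \<pi>(1) ij k conv_power_cont[OF k]] by (simp add: k0 ij)
    qed (simp add: k0 ij)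
    then show "(\<integral>x. p x * \<pi> x $$ (i,j) \<partial>\<mu>) = 0"
      using p(4) rep_cont[OF \<pi>(1) ij] by blast
  qed
qed

end

section \<open>Uniform Fourier approximation\<close>

context haar_group begin

interpretation prob_space \<mu> by (rule prob)

text \<open>The block d_\<xi> Tr(\<xi>(x) H) of the Fourier series of \<open>h\<close>, where H is
  the Fourier coefficient of \<open>h\<close> at \<xi>: its entry in row j and column i is
  \<open>ip h\<close> against the entry (i,j) of \<xi>.\<close>

definition fourier_part :: "('g \<Rightarrow> complex) \<Rightarrow> ('g \<Rightarrow> complex mat) \<Rightarrow> 'g \<Rightarrow> complex"
  where "fourier_part h \<xi> x = of_nat (rep_dim e \<xi>) *
    (\<Sum>i<rep_dim e \<xi>. \<Sum>j<rep_dim e \<xi>. ip h (\<lambda>y. \<xi> y $$ (i,j)) * \<xi> x $$ (i,j))"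

text \<open>d_\<xi> times the squared Hilbert-Schmidt norm of the Fourier coefficient: the share of
  \<xi> in the square norm of \<open>h\<close>.\<close>

definition fourier_energy :: "('g \<Rightarrow> complex) \<Rightarrow> ('g \<Rightarrow> complex mat) \<Rightarrow> real"
  where "fourier_energy h \<xi> = real (rep_dim e \<xi>) *
    (\<Sum>i<rep_dim e \<xi>. \<Sum>j<rep_dim e \<xi>. (cmod (ip h (\<lambda>y. \<xi> y $$ (i,j))))\<^sup>2)"

lemma fourier_energy_nonneg: "fourier_energy h \<xi> \<ge> 0"
  unfolding fourier_energy_def by (intro mult_nonneg_nonneg sum_nonneg) auto

lemma ip_conv_coefficient:
  assumes \<xi>: "unitary_rep mul d \<xi>" and ij: "i < d" "j < d"
    and a: "continuous_on UNIV a" and b: "continuous_on UNIV b"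
  shows "ip (conv a b) (\<lambda>x. \<xi> x $$ (i,j)) = (\<Sum>m<d. ip a (\<lambda>x. \<xi> x $$ (i,m)) * ip b (\<lambda>x. \<xi> x $$ (m,j)))"
proof -
  have cn: "(\<integral>x. cnj (f x) * \<xi> x $$ (i,j) \<partial>\<mu>) = cnj (ip f (\<lambda>x. \<xi> x $$ (i,j)))" for f i j
    unfolding ip_def cnj_integral by simp
  \<comment> \<open>Conjugating both factors turns the inner products into the unconjugated pairings
    of \<open>conv_coefficient\<close>.\<close>
  have "conv (\<lambda>x. cnj (a x)) (\<lambda>x. cnj (b x)) = (\<lambda>x. cnj (conv a b x))"
    unfolding conv_def[abs_def] cnj_integral by simp
  then have "cnj (ip (conv a b) (\<lambda>x. \<xi> x $$ (i,j)))
      = (\<integral>x. conv (\<lambda>x. cnj (a x)) (\<lambda>x. cnj (b x)) x * \<xi> x $$ (i,j) \<partial>\<mu>)"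
    by (simp only: cn)
  also have "\<dots> = (\<Sum>m<d. cnj (ip a (\<lambda>x. \<xi> x $$ (i,m))) * cnj (ip b (\<lambda>x. \<xi> x $$ (m,j))))"
    by (subst conv_coefficient[OF \<xi> ij]) (auto simp only: cn intro!: continuous_intros a b)
  also have "\<dots> = cnj (\<Sum>m<d. ip a (\<lambda>x. \<xi> x $$ (i,m)) * ip b (\<lambda>x. \<xi> x $$ (m,j)))" by simp
  finally show ?thesis by (simp only: complex_cnj_cancel_iff)
qed

lemma fourier_part_cont:
  assumes "unitary_dual mul e D" "\<xi> \<in> D"
  shows "continuous_on UNIV (fourier_part h \<xi>)"
  unfolding fourier_part_def[abs_def]
  by (intro continuous_intros rep_cont[OF dual_rep(1)[OF assms]]) auto

text \<open>A convolution square has absolutely summable Fourier series, because the coefficient matrix of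
  \<open>g * g\<close> is the square of that of \<open>g\<close>.\<close>

lemma fourier_part_conv_bound:
  assumes D: "unitary_dual mul e D" "\<xi> \<in> D" and g: "continuous_on UNIV g"
  shows "cmod (fourier_part (conv g g) \<xi> x) \<le> fourier_energy g \<xi>"
proof -
  define d where "d = rep_dim e \<xi>"
  note r = dual_rep(1)[OF D, folded d_def]
  define c where "c i j = ip g (\<lambda>y. \<xi> y $$ (i,j))" for i j
  \<comment> \<open>\<open>b m\<close> is the image of row \<open>m\<close> of the coefficient
    matrix \<open>c\<close> under the unitary matrix \<open>\<xi> x\<close>, hence a vector of the
    same length; \<open>b2\<close> proves this from orthonormality of the columns.\<close>
  define b where "b m i = (\<Sum>j<d. c m j * \<xi> x $$ (i,j))" for m i
  have eq: "fourier_part (conv g g) \<xi> x = of_nat d * (\<Sum>i<d. \<Sum>m<d. c i m * b m i)"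
  proof -
    have "(\<Sum>j<d. ip (conv g g) (\<lambda>y. \<xi> y $$ (i,j)) * \<xi> x $$ (i,j)) = (\<Sum>m<d. c i m * b m i)" if "i < d" for i
    proof -
      have "(\<Sum>j<d. ip (conv g g) (\<lambda>y. \<xi> y $$ (i,j)) * \<xi> x $$ (i,j))
          = (\<Sum>j<d. \<Sum>m<d. c i m * c m j * \<xi> x $$ (i,j))"
        using that by (intro sum.cong) (auto simp: ip_conv_coefficient[OF r _ _ g g] c_def sum_distrib_right)
      also have "\<dots> = (\<Sum>m<d. \<Sum>j<d. c i m * c m j * \<xi> x $$ (i,j))" by (rule sum.swap)
      also have "\<dots> = (\<Sum>m<d. c i m * b m i)" by (simp add: b_def sum_distrib_left mult.assoc)
      finally show ?thesis .
    qed
    then show ?thesis by (simp add: fourier_part_def d_def[symmetric])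
  qed
  have b2: "(\<Sum>i<d. (cmod (b m i))\<^sup>2) = (\<Sum>j<d. (cmod (c m j))\<^sup>2)" for m
  proof -
    have "complex_of_real (\<Sum>i<d. (cmod (b m i))\<^sup>2) = (\<Sum>i<d. b m i * cnj (b m i))"
      by (simp add: complex_norm_square del: of_real_power)
    also have "\<dots> = (\<Sum>i<d. \<Sum>j<d. \<Sum>l<d. c m j * cnj (c m l) * (cnj (\<xi> x $$ (i,l)) * \<xi> x $$ (i,j)))"
      by (simp add: b_def sum_product mult_ac)
    also have "\<dots> = (\<Sum>j<d. \<Sum>i<d. \<Sum>l<d. c m j * cnj (c m l) * (cnj (\<xi> x $$ (i,l)) * \<xi> x $$ (i,j)))"
      by (rule sum.swap)
    also have "\<dots> = (\<Sum>j<d. \<Sum>l<d. \<Sum>i<d. c m j * cnj (c m l) * (cnj (\<xi> x $$ (i,l)) * \<xi> x $$ (i,j)))"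
      by (intro sum.cong refl sum.swap)
    also have "\<dots> = (\<Sum>j<d. \<Sum>l<d. if l = j then c m j * cnj (c m l) else 0)"
      unfolding sum_distrib_left[symmetric] by (intro sum.cong) (auto simp: rep_cols[OF r])
    also have "\<dots> = (\<Sum>j<d. c m j * cnj (c m j))" by (intro sum.cong) auto
    also have "\<dots> = complex_of_real (\<Sum>j<d. (cmod (c m j))\<^sup>2)"
      by (simp add: complex_norm_square del: of_real_power)
    finally show ?thesis by (simp only: of_real_eq_iff)
  qed
  have "cmod (\<Sum>i<d. \<Sum>m<d. c i m * b m i) \<le> (\<Sum>i<d. \<Sum>m<d. cmod (c i m) * cmod (b m i))"
    by (intro sum_norm_le) (simp add: norm_mult flip: norm_mult)
  \<comment> \<open>The arithmetic-geometric mean inequality, term by term; by \<open>b2\<close> the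
    two resulting sums of squares coincide, so the factor 1/2 disappears.\<close>
  also have "\<dots> \<le> (\<Sum>i<d. \<Sum>m<d. ((cmod (c i m))\<^sup>2 + (cmod (b m i))\<^sup>2) / 2)"
  proof (intro sum_mono)
    fix i m
    show "cmod (c i m) * cmod (b m i) \<le> ((cmod (c i m))\<^sup>2 + (cmod (b m i))\<^sup>2) / 2"
      using sum_squares_bound[of "cmod (c i m)" "cmod (b m i)"] by simp
  qed
  also have "\<dots> = ((\<Sum>i<d. \<Sum>m<d. (cmod (c i m))\<^sup>2) + (\<Sum>i<d. \<Sum>m<d. (cmod (b m i))\<^sup>2)) / 2"
    by (simp add: sum.distrib sum_divide_distrib[symmetric])
  also have "(\<Sum>i<d. \<Sum>m<d. (cmod (b m i))\<^sup>2) = (\<Sum>m<d. \<Sum>i<d. (cmod (b m i))\<^sup>2)" by (rule sum.swap)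
  also have "\<dots> = (\<Sum>i<d. \<Sum>m<d. (cmod (c i m))\<^sup>2)" by (simp add: b2)
  finally have "cmod (\<Sum>i<d. \<Sum>m<d. c i m * b m i) \<le> (\<Sum>i<d. \<Sum>m<d. (cmod (c i m))\<^sup>2)" by simp
  then show ?thesis
    unfolding eq fourier_energy_def d_def[symmetric] c_def[symmetric] norm_mult norm_of_nat
    by (intro mult_left_mono) auto
qed

text \<open>By Schur orthogonality the entries of \<xi> multiplied by sqrt d_\<xi> form an
  orthonormal family over all \<xi> in \<open>F\<close>, and Bessel's inequality applies.\<close>

lemma fourier_energy_sum_le:
  assumes D: "unitary_dual mul e D" and F: "finite F" "F \<subseteq> D" and g: "continuous_on UNIV g"
  shows "(\<Sum>\<xi>\<in>F. fourier_energy g \<xi>) \<le> sq g"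
proof -
  define I where "I = (SIGMA \<xi>:F. {..<rep_dim e \<xi>} \<times> {..<rep_dim e \<xi>})"
  define f where "f = (\<lambda>(\<xi>,i,j) x. complex_of_real (sqrt (real (rep_dim e \<xi>))) * \<xi> x $$ (i,j))"
  have "(\<Sum>k\<in>I. (cmod (ip g (f k)))\<^sup>2) \<le> sq g"
  proof (rule Bessel)
    show "finite I" unfolding I_def using F by auto
    show "continuous_on UNIV (f k)" if "k \<in> I" for k
      using that F by (auto simp: I_def f_def intro!: continuous_intros rep_cont[OF dual_rep(1)[OF D]])
    fix k l assume "k \<in> I" "l \<in> I"
    moreover obtain \<xi> i j where k: "k = (\<xi>,i,j)" by (cases k)
    moreover obtain \<eta> i' j' where l: "l = (\<eta>,i',j')" by (cases l)
    ultimately have kl: "k = (\<xi>,i,j)" "l = (\<eta>,i',j')" "\<xi> \<in> D" "\<eta> \<in> D" "i < rep_dim e \<xi>" "j < rep_dim e \<xi>"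
      "i' < rep_dim e \<eta>" "j' < rep_dim e \<eta>" using F by (auto simp: I_def)
    have pos: "real (rep_dim e \<xi>) > 0" using dual_rep(3)[OF D kl(3)] by simp
    have "complex_of_real (sqrt (real (rep_dim e \<xi>))) * complex_of_real (sqrt (real (rep_dim e \<xi>))) = of_nat (rep_dim e \<xi>)"
      using pos by (simp flip: of_real_mult)
    then show "ip (f k) (f l) = (if k = l then 1 else 0)"
      unfolding kl f_def prod.case ip_scale_left ip_scale_right Schur_orthogonality[OF D kl(3-8)]
      using pos by auto
  qed (rule g)
  also have "(\<Sum>k\<in>I. (cmod (ip g (f k)))\<^sup>2) = (\<Sum>\<xi>\<in>F. \<Sum>(i,j)\<in>{..<rep_dim e \<xi>} \<times> {..<rep_dim e \<xi>}.
      real (rep_dim e \<xi>) * (cmod (ip g (\<lambda>x. \<xi> x $$ (i,j))))\<^sup>2)"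
    unfolding I_def using F
    by (subst sum.Sigma) (auto simp: f_def case_prod_unfold ip_scale_right norm_mult power_mult_distrib intro!: sum.cong)
  also have "\<dots> = (\<Sum>\<xi>\<in>F. fourier_energy g \<xi>)"
    by (intro sum.cong refl) (simp add: fourier_energy_def sum_distrib_left sum.cartesian_product)
  finally show ?thesis .
qed

lemma ip_fourier_part:
  assumes D: "unitary_dual mul e D" and \<xi>: "\<xi> \<in> D" and \<eta>: "\<eta> \<in> D" and kl: "k < rep_dim e \<eta>" "l < rep_dim e \<eta>"
  shows "ip (fourier_part h \<xi>) (\<lambda>x. \<eta> x $$ (k,l)) = (if \<xi> = \<eta> then ip h (\<lambda>x. \<eta> x $$ (k,l)) else 0)"
proof -
  define d where "d = rep_dim e \<xi>"
  note r = dual_rep(1)[OF D \<xi>, folded d_def] and r' = dual_rep(1)[OF D \<eta>]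
  note c = rep_cont[OF r]
  have "ip (fourier_part h \<xi>) (\<lambda>x. \<eta> x $$ (k,l))
      = of_nat d * (\<Sum>i<d. \<Sum>j<d. ip h (\<lambda>y. \<xi> y $$ (i,j)) * ip (\<lambda>x. \<xi> x $$ (i,j)) (\<lambda>x. \<eta> x $$ (k,l)))"
    unfolding fourier_part_def[abs_def] d_def[symmetric] ip_scale_left
    apply (subst ip_sum_left)
    apply (intro continuous_intros c; simp)
    apply (rule rep_cont[OF r' kl])
    apply (rule arg_cong[where f="(*) _"])
    apply (intro sum.cong refl)
    apply (subst ip_sum_left)
    apply (intro continuous_intros c; simp)
    apply (rule rep_cont[OF r' kl])
    apply (simp add: ip_scale_left)
    done
  also have "\<dots> = of_nat d * (\<Sum>i<d. \<Sum>j<d. if j = l then (if i = k then (if \<xi> = \<eta> then ip h (\<lambda>y. \<xi> y $$ (i,j)) / of_nat d else 0) else 0) else 0)"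
    by (intro arg_cong[where f="(*) _"] sum.cong refl)
       (auto simp: Schur_orthogonality[OF D \<xi> \<eta> _ _ kl] d_def)
  also have "\<dots> = (if \<xi> = \<eta> then ip h (\<lambda>x. \<eta> x $$ (k,l)) else 0)"
    using kl dual_rep(3)[OF D \<xi>] by (auto simp: d_def)
  finally show ?thesis .
qed

text \<open>The energies of \<open>g\<close> are summable and dominate the blocks of g * g, so the
  Weierstrass test gives some uniform limit \<open>S\<close>. Coefficients pass to uniform limits,
  so \<open>S\<close> and g * g have the same ones and agree by completeness. Convergence is along
  finite subsets of \<open>D\<close>, which may be uncountable at this point.\<close>

theorem conv_fourier_uniform:
  assumes D: "unitary_dual mul e D" and g: "continuous_on UNIV g"
  shows "uniform_limit UNIV (\<lambda>F x. \<Sum>\<xi>\<in>F. fourier_part (conv g g) \<xi> x) (conv g g) (finite_subsets_at_top D)"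
proof -
  let ?S = "\<lambda>F x. \<Sum>\<xi>\<in>F. fourier_part (conv g g) \<xi> x"
  define S where "S x = (\<Sum>\<^sub>\<infinity>\<xi>\<in>D. fourier_part (conv g g) \<xi> x)" for x
  have gg: "continuous_on UNIV (conv g g)" by (rule conv_cont[OF g g])
  have "fourier_energy g summable_on D"
    by (rule nonneg_bdd_above_summable_on)
       (auto simp: fourier_energy_nonneg intro!: bdd_aboveI2[where M="sq g"] fourier_energy_sum_le[OF D _ _ g])
  then have lim: "uniform_limit UNIV ?S S (finite_subsets_at_top D)"
    unfolding S_def using fourier_part_conv_bound[OF D _ g]
    by (intro Weierstrass_m_test_general) auto
  have ev: "\<forall>\<^sub>F F in finite_subsets_at_top D. finite F \<and> F \<subseteq> D"
    by (simp add: eventually_finite_subsets_at_top_weakI)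
  have Fc: "continuous_on UNIV (?S F)" if "F \<subseteq> D" for F
    using that by (intro continuous_intros fourier_part_cont[OF D]) auto
  have Sc: "continuous_on UNIV S"
    by (rule uniform_limit_theorem[OF _ lim]) (auto intro: eventually_mono[OF ev] Fc)
  have coef: "ip S (\<lambda>x. \<eta> x $$ (k,l)) = ip (conv g g) (\<lambda>x. \<eta> x $$ (k,l))"
    if \<eta>: "\<eta> \<in> D" and kl: "k < rep_dim e \<eta>" "l < rep_dim e \<eta>" for \<eta> k l
  proof (rule tendsto_unique[OF finite_subsets_at_top_neq_bot])
    let ?e = "\<lambda>x. \<eta> x $$ (k,l)"
    note r = dual_rep(1)[OF D \<eta>]
    have ec: "continuous_on UNIV ?e" by (rule rep_cont[OF r kl])
    show "((\<lambda>F. ip (?S F) ?e) \<longlongrightarrow> ip (conv g g) ?e) (finite_subsets_at_top D)"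
    proof (rule tendsto_eventually)
      have "\<forall>\<^sub>F F in finite_subsets_at_top D. finite F \<and> {\<eta>} \<subseteq> F \<and> F \<subseteq> D"
        unfolding eventually_finite_subsets_at_top using \<eta> by (intro exI[of _ "{\<eta>}"]) auto
      then show "\<forall>\<^sub>F F in finite_subsets_at_top D. ip (?S F) ?e = ip (conv g g) ?e"
      proof eventually_elim
        case (elim F)
        have "ip (?S F) ?e = (\<Sum>\<xi>\<in>F. ip (fourier_part (conv g g) \<xi>) ?e)"
          using elim by (intro ip_sum_left fourier_part_cont[OF D] ec) auto
        also have "\<dots> = (\<Sum>\<xi>\<in>F. if \<xi> = \<eta> then ip (conv g g) ?e else 0)"
          using elim by (intro sum.cong refl) (auto simp: ip_fourier_part[OF D _ \<eta> kl])
        finally show ?case using elim by simp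
      qed
    qed
    show "((\<lambda>F. ip (?S F) ?e) \<longlongrightarrow> ip S ?e) (finite_subsets_at_top D)"
      unfolding tendsto_iff
    proof (intro allI impI)
      fix \<epsilon> :: real assume "\<epsilon> > 0"
      then have "\<epsilon> / 2 > 0" by simp
      from uniform_limitD[OF lim this] ev
      show "\<forall>\<^sub>F F in finite_subsets_at_top D. dist (ip (?S F) ?e) (ip S ?e) < \<epsilon>"
      proof eventually_elim
        case (elim F)
        have "dist (ip (?S F) ?e) (ip S ?e) = cmod (ip (\<lambda>x. ?S F x - S x) ?e)"
          using elim by (simp only: dist_norm ip_diff_left[OF Fc Sc ec])
        also have "\<dots> \<le> \<epsilon> / 2 * 1"
          using elim rep_bound[OF r kl]
          by (intro ip_cont_bound continuous_intros Fc Sc ec fourier_part_cont[OF D]) (auto simp: dist_norm less_imp_le)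
        finally show ?case using \<open>\<epsilon> > 0\<close> by simp
      qed
    qed
  qed
  \<comment> \<open>Completeness is stated for pairings without conjugation, so it is applied to the
    conjugate of the difference.\<close>
  have "cnj (conv g g x - S x) = 0" for x
  proof (rule coefficients_complete[OF D])
    show "continuous_on UNIV (\<lambda>x. cnj (conv g g x - S x))" by (intro continuous_intros gg Sc)
    fix \<eta> i j assume \<eta>: "\<eta> \<in> D" "i < rep_dim e \<eta>" "j < rep_dim e \<eta>"
    have "(\<integral>x. cnj (conv g g x - S x) * \<eta> x $$ (i,j) \<partial>\<mu>) = cnj (ip (\<lambda>x. conv g g x - S x) (\<lambda>x. \<eta> x $$ (i,j)))"
      unfolding ip_def cnj_integral by simp
    also have "\<dots> = 0"
      using coef[OF \<eta>] by (simp add: ip_diff_left[OF gg Sc rep_cont[OF dual_rep(1)[OF D \<eta>(1)] \<eta>(2,3)]])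
    finally show "(\<integral>x. cnj (conv g g x - S x) * \<eta> x $$ (i,j) \<partial>\<mu>) = 0" .
  qed
  then have "S = conv g g" by (auto simp: fun_eq_iff)
  then show ?thesis using lim by simp
qed

section \<open>Approximate identities\<close>

lemma bump_function:
  assumes W: "open W" "e \<in> W"
  obtains g :: "'g \<Rightarrow> real" where "continuous_on UNIV g" "\<forall>x. g x \<ge> 0" "\<forall>x. x \<notin> W \<longrightarrow> g x = 0" "(\<integral>x. g x \<partial>\<mu>) = 1"
proof -
  have "Hausdorff_space (euclidean :: 'g topology)"
    unfolding Hausdorff_space_def disjnt_def open_openin[symmetric] using hausdorff by auto
  \<comment> \<open>Compact Hausdorff spaces are normal, so Urysohn's lemma separates
    \<open>e\<close> from the complement of \<open>W\<close>. A continuous bump is enough, since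
    convolution with a smooth function supplies the smoothness.\<close>
  then have "normal_space (euclidean :: 'g topology)"
    using compact_UNIV by (intro compact_Hausdorff_or_regular_imp_normal_space) (auto simp: compact_space_def)
  from Urysohn_lemma[OF this, of "- W" "{e}" 0 1]
  obtain f where f: "continuous_map euclidean (top_of_set {0..1::real}) f" "f ` (-W) \<subseteq> {0}" "f ` {e} \<subseteq> {1}"
    using W by (auto simp: disjnt_def closed_closedin[symmetric] open_closed)
  have fc: "continuous_on UNIV f" and f0: "f x \<ge> 0" for x
    using f(1) by (auto simp: continuous_map_in_subtopology)
  have I: "(\<integral>x. f x \<partial>\<mu>) > 0" using f by (intro integral_pos[of f e] fc f0) auto
  define g where "g x = f x / (\<integral>x. f x \<partial>\<mu>)" for x
  show ?thesis
  proof (rule that[of g])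
    show "continuous_on UNIV g" unfolding g_def using I by (intro continuous_intros fc) auto
    show "\<forall>x. g x \<ge> 0" using I f0 by (simp add: g_def)
    show "\<forall>x. x \<notin> W \<longrightarrow> g x = 0" using f(2) by (auto simp: g_def)
    show "(\<integral>x. g x \<partial>\<mu>) = 1" using I by (simp add: g_def)
  qed
qed

text \<open>A bump supported in A \<inter> B with A B \<subseteq> N has its convolution square
  supported in \<open>N\<close>. Nonnegativity makes the integral of the modulus equal to the
  integral, which is multiplicative under convolution.\<close>

lemma approximate_identity:
  assumes N: "open N" "e \<in> N"
  obtains g where "continuous_on UNIV g" "\<forall>x. x \<notin> N \<longrightarrow> conv g g x = 0" "(\<integral>x. conv g g x \<partial>\<mu>) = 1"
    "(\<integral>x. cmod (conv g g x) \<partial>\<mu>) = 1"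
proof -
  have "open ((\<lambda>(x,y). mul x y) -` N)" using N(1) cont_mul by (rule open_vimage)
  moreover have "(e,e) \<in> (\<lambda>(x,y). mul x y) -` N" using N(2) by simp
  ultimately obtain A B where AB0: "open A" "open B" "(e,e) \<in> A \<times> B" "A \<times> B \<subseteq> (\<lambda>(x,y). mul x y) -` N"
    by (rule open_prod_elim)
  then have AB: "open A" "open B" "e \<in> A" "e \<in> B" by simp_all
  have "open (A \<inter> B)" "e \<in> A \<inter> B" using AB by auto
  from bump_function[OF this]
  obtain h :: "'g \<Rightarrow> real" where h: "continuous_on UNIV h" "\<forall>x. h x \<ge> 0" "\<forall>x. x \<notin> A \<inter> B \<longrightarrow> h x = 0" "(\<integral>x. h x \<partial>\<mu>) = 1" .
  define g where "g x = complex_of_real (h x)" for x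
  have g: "continuous_on UNIV g" unfolding g_def by (intro continuous_intros h)
  have gi: "(\<integral>x. g x \<partial>\<mu>) = 1" unfolding g_def by (simp add: h(4))
  have c: "conv g g x = complex_of_real (\<integral>y. h y * h (mul (iv y) x) \<partial>\<mu>)" for x
    unfolding conv_def g_def of_real_mult[symmetric] by (rule integral_complex_of_real)
  have nn: "(\<integral>y. h y * h (mul (iv y) x) \<partial>\<mu>) \<ge> 0" for x using h(2) by simp
  have supp: "conv g g x = 0" if "x \<notin> N" for x
  proof -
    have "h y * h (mul (iv y) x) = 0" for y
    proof (rule ccontr)
      assume "h y * h (mul (iv y) x) \<noteq> 0"
      then have "y \<in> A" "mul (iv y) x \<in> B" using h(3) by auto
      then have "(y, mul (iv y) x) \<in> (\<lambda>(x,y). mul x y) -` N" by (intro subsetD[OF AB0(4)] SigmaI)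
      then show False using that by (simp add: assoc[symmetric])
    qed
    then have "(\<lambda>y. h y * h (mul (iv y) x)) = (\<lambda>y. 0)" by blast
    then show ?thesis unfolding c by simp
  qed
  have one: "(\<integral>x. conv g g x \<partial>\<mu>) = 1"
  proof -
    have "(\<integral>x. conv g g x \<partial>\<mu>) = (\<integral>y. (\<integral>x. g y * g (mul (iv y) x) \<partial>\<mu>) \<partial>\<mu>)"
      unfolding conv_def
      by (rule Fubini_cont) (auto simp: case_prod_unfold intro!: continuous_intros cont_comp[OF g])
    also have "\<dots> = 1" by (simp add: integral_left[OF g] gi)
    finally show ?thesis .
  qed
  have "complex_of_real (\<integral>x. cmod (conv g g x) \<partial>\<mu>) = (\<integral>x. complex_of_real (cmod (conv g g x)) \<partial>\<mu>)"
    by (rule integral_complex_of_real[symmetric])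
  also have "\<dots> = (\<integral>x. conv g g x \<partial>\<mu>)"
    using nn by (simp add: c abs_of_nonneg)
  finally have "complex_of_real (\<integral>x. cmod (conv g g x) \<partial>\<mu>) = of_real 1" using one by simp
  then have "(\<integral>x. cmod (conv g g x) \<partial>\<mu>) = 1" by (simp only: of_real_eq_iff)
  then show ?thesis using that[OF g _ one] supp by simp
qed

end

section \<open>Calculus with iterated partial derivatives\<close>

lemma Euclidean_space_top_of_set: "Euclidean_space n = top_of_set {x. \<forall>i\<ge>n. x i = 0}"
  by (simp add: Euclidean_space_def euclidean_product_topology)

lemma openin_Euclidean_box:
  assumes V: "openin (Euclidean_space n) V" and z: "z \<in> V"
  obtains \<delta> where "\<delta> > 0" "\<forall>w. (\<forall>i<n. \<bar>w i - z i\<bar> < \<delta>) \<longrightarrow> (\<forall>i\<ge>n. w i = 0) \<longrightarrow> w \<in> V"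
proof -
  obtain T where T: "openin (powertop_real UNIV) T" "V = T \<inter> {x. \<forall>i\<ge>n. x i = 0}"
    using V by (auto simp: Euclidean_space_def openin_subtopology)
  have zT: "z \<in> T" and z0: "\<forall>i\<ge>n. z i = 0" using z T by auto
  obtain X where X0: "z \<in> (\<Pi>\<^sub>E i\<in>UNIV. X i) \<and> (\<forall>i. openin euclideanreal (X i)) \<and>
      finite {i. X i \<noteq> topspace euclideanreal} \<and> (\<Pi>\<^sub>E i\<in>UNIV. X i) \<subseteq> T"
    using product_topology_open_contains_basis[OF T(1) zT] ..
  then have X: "\<And>i. z i \<in> X i" "\<And>i. open (X i)" "(\<Pi>\<^sub>E i\<in>UNIV. X i) \<subseteq> T"
    by (simp_all add: PiE_iff)
  have "\<forall>i. \<exists>d. d > 0 \<and> ball (z i) d \<subseteq> X i"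
  proof
    show "\<exists>d. d > 0 \<and> ball (z i) d \<subseteq> X i" for i by (rule openE[OF X(2,1)]) auto
  qed
  then obtain d where "\<forall>i. d i > 0 \<and> ball (z i) (d i) \<subseteq> X i" unfolding choice_iff ..
  then have d: "\<And>i. d i > 0" "\<And>i. ball (z i) (d i) \<subseteq> X i" by simp_all
  \<comment> \<open>The inserted 1 keeps the minimum defined when \<open>n = 0\<close>.\<close>
  define \<delta> where "\<delta> = Min (insert 1 (d ` {..<n}))"
  have \<delta>: "\<delta> > 0" using d(1) by (simp add: \<delta>_def)
  have \<delta>d: "\<delta> \<le> d i" if "i < n" for i using that by (simp add: \<delta>_def)
  show ?thesis
  proof (rule that[OF \<delta>], intro allI impI)
    fix w assume w: "\<forall>i<n. \<bar>w i - z i\<bar> < \<delta>" "\<forall>i\<ge>n. w i = 0"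
    have "w i \<in> X i" for i
    proof (cases "i < n")
      case True
      then have "\<bar>w i - z i\<bar> < d i" using w(1) \<delta>d[OF True] by (meson less_le_trans)
      then have "w i \<in> ball (z i) (d i)" by (simp add: dist_real_def abs_minus_commute)
      then show ?thesis using d(2) by blast
    next
      case False
      then have "w i = z i" using w(2) z0 by simp
      then show ?thesis using X(1) by simp
    qed
    then have "w \<in> T" using X(3) by (auto simp: PiE_iff)
    then show "w \<in> V" using T(2) w(2) by simp
  qed
qed

lemma openin_Euclidean_vanishes: "openin (Euclidean_space n) V \<Longrightarrow> z \<in> V \<Longrightarrow> i \<ge> n \<Longrightarrow> z i = 0"
  using openin_subset[of "Euclidean_space n" V] by (auto simp: topspace_Euclidean_space)

lemma eventually_upd_in:
  assumes V: "openin (Euclidean_space n) V" and z: "z \<in> V" and i: "i < n"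
  shows "\<forall>\<^sub>F t in nhds (z i). z(i := t) \<in> V"
proof -
  obtain \<delta> where \<delta>: "\<delta> > 0" "\<forall>w. (\<forall>i<n. \<bar>w i - z i\<bar> < \<delta>) \<longrightarrow> (\<forall>i\<ge>n. w i = 0) \<longrightarrow> w \<in> V"
    by (rule openin_Euclidean_box[OF V z])
  have "z(i := t) \<in> V" if "dist t (z i) < \<delta>" for t
    using that \<delta> i openin_Euclidean_vanishes[OF V z] by (intro \<delta>(2)[rule_format]) (auto simp: dist_real_def)
  then show ?thesis unfolding eventually_nhds_metric using \<delta>(1) by blast
qed

section \<open>Iterated partial derivatives and the classes C^k\<close>

lemma partial_derivs_Nil [simp]: "partial_derivs [] f = f"
  by (simp add: partial_derivs_def)

lemma partial_derivs_Cons [simp]: "partial_derivs (i # is) f = partial_deriv i (partial_derivs is f)"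
  by (simp add: partial_derivs_def)

lemma partial_derivs_snoc: "partial_derivs (is @ [i]) f = partial_derivs is (partial_deriv i f)"
  by (simp add: partial_derivs_def)

lemma partial_deriv_eqI: "((\<lambda>t. f (z(i := t))) has_vector_derivative D) (at (z i)) \<Longrightarrow> partial_deriv i f z = D"
  by (simp add: partial_deriv_def vector_derivative_at)

lemma partial_deriv_works:
  "(\<lambda>t. f (z(i := t))) differentiable (at (z i)) \<Longrightarrow>
    ((\<lambda>t. f (z(i := t))) has_vector_derivative partial_deriv i f z) (at (z i))"
  by (simp add: partial_deriv_def vector_derivative_works)

lemma has_vector_derivative_differentiable: "(f has_vector_derivative D) (at x) \<Longrightarrow> f differentiable (at x)"
  unfolding has_vector_derivative_def differentiable_def by blast

lemma has_vector_derivative_upd_cong: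
  assumes V: "openin (Euclidean_space n) V" "z \<in> V" "i < n" and eq: "\<And>w. w \<in> V \<Longrightarrow> f w = g w"
  shows "((\<lambda>t. f (z(i := t))) has_vector_derivative D) (at (z i)) \<longleftrightarrow> ((\<lambda>t. g (z(i := t))) has_vector_derivative D) (at (z i))"
  by (rule has_vector_derivative_cong_ev)
     (use eventually_upd_in[OF V] V in \<open>auto elim!: eventually_mono simp: eq\<close>)

lemma partial_deriv_cong:
  assumes V: "openin (Euclidean_space n) V" "z \<in> V" "i < n" and eq: "\<And>w. w \<in> V \<Longrightarrow> f w = g w"
  shows "partial_deriv i f z = partial_deriv i g z"
proof -
  have "((\<lambda>t. f (z(i := t))) has_vector_derivative D) (at (z i)) \<longleftrightarrow> ((\<lambda>t. g (z(i := t))) has_vector_derivative D) (at (z i))" for D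
    by (rule has_vector_derivative_upd_cong[OF V eq])
  then show ?thesis unfolding partial_deriv_def vector_derivative_def by (simp only:)
qed

definition partially_differentiable :: "nat \<Rightarrow> (nat \<Rightarrow> real) set \<Rightarrow> ((nat \<Rightarrow> real) \<Rightarrow> 'b::real_normed_vector) \<Rightarrow> bool"
  where "partially_differentiable n V f \<longleftrightarrow> (\<forall>i<n. \<forall>z\<in>V. (\<lambda>t. f (z(i := t))) differentiable (at (z i)))"

text \<open>Recursion on the order lets the sum, product and chain rules be proved by induction on
  \<open>k\<close>: a first derivative of the result is again an expression of the same kind in
  functions of class \<open>Ck k\<close>.\<close>

primrec Ck :: "nat \<Rightarrow> nat \<Rightarrow> (nat \<Rightarrow> real) set \<Rightarrow> ((nat \<Rightarrow> real) \<Rightarrow> 'b::real_normed_vector) \<Rightarrow> bool" where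
  "Ck 0 n V f \<longleftrightarrow> continuous_on V f"
| "Ck (Suc k) n V f \<longleftrightarrow> continuous_on V f \<and> partially_differentiable n V f \<and> (\<forall>i<n. Ck k n V (partial_deriv i f))"

lemma Ck_cont: "Ck k n V f \<Longrightarrow> continuous_on V f"
  by (cases k) auto

lemma Ck_mono: "Ck (Suc k) n V f \<Longrightarrow> Ck k n V f"
  by (induction k arbitrary: f) (simp_all add: Ck_cont)

text \<open>\<open>Ck\<close> peels off the derivative that is taken first, which is the last
  element of the list; hence the case distinction from the end.\<close>

lemma Ck_iff_partial_derivs:
  "Ck k n V f \<longleftrightarrow> (\<forall>is. set is \<subseteq> {..<n} \<longrightarrow>
     (length is \<le> k \<longrightarrow> continuous_on V (partial_derivs is f)) \<and>
     (length is < k \<longrightarrow> partially_differentiable n V (partial_derivs is f)))"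
proof (induction k arbitrary: f)
  case 0
  then show ?case by simp
next
  case (Suc k)
  let ?P = "\<lambda>k f is. (length is \<le> k \<longrightarrow> continuous_on V (partial_derivs is f)) \<and>
     (length is < k \<longrightarrow> partially_differentiable n V (partial_derivs is f))"
  show ?case
  proof
    assume C: "Ck (Suc k) n V f"
    show "\<forall>is. set is \<subseteq> {..<n} \<longrightarrow> ?P (Suc k) f is"
    proof (intro allI impI)
      fix "is" assume "is": "set is \<subseteq> {..<n}"
      show "?P (Suc k) f is"
      proof (cases "is" rule: rev_cases)
        case Nil
        then show ?thesis using C by simp
      next
        case (snoc js j)
        then have "set js \<subseteq> {..<n}" "j < n" using "is" by auto
        then have "?P k (partial_deriv j f) js" using C Suc[of "partial_deriv j f"] by simp
        then show ?thesis by (simp add: snoc partial_derivs_snoc)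
      qed
    qed
  next
    assume P: "\<forall>is. set is \<subseteq> {..<n} \<longrightarrow> ?P (Suc k) f is"
    have 0: "?P (Suc k) f []" by (rule P[rule_format]) simp
    have "?P k (partial_deriv j f) js" if "set js \<subseteq> {..<n}" "j < n" for js j
      using P[THEN spec, of "js @ [j]"] that by (simp add: partial_derivs_snoc)
    then have "Ck k n V (partial_deriv j f)" if "j < n" for j unfolding Suc using that by blast
    then show "Ck (Suc k) n V f" using 0 by simp
  qed
qed

lemma smooth_on_iff_Ck: "smooth_on n V f \<longleftrightarrow> (\<forall>k. Ck k n V f)"
proof
  assume "smooth_on n V f"
  then show "\<forall>k. Ck k n V f" unfolding smooth_on_def Ck_iff_partial_derivs partially_differentiable_def by simp
next
  assume C: "\<forall>k. Ck k n V f"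
  show "smooth_on n V f"
    unfolding smooth_on_def
  proof (intro allI impI)
    fix "is" assume "set is \<subseteq> {..<n}"
    then show "continuous_on V (partial_derivs is f) \<and>
        (\<forall>i<n. \<forall>z\<in>V. (\<lambda>t. partial_derivs is f (z(i := t))) differentiable (at (z i)))"
      using C[rule_format, of "Suc (length is)", unfolded Ck_iff_partial_derivs, rule_format, of "is"]
      unfolding partially_differentiable_def by simp
  qed
qed

text \<open>Congruence of class \<open>k\<close> is a hypothesis because this rule serves inside the
  very induction that proves \<open>Ck_cong\<close>; \<open>Ck_SucI'\<close> discharges it
  afterwards.\<close>

lemma Ck_SucI:
  assumes V: "openin (Euclidean_space n) V" and "continuous_on V f"
    and D: "\<And>i z. i < n \<Longrightarrow> z \<in> V \<Longrightarrow> ((\<lambda>t. f (z(i := t))) has_vector_derivative D i z) (at (z i))"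
    and C: "\<And>i. i < n \<Longrightarrow> Ck k n V (D i)"
    and cong: "\<And>f g. Ck k n V f \<Longrightarrow> (\<And>z. z \<in> V \<Longrightarrow> f z = (g z :: 'b::real_normed_vector)) \<Longrightarrow> Ck k n V g"
  shows "Ck (Suc k) n V (f :: _ \<Rightarrow> 'b)"
proof -
  have "Ck k n V (partial_deriv i f)" if "i < n" for i
    by (rule cong[OF C[OF that]]) (simp add: partial_deriv_eqI[OF D[OF that]])
  then show ?thesis
    using assms(2) has_vector_derivative_differentiable[OF D] by (simp add: partially_differentiable_def)
qed

lemma Ck_cong:
  assumes V: "openin (Euclidean_space n) V"
  shows "Ck k n V f \<Longrightarrow> (\<And>z. z \<in> V \<Longrightarrow> f z = g z) \<Longrightarrow> Ck k n V g"
proof (induction k arbitrary: f g)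
  case 0
  then show ?case using continuous_on_cong[of V V f g] by simp
next
  case (Suc k)
  have "continuous_on V g" using Suc.prems continuous_on_cong[of V V f g] by simp
  then show ?case
  proof (rule Ck_SucI[OF V])
    fix i z assume i: "i < n" and z: "z \<in> V"
    have "((\<lambda>t. f (z(i := t))) has_vector_derivative partial_deriv i f z) (at (z i))"
      using Suc.prems(1) i z by (intro partial_deriv_works) (simp add: partially_differentiable_def)
    then show "((\<lambda>t. g (z(i := t))) has_vector_derivative partial_deriv i f z) (at (z i))"
      by (rule has_vector_derivative_upd_cong[OF V z i Suc.prems(2), THEN iffD1, rotated])
  next
    show "Ck k n V (partial_deriv i f)" if "i < n" for i using Suc.prems(1) that by simp
    show "Ck k n V g" if "Ck k n V f" "\<And>z. z \<in> V \<Longrightarrow> f z = g z" for f g :: "_ \<Rightarrow> 'a"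
      using that by (rule Suc.IH)
  qed
qed

lemma Ck_SucI':
  assumes V: "openin (Euclidean_space n) V" and "continuous_on V f"
    and "\<And>i z. i < n \<Longrightarrow> z \<in> V \<Longrightarrow> ((\<lambda>t. f (z(i := t))) has_vector_derivative D i z) (at (z i))"
    and "\<And>i. i < n \<Longrightarrow> Ck k n V (D i)"
  shows "Ck (Suc k) n V f"
  by (rule Ck_SucI[OF assms]) (assumption | rule Ck_cong[OF V])+

lemma Ck_SucD:
  assumes "Ck (Suc k) n V f" "i < n"
  shows "z \<in> V \<Longrightarrow> ((\<lambda>t. f (z(i := t))) has_vector_derivative partial_deriv i f z) (at (z i))"
    "Ck k n V (partial_deriv i f)"
  using assms by (auto intro!: partial_deriv_works simp: partially_differentiable_def)

lemma Ck_const: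
  assumes V: "openin (Euclidean_space n) V"
  shows "Ck k n V (\<lambda>z. c)"
proof (induction k arbitrary: c)
  case (Suc k)
  show ?case by (rule Ck_SucI'[OF V, where D="\<lambda>i z. 0"]) (auto simp: V Suc)
qed auto

lemma Ck_add:
  assumes V: "openin (Euclidean_space n) V"
  shows "Ck k n V f \<Longrightarrow> Ck k n V g \<Longrightarrow> Ck k n V (\<lambda>z. f z + g z)"
proof (induction k arbitrary: f g)
  case (Suc k)
  show ?case
  proof (rule Ck_SucI'[OF V])
    show "continuous_on V (\<lambda>z. f z + g z)"
      using Suc.prems by (intro continuous_intros) (auto intro: Ck_cont)
    show "((\<lambda>t. f (z(i := t)) + g (z(i := t))) has_vector_derivative partial_deriv i f z + partial_deriv i g z) (at (z i))"
      if "i < n" "z \<in> V" for i z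
      by (rule has_vector_derivative_add[OF Ck_SucD(1)[OF Suc.prems(1) that] Ck_SucD(1)[OF Suc.prems(2) that]])
    show "Ck k n V (\<lambda>z. partial_deriv i f z + partial_deriv i g z)" if "i < n" for i
      using Suc.prems that by (intro Suc.IH Ck_SucD(2))
  qed
qed (auto intro: continuous_intros)

lemma Ck_sum:
  assumes V: "openin (Euclidean_space n) V"
  shows "(\<And>i. i \<in> I \<Longrightarrow> Ck k n V (f i)) \<Longrightarrow> Ck k n V (\<lambda>z. \<Sum>i\<in>I. f i z)"
  by (induction I rule: infinite_finite_induct) (auto intro: Ck_add[OF V] Ck_const[OF V])

lemma has_vector_derivative_bilinear:
  assumes B: "bounded_bilinear B" and f: "(f has_vector_derivative f') (at x)" and g: "(g has_vector_derivative g') (at x)"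
  shows "((\<lambda>t. B (f t) (g t)) has_vector_derivative (B (f x) g' + B f' (g x))) (at x)"
proof -
  interpret bounded_bilinear B by (rule B)
  show ?thesis
    using FDERIV[OF f[unfolded has_vector_derivative_def] g[unfolded has_vector_derivative_def]]
    by (simp add: has_vector_derivative_def scaleR_left scaleR_right scaleR_add_right)
qed

lemma Ck_bilinear:
  assumes V: "openin (Euclidean_space n) V" and B: "bounded_bilinear B"
  shows "Ck k n V f \<Longrightarrow> Ck k n V g \<Longrightarrow> Ck k n V (\<lambda>z. B (f z) (g z))"
proof (induction k arbitrary: f g)
  case 0
  then show ?case by (auto intro: bounded_bilinear.continuous_on[OF B])
next
  case (Suc k)
  show ?case
  proof (rule Ck_SucI'[OF V])
    show "continuous_on V (\<lambda>z. B (f z) (g z))"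
      using Suc.prems by (intro bounded_bilinear.continuous_on[OF B]) (auto intro: Ck_cont)
    show "((\<lambda>t. B (f (z(i := t))) (g (z(i := t)))) has_vector_derivative
        B (f z) (partial_deriv i g z) + B (partial_deriv i f z) (g z)) (at (z i))" if "i < n" "z \<in> V" for i z
      using has_vector_derivative_bilinear[OF B Ck_SucD(1)[OF Suc.prems(1) that] Ck_SucD(1)[OF Suc.prems(2) that]]
      by (simp only: fun_upd_triv)
    show "Ck k n V (\<lambda>z. B (f z) (partial_deriv i g z) + B (partial_deriv i f z) (g z))" if "i < n" for i
      by (intro Ck_add[OF V] Suc.IH Ck_mono[OF Suc.prems(1)] Ck_mono[OF Suc.prems(2)]
          Ck_SucD(2)[OF Suc.prems(1) that] Ck_SucD(2)[OF Suc.prems(2) that])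
  qed
qed

lemma Ck_linear:
  assumes V: "openin (Euclidean_space n) V" and L: "bounded_linear L"
  shows "Ck k n V f \<Longrightarrow> Ck k n V (\<lambda>z. L (f z))"
proof (induction k arbitrary: f)
  case 0
  then show ?case by (auto intro: bounded_linear.continuous_on[OF L])
next
  case (Suc k)
  show ?case
  proof (rule Ck_SucI'[OF V])
    show "continuous_on V (\<lambda>z. L (f z))"
      using Suc.prems by (intro bounded_linear.continuous_on[OF L]) (auto intro: Ck_cont)
    show "((\<lambda>t. L (f (z(i := t)))) has_vector_derivative L (partial_deriv i f z)) (at (z i))" if "i < n" "z \<in> V" for i z
      by (rule bounded_linear.has_vector_derivative[OF L Ck_SucD(1)[OF Suc.prems that]])
    show "Ck k n V (\<lambda>z. L (partial_deriv i f z))" if "i < n" for i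
      using Suc.prems that by (intro Suc.IH Ck_SucD(2))
  qed
qed

section \<open>The chain rule\<close>

lemma continuous_on_Euclidean_box:
  fixes G :: "(nat \<Rightarrow> real) \<Rightarrow> 'b::metric_space"
  assumes W: "openin (Euclidean_space n) W" and G: "continuous_on W G" and w0: "w0 \<in> W" and \<epsilon>: "\<epsilon> > 0"
  obtains \<delta> where "\<delta> > 0" "\<forall>w. (\<forall>i<n. \<bar>w i - w0 i\<bar> < \<delta>) \<longrightarrow> (\<forall>i\<ge>n. w i = 0) \<longrightarrow> w \<in> W \<and> dist (G w) (G w0) < \<epsilon>"
proof -
  have "openin (top_of_set W) (W \<inter> G -` ball (G w0) \<epsilon>)"
    using G by (rule continuous_openin_preimage_gen) simp
  then have "openin (Euclidean_space n) (W \<inter> G -` ball (G w0) \<epsilon>)"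
    using W unfolding Euclidean_space_top_of_set by (rule openin_trans)
  from openin_Euclidean_box[OF this, of w0]
  obtain \<delta> where "\<delta> > 0" "\<forall>w. (\<forall>i<n. \<bar>w i - w0 i\<bar> < \<delta>) \<longrightarrow> (\<forall>i\<ge>n. w i = 0) \<longrightarrow> w \<in> W \<inter> G -` ball (G w0) \<epsilon>"
    using w0 \<epsilon> by auto
  then show ?thesis using that[of \<delta>] by (simp add: dist_commute)
qed

text \<open>Only partial derivatives are given, so the coordinates are released one at a time. Each
  induction step then concerns a function of two real variables, for which continuity of the single
  partial derivative \<open>G m\<close> gives differentiability.\<close>

lemma has_vector_derivative_partial_chain:
  fixes g :: "(nat \<Rightarrow> real) \<Rightarrow> 'b::real_normed_vector"
  assumes W: "openin (Euclidean_space n) W"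
    and g: "\<And>j z. j < n \<Longrightarrow> z \<in> W \<Longrightarrow> ((\<lambda>s. g (z(j := s))) has_vector_derivative G j z) (at (z j))"
    and G: "\<And>j. j < n \<Longrightarrow> continuous_on W (G j)"
    and \<gamma>: "\<And>j. j < n \<Longrightarrow> ((\<lambda>t. \<gamma> t j) has_vector_derivative \<gamma>' j) (at t0)"
    and \<gamma>0: "\<And>t j. j \<ge> n \<Longrightarrow> \<gamma> t j = 0" and w0: "\<gamma> t0 \<in> W"
  shows "((\<lambda>t. g (\<gamma> t)) has_vector_derivative (\<Sum>j<n. \<gamma>' j *\<^sub>R G j (\<gamma> t0))) (at t0)"
proof -
  define w where "w = \<gamma> t0"
  \<comment> \<open>\<open>h m\<close> lets the first \<open>m\<close> coordinates follow \<gamma>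
    and freezes the others at their value at \<open>t0\<close>.\<close>
  define h where "h m t = (\<lambda>j. if j < m then \<gamma> t j else w j)" for m t
  have h0: "h m t0 = w" for m by (auto simp: h_def w_def)
  have "((\<lambda>t. g (h m t)) has_vector_derivative (\<Sum>j<m. \<gamma>' j *\<^sub>R G j w)) (at t0)" if "m \<le> n" for m
    using that
  proof (induction m)
    case 0
    then show ?case by (simp add: h_def)
  next
    case (Suc m)
    then have m: "m < n" by simp
    obtain \<delta> where \<delta>: "\<delta> > 0" "\<forall>v. (\<forall>i<n. \<bar>v i - w i\<bar> < \<delta>) \<longrightarrow> (\<forall>i\<ge>n. v i = 0) \<longrightarrow> v \<in> W"
      using openin_Euclidean_box[OF W w0] unfolding w_def by blast
    have close: "\<forall>\<^sub>F t in nhds t0. \<forall>j<n. \<bar>\<gamma> t j - w j\<bar> < r" if "r > 0" for r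
    proof -
      have "\<forall>\<^sub>F t in nhds t0. \<forall>j\<in>{..<n}. \<bar>\<gamma> t j - w j\<bar> < r"
      proof (rule eventually_ball_finite)
        show "\<forall>j\<in>{..<n}. \<forall>\<^sub>F t in nhds t0. \<bar>\<gamma> t j - w j\<bar> < r"
        proof
          fix j assume "j \<in> {..<n}"
          then have "isCont (\<lambda>t. \<gamma> t j) t0" by (intro has_vector_derivative_continuous[OF \<gamma>]) simp
          then have "((\<lambda>t. \<gamma> t j) \<longlongrightarrow> w j) (nhds t0)"
            unfolding w_def continuous_at by (rule tendsto_at_iff_tendsto_nhds[THEN iffD1])
          from tendstoD[OF this that] show "\<forall>\<^sub>F t in nhds t0. \<bar>\<gamma> t j - w j\<bar> < r" by (simp add: dist_real_def)
        qed
      qed simp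
      then show ?thesis by (auto elim: eventually_mono)
    qed
    obtain \<rho> where \<rho>: "\<rho> > 0" "\<And>t. dist t t0 < \<rho> \<Longrightarrow> \<forall>j<n. \<bar>\<gamma> t j - w j\<bar> < \<delta>"
      using close[OF \<delta>(1)] unfolding eventually_nhds_metric by blast
    define X where "X = ball t0 \<rho>"
    define Y where "Y = ball (w m) \<delta>"
    \<comment> \<open>In \<open>P\<close>, the variable \<open>t\<close> moves the coordinates below
      \<open>m\<close> along \<gamma>, while \<open>s\<close> is coordinate \<open>m\<close> as an
      independent variable.\<close>
    define P where "P t s = g ((h m t)(m := s))" for t s
    have w_vanish: "w j = 0" if "j \<ge> n" for j using \<gamma>0[OF that] by (simp add: w_def)
    have inW: "(h m t)(m := s) \<in> W" if "t \<in> X" "s \<in> Y" for t s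
    proof (rule \<delta>(2)[rule_format])
      show "\<bar>((h m t)(m := s)) i - w i\<bar> < \<delta>" if "i < n" for i
        using \<rho>(2)[of t] \<open>t \<in> X\<close> \<open>s \<in> Y\<close> \<delta>(1) that by (auto simp: X_def Y_def h_def dist_real_def dist_commute abs_minus_commute)
      show "((h m t)(m := s)) i = 0" if "i \<ge> n" for i
        using that m by (simp add: h_def w_vanish)
    qed
    have P: "((\<lambda>(t,s). P t s) has_derivative (\<lambda>(tx, ty). tx *\<^sub>R (\<Sum>j<m. \<gamma>' j *\<^sub>R G j w) + blinfun_scaleR_left (G m w) ty))
        (at (t0, w m) within X \<times> Y)"
    proof -
      have "((\<lambda>(t,s). P t s) has_derivative (\<lambda>(tx, ty). tx *\<^sub>R (\<Sum>j<m. \<gamma>' j *\<^sub>R G j w) +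
          blinfun_apply (blinfun_scaleR_left (G m ((h m t0)(m := w m)))) ty)) (at (t0, w m) within X \<times> Y)"
      proof (rule has_derivative_partialsI[where fx="\<lambda>tx. tx *\<^sub>R (\<Sum>j<m. \<gamma>' j *\<^sub>R G j w)"
            and fy="\<lambda>t s. blinfun_scaleR_left (G m ((h m t)(m := s)))"])
        have "(\<lambda>t. P t (w m)) = (\<lambda>t. g (h m t))"
          unfolding P_def by (intro ext arg_cong[where f=g]) (simp add: h_def)
        then show "((\<lambda>t. P t (w m)) has_derivative (\<lambda>tx. tx *\<^sub>R (\<Sum>j<m. \<gamma>' j *\<^sub>R G j w))) (at t0 within X)"
          using Suc.IH m unfolding has_vector_derivative_def by (auto intro: has_derivative_at_withinI)
        show "((\<lambda>s. P t s) has_derivative blinfun_apply (blinfun_scaleR_left (G m ((h m t)(m := s))))) (at s within Y)"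
          if "t \<in> X" "s \<in> Y" for t s
          using g[OF m inW[OF that]] unfolding P_def has_vector_derivative_def
          by (simp add: has_derivative_at_withinI)
        show "w m \<in> Y" "convex Y" using \<delta>(1) by (auto simp: Y_def)
        show "continuous (at (t0, w m) within X \<times> Y) (\<lambda>(t, s). blinfun_scaleR_left (G m ((h m t)(m := s))))"
          unfolding continuous_within case_prod_unfold
        proof (rule bounded_linear.tendsto[OF bounded_linear_blinfun_scaleR_left], rule tendstoI)
          fix \<epsilon> :: real assume "\<epsilon> > 0"
          have hw: "(h m t0)(m := w m) = w" by (simp add: h0)
          obtain \<delta>' where \<delta>': "\<delta>' > 0" "\<forall>v. (\<forall>i<n. \<bar>v i - w i\<bar> < \<delta>') \<longrightarrow> (\<forall>i\<ge>n. v i = 0) \<longrightarrow> v \<in> W \<and> dist (G m v) (G m w) < \<epsilon>"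
            using continuous_on_Euclidean_box[OF W G[OF m] w0 \<open>\<epsilon> > 0\<close>] unfolding w_def by blast
          have "\<forall>\<^sub>F p in nhds (t0, w m). (\<forall>j<n. \<bar>\<gamma> (fst p) j - w j\<bar> < \<delta>') \<and> \<bar>snd p - w m\<bar> < \<delta>'"
          proof (rule eventually_conj)
            have "((\<lambda>p. fst p) \<longlongrightarrow> fst (t0, w m)) (nhds (t0, w m))" by (intro tendsto_fst filterlim_ident)
            then have "(fst \<longlongrightarrow> t0) (nhds (t0, w m))" by simp
            then show "\<forall>\<^sub>F p in nhds (t0, w m). \<forall>j<n. \<bar>\<gamma> (fst p) j - w j\<bar> < \<delta>'"
              using close[OF \<delta>'(1)] by (rule eventually_compose_filterlim[rotated])
            have "((\<lambda>p. snd p) \<longlongrightarrow> snd (t0, w m)) (nhds (t0, w m))" by (intro tendsto_snd filterlim_ident)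
            then have "(snd \<longlongrightarrow> w m) (nhds (t0, w m))" by simp
            from tendstoD[OF this \<delta>'(1)] show "\<forall>\<^sub>F p in nhds (t0, w m). \<bar>snd p - w m\<bar> < \<delta>'" by (simp add: dist_real_def)
          qed
          then have "\<forall>\<^sub>F p in nhds (t0, w m). dist (G m ((h m (fst p))(m := snd p))) (G m w) < \<epsilon>"
          proof eventually_elim
            case (elim p)
            have "(h m (fst p))(m := snd p) \<in> W \<and> dist (G m ((h m (fst p))(m := snd p))) (G m w) < \<epsilon>"
              using elim m \<delta>'(1) by (intro \<delta>'(2)[rule_format]) (auto simp: h_def w_vanish)
            then show ?case by simp
          qed
          then show "\<forall>\<^sub>F p in at (t0, w m) within X \<times> Y.
              dist (G m ((h m (fst p))(m := snd p))) (G m ((h m (fst (t0, w m)))(m := snd (t0, w m)))) < \<epsilon>"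
            unfolding fst_conv snd_conv hw by (rule filter_leD[OF at_within_le_nhds])
        qed
      qed
      then show ?thesis by (simp add: h0)
    qed
    \<comment> \<open>Substituting s = \<open>\<gamma> t m\<close> returns to the curve
      \<open>h (Suc m)\<close>.\<close>
    have c: "((\<lambda>t. (t, \<gamma> t m)) has_derivative (\<lambda>x. (x, x *\<^sub>R \<gamma>' m))) (at t0 within X)"
      by (rule has_derivative_Pair[OF has_derivative_ident
            has_derivative_at_withinI[OF \<gamma>[OF m, unfolded has_vector_derivative_def]]])
    have img: "(\<lambda>t. (t, \<gamma> t m)) ` X \<subseteq> X \<times> Y"
      using \<rho>(2) m by (auto simp: X_def Y_def dist_real_def dist_commute abs_minus_commute)
    have "((\<lambda>(t,s). P t s) has_derivative (\<lambda>(tx, ty). tx *\<^sub>R (\<Sum>j<m. \<gamma>' j *\<^sub>R G j w) + blinfun_scaleR_left (G m w) ty))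
        (at (t0, \<gamma> t0 m) within (\<lambda>t. (t, \<gamma> t m)) ` X)"
      using has_derivative_subset[OF P img] by (simp add: w_def)
    from has_derivative_in_compose[OF c this]
    have "((\<lambda>t. P t (\<gamma> t m)) has_derivative (\<lambda>x. x *\<^sub>R (\<Sum>j<m. \<gamma>' j *\<^sub>R G j w) + (x *\<^sub>R \<gamma>' m) *\<^sub>R G m w)) (at t0 within X)"
      by simp
    moreover have "at t0 within X = at t0" by (rule at_within_open) (use \<rho>(1) in \<open>auto simp: X_def\<close>)
    ultimately have "((\<lambda>t. P t (\<gamma> t m)) has_derivative (\<lambda>x. x *\<^sub>R (\<Sum>j<m. \<gamma>' j *\<^sub>R G j w) + (x *\<^sub>R \<gamma>' m) *\<^sub>R G m w)) (at t0)"
      by (simp only:)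
    moreover have "P t (\<gamma> t m) = g (h (Suc m) t)" for t
      unfolding P_def by (intro arg_cong[where f=g]) (auto simp: h_def less_Suc_eq)
    ultimately show ?case
      by (simp add: has_vector_derivative_def scaleR_add_right)
  qed
  from this[of n] have "((\<lambda>t. g (h n t)) has_vector_derivative (\<Sum>j<n. \<gamma>' j *\<^sub>R G j w)) (at t0)" by simp
  moreover have "h n t = \<gamma> t" for t using \<gamma>0 by (auto simp: h_def w_def)
  ultimately show ?thesis by (simp add: w_def)
qed

lemma continuous_on_truncate:
  fixes F :: "nat \<Rightarrow> 'a::topological_space \<Rightarrow> real"
  assumes "\<And>j. j < n \<Longrightarrow> continuous_on V (F j)"
  shows "continuous_on V (\<lambda>z j. if j < n then F j z else 0)"
proof (rule continuous_on_coordinatewise_then_product)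
  show "continuous_on V (\<lambda>z. if i < n then F i z else 0)" for i using assms by (cases "i < n") auto
qed

text \<open>Padding the component functions with zeros makes their value a point of
  \<open>Euclidean_space n\<close>, where \<open>g\<close> is given. The induction generalises over
  \<open>g\<close> because each derivative of the composite contains composites of the partial
  derivatives of \<open>g\<close>.\<close>

lemma Ck_compose:
  fixes g :: "(nat \<Rightarrow> real) \<Rightarrow> 'b::real_normed_vector"
  assumes V: "openin (Euclidean_space m) V" and W: "openin (Euclidean_space n) W"
    and FW: "\<And>z. z \<in> V \<Longrightarrow> (\<lambda>j. if j < n then F j z else 0) \<in> W"
  shows "(\<And>j. j < n \<Longrightarrow> Ck k m V (F j)) \<Longrightarrow> Ck k n W g \<Longrightarrow> Ck k m V (\<lambda>z. g (\<lambda>j. if j < n then F j z else 0))"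
proof (induction k arbitrary: g)
  case 0
  then have c: "continuous_on V (\<lambda>z. \<lambda>j. if j < n then F j z else 0)" "continuous_on W g"
    by (simp_all add: continuous_on_truncate)
  show ?case
    unfolding Ck.simps by (rule continuous_on_compose2[OF c(2,1)]) (intro image_subsetI FW)
next
  case (Suc k)
  let ?F = "\<lambda>z j. if j < n then F j z else 0"
  show ?case
  proof (rule Ck_SucI'[OF V])
    have "continuous_on V ?F"
      by (rule continuous_on_truncate) (rule Ck_cont[OF Suc.prems(1)])
    then show "continuous_on V (\<lambda>z. g (?F z))"
      by (rule continuous_on_compose2[OF Ck_cont[OF Suc.prems(2)]]) (intro image_subsetI FW)
    show "((\<lambda>t. g (?F (z(i := t)))) has_vector_derivative
        (\<Sum>j<n. partial_deriv i (F j) z *\<^sub>R partial_deriv j g (?F z))) (at (z i))" if i: "i < m" and z: "z \<in> V" for i z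
    proof -
      have "((\<lambda>t. g (?F (z(i := t)))) has_vector_derivative
        (\<Sum>j<n. partial_deriv i (F j) z *\<^sub>R partial_deriv j g (?F (z(i := z i))))) (at (z i))"
      proof (rule has_vector_derivative_partial_chain[OF W])
        show "((\<lambda>s. g (v(j := s))) has_vector_derivative partial_deriv j g v) (at (v j))" if "j < n" "v \<in> W" for j v
          by (rule Ck_SucD(1)[OF Suc.prems(2) that])
        show "continuous_on W (partial_deriv j g)" if "j < n" for j
          by (rule Ck_cont[OF Ck_SucD(2)[OF Suc.prems(2) that]])
        show "((\<lambda>t. ?F (z(i := t)) j) has_vector_derivative partial_deriv i (F j) z) (at (z i))" if "j < n" for j
          using Ck_SucD(1)[OF Suc.prems(1)[OF that] i z] by (simp only: that if_True)
      qed (use FW z in auto)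
      then show ?thesis unfolding fun_upd_triv .
    qed
    show "Ck k m V (\<lambda>z. \<Sum>j<n. partial_deriv i (F j) z *\<^sub>R partial_deriv j g (?F z))" if i: "i < m" for i
      using i
      by (intro Ck_sum[OF V] Ck_bilinear[OF V bounded_bilinear_scaleR] Suc.IH Ck_mono[OF Suc.prems(1)]
          Ck_SucD(2)[OF Suc.prems(1)] Ck_SucD(2)[OF Suc.prems(2)]) auto
  qed
qed

section \<open>Smooth functions on a compact Lie group\<close>

lemma continuous_on_local:
  fixes f :: "'a::t2_space \<Rightarrow> 'b::topological_space"
  assumes "\<And>x. x \<in> S \<Longrightarrow> \<exists>T. open T \<and> x \<in> T \<and> continuous_on (S \<inter> T) f"
  shows "continuous_on S f"
  unfolding continuous_on_eq_continuous_within
proof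
  fix x assume x: "x \<in> S"
  then obtain T where T: "open T" "x \<in> T" "continuous_on (S \<inter> T) f" using assms by blast
  then have "continuous (at x within (S \<inter> T)) f" using x by (simp add: continuous_on_eq_continuous_within)
  moreover have "at x within (S \<inter> T) = at x within S"
    by (rule at_within_nhd[OF T(2,1)]) auto
  ultimately show "continuous (at x within S) f" by simp
qed

text \<open>\<open>P\<close> singles out the small sets on which the claim is provable directly; in
  the application below these are the parts of a chart image that are mapped into a single
  chart.\<close>

lemma Ck_local:
  assumes loc: "\<And>z. z \<in> V \<Longrightarrow> \<exists>V'. openin (Euclidean_space n) V' \<and> z \<in> V' \<and> V' \<subseteq> V \<and> P V'"
  shows "(\<And>V'. openin (Euclidean_space n) V' \<Longrightarrow> V' \<subseteq> V \<Longrightarrow> P V' \<Longrightarrow> Ck k n V' f) \<Longrightarrow>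
    openin (Euclidean_space n) V \<Longrightarrow> Ck k n V f"
proof (induction k arbitrary: f)
  case 0
  have "continuous_on V f"
  proof (rule continuous_on_local)
    fix z assume "z \<in> V"
    then obtain V' where V': "openin (Euclidean_space n) V'" "z \<in> V'" "V' \<subseteq> V" "P V'" using loc by blast
    obtain T where T: "open T" "V' = {x. \<forall>i\<ge>n. x i = 0} \<inter> T"
      using V'(1) unfolding Euclidean_space_top_of_set openin_open by blast
    have "V \<inter> T = V'" using V'(3) T(2) openin_Euclidean_vanishes[OF 0(2)] by auto
    then show "\<exists>T. open T \<and> z \<in> T \<and> continuous_on (V \<inter> T) f"
      using T V' 0(1)[OF V'(1,3,4)] by (intro exI[of _ T]) auto
  qed
  then show ?case by simp
next
  case (Suc k)
  have *: "Ck (Suc k) n V' f" if "openin (Euclidean_space n) V'" "V' \<subseteq> V" "P V'" for V'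
    using Suc.prems(1)[OF that] .
  have "Ck k n V f"
    by (rule Suc.IH[OF _ Suc.prems(2)]) (rule Ck_mono[OF *])
  then have "continuous_on V f" by (rule Ck_cont)
  moreover have "partially_differentiable n V f"
    unfolding partially_differentiable_def
  proof (intro allI impI ballI)
    fix i z assume i: "i < n" and z: "z \<in> V"
    obtain V' where V': "openin (Euclidean_space n) V'" "z \<in> V'" "V' \<subseteq> V" "P V'" using loc[OF z] by blast
    show "(\<lambda>t. f (z(i := t))) differentiable at (z i)"
      using *[OF V'(1,3,4)] i V'(2) by (simp add: partially_differentiable_def)
  qed
  moreover have "Ck k n V (partial_deriv i f)" if "i < n" for i
    by (rule Suc.IH[OF _ Suc.prems(2)]) (use * that in auto)
  ultimately show ?case by simp
qed

locale haar_lie_group = haar_group mul e iv \<mu> + compact_lie_group mul e iv n \<A>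
  for mul :: "'g::{t2_space, second_countable_topology} \<Rightarrow> 'g \<Rightarrow> 'g" and e :: 'g and iv :: "'g \<Rightarrow> 'g"
    and \<mu> :: "'g measure" and n :: nat and \<A> :: "'g atlas"
begin

interpretation prob_space \<mu> by (rule prob)

lemma chart:
  assumes "(U,\<phi>) \<in> \<A>"
  shows "open U" "openin (Euclidean_space n) (\<phi> ` U)" "continuous_on U \<phi>"
    "continuous_on (\<phi> ` U) (inv_into U \<phi>)" "inj_on \<phi> U"
proof -
  have A: "\<forall>(U,\<phi>)\<in>\<A>. open U \<and> openin (Euclidean_space n) (\<phi> ` U) \<and> homeomorphism U (\<phi> ` U) \<phi> (inv_into U \<phi>)"
    using atlas by (simp add: smooth_atlas_def)
  then have *: "open U \<and> openin (Euclidean_space n) (\<phi> ` U) \<and> homeomorphism U (\<phi> ` U) \<phi> (inv_into U \<phi>)"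
    using bspec[OF A assms] by simp
  then show "open U" "openin (Euclidean_space n) (\<phi> ` U)" "continuous_on U \<phi>"
    "continuous_on (\<phi> ` U) (inv_into U \<phi>)" by (simp_all add: homeomorphism_def)
  show "inj_on \<phi> U" using * by (intro inj_on_inverseI[of U "inv_into U \<phi>"]) (simp add: homeomorphism_def)
qed

lemma chart_vanishes: "(U,\<phi>) \<in> \<A> \<Longrightarrow> x \<in> U \<Longrightarrow> i \<ge> n \<Longrightarrow> \<phi> x i = 0"
  by (rule openin_Euclidean_vanishes[OF chart(2)]) auto

lemma chart_inv: "(U,\<phi>) \<in> \<A> \<Longrightarrow> x \<in> U \<Longrightarrow> inv_into U \<phi> (\<phi> x) = x"
  using chart(5) by (rule inv_into_f_f)

lemma chart_inv_in: "z \<in> \<phi> ` U \<Longrightarrow> inv_into U \<phi> z \<in> U" "z \<in> \<phi> ` U \<Longrightarrow> \<phi> (inv_into U \<phi> z) = z"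
  by (auto intro: inv_into_into f_inv_into_f)

lemma chart_at:
  obtains U \<phi> where "(U,\<phi>) \<in> \<A>" "x \<in> U"
proof -
  have "x \<in> (\<Union>(U,\<phi>)\<in>\<A>. U)" using atlas by (simp add: smooth_atlas_def)
  then show ?thesis using that by auto
qed

lemma smooth_funsD: "f \<in> smooth_funs n \<A> \<Longrightarrow> (U,\<phi>) \<in> \<A> \<Longrightarrow> smooth_on n (\<phi> ` U) (\<lambda>z. f (inv_into U \<phi> z))"
  by (auto simp: smooth_funs_def o_def)

lemma smooth_funsI: "(\<And>U \<phi>. (U,\<phi>) \<in> \<A> \<Longrightarrow> smooth_on n (\<phi> ` U) (\<lambda>z. f (inv_into U \<phi> z))) \<Longrightarrow> f \<in> smooth_funs n \<A>"
  by (auto simp: smooth_funs_def o_def)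

lemma smooth_cont:
  assumes f: "f \<in> smooth_funs n \<A>"
  shows "continuous_on UNIV f"
proof (rule continuous_on_local)
  fix x
  obtain U \<phi> where U: "(U,\<phi>) \<in> \<A>" "x \<in> U" by (rule chart_at)
  have "continuous_on (\<phi> ` U) (\<lambda>z. f (inv_into U \<phi> z))"
    using smooth_funsD[OF f U(1)] unfolding smooth_on_iff_Ck by (auto intro: Ck_cont)
  then have "continuous_on U (\<lambda>x. f (inv_into U \<phi> (\<phi> x)))"
    by (rule continuous_on_compose2[OF _ chart(3)[OF U(1)]]) simp
  then have "continuous_on U f"
    by (rule continuous_on_eq) (simp add: chart_inv[OF U(1)])
  then show "\<exists>T. open T \<and> x \<in> T \<and> continuous_on (UNIV \<inter> T) f"
    using U chart(1)[OF U(1)] by (intro exI[of _ U]) simp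
qed

lemma smooth_bilinear:
  assumes "f \<in> smooth_funs n \<A>" "g \<in> smooth_funs n \<A>"
  shows "(\<lambda>x. f x * g x) \<in> smooth_funs n \<A>" "(\<lambda>x. f x + g x) \<in> smooth_funs n \<A>"
  using smooth_funsD[OF assms(1)] smooth_funsD[OF assms(2)]
  by (auto intro!: smooth_funsI Ck_bilinear[OF chart(2) bounded_bilinear_mult] Ck_add[OF chart(2)] simp: smooth_on_iff_Ck)

lemma smooth_const: "(\<lambda>x. c) \<in> smooth_funs n \<A>"
  by (auto intro!: smooth_funsI Ck_const[OF chart(2)] simp: smooth_on_iff_Ck)

lemma smooth_cnj: "f \<in> smooth_funs n \<A> \<Longrightarrow> (\<lambda>x. cnj (f x)) \<in> smooth_funs n \<A>"
  using smooth_funsD[of f]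
  by (auto intro!: smooth_funsI Ck_linear[OF chart(2) bounded_linear_cnj] simp: smooth_on_iff_Ck)

lemma smooth_sum: "(\<And>i. i \<in> I \<Longrightarrow> f i \<in> smooth_funs n \<A>) \<Longrightarrow> (\<lambda>x. \<Sum>i\<in>I. f i x) \<in> smooth_funs n \<A>"
  by (induction I rule: infinite_finite_induct) (auto intro: smooth_bilinear smooth_const)

lemma preimage_chart_open:
  fixes q :: "'g \<Rightarrow> 'c::topological_space"
  assumes U: "(U,\<phi>) \<in> \<A>" and q: "continuous_on UNIV q" and V: "open V"
  shows "openin (Euclidean_space n) {z \<in> \<phi> ` U. q (inv_into U \<phi> z) \<in> V}"
proof -
  have "continuous_on (\<phi> ` U) (\<lambda>z. q (inv_into U \<phi> z))"
    by (rule continuous_on_compose2[OF q chart(4)[OF U]]) simp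
  then have "openin (top_of_set (\<phi> ` U)) (\<phi> ` U \<inter> (\<lambda>z. q (inv_into U \<phi> z)) -` V)"
    using V by (rule continuous_openin_preimage_gen)
  then have "openin (Euclidean_space n) (\<phi> ` U \<inter> (\<lambda>z. q (inv_into U \<phi> z)) -` V)"
    using chart(2)[OF U] unfolding Euclidean_space_top_of_set by (rule openin_trans)
  moreover have "\<phi> ` U \<inter> (\<lambda>z. q (inv_into U \<phi> z)) -` V = {z \<in> \<phi> ` U. q (inv_into U \<phi> z) \<in> V}" by auto
  ultimately show ?thesis by simp
qed

text \<open>Where inversion maps into a single chart V with coordinates \<psi>, the function is
  \<open>f\<close> read in that chart, composed with the coordinates of \<psi> after
  \<open>iv\<close>; the latter are smooth by \<open>smooth_iv\<close>, and \<open>Ck_local\<close>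
  glues these regions.\<close>

lemma smooth_compose_iv:
  assumes f: "f \<in> smooth_funs n \<A>"
  shows "(\<lambda>x. f (iv x)) \<in> smooth_funs n \<A>"
proof (rule smooth_funsI)
  fix U \<phi> assume U: "(U,\<phi>) \<in> \<A>"
  let ?S = "\<lambda>V. {z \<in> \<phi> ` U. iv (inv_into U \<phi> z) \<in> V}"
  let ?P = "\<lambda>S. \<exists>V \<psi>. (V,\<psi>) \<in> \<A> \<and> S = ?S V"
  show "smooth_on n (\<phi> ` U) (\<lambda>z. f (iv (inv_into U \<phi> z)))"
    unfolding smooth_on_iff_Ck
  proof
    fix k
    show "Ck k n (\<phi> ` U) (\<lambda>z. f (iv (inv_into U \<phi> z)))"
    proof (rule Ck_local[where P="?P"])
      fix z assume z: "z \<in> \<phi> ` U"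
      obtain V \<psi> where V: "(V,\<psi>) \<in> \<A>" "iv (inv_into U \<phi> z) \<in> V" by (rule chart_at)
      show "\<exists>V'. openin (Euclidean_space n) V' \<and> z \<in> V' \<and> V' \<subseteq> \<phi> ` U \<and> ?P V'"
      proof (intro exI conjI)
        show "openin (Euclidean_space n) (?S V)" by (rule preimage_chart_open[OF U cont_iv chart(1)[OF V(1)]])
        show "z \<in> ?S V" using z V by simp
        show "(V,\<psi>) \<in> \<A>" by (rule V)
      qed auto
    next
      fix S assume S: "openin (Euclidean_space n) S" "?P S"
      then obtain V \<psi> where V: "(V,\<psi>) \<in> \<A>" "S = ?S V" by blast
      have SS: "S = \<phi> ` (U \<inter> iv -` V)"
        unfolding V(2) by (auto simp: chart_inv[OF U])
      have F: "Ck k n S (\<lambda>z. \<psi> (iv (inv_into U \<phi> z)) j)" if "j < n" for j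
      proof -
        have "\<forall>(U,\<phi>)\<in>\<A>. \<forall>(V,\<psi>)\<in>\<A>. \<forall>j<n. smooth_on n (\<phi> ` (U \<inter> iv -` V)) (\<lambda>z. \<psi> (iv (inv_into U \<phi> z)) j)"
          using smooth_iv by (simp add: smooth_map_def)
        from bspec[OF this U] have "\<forall>(V,\<psi>)\<in>\<A>. \<forall>j<n. smooth_on n (\<phi> ` (U \<inter> iv -` V)) (\<lambda>z. \<psi> (iv (inv_into U \<phi> z)) j)" by simp
        from bspec[OF this V(1)] that show ?thesis by (simp add: smooth_on_iff_Ck SS)
      qed
      have trunc: "(\<lambda>j. if j < n then \<psi> (iv (inv_into U \<phi> z)) j else 0) = \<psi> (iv (inv_into U \<phi> z))" if "z \<in> S" for z
        using that chart_vanishes[OF V(1), of "iv (inv_into U \<phi> z)"] by (auto simp: V(2))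
      have "Ck k n S (\<lambda>z. f (inv_into V \<psi> (\<lambda>j. if j < n then \<psi> (iv (inv_into U \<phi> z)) j else 0)))"
      proof (rule Ck_compose[OF S(1) chart(2)[OF V(1)]])
        show "(\<lambda>j. if j < n then \<psi> (iv (inv_into U \<phi> z)) j else 0) \<in> \<psi> ` V" if "z \<in> S" for z
          using that unfolding trunc[OF that] by (auto simp: V(2))
        show "Ck k n (\<psi> ` V) (\<lambda>z. f (inv_into V \<psi> z))"
          using smooth_funsD[OF f V(1)] by (simp add: smooth_on_iff_Ck)
      qed (rule F)
      then show "Ck k n S (\<lambda>z. f (iv (inv_into U \<phi> z)))"
        by (rule Ck_cong[OF S(1)]) (simp only: trunc, simp add: V(2) chart_inv[OF V(1)])
    qed (rule chart(2)[OF U])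
  qed
qed

end

text \<open>A point of a product chart is the concatenation of the coordinates of its two components.\<close>

definition low_half :: "nat \<Rightarrow> (nat \<Rightarrow> real) \<Rightarrow> nat \<Rightarrow> real"
  where "low_half n z = (\<lambda>i. if i < n then z i else 0)"

definition high_half :: "nat \<Rightarrow> (nat \<Rightarrow> real) \<Rightarrow> nat \<Rightarrow> real"
  where "high_half n z = (\<lambda>i. z (n + i))"

definition join_halves :: "nat \<Rightarrow> (nat \<Rightarrow> real) \<Rightarrow> (nat \<Rightarrow> real) \<Rightarrow> nat \<Rightarrow> real"
  where "join_halves n a b = (\<lambda>i. if i < n then a i else b (i - n))"

lemma low_half_join: "(\<And>i. i \<ge> n \<Longrightarrow> a i = 0) \<Longrightarrow> low_half n (join_halves n a b) = a"
  by (auto simp: low_half_def join_halves_def)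

lemma high_half_join: "high_half n (join_halves n a b) = b"
  by (auto simp: high_half_def join_halves_def)

lemma join_low_high: "join_halves n (low_half n z) (high_half n z) = z"
  by (auto simp: join_halves_def low_half_def high_half_def)

lemma join_halves_upd: "join_halves n a (b(i := t)) = (join_halves n a b)(n + i := t)"
  by (auto simp: join_halves_def fun_eq_iff fun_upd_def)

lemma continuous_on_coordinate: "continuous_on S (\<lambda>z::nat \<Rightarrow> real. z i)"
  by (rule continuous_on_product_then_coordinatewise) (rule continuous_on_id)

lemma continuous_on_low_half: "continuous_on S (low_half n)"
proof (rule continuous_on_coordinatewise_then_product)
  show "continuous_on S (\<lambda>z. low_half n z i)" for i
    by (cases "i < n") (simp_all add: low_half_def continuous_on_coordinate)
qed

lemma continuous_on_high_half: "continuous_on S (high_half n)"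
  unfolding high_half_def[abs_def]
  by (rule continuous_on_coordinatewise_then_product) (rule continuous_on_coordinate)

lemma continuous_on_join_halves:
  assumes "continuous_on S a" "continuous_on S b"
  shows "continuous_on S (\<lambda>x. join_halves n (a x) (b x))"
proof (rule continuous_on_coordinatewise_then_product)
  show "continuous_on S (\<lambda>x. join_halves n (a x) (b x) i)" for i
    by (cases "i < n")
       (simp_all add: join_halves_def continuous_on_product_then_coordinatewise[OF assms(1)]
         continuous_on_product_then_coordinatewise[OF assms(2)])
qed

section \<open>Multiplication in product charts and translations\<close>

context haar_lie_group begin

interpretation prob_space \<mu> by (rule prob)

definition chart_mul :: "'g set \<Rightarrow> ('g \<Rightarrow> nat \<Rightarrow> real) \<Rightarrow> 'g set \<Rightarrow> ('g \<Rightarrow> nat \<Rightarrow> real) \<Rightarrow> (nat \<Rightarrow> real) \<Rightarrow> 'g"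
  where "chart_mul U1 \<phi>1 U \<phi> z = mul (inv_into U1 \<phi>1 (low_half n z)) (inv_into U \<phi> (high_half n z))"

definition chart_mul_dom :: "'g set \<Rightarrow> ('g \<Rightarrow> nat \<Rightarrow> real) \<Rightarrow> 'g set \<Rightarrow> ('g \<Rightarrow> nat \<Rightarrow> real) \<Rightarrow> 'g set \<Rightarrow> (nat \<Rightarrow> real) set"
  where "chart_mul_dom U1 \<phi>1 U \<phi> V = {z. (\<forall>i\<ge>n+n. z i = 0) \<and> low_half n z \<in> \<phi>1 ` U1 \<and> high_half n z \<in> \<phi> ` U \<and>
    chart_mul U1 \<phi>1 U \<phi> z \<in> V}"

lemma chart_mul_dom_open:
  assumes U1: "(U1,\<phi>1) \<in> \<A>" and U: "(U,\<phi>) \<in> \<A>" and V: "open V"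
  shows "openin (Euclidean_space (n + n)) (chart_mul_dom U1 \<phi>1 U \<phi> V)"
proof -
  let ?E = "\<lambda>m. {x::nat \<Rightarrow> real. \<forall>i\<ge>m. x i = 0}"
  let ?A = "?E (n + n) \<inter> low_half n -` (\<phi>1 ` U1)"
  let ?B = "?E (n + n) \<inter> high_half n -` (\<phi> ` U)"
  have A: "openin (top_of_set (?E (n + n))) ?A"
    using chart(2)[OF U1] unfolding Euclidean_space_top_of_set
    by (intro continuous_openin_preimage[OF continuous_on_low_half]) (auto simp: low_half_def)
  have B: "openin (top_of_set (?E (n + n))) ?B"
    using chart(2)[OF U] unfolding Euclidean_space_top_of_set
    by (intro continuous_openin_preimage[OF continuous_on_high_half]) (auto simp: high_half_def)
  have AB: "openin (top_of_set (?E (n + n))) (?A \<inter> ?B)" using A B by (rule openin_Int)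
  have "continuous_on (?A \<inter> ?B) (\<lambda>z. inv_into U1 \<phi>1 (low_half n z))"
    by (rule continuous_on_compose2[OF chart(4)[OF U1] continuous_on_low_half]) auto
  moreover have "continuous_on (?A \<inter> ?B) (\<lambda>z. inv_into U \<phi> (high_half n z))"
    by (rule continuous_on_compose2[OF chart(4)[OF U] continuous_on_high_half]) auto
  ultimately have "continuous_on (?A \<inter> ?B) (chart_mul U1 \<phi>1 U \<phi>)"
    unfolding chart_mul_def[abs_def] by (rule cont_mul')
  then have "openin (top_of_set (?A \<inter> ?B)) ((?A \<inter> ?B) \<inter> chart_mul U1 \<phi>1 U \<phi> -` V)"
    using V by (rule continuous_openin_preimage_gen)
  then have "openin (top_of_set (?E (n + n))) ((?A \<inter> ?B) \<inter> chart_mul U1 \<phi>1 U \<phi> -` V)"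
    using AB by (rule openin_trans)
  moreover have "(?A \<inter> ?B) \<inter> chart_mul U1 \<phi>1 U \<phi> -` V = chart_mul_dom U1 \<phi>1 U \<phi> V"
    by (auto simp: chart_mul_dom_def)
  ultimately show ?thesis by (simp add: Euclidean_space_top_of_set)
qed

lemma low_half_chart: "(U,\<phi>) \<in> \<A> \<Longrightarrow> y \<in> U \<Longrightarrow> low_half n (join_halves n (\<phi> y) z) = \<phi> y"
  by (rule low_half_join) (rule chart_vanishes)

lemma chart_mul_join:
  assumes U1: "(U1,\<phi>1) \<in> \<A>" and y: "y \<in> U1"
  shows "chart_mul U1 \<phi>1 U \<phi> (join_halves n (\<phi>1 y) z) = mul y (inv_into U \<phi> z)"
  unfolding chart_mul_def high_half_join low_half_chart[OF U1 y] chart_inv[OF U1 y] ..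

lemma join_in_chart_mul_dom:
  assumes U1: "(U1,\<phi>1) \<in> \<A>" and U: "(U,\<phi>) \<in> \<A>" and y: "y \<in> U1" and z: "z \<in> \<phi> ` U" "mul y (inv_into U \<phi> z) \<in> V"
  shows "join_halves n (\<phi>1 y) z \<in> chart_mul_dom U1 \<phi>1 U \<phi> V"
  unfolding chart_mul_dom_def mem_Collect_eq chart_mul_join[OF U1 y] high_half_join low_half_chart[OF U1 y]
  using y z openin_Euclidean_vanishes[OF chart(2)[OF U] z(1)] by (auto simp: join_halves_def)

text \<open>\<open>smooth_mul\<close> speaks of the abstract inverse of a product chart. Most of the
  proof identifies this inverse with the pair of chart inverses on the two halves, and the domain
  with the image of the product chart; then the chain rule applies in the chart V of the
  product.\<close>

lemma smooth_chart_mul: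
  assumes f: "f \<in> smooth_funs n \<A>" and U1: "(U1,\<phi>1) \<in> \<A>" and U: "(U,\<phi>) \<in> \<A>" and V: "(V,\<psi>) \<in> \<A>"
  shows "smooth_on (n + n) (chart_mul_dom U1 \<phi>1 U \<phi> V) (\<lambda>z. f (chart_mul U1 \<phi>1 U \<phi> z))"
proof -
  let ?\<Omega> = "chart_mul_dom U1 \<phi>1 U \<phi> V"
  let ?\<Phi> = "\<lambda>(x,y) i. if i < n then \<phi>1 x i else \<phi> y (i - n)"
  have \<Phi>: "?\<Phi> (x,y) = join_halves n (\<phi>1 x) (\<phi> y)" for x y by (simp add: join_halves_def)
  have inj: "inj_on ?\<Phi> (U1 \<times> U)"
  proof (rule inj_onI)
    fix p q assume pq: "p \<in> U1 \<times> U" "q \<in> U1 \<times> U" "?\<Phi> p = ?\<Phi> q"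
    obtain x y x' y' where p: "p = (x,y)" and q: "q = (x',y')" by (cases p, cases q)
    have xs: "x \<in> U1" "y \<in> U" "x' \<in> U1" "y' \<in> U" using pq p q by auto
    have eq: "join_halves n (\<phi>1 x) (\<phi> y) = join_halves n (\<phi>1 x') (\<phi> y')" using pq(3) unfolding p q \<Phi> .
    have "\<phi>1 x = \<phi>1 x'"
      using arg_cong[OF eq, of "low_half n"]
      unfolding low_half_chart[OF U1 xs(1)] low_half_chart[OF U1 xs(3)] .
    moreover have "\<phi> y = \<phi> y'" using arg_cong[OF eq, of "high_half n"] unfolding high_half_join .
    ultimately show "p = q"
      using inj_onD[OF chart(5)[OF U1] _ xs(1,3)] inj_onD[OF chart(5)[OF U] _ xs(2,4)] by (simp add: p q)
  qed
  have rep: "z = ?\<Phi> (inv_into U1 \<phi>1 (low_half n z), inv_into U \<phi> (high_half n z))"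
    "(inv_into U1 \<phi>1 (low_half n z), inv_into U \<phi> (high_half n z)) \<in> U1 \<times> U" if "z \<in> ?\<Omega>" for z
  proof -
    have z: "low_half n z \<in> \<phi>1 ` U1" "high_half n z \<in> \<phi> ` U" using that by (auto simp: chart_mul_dom_def)
    show "z = ?\<Phi> (inv_into U1 \<phi>1 (low_half n z), inv_into U \<phi> (high_half n z))"
      unfolding \<Phi> chart_inv_in(2)[OF z(1)] chart_inv_in(2)[OF z(2)] join_low_high ..
    show "(inv_into U1 \<phi>1 (low_half n z), inv_into U \<phi> (high_half n z)) \<in> U1 \<times> U"
      using chart_inv_in(1)[OF z(1)] chart_inv_in(1)[OF z(2)] by simp
  qed
  have img: "?\<Phi> ` ((U1 \<times> U) \<inter> (\<lambda>(x,y). mul x y) -` V) = ?\<Omega>"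
  proof (intro equalityI subsetI)
    fix z assume z: "z \<in> ?\<Omega>"
    have "mul (inv_into U1 \<phi>1 (low_half n z)) (inv_into U \<phi> (high_half n z)) \<in> V"
      using z by (simp add: chart_mul_dom_def chart_mul_def)
    then have "?\<Phi> (inv_into U1 \<phi>1 (low_half n z), inv_into U \<phi> (high_half n z)) \<in>
        ?\<Phi> ` ((U1 \<times> U) \<inter> (\<lambda>(x,y). mul x y) -` V)"
      using rep(2)[OF z] by (intro imageI) simp
    then show "z \<in> ?\<Phi> ` ((U1 \<times> U) \<inter> (\<lambda>(x,y). mul x y) -` V)"
      unfolding rep(1)[OF z, symmetric] .
  next
    fix z assume "z \<in> ?\<Phi> ` ((U1 \<times> U) \<inter> (\<lambda>(x,y). mul x y) -` V)"
    then obtain x y where xy: "z = ?\<Phi> (x,y)" "x \<in> U1" "y \<in> U" "mul x y \<in> V" by auto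
    show "z \<in> ?\<Omega>"
      unfolding xy(1) \<Phi> using xy
      by (intro join_in_chart_mul_dom[OF U1 U xy(2)]) (auto simp: chart_inv[OF U])
  qed
  have inv: "inv_into (U1 \<times> U) ?\<Phi> z = (inv_into U1 \<phi>1 (low_half n z), inv_into U \<phi> (high_half n z))" if "z \<in> ?\<Omega>" for z
    by (subst rep(1)[OF that]) (rule inv_into_f_f[OF inj rep(2)[OF that]])
  have open\<Omega>: "openin (Euclidean_space (n + n)) ?\<Omega>" by (rule chart_mul_dom_open[OF U1 U chart(1)[OF V]])
  have "(U1 \<times> U, ?\<Phi>) \<in> prod_atlas n \<A> \<A>"
    unfolding prod_atlas_def mem_Collect_eq using U1 U by (intro exI conjI) (rule refl)
  have "\<forall>(U,\<phi>)\<in>prod_atlas n \<A> \<A>. \<forall>(V,\<psi>)\<in>\<A>. \<forall>j<n. smooth_on (n + n) (\<phi> ` (U \<inter> (\<lambda>(x,y). mul x y) -` V))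
      (\<lambda>z. \<psi> ((\<lambda>(x,y). mul x y) (inv_into U \<phi> z)) j)"
    using smooth_mul[unfolded smooth_map_def] by (rule conjunct2)
  from bspec[OF this \<open>(U1 \<times> U, ?\<Phi>) \<in> prod_atlas n \<A> \<A>\<close>]
  have "\<forall>(V,\<psi>)\<in>\<A>. \<forall>j<n. smooth_on (n + n) (?\<Phi> ` ((U1 \<times> U) \<inter> (\<lambda>(x,y). mul x y) -` V))
      (\<lambda>z. \<psi> ((\<lambda>(x,y). mul x y) (inv_into (U1 \<times> U) ?\<Phi> z)) j)" by (simp only: prod.case)
  from bspec[OF this V]
  have sm: "\<forall>j<n. smooth_on (n + n) ?\<Omega> (\<lambda>z. \<psi> ((\<lambda>(x,y). mul x y) (inv_into (U1 \<times> U) ?\<Phi> z)) j)"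
    by (simp only: prod.case img)
  show ?thesis
    unfolding smooth_on_iff_Ck
  proof
    fix k
    have F: "Ck k (n + n) ?\<Omega> (\<lambda>z. \<psi> (chart_mul U1 \<phi>1 U \<phi> z) j)" if "j < n" for j
    proof (rule Ck_cong[OF open\<Omega>])
      show "Ck k (n + n) ?\<Omega> (\<lambda>z. \<psi> ((\<lambda>(x,y). mul x y) (inv_into (U1 \<times> U) ?\<Phi> z)) j)"
        using sm that unfolding smooth_on_iff_Ck by blast
    qed (simp only: inv prod.case chart_mul_def)
    have inV: "chart_mul U1 \<phi>1 U \<phi> z \<in> V" if "z \<in> ?\<Omega>" for z using that by (simp add: chart_mul_dom_def)
    have trunc: "(\<lambda>j. if j < n then \<psi> (chart_mul U1 \<phi>1 U \<phi> z) j else 0) = \<psi> (chart_mul U1 \<phi>1 U \<phi> z)" if "z \<in> ?\<Omega>" for z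
      using chart_vanishes[OF V inV[OF that]] by auto
    have "Ck k (n + n) ?\<Omega> (\<lambda>z. f (inv_into V \<psi> (\<lambda>j. if j < n then \<psi> (chart_mul U1 \<phi>1 U \<phi> z) j else 0)))"
    proof (rule Ck_compose[OF open\<Omega> chart(2)[OF V]])
      show "(\<lambda>j. if j < n then \<psi> (chart_mul U1 \<phi>1 U \<phi> z) j else 0) \<in> \<psi> ` V" if "z \<in> ?\<Omega>" for z
        unfolding trunc[OF that] using inV[OF that] by simp
      show "Ck k n (\<psi> ` V) (\<lambda>z. f (inv_into V \<psi> z))"
        using smooth_funsD[OF f V] by (simp add: smooth_on_iff_Ck)
    qed (rule F)
    then show "Ck k (n + n) ?\<Omega> (\<lambda>z. f (chart_mul U1 \<phi>1 U \<phi> z))"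
      by (rule Ck_cong[OF open\<Omega>]) (simp only: trunc chart_inv[OF V inV])
  qed
qed

text \<open>Translation by a fixed element is multiplication restricted to a slice, whose derivatives are the
  derivatives of multiplication in the last \<open>n\<close> coordinates.\<close>

lemma partial_derivs_slice:
  assumes U1: "(U1,\<phi>1) \<in> \<A>" and U: "(U,\<phi>) \<in> \<A>" and V: "open V" and y: "y \<in> U1" and "set is \<subseteq> {..<n}"
  shows "z \<in> \<phi> ` U \<Longrightarrow> mul y (inv_into U \<phi> z) \<in> V \<Longrightarrow>
    partial_derivs is (\<lambda>z. f (mul y (inv_into U \<phi> z))) z =
    partial_derivs (map ((+) n) is) (\<lambda>z. f (chart_mul U1 \<phi>1 U \<phi> z)) (join_halves n (\<phi>1 y) z)"
  using assms(5)
proof (induction "is" arbitrary: z)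
  case Nil
  then show ?case by (simp add: chart_mul_join[OF U1 y])
next
  case (Cons i "is")
  let ?S = "{z \<in> \<phi> ` U. mul y (inv_into U \<phi> z) \<in> V}"
  let ?K = "partial_derivs (map ((+) n) is) (\<lambda>z. f (chart_mul U1 \<phi>1 U \<phi> z))"
  have S: "openin (Euclidean_space n) ?S"
    by (rule preimage_chart_open[OF U _ V]) (intro continuous_intros)
  have "partial_deriv i (partial_derivs is (\<lambda>z. f (mul y (inv_into U \<phi> z)))) z
      = partial_deriv i (\<lambda>z. ?K (join_halves n (\<phi>1 y) z)) z"
    by (rule partial_deriv_cong[OF S]) (use Cons in auto)
  also have "\<dots> = partial_deriv (n + i) ?K (join_halves n (\<phi>1 y) z)"
    unfolding partial_deriv_def join_halves_upd by (simp add: join_halves_def)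
  finally show ?case by simp
qed

text \<open>Continuity jointly in \<open>y\<close> and \<open>z\<close> is checked near each point
  in charts around the translating element and around the product. With compactness in
  \<open>y\<close> it later justifies differentiation under the integral and uniform
  estimates.\<close>

lemma translate_partials:
  assumes f: "f \<in> smooth_funs n \<A>" and U: "(U,\<phi>) \<in> \<A>" and "is": "set is \<subseteq> {..<n}"
  shows "continuous_on (UNIV \<times> \<phi> ` U) (\<lambda>(y,z). partial_derivs is (\<lambda>z. f (mul y (inv_into U \<phi> z))) z)"
    and "i < n \<Longrightarrow> z \<in> \<phi> ` U \<Longrightarrow> (\<lambda>t. partial_derivs is (\<lambda>z. f (mul y (inv_into U \<phi> z))) (z(i := t))) differentiable at (z i)"
proof -
  let ?P = "\<lambda>y. partial_derivs is (\<lambda>z. f (mul y (inv_into U \<phi> z)))"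
  have js: "set (map ((+) n) is) \<subseteq> {..<n + n}" using "is" by auto
  show "continuous_on (UNIV \<times> \<phi> ` U) (\<lambda>(y,z). ?P y z)"
  proof (rule continuous_on_local)
    fix p assume p: "p \<in> (UNIV :: 'g set) \<times> \<phi> ` U"
    obtain y0 z0 where p0: "p = (y0,z0)" by (cases p)
    obtain U1 \<phi>1 where U1: "(U1,\<phi>1) \<in> \<A>" "y0 \<in> U1" by (rule chart_at)
    obtain V \<psi> where V: "(V,\<psi>) \<in> \<A>" "mul y0 (inv_into U \<phi> z0) \<in> V" by (rule chart_at)
    let ?K = "partial_derivs (map ((+) n) is) (\<lambda>z. f (chart_mul U1 \<phi>1 U \<phi> z))"
    let ?\<Omega> = "chart_mul_dom U1 \<phi>1 U \<phi> V"
    have K: "continuous_on ?\<Omega> ?K"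
      using smooth_chart_mul[OF f U1(1) U V(1)] js unfolding smooth_on_def by blast
    let ?m = "\<lambda>p. mul (fst p) (inv_into U \<phi> (snd p))"
    have m: "continuous_on (U1 \<times> \<phi> ` U) ?m"
      by (intro cont_mul' continuous_on_fst continuous_on_id continuous_on_compose2[OF chart(4)[OF U]] continuous_on_snd) auto
    have "openin (top_of_set (U1 \<times> \<phi> ` U)) ((U1 \<times> \<phi> ` U) \<inter> ?m -` V)"
      using m chart(1)[OF V(1)] by (rule continuous_openin_preimage_gen)
    then obtain T where T: "open T" "(U1 \<times> \<phi> ` U) \<inter> ?m -` V = (U1 \<times> \<phi> ` U) \<inter> T"
      unfolding openin_open by blast
    let ?T = "T \<inter> (U1 \<times> UNIV)"
    have "open ?T" using T(1) chart(1)[OF U1(1)] by (intro open_Int open_Times) auto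
    moreover have pin: "p \<in> (U1 \<times> \<phi> ` U) \<inter> ?m -` V" using p U1(2) V(2) by (simp add: p0)
    then have "p \<in> ?T" unfolding T(2) using U1(2) by (simp add: p0)
    moreover have "continuous_on ((UNIV \<times> \<phi> ` U) \<inter> ?T) (\<lambda>(y,z). ?P y z)"
    proof -
      have eq: "(UNIV \<times> \<phi> ` U) \<inter> ?T = (U1 \<times> \<phi> ` U) \<inter> ?m -` V" unfolding T(2) by auto
      have j: "continuous_on ((U1 \<times> \<phi> ` U) \<inter> ?m -` V) (\<lambda>p. join_halves n (\<phi>1 (fst p)) (snd p))"
        by (intro continuous_on_join_halves continuous_on_compose2[OF chart(3)[OF U1(1)]] continuous_on_fst
            continuous_on_snd continuous_on_id) auto
      have jin: "join_halves n (\<phi>1 (fst p)) (snd p) \<in> ?\<Omega>" if "p \<in> (U1 \<times> \<phi> ` U) \<inter> ?m -` V" for p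
        using that by (intro join_in_chart_mul_dom[OF U1(1) U]) auto
      have "continuous_on ((U1 \<times> \<phi> ` U) \<inter> ?m -` V) (\<lambda>p. ?K (join_halves n (\<phi>1 (fst p)) (snd p)))"
        by (rule continuous_on_compose2[OF K j]) (intro image_subsetI jin)
      then show ?thesis
        unfolding eq
      proof (rule continuous_on_eq)
        fix p assume "p \<in> (U1 \<times> \<phi> ` U) \<inter> ?m -` V"
        then have p: "fst p \<in> U1" "snd p \<in> \<phi> ` U" "mul (fst p) (inv_into U \<phi> (snd p)) \<in> V" by auto
        show "?K (join_halves n (\<phi>1 (fst p)) (snd p)) = (\<lambda>(y,z). ?P y z) p"
          unfolding case_prod_unfold
          by (rule partial_derivs_slice[OF U1(1) U chart(1)[OF V(1)] p(1) "is" p(2,3), symmetric])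
      qed
    qed
    ultimately show "\<exists>T. open T \<and> p \<in> T \<and> continuous_on ((UNIV \<times> \<phi> ` U) \<inter> T) (\<lambda>(y,z). ?P y z)" by blast
  qed
  show "(\<lambda>t. ?P y (z(i := t))) differentiable at (z i)" if i: "i < n" and z: "z \<in> \<phi> ` U"
  proof -
    obtain U1 \<phi>1 where U1: "(U1,\<phi>1) \<in> \<A>" "y \<in> U1" by (rule chart_at)
    obtain V \<psi> where V: "(V,\<psi>) \<in> \<A>" "mul y (inv_into U \<phi> z) \<in> V" by (rule chart_at)
    let ?K = "partial_derivs (map ((+) n) is) (\<lambda>z. f (chart_mul U1 \<phi>1 U \<phi> z))"
    let ?\<zeta> = "join_halves n (\<phi>1 y) z"
    have "?\<zeta> \<in> chart_mul_dom U1 \<phi>1 U \<phi> V" by (rule join_in_chart_mul_dom[OF U1(1) U U1(2) z V(2)])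
    then have "(\<lambda>t. ?K (?\<zeta>(n + i := t))) differentiable at (?\<zeta> (n + i))"
      using smooth_chart_mul[OF f U1(1) U V(1)] js i unfolding smooth_on_def by simp
    then have "((\<lambda>t. ?K (join_halves n (\<phi>1 y) (z(i := t)))) has_vector_derivative partial_deriv (n + i) ?K ?\<zeta>) (at (z i))"
      using partial_deriv_works[of ?K ?\<zeta> "n + i"] by (simp only: join_halves_upd) (simp add: join_halves_def)
    moreover have S: "openin (Euclidean_space n) {z \<in> \<phi> ` U. mul y (inv_into U \<phi> z) \<in> V}"
      by (rule preimage_chart_open[OF U _ chart(1)[OF V(1)]]) (intro continuous_intros)
    have "((\<lambda>t. ?P y (z(i := t))) has_vector_derivative partial_deriv (n + i) ?K ?\<zeta>) (at (z i)) \<longleftrightarrow>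
        ((\<lambda>t. ?K (join_halves n (\<phi>1 y) (z(i := t)))) has_vector_derivative partial_deriv (n + i) ?K ?\<zeta>) (at (z i))"
      by (rule has_vector_derivative_upd_cong[OF S _ i])
         (use z V partial_derivs_slice[OF U1(1) U chart(1)[OF V(1)] U1(2) "is"] in auto)
    ultimately show ?thesis using has_vector_derivative_differentiable by blast
  qed
qed

lemma smooth_translate_left:
  assumes f: "f \<in> smooth_funs n \<A>"
  shows "(\<lambda>x. f (mul y x)) \<in> smooth_funs n \<A>"
proof (rule smooth_funsI)
  fix U \<phi> assume U: "(U,\<phi>) \<in> \<A>"
  show "smooth_on n (\<phi> ` U) (\<lambda>z. f (mul y (inv_into U \<phi> z)))"
    unfolding smooth_on_def
  proof (intro allI impI conjI ballI)
    fix "is" assume "is": "set is \<subseteq> {..<n}"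
    have "continuous_on (\<phi> ` U) (\<lambda>z::nat \<Rightarrow> real. (y,z))" by (intro continuous_intros)
    from continuous_on_compose2[OF translate_partials(1)[OF f U "is"] this]
    show "continuous_on (\<phi> ` U) (partial_derivs is (\<lambda>z. f (mul y (inv_into U \<phi> z))))" by (simp add: image_subset_iff)
  qed (rule translate_partials(2)[OF f U])
qed

text \<open>Right translation is left translation conjugated by inversion.\<close>

lemma smooth_translate_right:
  assumes f: "f \<in> smooth_funs n \<A>"
  shows "(\<lambda>x. f (mul x b)) \<in> smooth_funs n \<A>"
  using smooth_compose_iv[OF smooth_translate_left[OF smooth_compose_iv[OF f], of "iv b"]]
  by (simp add: inverse_distrib_swap)

end

section \<open>Differentiation under the Haar integral\<close>

context haar_group begin

interpretation prob_space \<mu> by (rule prob)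

text \<open>Because the group is compact, the partial derivative is continuous in \<open>z\<close>
  uniformly in \<open>y\<close>. The mean value inequality then bounds the error of linear
  approximation uniformly in \<open>y\<close>, so it survives integration against the bounded
  \<open>t\<close>.\<close>

lemma has_vector_derivative_integral_param:
  fixes H :: "'g \<Rightarrow> (nat \<Rightarrow> real) \<Rightarrow> complex"
  assumes V: "openin (Euclidean_space n) V" and z: "z \<in> V" and i: "i < n" and t: "continuous_on UNIV t"
    and H: "continuous_on (UNIV \<times> V) (\<lambda>(y,z). H y z)"
    and H': "continuous_on (UNIV \<times> V) (\<lambda>(y,z). partial_deriv i (H y) z)"
    and diff: "\<And>y w. w \<in> V \<Longrightarrow> (\<lambda>s. H y (w(i := s))) differentiable at (w i)"
  shows "((\<lambda>s. \<integral>y. t y * H y (z(i := s)) \<partial>\<mu>) has_vector_derivative (\<integral>y. t y * partial_deriv i (H y) z \<partial>\<mu>)) (at (z i))"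
proof -
  let ?D = "\<lambda>y. partial_deriv i (H y)"
  obtain B where B: "B > 0" "\<And>y. cmod (t y) \<le> B" using cont_bound[OF t] by blast
  have sect: "continuous_on UNIV (\<lambda>y. F y w)" if "continuous_on (UNIV \<times> V) (\<lambda>(y,z). F y z)" "w \<in> V" for F :: "'g \<Rightarrow> (nat \<Rightarrow> real) \<Rightarrow> complex" and w
  proof -
    have "continuous_on UNIV (\<lambda>y::'g. (y,w))" by (intro continuous_intros)
    from continuous_on_compose2[OF that(1) this] that(2) show ?thesis by (simp add: image_subset_iff)
  qed
  have int: "integrable \<mu> (\<lambda>y. t y * H y w)" "integrable \<mu> (\<lambda>y. t y * ?D y w)" if "w \<in> V" for w
    by (intro cont_integrable continuous_on_mult t sect[OF H that] sect[OF H' that])+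
  have swap: "continuous_on (V \<times> UNIV) (\<lambda>(z,y). ?D y z)"
  proof -
    have "continuous_on (V \<times> UNIV) (\<lambda>p::(nat \<Rightarrow> real) \<times> 'g. (snd p, fst p))" by (intro continuous_intros)
    from continuous_on_compose2[OF H' this] show ?thesis by (simp add: case_prod_unfold image_subset_iff)
  qed
  show ?thesis
    unfolding has_vector_derivative_def has_derivative_at_alt
  proof (intro conjI allI impI)
    show "bounded_linear (\<lambda>x. x *\<^sub>R (\<integral>y. t y * ?D y z \<partial>\<mu>))" by (rule bounded_linear_scaleR_left)
    fix \<epsilon> :: real assume \<epsilon>: "\<epsilon> > 0"
    then have "\<epsilon> / B > 0" using B(1) by simp
    from continuous_on_prod_compactE[OF swap compact_UNIV z this]
    obtain X where X0: "z \<in> X" "open X"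
      "\<forall>w\<in>X \<inter> V. \<forall>y\<in>UNIV. dist ((\<lambda>(z,y). ?D y z) (w,y)) ((\<lambda>(z,y). ?D y z) (z,y)) \<le> \<epsilon> / B" .
    then have X: "z \<in> X" "open X" "\<And>w y. w \<in> X \<inter> V \<Longrightarrow> dist (?D y w) (?D y z) \<le> \<epsilon> / B"
      by simp_all
    have "openin (Euclidean_space n) (X \<inter> V)"
      unfolding Int_commute[of X] using V X(2) unfolding Euclidean_space_top_of_set by (rule openin_Int_open)
    from eventually_upd_in[OF this _ i] z X(1)
    have "\<forall>\<^sub>F s in nhds (z i). z(i := s) \<in> X \<inter> V" by simp
    then obtain \<delta> where \<delta>: "\<delta> > 0" "\<And>s. dist s (z i) < \<delta> \<Longrightarrow> z(i := s) \<in> X \<inter> V"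
      unfolding eventually_nhds_metric by blast
    have pt: "cmod (H y (z(i := s)) - H y z - (s - z i) *\<^sub>R ?D y z) \<le> \<epsilon> / B * \<bar>s - z i\<bar>" if s: "dist s (z i) < \<delta>" for y s
    proof -
      \<comment> \<open>Subtracting the linear part leaves a function whose derivative is at most
        \<epsilon> / B in norm on the ball.\<close>
      let ?q = "\<lambda>s. H y (z(i := s)) - s *\<^sub>R ?D y z"
      have dq: "(?q has_vector_derivative (?D y (z(i := u)) - ?D y z)) (at u)" if "dist u (z i) < \<delta>" for u
      proof -
        have "z(i := u) \<in> V" using \<delta>(2)[OF that] by simp
        from partial_deriv_works[OF diff[OF this, of y]]
        have "((\<lambda>s. H y (z(i := s))) has_vector_derivative ?D y (z(i := u))) (at u)" by (simp only: fun_upd_upd fun_upd_same)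
        moreover have "((\<lambda>s. s *\<^sub>R ?D y z) has_vector_derivative ?D y z) (at u)"
          unfolding has_vector_derivative_def by (rule bounded_linear_imp_has_derivative[OF bounded_linear_scaleR_left])
        ultimately show ?thesis by (rule has_vector_derivative_diff)
      qed
      have "norm (?q s - ?q (z i)) \<le> \<epsilon> / B * norm (s - z i)"
      proof (rule differentiable_bound[where S="ball (z i) \<delta>"])
        show "(?q has_derivative (\<lambda>h. h *\<^sub>R (?D y (z(i := u)) - ?D y z))) (at u within ball (z i) \<delta>)" if "u \<in> ball (z i) \<delta>" for u
        proof -
          have "dist u (z i) < \<delta>" using that by (simp add: dist_commute)
          from has_derivative_at_withinI[OF dq[OF this, unfolded has_vector_derivative_def]] show ?thesis .
        qed
        show "onorm (\<lambda>h. h *\<^sub>R (?D y (z(i := u)) - ?D y z)) \<le> \<epsilon> / B" if "u \<in> ball (z i) \<delta>" for u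
        proof (rule onorm_bound)
          have "z(i := u) \<in> X \<inter> V" using that by (intro \<delta>(2)) (simp add: dist_commute)
          then have "cmod (?D y (z(i := u)) - ?D y z) \<le> \<epsilon> / B" unfolding dist_norm[symmetric] by (rule X(3))
          then show "norm (h *\<^sub>R (?D y (z(i := u)) - ?D y z)) \<le> \<epsilon> / B * norm h" for h
            unfolding norm_scaleR real_norm_def mult.commute[of "\<epsilon> / B"] by (rule mult_left_mono) simp
        qed (use \<open>\<epsilon> / B > 0\<close> in simp)
      qed (use s \<delta>(1) in \<open>auto simp: dist_commute\<close>)
      moreover have "?q s - ?q (z i) = H y (z(i := s)) - H y z - (s - z i) *\<^sub>R ?D y z"
        unfolding fun_upd_triv by (simp add: algebra_simps)
      ultimately show ?thesis by (simp only: real_norm_def)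
    qed
    show "\<exists>d>0. \<forall>s. norm (s - z i) < d \<longrightarrow>
      norm ((\<integral>y. t y * H y (z(i := s)) \<partial>\<mu>) - (\<integral>y. t y * H y (z(i := z i)) \<partial>\<mu>) - (s - z i) *\<^sub>R (\<integral>y. t y * ?D y z \<partial>\<mu>))
        \<le> \<epsilon> * norm (s - z i)"
    proof (intro exI conjI allI impI)
      fix s assume s: "norm (s - z i) < \<delta>"
      then have s': "dist s (z i) < \<delta>" by (simp add: dist_norm)
      have sV: "z(i := s) \<in> V" using \<delta>(2)[OF s'] by simp
      have "(\<integral>y. t y * H y (z(i := s)) \<partial>\<mu>) - (\<integral>y. t y * H y z \<partial>\<mu>) - (s - z i) *\<^sub>R (\<integral>y. t y * ?D y z \<partial>\<mu>)
          = (\<integral>y. t y * H y (z(i := s)) - t y * H y z - (s - z i) *\<^sub>R (t y * ?D y z) \<partial>\<mu>)"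
        by (simp only: Bochner_Integration.integral_diff Bochner_Integration.integrable_diff integrable_scaleR_right
            integral_scaleR_right int[OF sV] int[OF z])
      also have "\<dots> = (\<integral>y. t y * (H y (z(i := s)) - H y z - (s - z i) *\<^sub>R ?D y z) \<partial>\<mu>)"
        by (simp only: right_diff_distrib mult_scaleR_right)
      also have "norm \<dots> \<le> B * (\<epsilon> / B * \<bar>s - z i\<bar>)"
        unfolding atomize_not
        by (rule integral_norm_le, subst norm_mult, rule mult_mono[OF B(2) pt[OF s']]) (use B(1) in auto)
      finally show "norm ((\<integral>y. t y * H y (z(i := s)) \<partial>\<mu>) - (\<integral>y. t y * H y (z(i := z i)) \<partial>\<mu>) - (s - z i) *\<^sub>R (\<integral>y. t y * ?D y z \<partial>\<mu>))
        \<le> \<epsilon> * norm (s - z i)" unfolding fun_upd_triv using B(1) by simp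
    qed (rule \<delta>(1))
  qed
qed

end

section \<open>Smoothness of convolutions and Frechet convergence\<close>

context haar_lie_group begin

interpretation prob_space \<mu> by (rule prob)

lemma translate_partials_inverse:
  assumes "f \<in> smooth_funs n \<A>" "(U,\<phi>) \<in> \<A>" "set is \<subseteq> {..<n}"
  shows "continuous_on (UNIV \<times> \<phi> ` U) (\<lambda>(y,z). partial_derivs is (\<lambda>z. f (mul (iv y) (inv_into U \<phi> z))) z)"
proof -
  have "continuous_on (UNIV \<times> \<phi> ` U) (\<lambda>p::'g \<times> (nat \<Rightarrow> real). (iv (fst p), snd p))"
    by (intro continuous_intros)
  from continuous_on_compose2[OF translate_partials(1)[OF assms] this]
  show ?thesis by (simp add: case_prod_unfold image_subset_iff mem_Times_iff)
qed

text \<open>The variable enters only through the second factor, translated by \<open>iv y\<close>,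
  so all derivatives fall on the smooth \<open>f\<close> and the first factor may be merely
  continuous.\<close>

lemma conv_smooth:
  assumes t: "continuous_on UNIV t" and f: "f \<in> smooth_funs n \<A>"
  shows "conv t f \<in> smooth_funs n \<A>"
    and "(U,\<phi>) \<in> \<A> \<Longrightarrow> set is \<subseteq> {..<n} \<Longrightarrow> z \<in> \<phi> ` U \<Longrightarrow>
      partial_derivs is (\<lambda>z. conv t f (inv_into U \<phi> z)) z =
      (\<integral>y. t y * partial_derivs is (\<lambda>z. f (mul (iv y) (inv_into U \<phi> z))) z \<partial>\<mu>)"
proof -
  have *: "partial_derivs is (\<lambda>z. conv t f (inv_into U \<phi> z)) z =
      (\<integral>y. t y * partial_derivs is (\<lambda>z. f (mul (iv y) (inv_into U \<phi> z))) z \<partial>\<mu>)" (is "_ = ?H is z")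
    and **: "i < n \<Longrightarrow> (\<lambda>s. partial_derivs is (\<lambda>z. conv t f (inv_into U \<phi> z)) (z(i := s))) differentiable at (z i)"
    if U: "(U,\<phi>) \<in> \<A>" and "is": "set is \<subseteq> {..<n}" and z: "z \<in> \<phi> ` U" for U \<phi> "is" z i
  proof -
    let ?H = "\<lambda>is z. (\<integral>y. t y * partial_derivs is (\<lambda>z. f (mul (iv y) (inv_into U \<phi> z))) z \<partial>\<mu>)"
    have d: "((\<lambda>s. ?H is (z(i := s))) has_vector_derivative ?H (i # is) z) (at (z i))"
      if "set is \<subseteq> {..<n}" "z \<in> \<phi> ` U" "i < n" for "is" z i
    proof -
      have ii: "set (i # is) \<subseteq> {..<n}" using that by simp
      show ?thesis
        unfolding partial_derivs_Cons
        by (rule has_vector_derivative_integral_param[OF chart(2)[OF U] that(2,3) t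
              translate_partials_inverse[OF f U that(1)]
              translate_partials_inverse[OF f U ii, unfolded partial_derivs_Cons]
              translate_partials(2)[OF f U that(1,3)]])
    qed
    have eq: "partial_derivs is (\<lambda>z. conv t f (inv_into U \<phi> z)) z = ?H is z"
      if "set is \<subseteq> {..<n}" "z \<in> \<phi> ` U" for "is" z
      using that
    proof (induction "is" arbitrary: z)
      case Nil
      then show ?case by (simp add: conv_def)
    next
      case (Cons i "is")
      have "partial_deriv i (partial_derivs is (\<lambda>z. conv t f (inv_into U \<phi> z))) z = partial_deriv i (?H is) z"
        by (rule partial_deriv_cong[OF chart(2)[OF U]]) (use Cons in auto)
      also have "\<dots> = ?H (i # is) z"
        using Cons.prems by (intro partial_deriv_eqI d) auto
      finally show ?case by simp
    qed
    show "partial_derivs is (\<lambda>z. conv t f (inv_into U \<phi> z)) z = ?H is z" by (rule eq[OF "is" z])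
    show "(\<lambda>s. partial_derivs is (\<lambda>z. conv t f (inv_into U \<phi> z)) (z(i := s))) differentiable at (z i)" if i: "i < n"
    proof -
      have "((\<lambda>s. partial_derivs is (\<lambda>z. conv t f (inv_into U \<phi> z)) (z(i := s))) has_vector_derivative ?H (i # is) z) (at (z i))"
        by (rule has_vector_derivative_upd_cong[OF chart(2)[OF U] z i eq[OF "is"], THEN iffD2]) (assumption, rule d[OF "is" z i])
      then show ?thesis by (rule has_vector_derivative_differentiable)
    qed
  qed
  show "(U,\<phi>) \<in> \<A> \<Longrightarrow> set is \<subseteq> {..<n} \<Longrightarrow> z \<in> \<phi> ` U \<Longrightarrow>
      partial_derivs is (\<lambda>z. conv t f (inv_into U \<phi> z)) z =
      (\<integral>y. t y * partial_derivs is (\<lambda>z. f (mul (iv y) (inv_into U \<phi> z))) z \<partial>\<mu>)" by (rule *)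
  show "conv t f \<in> smooth_funs n \<A>"
  proof (rule smooth_funsI)
    fix U \<phi> assume U: "(U,\<phi>) \<in> \<A>"
    show "smooth_on n (\<phi> ` U) (\<lambda>z. conv t f (inv_into U \<phi> z))"
      unfolding smooth_on_def
    proof (intro allI impI conjI ballI)
      fix "is" assume "is": "set is \<subseteq> {..<n}"
      have "continuous_on (UNIV \<times> \<phi> ` U) (\<lambda>p::'g \<times> (nat \<Rightarrow> real). t (fst p))"
        by (intro cont_comp[OF t] continuous_intros)
      then have "continuous_on (UNIV \<times> \<phi> ` U) (\<lambda>(y,z). t y * partial_derivs is (\<lambda>z. f (mul (iv y) (inv_into U \<phi> z))) z)"
        using translate_partials_inverse[OF f U "is"] unfolding case_prod_unfold by (rule continuous_on_mult)
      from cont_param_integral[OF this]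
      show "continuous_on (\<phi> ` U) (partial_derivs is (\<lambda>z. conv t f (inv_into U \<phi> z)))"
        by (rule continuous_on_eq) (simp only: *[OF U "is"])
    qed (rule **[OF U])
  qed
qed

text \<open>Convergence in the Frechet topology along an arbitrary filter: it is used for sequences
  and for the net of finite subsets of \<open>D\<close>.\<close>

definition smoothly_tends :: "('i \<Rightarrow> 'g \<Rightarrow> complex) \<Rightarrow> ('g \<Rightarrow> complex) \<Rightarrow> 'i filter \<Rightarrow> bool"
  where "smoothly_tends h h0 Fl \<longleftrightarrow> (\<forall>U \<phi> is K \<epsilon>. (U,\<phi>) \<in> \<A> \<longrightarrow> set is \<subseteq> {..<n} \<longrightarrow> compact K \<longrightarrow> K \<subseteq> \<phi> ` U \<longrightarrow> \<epsilon> > 0 \<longrightarrow>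
    (\<forall>\<^sub>F i in Fl. \<forall>z\<in>K. cmod (partial_derivs is (\<lambda>z. h i (inv_into U \<phi> z)) z -
      partial_derivs is (\<lambda>z. h0 (inv_into U \<phi> z)) z) \<le> \<epsilon>))"

lemma smoothly_tendsD:
  "smoothly_tends h h0 Fl \<Longrightarrow> (U,\<phi>) \<in> \<A> \<Longrightarrow> set is \<subseteq> {..<n} \<Longrightarrow> compact K \<Longrightarrow> K \<subseteq> \<phi> ` U \<Longrightarrow> \<epsilon> > 0 \<Longrightarrow>
    \<forall>\<^sub>F i in Fl. \<forall>z\<in>K. cmod (partial_derivs is (\<lambda>z. h i (inv_into U \<phi> z)) z -
      partial_derivs is (\<lambda>z. h0 (inv_into U \<phi> z)) z) \<le> \<epsilon>"
  by (simp add: smoothly_tends_def)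

text \<open>The topology is generated by seminorm balls with arbitrary centres, so the proof follows
  the generation of the open set \<open>S\<close>; only the case of a ball has content.\<close>

lemma smooth_topology_eventually:
  assumes h: "\<And>i. h i \<in> smooth_funs n \<A>" and h0: "h0 \<in> smooth_funs n \<A>" and lim: "smoothly_tends h h0 Fl"
    and S: "openin (smooth_topology n \<A>) S"
  shows "h0 \<in> S \<Longrightarrow> \<forall>\<^sub>F i in Fl. h i \<in> S"
proof -
  let ?B = "{{g \<in> smooth_funs n \<A>. \<forall>z\<in>K.
        cmod (partial_derivs is (g \<circ> inv_into U \<phi>) z - partial_derivs is (f \<circ> inv_into U \<phi>) z) < \<epsilon>}
     | f U \<phi> K is \<epsilon>. f \<in> smooth_funs n \<A> \<and> (U,\<phi>) \<in> \<A> \<and> compact K \<and> K \<subseteq> \<phi> ` U \<and> set is \<subseteq> {..<n} \<and> \<epsilon> > 0}"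
  have "generate_topology_on ?B S"
    using S unfolding smooth_topology_def openin_topology_generated_by_iff .
  then show "h0 \<in> S \<Longrightarrow> \<forall>\<^sub>F i in Fl. h i \<in> S"
  proof (induction rule: generate_topology_on.induct)
    case Empty
    then show ?case by simp
  next
    case (Int a b)
    have "\<forall>\<^sub>F i in Fl. h i \<in> a" "\<forall>\<^sub>F i in Fl. h i \<in> b" using Int by simp_all
    then show ?case by eventually_elim simp
  next
    case (UN K)
    then obtain k where k: "k \<in> K" "h0 \<in> k" by blast
    have "\<forall>\<^sub>F i in Fl. h i \<in> k" by (rule UN.IH[OF k])
    then show ?case by eventually_elim (use k in blast)
  next
    case (Basis s)
    obtain f U \<phi> K "is" \<epsilon> where s: "s = {g \<in> smooth_funs n \<A>. \<forall>z\<in>K.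
        cmod (partial_derivs is (g \<circ> inv_into U \<phi>) z - partial_derivs is (f \<circ> inv_into U \<phi>) z) < \<epsilon>}"
      and f: "f \<in> smooth_funs n \<A>" and U: "(U,\<phi>) \<in> \<A>" and K: "compact K" "K \<subseteq> \<phi> ` U" and "is": "set is \<subseteq> {..<n}" and \<epsilon>: "\<epsilon> > 0"
      using Basis(1) unfolding mem_Collect_eq by (elim exE conjE)
    let ?p = "\<lambda>g. partial_derivs is (\<lambda>z. g (inv_into U \<phi> z))"
    have s': "s = {g \<in> smooth_funs n \<A>. \<forall>z\<in>K. cmod (?p g z - ?p f z) < \<epsilon>}" unfolding s o_def ..
    have h0s: "\<forall>z\<in>K. cmod (?p h0 z - ?p f z) < \<epsilon>" using Basis(2) unfolding s' by simp
    \<comment> \<open>On a compact set the maximum is attained, so the strict inequality for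
      \<open>h0\<close> leaves a margin \<delta>. The ball need not be centred at \<open>h0\<close>,
      hence the triangle inequality below.\<close>
    obtain \<delta> where \<delta>: "\<delta> > 0" "\<forall>z\<in>K. cmod (?p h0 z - ?p f z) \<le> \<epsilon> - \<delta>"
    proof (cases "K = {}")
      case True
      then show ?thesis using that[of 1] by simp
    next
      case False
      have c: "continuous_on (\<phi> ` U) (?p g)" if "g \<in> smooth_funs n \<A>" for g
        using smooth_funsD[OF that U] "is" by (simp add: smooth_on_def)
      have "continuous_on K (\<lambda>z. cmod (?p h0 z - ?p f z))"
        by (intro continuous_intros continuous_on_subset[OF c K(2)] h0 f)
      from continuous_attains_sup[OF K(1) False this] obtain z1 where
        z1: "z1 \<in> K" "\<forall>z\<in>K. cmod (?p h0 z - ?p f z) \<le> cmod (?p h0 z1 - ?p f z1)" by blast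
      show ?thesis
        using h0s z1 by (intro that[of "\<epsilon> - cmod (?p h0 z1 - ?p f z1)"]) auto
    qed
    have "\<delta> / 2 > 0" using \<delta>(1) by simp
    from smoothly_tendsD[OF lim U "is" K this] show ?case
    proof eventually_elim
      case (elim i)
      have "cmod (?p (h i) z - ?p f z) < \<epsilon>" if "z \<in> K" for z
      proof -
        have "cmod (?p (h i) z - ?p f z) \<le> cmod (?p (h i) z - ?p h0 z) + cmod (?p h0 z - ?p f z)"
          using norm_triangle_ineq[of "?p (h i) z - ?p h0 z" "?p h0 z - ?p f z"] by simp
        also have "\<dots> \<le> \<delta> / 2 + (\<epsilon> - \<delta>)" using elim \<delta>(2) that by (intro add_mono) auto
        also have "\<dots> < \<epsilon>" using \<delta>(1) by simp
        finally show ?thesis .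
      qed
      then show ?case unfolding s' using h by simp
    qed
  qed
qed

text \<open>With the empty compact set the whole space is one of the generating sets.\<close>

lemma topspace_smooth: "topspace (smooth_topology n \<A>) = smooth_funs n \<A>"
proof -
  obtain U \<phi> where U: "(U,\<phi>) \<in> \<A>" "e \<in> U" by (rule chart_at)
  let ?B = "{{g \<in> smooth_funs n \<A>. \<forall>z\<in>K.
        cmod (partial_derivs is (g \<circ> inv_into U \<phi>) z - partial_derivs is (f \<circ> inv_into U \<phi>) z) < \<epsilon>}
     | f U \<phi> K is \<epsilon>. f \<in> smooth_funs n \<A> \<and> (U,\<phi>) \<in> \<A> \<and> compact K \<and> K \<subseteq> \<phi> ` U \<and> set is \<subseteq> {..<n} \<and> \<epsilon> > 0}"
  have "smooth_funs n \<A> \<in> ?B"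
    unfolding mem_Collect_eq using smooth_const[of 0] U(1)
    by (intro exI[of _ "\<lambda>x. 0"] exI[of _ U] exI[of _ \<phi>] exI[of _ "{}"] exI[of _ "[]"] exI[of _ 1]) simp
  moreover have "\<forall>s\<in>?B. s \<subseteq> smooth_funs n \<A>" by auto
  ultimately have "\<Union>?B = smooth_funs n \<A>" by (intro equalityI Union_least Union_upper) simp_all
  then show ?thesis unfolding smooth_topology_def topology_generated_by_topspace .
qed

lemma continuous_linear_operator_tendsto:
  assumes A: "continuous_linear_operator n \<A> A" and \<psi>: "\<psi> \<in> smooth_funs n \<A>"
    and h: "\<And>i. h i \<in> smooth_funs n \<A>" and h0: "h0 \<in> smooth_funs n \<A>" and lim: "smoothly_tends h h0 Fl"
  shows "((\<lambda>i. A (h i) \<psi>) \<longlongrightarrow> A h0 \<psi>) Fl"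
proof (rule topological_tendstoI)
  fix V :: "complex set" assume V: "open V" "A h0 \<psi> \<in> V"
  have Ac: "continuous_map (smooth_topology n \<A>) (distribution_topology n \<A>) A"
    and Ad: "\<And>f. f \<in> smooth_funs n \<A> \<Longrightarrow> A f \<in> distributions n \<A>"
    using A by (simp_all add: continuous_linear_operator_def)
  let ?W = "{u \<in> distributions n \<A>. u \<psi> \<in> V}"
  have "openin (distribution_topology n \<A>) ?W"
    unfolding distribution_topology_def
    by (rule topology_generated_by_Basis) (use \<psi> V(1) in blast)
  from openin_continuous_map_preimage[OF Ac this]
  have "openin (smooth_topology n \<A>) {x \<in> smooth_funs n \<A>. A x \<in> ?W}" by (simp add: topspace_smooth)
  from smooth_topology_eventually[OF h h0 lim this]
  have "\<forall>\<^sub>F i in Fl. h i \<in> {x \<in> smooth_funs n \<A>. A x \<in> ?W}" using h0 V(2) Ad[OF h0] by simp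
  then show "\<forall>\<^sub>F i in Fl. A (h i) \<psi> \<in> V" by eventually_elim simp
qed

text \<open>Since all derivatives fall on \<open>f\<close>, the difference of derivatives is an
  integral of t - k against a derivative of a translate of \<open>f\<close>, and the latter is
  bounded by \<open>M\<close> on the compact product of the group with \<open>K\<close>.\<close>

lemma conv_smoothly_tends:
  assumes t: "\<And>i. continuous_on UNIV (t i)" and k: "continuous_on UNIV k" and lim: "uniform_limit UNIV t k Fl"
    and f: "f \<in> smooth_funs n \<A>"
  shows "smoothly_tends (\<lambda>i. conv (t i) f) (conv k f) Fl"
  unfolding smoothly_tends_def
proof (intro allI impI)
  fix U \<phi> "is" K and \<epsilon> :: real
  assume U: "(U,\<phi>) \<in> \<A>" and "is": "set is \<subseteq> {..<n}" and K: "compact K" "K \<subseteq> \<phi> ` U" and \<epsilon>: "\<epsilon> > 0"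
  let ?K = "\<lambda>y. partial_derivs is (\<lambda>z. f (mul (iv y) (inv_into U \<phi> z)))"
  have "compact ((UNIV :: 'g set) \<times> K)" by (rule compact_Times[OF compact_UNIV K(1)])
  moreover have "continuous_on (UNIV \<times> K) (\<lambda>(y,z). ?K y z)"
    by (rule continuous_on_subset[OF translate_partials_inverse[OF f U "is"]]) (use K(2) in auto)
  ultimately have "bounded ((\<lambda>(y,z). ?K y z) ` (UNIV \<times> K))"
    by (intro compact_imp_bounded compact_continuous_image)
  then obtain M where M0: "M > 0" "\<forall>x\<in>(\<lambda>(y,z). ?K y z) ` (UNIV \<times> K). cmod x \<le> M"
    unfolding bounded_pos by (elim exE conjE)
  then have M: "M > 0" "\<And>y z. z \<in> K \<Longrightarrow> cmod (?K y z) \<le> M" by auto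
  have "\<epsilon> / M > 0" using \<epsilon> M(1) by simp
  from uniform_limitD[OF lim this]
  show "\<forall>\<^sub>F i in Fl. \<forall>z\<in>K. cmod (partial_derivs is (\<lambda>z. conv (t i) f (inv_into U \<phi> z)) z -
      partial_derivs is (\<lambda>z. conv k f (inv_into U \<phi> z)) z) \<le> \<epsilon>"
  proof eventually_elim
    case (elim i)
    show ?case
    proof
      fix z assume z: "z \<in> K"
      then have z': "z \<in> \<phi> ` U" using K(2) by blast
      have Kc: "continuous_on UNIV (\<lambda>y. ?K y z)"
      proof -
        have "continuous_on UNIV (\<lambda>y::'g. (y,z))" by (intro continuous_intros)
        from continuous_on_compose2[OF translate_partials_inverse[OF f U "is"] this] z'
        show ?thesis by (simp add: image_subset_iff)
      qed
      have "partial_derivs is (\<lambda>z. conv (t i) f (inv_into U \<phi> z)) z - partial_derivs is (\<lambda>z. conv k f (inv_into U \<phi> z)) z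
          = (\<integral>y. t i y * ?K y z \<partial>\<mu>) - (\<integral>y. k y * ?K y z \<partial>\<mu>)"
        by (simp only: conv_smooth(2)[OF t f U "is" z'] conv_smooth(2)[OF k f U "is" z'])
      also have "\<dots> = (\<integral>y. t i y * ?K y z - k y * ?K y z \<partial>\<mu>)"
        by (rule Bochner_Integration.integral_diff[symmetric]) (intro cont_integrable continuous_on_mult t k Kc)+
      also have "\<dots> = (\<integral>y. (t i y - k y) * ?K y z \<partial>\<mu>)" by (simp only: left_diff_distrib)
      also have "cmod \<dots> \<le> \<epsilon> / M * M"
        by (rule integral_norm_le, subst norm_mult, rule mult_mono)
           (use elim M(1) M(2)[OF z] \<epsilon> in \<open>auto simp: dist_norm less_imp_le\<close>)
      finally show "cmod (partial_derivs is (\<lambda>z. conv (t i) f (inv_into U \<phi> z)) z -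
          partial_derivs is (\<lambda>z. conv k f (inv_into U \<phi> z)) z) \<le> \<epsilon>" using M(1) by simp
    qed
  qed
qed

end

section \<open>Lebesgue spaces and nuclear series\<close>

lemma powr_convex_nonneg:
  fixes x y s t p :: real
  assumes p: "p \<ge> 1" and xy: "x \<ge> 0" "y \<ge> 0" and st: "s \<ge> 0" "t \<ge> 0" "s + t = 1"
  shows "(s * x + t * y) powr p \<le> s * x powr p + t * y powr p"
proof -
  \<comment> \<open>Used on the boundary, where one of the two points is 0.\<close>
  have sm: "(c * z) powr p \<le> c * z powr p" if "0 \<le> c" "c \<le> 1" "z \<ge> 0" for c z :: real
  proof -
    have "c powr p \<le> c powr 1"
      using powr_mono'[of 1 p c] that p by simp
    then have "c powr p * z powr p \<le> c * z powr p" using that by (intro mult_right_mono) simp_all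
    then show ?thesis using that by (simp add: powr_mult)
  qed
  consider "x = 0" | "y = 0" | "x > 0" "y > 0" using xy by linarith
  then show ?thesis
  proof cases
    case 1 then show ?thesis using sm[of t y] xy st p by simp
  next
    case 2 then show ?thesis using sm[of s x] xy st p by simp
  next
    case 3
    have "t = 1 - s" using st by simp
    have "(\<lambda>x. x powr p) ((1 - t) *\<^sub>R x + t *\<^sub>R y) \<le> (1 - t) * x powr p + t * y powr p"
      by (rule convex_onD[OF powr_convex[OF p]]) (use st 3 in auto)
    moreover have "1 - t = s" using st by simp
    ultimately show ?thesis by simp
  qed
qed

section \<open>Lebesgue seminorms, Minkowski's inequality and series\<close>

lemma Lp_norm_nonneg [simp]: "Lp_norm M p f \<ge> 0"
  by (simp add: Lp_norm_def)

lemma Lp_norm_powr: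
  assumes "p > 0"
  shows "Lp_norm M p f powr p = (\<integral>x. norm (f x) powr p \<partial>M)"
  using assms by (simp add: Lp_norm_def powr_powr)

lemma Lp_norm_leI:
  assumes p: "p > 0" and "(\<integral>x. norm (f x) powr p \<partial>M) \<le> B powr p" "B \<ge> 0"
  shows "Lp_norm M p f \<le> B"
proof -
  have "Lp_norm M p f \<le> (B powr p) powr (1 / p)"
    unfolding Lp_norm_def by (rule powr_mono2) (use assms in auto)
  then show ?thesis using p \<open>B \<ge> 0\<close> by (simp add: powr_powr)
qed

lemma Lp_norm_norm [simp]: "Lp_norm M p (\<lambda>x. norm (f x)) = Lp_norm M p f"
  by (simp add: Lp_norm_def)

lemma Lp_norm_eq_0_AE:
  assumes p: "p > 0" and int: "integrable M (\<lambda>x. norm (f x) powr p)" and 0: "Lp_norm M p f = 0"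
  shows "AE x in M. f x = 0"
proof -
  have "(\<integral>x. norm (f x) powr p \<partial>M) = 0" using Lp_norm_powr[OF p, of M f] 0 p by simp
  then have "AE x in M. norm (f x) powr p = 0"
    using integral_nonneg_eq_0_iff_AE[OF int] by simp
  then show ?thesis by eventually_elim simp
qed

lemma Lp_norm_AE_0:
  assumes "AE x in M. f x = 0"
  shows "Lp_norm M p f = 0"
proof -
  have "(\<integral>x. norm (f x) powr p \<partial>M) = (\<integral>x. 0 \<partial>M)"
  proof (cases "(\<lambda>x. norm (f x) powr p) \<in> borel_measurable M")
    case True
    then show ?thesis by (intro integral_cong_AE) (use assms in auto)
  next
    \<comment> \<open>A non-measurable integrand is not integrable and has integral 0 by
      convention.\<close>
    case False
    then have "\<not> integrable M (\<lambda>x. norm (f x) powr p)" by auto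
    then show ?thesis by (simp add: not_integrable_integral_eq)
  qed
  then show ?thesis by (simp add: Lp_norm_def)
qed

lemma Lp_dominated:
  fixes f :: "'a \<Rightarrow> 'b::{banach,second_countable_topology}" and g :: "'a \<Rightarrow> 'c::{banach,second_countable_topology}"
  assumes p: "p > 0" and f: "f \<in> borel_measurable M" and g: "integrable M (\<lambda>x. norm (g x) powr p)"
    and le: "AE x in M. norm (f x) \<le> norm (g x)"
  shows "integrable M (\<lambda>x. norm (f x) powr p)" "Lp_norm M p f \<le> Lp_norm M p g"
proof -
  have le': "AE x in M. norm (f x) powr p \<le> norm (g x) powr p"
    using le by eventually_elim (use p in \<open>auto intro!: powr_mono2\<close>)
  show i: "integrable M (\<lambda>x. norm (f x) powr p)"
    by (rule Bochner_Integration.integrable_bound[OF g]) (use f le' in auto)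
  show "Lp_norm M p f \<le> Lp_norm M p g"
  proof (rule Lp_norm_leI[OF p])
    show "(\<integral>x. norm (f x) powr p \<partial>M) \<le> Lp_norm M p g powr p"
      unfolding Lp_norm_powr[OF p] by (rule integral_mono_AE[OF i g le'])
  qed simp
qed

text \<open>With a and b the two norms, (f + g) / (a + b) is the convex combination of f / a and g /
  b with weights a / (a + b) and b / (a + b). Convexity of the p-th power bounds the integral of its
  p-th power by 1.\<close>

lemma Minkowski:
  fixes f g :: "'a \<Rightarrow> real"
  assumes p: "p \<ge> 1" and f: "f \<in> borel_measurable M" "integrable M (\<lambda>x. norm (f x) powr p)" "\<And>x. f x \<ge> 0"
    and g: "g \<in> borel_measurable M" "integrable M (\<lambda>x. norm (g x) powr p)" "\<And>x. g x \<ge> 0"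
  shows "integrable M (\<lambda>x. norm (f x + g x) powr p)" "Lp_norm M p (\<lambda>x. f x + g x) \<le> Lp_norm M p f + Lp_norm M p g"
proof -
  have p0: "p > 0" using p by simp
  \<comment> \<open>Midpoint convexity of the p-th power gives this majorant, which already proves
    integrability.\<close>
  have "integrable M (\<lambda>x. 2 powr p * (1/2 * norm (f x) powr p + 1/2 * norm (g x) powr p))"
    using f(2) g(2) by (intro integrable_mult_right Bochner_Integration.integrable_add)
  then show i: "integrable M (\<lambda>x. norm (f x + g x) powr p)"
  proof (rule Bochner_Integration.integrable_bound)
    show "AE x in M. norm (norm (f x + g x) powr p) \<le> norm (2 powr p * (1/2 * norm (f x) powr p + 1/2 * norm (g x) powr p))"
    proof (rule AE_I2)
      fix x
      have "(f x + g x) powr p = 2 powr p * (1/2 * f x + 1/2 * g x) powr p"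
        using f(3)[of x] g(3)[of x] by (simp add: powr_mult[symmetric] del: powr_mult)
      also have "\<dots> \<le> 2 powr p * (1/2 * f x powr p + 1/2 * g x powr p)"
        by (intro mult_left_mono powr_convex_nonneg p f g) auto
      finally show "norm (norm (f x + g x) powr p) \<le> norm (2 powr p * (1/2 * norm (f x) powr p + 1/2 * norm (g x) powr p))"
        using f(3)[of x] g(3)[of x] by simp
    qed
  qed (use f g in measurable)
  define a where "a = Lp_norm M p f"
  define b where "b = Lp_norm M p g"
  show "Lp_norm M p (\<lambda>x. f x + g x) \<le> Lp_norm M p f + Lp_norm M p g"
  proof (cases "a = 0 \<or> b = 0")
    case True
    then show ?thesis
    proof
      assume "a = 0"
      then have "AE x in M. f x = 0" using Lp_norm_eq_0_AE[OF p0 f(2)] by (simp add: a_def)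
      then have "AE x in M. norm (f x + g x) \<le> norm (g x)" by eventually_elim simp
      from Lp_dominated(2)[OF p0 _ g(2) this] f(1) g(1) \<open>a = 0\<close> show ?thesis by (simp add: a_def)
    next
      assume "b = 0"
      then have "AE x in M. g x = 0" using Lp_norm_eq_0_AE[OF p0 g(2)] by (simp add: b_def)
      then have "AE x in M. norm (f x + g x) \<le> norm (f x)" by eventually_elim simp
      from Lp_dominated(2)[OF p0 _ f(2) this] f(1) g(1) \<open>b = 0\<close> show ?thesis by (simp add: b_def)
    qed
  next
    case False
    then have a: "a > 0" and b: "b > 0" by (auto simp: a_def b_def less_le)
    let ?s = "a / (a + b)" and ?t = "b / (a + b)"
    have st: "?s \<ge> 0" "?t \<ge> 0" "?s + ?t = 1" using a b by (auto simp: add_divide_distrib[symmetric])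
    have pt: "norm (f x + g x) powr p \<le> (a + b) powr p * (?s * (norm (f x) powr p / a powr p) + ?t * (norm (g x) powr p / b powr p))" for x
    proof -
      have "?s * (f x / a) + ?t * (g x / b) = (f x + g x) / (a + b)"
        using a b by (simp add: add_divide_distrib)
      then have "f x + g x = (a + b) * (?s * (f x / a) + ?t * (g x / b))"
        using a b by simp
      then have "norm (f x + g x) powr p = (a + b) powr p * (?s * (f x / a) + ?t * (g x / b)) powr p"
        using a b f(3)[of x] g(3)[of x] by (simp only: real_norm_def) (simp add: abs_of_nonneg powr_mult)
      also have "\<dots> \<le> (a + b) powr p * (?s * (f x / a) powr p + ?t * (g x / b) powr p)"
        using a b f(3)[of x] g(3)[of x] by (intro mult_left_mono powr_convex_nonneg p st) auto
      finally show ?thesis using a b f(3)[of x] g(3)[of x] by (simp add: powr_divide)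
    qed
    have "(\<integral>x. norm (f x + g x) powr p \<partial>M) \<le>
        (\<integral>x. (a + b) powr p * (?s * (norm (f x) powr p / a powr p) + ?t * (norm (g x) powr p / b powr p)) \<partial>M)"
      using f(2) g(2) by (intro integral_mono i pt integrable_mult_right Bochner_Integration.integrable_add integrable_divide)
    also have "\<dots> = (a + b) powr p * (?s * ((\<integral>x. norm (f x) powr p \<partial>M) / a powr p) + ?t * ((\<integral>x. norm (g x) powr p \<partial>M) / b powr p))"
      using f(2) g(2) by simp
    also have "(\<integral>x. norm (f x) powr p \<partial>M) = a powr p" by (simp only: a_def Lp_norm_powr[OF p0])
    also have "(\<integral>x. norm (g x) powr p \<partial>M) = b powr p" by (simp only: b_def Lp_norm_powr[OF p0])
    also have "(a + b) powr p * (?s * (a powr p / a powr p) + ?t * (b powr p / b powr p)) = (a + b) powr p"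
      using a b st(3) by simp
    finally show ?thesis unfolding a_def[symmetric] b_def[symmetric] using a b by (intro Lp_norm_leI[OF p0]) auto
  qed
qed

text \<open>Minkowski's inequality bounds the norms of all partial sums by \<tau>. Monotone
  convergence then bounds the integral of the supremum of their p-th powers, so the supremum is
  finite almost everywhere and the series converges there.\<close>

lemma Lp_series_nonneg:
  fixes g :: "nat \<Rightarrow> 'a \<Rightarrow> real"
  assumes p: "p \<ge> 1" and g: "\<And>k. g k \<in> borel_measurable M" "\<And>k. integrable M (\<lambda>x. norm (g k x) powr p)" "\<And>k x. g k x \<ge> 0"
    and s: "summable (\<lambda>k. Lp_norm M p (g k))"
  shows "AE x in M. summable (\<lambda>k. g k x)" "integrable M (\<lambda>x. norm (\<Sum>k. g k x) powr p)"
    "Lp_norm M p (\<lambda>x. \<Sum>k. g k x) \<le> (\<Sum>k. Lp_norm M p (g k))"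
proof -
  have p0: "p > 0" using p by simp
  let ?S = "\<lambda>m x. \<Sum>k<m. g k x"
  define \<tau> where "\<tau> = (\<Sum>k. Lp_norm M p (g k))"
  have \<tau>: "\<tau> \<ge> 0" unfolding \<tau>_def by (intro suminf_nonneg s) simp
  have Sm: "?S m \<in> borel_measurable M" for m using g(1) by measurable
  have S0: "?S m x \<ge> 0" for m x by (intro sum_nonneg g)
  have fin: "integrable M (\<lambda>x. norm (?S m x) powr p) \<and> Lp_norm M p (?S m) \<le> (\<Sum>k<m. Lp_norm M p (g k))" for m
  proof (induction m)
    case 0
    then show ?case by (simp add: Lp_norm_def)
  next
    case (Suc m)
    have "integrable M (\<lambda>x. norm (?S m x) powr p)" using Suc by simp
    note mk = Minkowski[OF p Sm this S0 g]
    have "Lp_norm M p (\<lambda>x. ?S m x + g m x) \<le> (\<Sum>k<m. Lp_norm M p (g k)) + Lp_norm M p (g m)"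
      using mk(2)[of m] Suc by linarith
    then show ?case using mk(1)[of m] by simp
  qed
  have bound: "(\<integral>\<^sup>+x. ennreal (?S m x powr p) \<partial>M) \<le> ennreal (\<tau> powr p)" for m
  proof -
    have "Lp_norm M p (?S m) \<le> \<tau>"
      using fin[of m] sum_le_suminf[OF s, of "{..<m}"] by (simp add: \<tau>_def)
    then have "Lp_norm M p (?S m) powr p \<le> \<tau> powr p" using p0 by (intro powr_mono2) auto
    then have le: "(\<integral>x. norm (?S m x) powr p \<partial>M) \<le> \<tau> powr p" by (simp only: Lp_norm_powr[OF p0])
    have "(\<integral>\<^sup>+x. ennreal (?S m x powr p) \<partial>M) = ennreal (\<integral>x. norm (?S m x) powr p \<partial>M)"
      using fin[of m] by (subst nn_integral_eq_integral[symmetric]) (simp_all add: abs_of_nonneg S0)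
    then show ?thesis using le by (simp add: ennreal_leI)
  qed
  define F where "F m x = ennreal (?S m x powr p)" for m x
  have incF: "incseq F"
    unfolding F_def by (intro incseq_SucI le_funI ennreal_leI powr_mono2) (use p0 S0 g(3) in auto)
  have Fm: "F m \<in> borel_measurable M" for m unfolding F_def using Sm by measurable
  have supI: "(\<integral>\<^sup>+x. (SUP m. F m x) \<partial>M) \<le> ennreal (\<tau> powr p)"
    unfolding nn_integral_monotone_convergence_SUP[OF incF Fm] unfolding F_def by (rule SUP_least) (rule bound)
  then have "(\<integral>\<^sup>+x. (SUP m. F m x) \<partial>M) \<noteq> \<infinity>" by (auto simp: top_unique)
  then have AEfin: "AE x in M. (SUP m. F m x) \<noteq> \<infinity>"
    by (intro nn_integral_noteq_infinite) (use Fm in measurable)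
  show sumAE: "AE x in M. summable (\<lambda>k. g k x)"
    using AEfin
  proof eventually_elim
    case (elim x)
    then obtain R where R: "(SUP m. F m x) = ennreal R" "R \<ge> 0" by (cases "SUP m. F m x") auto
    have "?S m x \<le> R powr (1 / p)" for m
    proof -
      have "F m x \<le> ennreal R" unfolding R(1)[symmetric] by (rule SUP_upper) simp
      then have "?S m x powr p \<le> R" using R(2) by (simp add: F_def)
      then have "(?S m x powr p) powr (1 / p) \<le> R powr (1 / p)" using p0 by (intro powr_mono2) auto
      then show ?thesis using p0 S0 by (simp add: powr_powr)
    qed
    then show ?case by (intro summableI_nonneg_bounded[of _ "R powr (1 / p)"] g(3))
  qed
  have lim: "AE x in M. (SUP m. F m x) = ennreal (norm (\<Sum>k. g k x) powr p)"
    using sumAE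
  proof eventually_elim
    case (elim x)
    have "(\<lambda>m. ?S m x) \<longlonglongrightarrow> (\<Sum>k. g k x)" using elim by (rule summable_LIMSEQ)
    then have "(\<lambda>m. norm (?S m x) powr p) \<longlonglongrightarrow> norm (\<Sum>k. g k x) powr p"
      by (intro tendsto_powr2 tendsto_norm tendsto_const) (use p0 in auto)
    then have "(\<lambda>m. F m x) \<longlonglongrightarrow> ennreal (norm (\<Sum>k. g k x) powr p)"
      unfolding F_def using S0 by (intro tendsto_ennrealI) (simp add: abs_of_nonneg)
    moreover have "(\<lambda>m. F m x) \<longlonglongrightarrow> (SUP m. F m x)"
      by (rule LIMSEQ_SUP) (use incF in \<open>auto simp: incseq_def le_fun_def\<close>)
    ultimately show ?case using LIMSEQ_unique by blast
  qed
  have meas: "(\<lambda>x. norm (\<Sum>k. g k x) powr p) \<in> borel_measurable M" using g(1) by measurable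
  have nn: "(\<integral>\<^sup>+x. ennreal (norm (\<Sum>k. g k x) powr p) \<partial>M) \<le> ennreal (\<tau> powr p)"
    using supI nn_integral_cong_AE[OF lim] by simp
  show int: "integrable M (\<lambda>x. norm (\<Sum>k. g k x) powr p)"
    by (rule integrableI_bounded[OF meas]) (use nn le_less_trans in \<open>auto simp: less_top[symmetric] top_unique\<close>)
  have "(\<integral>x. norm (\<Sum>k. g k x) powr p \<partial>M) \<le> \<tau> powr p"
    using nn nn_integral_eq_integral[OF int] by simp
  then show "Lp_norm M p (\<lambda>x. \<Sum>k. g k x) \<le> (\<Sum>k. Lp_norm M p (g k))"
    unfolding \<tau>_def[symmetric] by (rule Lp_norm_leI[OF p0 _ \<tau>])
qed

lemma Lp_norm_scale:
  fixes f :: "'a \<Rightarrow> 'b::{real_normed_div_algebra, second_countable_topology}"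
  assumes "p > 0"
  shows "Lp_norm M p (\<lambda>x. c * f x) = norm c * Lp_norm M p f"
  using assms by (simp add: Lp_norm_def norm_mult powr_mult powr_powr)

lemma Lp_spaceD: "f \<in> Lp_space M p \<Longrightarrow> f \<in> borel_measurable M" "f \<in> Lp_space M p \<Longrightarrow> integrable M (\<lambda>x. norm (f x) powr p)"
  by (simp_all add: Lp_space_def)

lemma Lp_space_scale:
  assumes "p > 0" "f \<in> Lp_space M p"
  shows "(\<lambda>x. c * f x) \<in> Lp_space M p"
  using assms by (auto simp: Lp_space_def norm_mult powr_mult)

lemma Lp_space_add:
  assumes p: "p \<ge> 1" and f: "f \<in> Lp_space M p" and g: "g \<in> Lp_space M p"
  shows "(\<lambda>x. f x + g x) \<in> Lp_space M p"
proof -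
  have "integrable M (\<lambda>x. norm (norm (f x) + norm (g x)) powr p)"
    using Lp_spaceD[OF f] Lp_spaceD[OF g] by (intro Minkowski(1)[OF p]) auto
  then have "integrable M (\<lambda>x. norm (f x + g x) powr p)"
    by (rule Lp_dominated(1)[rotated 2]) (use p Lp_spaceD[OF f] Lp_spaceD[OF g] in \<open>auto intro: norm_triangle_ineq\<close>)
  then show ?thesis using Lp_spaceD[OF f] Lp_spaceD[OF g] by (simp add: Lp_space_def)
qed

text \<open>Completeness in the form of absolutely convergent series: the series of moduli
  dominates, and its tails, which tend to 0 in norm, dominate the error of the partial sums.\<close>

lemma Lp_series:
  assumes p: "p \<ge> 1" and v: "\<And>k. v k \<in> Lp_space M p" and s: "summable (\<lambda>k. cmod (c k) * Lp_norm M p (v k))"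
  shows "AE y in M. summable (\<lambda>k. c k * v k y)" "(\<lambda>y. \<Sum>k. c k * v k y) \<in> Lp_space M p"
    "(\<lambda>m. Lp_norm M p (\<lambda>y. (\<Sum>k. c k * v k y) - (\<Sum>k<m. c k * v k y))) \<longlonglongrightarrow> 0"
proof -
  have p0: "p > 0" using p by simp
  define g where "g k y = cmod (c k * v k y)" for k y
  have g_alt: "g k = (\<lambda>y. cmod (c k * v k y))" for k by (simp add: g_def fun_eq_iff)
  have gn: "Lp_norm M p (g k) = cmod (c k) * Lp_norm M p (v k)" for k
    unfolding g_alt using Lp_norm_scale[OF p0, of M "c k" "v k"] by simp
  have g: "g k \<in> borel_measurable M" "integrable M (\<lambda>x. norm (g k x) powr p)" "g k x \<ge> 0" for k x
    using Lp_spaceD[OF Lp_space_scale[OF p0 v, of "c k" k]] by (auto simp: g_alt)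
  have sg: "summable (\<lambda>k. Lp_norm M p (g k))" unfolding gn by (rule s)
  have sg': "summable (\<lambda>k. Lp_norm M p (g (k + m)))" for m using sg by (subst summable_iff_shift)
  note ser = Lp_series_nonneg[OF p g(1) g(2) g(3) sg]
  note ser' = Lp_series_nonneg[OF p g(1) g(2) g(3) sg']
  have cm: "(\<lambda>y. c k * v k y) \<in> borel_measurable M" for k using Lp_spaceD(1)[OF v] by measurable
  show AEs: "AE y in M. summable (\<lambda>k. c k * v k y)"
    using ser(1) by eventually_elim (auto simp: g_def intro: summable_norm_cancel)
  have Tm: "(\<lambda>y. \<Sum>k. c k * v k y) \<in> borel_measurable M" using cm by measurable
  have tail: "AE y in M. norm ((\<Sum>k. c k * v k y) - (\<Sum>k<m. c k * v k y)) \<le> norm (\<Sum>k. g (k + m) y)" for m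
    using ser(1)
  proof eventually_elim
    case (elim y)
    then have ns: "summable (\<lambda>k. norm (c k * v k y))" by (simp add: g_def)
    then have "summable (\<lambda>k. c k * v k y)" by (rule summable_norm_cancel)
    then have "(\<Sum>k. c k * v k y) - (\<Sum>k<m. c k * v k y) = (\<Sum>k. c (k + m) * v (k + m) y)"
      by (rule suminf_minus_initial_segment[symmetric])
    also have "norm \<dots> \<le> (\<Sum>k. norm (c (k + m) * v (k + m) y))"
      by (rule summable_norm) (use ns in \<open>subst summable_iff_shift[where f="\<lambda>k. norm (c k * v k y)"], simp\<close>)
    finally show ?case unfolding g_def real_norm_def by (rule order_trans[OF _ abs_ge_self])
  qed
  have Dm: "(\<lambda>y. (\<Sum>k. c k * v k y) - (\<Sum>k<m. c k * v k y)) \<in> borel_measurable M" for m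
    using Tm cm by measurable
  have "AE y in M. norm (\<Sum>k. c k * v k y) \<le> norm (\<Sum>k. g k y)" using tail[of 0] by simp
  from Lp_dominated(1)[OF p0 Tm ser(2) this] Tm
  show "(\<lambda>y. \<Sum>k. c k * v k y) \<in> Lp_space M p" by (simp add: Lp_space_def)
  show "(\<lambda>m. Lp_norm M p (\<lambda>y. (\<Sum>k. c k * v k y) - (\<Sum>k<m. c k * v k y))) \<longlonglongrightarrow> 0"
  proof (rule tendsto_sandwich[of "\<lambda>_. 0"])
    show "(\<lambda>m. \<Sum>k. Lp_norm M p (g (k + m))) \<longlonglongrightarrow> 0" by (rule suminf_exist_split2[OF sg])
    show "\<forall>\<^sub>F m in sequentially. Lp_norm M p (\<lambda>y. (\<Sum>k. c k * v k y) - (\<Sum>k<m. c k * v k y)) \<le> (\<Sum>k. Lp_norm M p (g (k + m)))"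
    proof (rule always_eventually, rule allI)
      fix m
      show "Lp_norm M p (\<lambda>y. (\<Sum>k. c k * v k y) - (\<Sum>k<m. c k * v k y)) \<le> (\<Sum>k. Lp_norm M p (g (k + m)))"
        by (rule order_trans[OF Lp_dominated(2)[OF p0 Dm ser'(2) tail] ser'(3)])
    qed
  qed auto
qed

section \<open>Nuclear series and Hoelder bounds\<close>

lemma zero_in_Lp: "(\<lambda>x. 0) \<in> Lp_space M p"
  by (simp add: Lp_space_def)

text \<open>The terms eventually lie below 1, and there x \<le> x^r because r \<le> 1.\<close>

lemma summable_of_summable_powr:
  fixes x :: "nat \<Rightarrow> real"
  assumes r: "0 < r" "r \<le> 1" and x: "\<And>k. x k \<ge> 0" and s: "summable (\<lambda>k. x k powr r)"
  shows "summable x"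
proof (rule summable_comparison_test_ev[OF _ s])
  have "\<forall>\<^sub>F k in sequentially. x k powr r < 1"
    using summable_LIMSEQ_zero[OF s] by (rule order_tendstoD) simp
  then show "\<forall>\<^sub>F k in sequentially. norm (x k) \<le> x k powr r"
  proof eventually_elim
    case (elim k)
    have "x k \<le> 1"
    proof (rule ccontr)
      assume "\<not> x k \<le> 1"
      then have "x k powr r \<ge> 1" using r by (intro ge_one_powr_ge_zero) auto
      then show False using elim by simp
    qed
    then have "x k powr 1 \<le> x k powr r" using powr_mono'[of r 1 "x k"] r x[of k] by simp
    then show ?case using x[of k] by simp
  qed
qed

text \<open>\<open>\<alpha> k\<close> is any explicit bound for the functional \<open>u k\<close>;
  the dual norm enters only at the end, by comparison. Summability of r-th powers implies that of
  the terms, so the series converges absolutely in norm. Convergence at points holds only almost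
  everywhere, which is why linearity is proved up to null functions.\<close>

lemma r_nuclear_series:
  assumes r: "0 < r" "r \<le> 1" and p1: "p1 \<ge> 1" and p2: "p2 \<ge> 1"
    and u: "\<And>k. u k \<in> dual_space (Lp_space M p1) (Lp_norm M p1)"
    and v: "\<And>k. v k \<in> Lp_space M' p2"
    and \<alpha>: "\<And>k f. f \<in> Lp_space M p1 \<Longrightarrow> cmod (u k f) \<le> \<alpha> k * Lp_norm M p1 f" "\<And>k. \<alpha> k \<ge> 0"
    and s: "summable (\<lambda>k. (\<alpha> k * Lp_norm M' p2 (v k)) powr r)"
  defines "T \<equiv> (\<lambda>f y. \<Sum>k. u k f * v k y)"
  shows "r_nuclear r (Lp_space M p1) (Lp_norm M p1) (Lp_space M' p2) (Lp_norm M' p2) T"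
    and "f \<in> Lp_space M p1 \<Longrightarrow> T f \<in> Lp_space M' p2"
    and "f \<in> Lp_space M p1 \<Longrightarrow> (\<lambda>m. Lp_norm M' p2 (\<lambda>y. T f y - (\<Sum>k<m. u k f * v k y))) \<longlonglongrightarrow> 0"
    and "summable (\<lambda>k. \<alpha> k * Lp_norm M' p2 (v k))"
proof -
  let ?E = "Lp_space M p1" and ?N = "Lp_norm M p1" and ?F = "Lp_space M' p2" and ?N' = "Lp_norm M' p2"
  have p10: "p1 > 0" using p1 by simp
  show s1: "summable (\<lambda>k. \<alpha> k * ?N' (v k))"
    by (rule summable_of_summable_powr[OF r _ s]) (simp add: \<alpha>)
  have sf: "summable (\<lambda>k. cmod (u k f) * ?N' (v k))" if "f \<in> ?E" for f
  proof (rule summable_comparison_test'[where N=0])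
    show "summable (\<lambda>k. ?N f * (\<alpha> k * ?N' (v k)))" by (rule summable_mult[OF s1])
    show "norm (cmod (u k f) * ?N' (v k)) \<le> ?N f * (\<alpha> k * ?N' (v k))" for k
      using mult_right_mono[OF \<alpha>(1)[OF that, of k], of "?N' (v k)"] by (simp add: mult_ac)
  qed
  note ser = Lp_series[OF p2 v sf]
  show TF: "T f \<in> ?F" if "f \<in> ?E" for f unfolding T_def by (rule ser(2)[OF that])
  show lim: "(\<lambda>m. ?N' (\<lambda>y. T f y - (\<Sum>k<m. u k f * v k y))) \<longlonglongrightarrow> 0" if "f \<in> ?E" for f
    unfolding T_def by (rule ser(3)[OF that])
  have lin: "u k (\<lambda>x. a * f x + b * g x) = a * u k f + b * u k g" if "f \<in> ?E" "g \<in> ?E" for k f g a b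
    using u[of k] that by (simp add: dual_space_def)
  have comb: "(\<lambda>x. a * f x + b * g x) \<in> ?E" if "f \<in> ?E" "g \<in> ?E" for f g a b
    by (intro Lp_space_add p1 Lp_space_scale p10 that)
  have L: "linear_operator ?E ?N ?F ?N' T"
    unfolding linear_operator_def
  proof (intro conjI ballI allI impI)
    fix f g assume fg: "f \<in> ?E" "g \<in> ?E"
    show "?N' (\<lambda>x. T f x - T g x) = 0" if "?N (\<lambda>x. f x - g x) = 0"
    proof -
      have "u k f = u k g" for k
      proof -
        have "cmod (u k (\<lambda>x. 1 * f x + (-1) * g x)) \<le> \<alpha> k * ?N (\<lambda>x. 1 * f x + (-1) * g x)"
          by (rule \<alpha>(1)[OF comb[OF fg]])
        then have "cmod (u k f - u k g) \<le> 0" unfolding lin[OF fg] using that by simp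
        then show ?thesis by simp
      qed
      then have "T f = T g" by (simp add: T_def)
      then show ?thesis by (intro Lp_norm_AE_0) simp
    qed
    fix a b
    have "AE y in M'. T (\<lambda>x. a * f x + b * g x) y - (a * T f y + b * T g y) = 0"
      using ser(1)[OF fg(1)] ser(1)[OF fg(2)]
    proof eventually_elim
      case (elim y)
      have "(\<lambda>k. a * (u k f * v k y) + b * (u k g * v k y)) sums (a * T f y + b * T g y)"
        unfolding T_def by (intro sums_add sums_mult summable_sums elim)
      moreover have "T (\<lambda>x. a * f x + b * g x) y = (\<Sum>k. a * (u k f * v k y) + b * (u k g * v k y))"
        unfolding T_def lin[OF fg] by (simp add: algebra_simps)
      ultimately show ?case by (simp add: sums_iff)
    qed
    then show "?N' (\<lambda>y. T (\<lambda>x. a * f x + b * g x) y - (a * T f y + b * T g y)) = 0" by (rule Lp_norm_AE_0)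
  qed (rule TF)
  have dn: "0 \<le> dual_norm ?E ?N (u k)" "dual_norm ?E ?N (u k) \<le> \<alpha> k" for k
  proof -
    have le: "cmod (u k f) \<le> \<alpha> k" if "f \<in> {f \<in> ?E. ?N f \<le> 1}" for f
    proof -
      have "cmod (u k f) \<le> \<alpha> k * ?N f" using that by (intro \<alpha>(1)) simp
      also have "\<dots> \<le> \<alpha> k * 1" using that \<alpha>(2) by (intro mult_left_mono) auto
      finally show ?thesis by simp
    qed
    \<comment> \<open>The zero function lies in the unit ball, so the supremum is over a nonempty
      set and is nonnegative.\<close>
    have 0: "(\<lambda>x. 0) \<in> {f \<in> ?E. ?N f \<le> 1}" using zero_in_Lp by (simp add: Lp_norm_def)
    show "dual_norm ?E ?N (u k) \<le> \<alpha> k" unfolding dual_norm_def using 0 le by (intro cSUP_least) blast+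
    have "cmod (u k (\<lambda>x. 0)) \<le> dual_norm ?E ?N (u k)"
      unfolding dual_norm_def by (rule cSUP_upper[OF 0]) (rule bdd_aboveI2[OF le])
    then show "0 \<le> dual_norm ?E ?N (u k)" using norm_ge_zero order_trans by blast
  qed
  have "summable (\<lambda>k. dual_norm ?E ?N (u k) powr r * ?N' (v k) powr r)"
  proof (rule summable_comparison_test'[OF s, where N=0])
    fix k :: nat
    have "dual_norm ?E ?N (u k) powr r * ?N' (v k) powr r \<le> \<alpha> k powr r * ?N' (v k) powr r"
      using dn r by (intro mult_right_mono powr_mono2) auto
    then show "norm (dual_norm ?E ?N (u k) powr r * ?N' (v k) powr r) \<le> (\<alpha> k * ?N' (v k)) powr r"
      using \<alpha>(2)[of k] by (simp add: powr_mult)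
  qed
  then show "r_nuclear r ?E ?N ?F ?N' T"
    unfolding r_nuclear_def using L u v lim by blast
qed

text \<open>The constant bounds the norm of \<open>w\<close> in the conjugate exponent q. If p \<le>
  2, then q \<ge> 2 and |w|^q \<le> |w|^2, so the norm is at most d^(-1/q) = d^(1/p - 1). If p > 2,
  then q < 2 and on a probability space the q-norm is at most the 2-norm, d^(-1/2). For p = 1 the
  bound |w| \<le> 1 gives exponent 0.\<close>

lemma (in prob_space) Hoelder_bounded:
  fixes f w :: "'a \<Rightarrow> complex" and d :: real
  assumes p: "p \<ge> 1" and f: "f \<in> Lp_space M p" and w: "w \<in> borel_measurable M" "\<And>x. cmod (w x) \<le> 1"
    and d: "d \<ge> 1" "(\<integral>x. (cmod (w x))\<^sup>2 \<partial>M) \<le> 1 / d"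
  shows "integrable M (\<lambda>x. cmod (f x) * cmod (w x))"
    "(\<integral>x. cmod (f x) * cmod (w x) \<partial>M) \<le> d powr (1 / min 2 p - 1) * Lp_norm M p f"
proof -
  have p0: "p > 0" using p by simp
  note fm = Lp_spaceD(1)[OF f] and fi = Lp_spaceD(2)[OF f]
  have le1: "t \<le> 1 + t powr p" if "t \<ge> 0" for t :: real
  proof (cases "t \<le> 1")
    case False
    then have "t powr 1 \<le> t powr p" using p by (intro powr_mono) auto
    then show ?thesis using that by simp
  qed (use powr_ge_zero[of t p] in linarith)
  show i: "integrable M (\<lambda>x. cmod (f x) * cmod (w x))"
  proof (rule Bochner_Integration.integrable_bound)
    show "integrable M (\<lambda>x. 1 + norm (f x) powr p)" using fi by simp
    show "AE x in M. norm (cmod (f x) * cmod (w x)) \<le> norm (1 + norm (f x) powr p)"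
    proof (rule AE_I2)
      fix x
      have "cmod (f x) * cmod (w x) \<le> cmod (f x) * 1" using w(2) by (intro mult_left_mono) auto
      also have "\<dots> \<le> 1 + norm (f x) powr p" using le1[of "cmod (f x)"] by simp
      finally show "norm (cmod (f x) * cmod (w x)) \<le> norm (1 + norm (f x) powr p)" by simp
    qed
  qed (use fm w in measurable)
  have w2: "integrable M (\<lambda>x. (cmod (w x))\<^sup>2)"
    by (rule integrable_const_bound[where B=1]) (use w in \<open>auto simp: power_le_one\<close>)
  define A where "A = Lp_norm M p f"
  show "(\<integral>x. cmod (f x) * cmod (w x) \<partial>M) \<le> d powr (1 / min 2 p - 1) * Lp_norm M p f"
  proof (cases "A = 0")
    case True
    then have "AE x in M. f x = 0" using Lp_norm_eq_0_AE[OF p0 fi] by (simp add: A_def)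
    then have "AE x in M. cmod (f x) * cmod (w x) = 0" by eventually_elim simp
    then have "(\<integral>x. cmod (f x) * cmod (w x) \<partial>M) = (\<integral>x. 0 \<partial>M)" using i by (intro integral_cong_AE) auto
    then show ?thesis using True by (simp add: A_def[symmetric])
  next
    case False
    then have A: "A > 0" by (simp add: A_def less_le)
    show ?thesis
    proof (cases "p = 1")
      case True
      have "(\<integral>x. cmod (f x) * cmod (w x) \<partial>M) \<le> (\<integral>x. norm (f x) powr p \<partial>M)"
        by (rule integral_mono[OF i fi]) (use w(2) True in \<open>simp add: mult_left_le\<close>)
      also have "\<dots> = A" using Lp_norm_powr[OF p0, of M f] True A by (simp add: A_def)
      finally show ?thesis using True d by (simp add: A_def)
    next
      case False
      then have p1: "p > 1" using p by simp
      define q where "q = p / (p - 1)"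
      have q: "q > 1" "1 / p + 1 / q = 1" using p1 by (auto simp: q_def field_simps)
      define W where "W = d powr (1 / min 2 p - 1)"
      have W: "W > 0" using d by (simp add: W_def)
      have s: "integrable M (\<lambda>x. (cmod (w x) / W) powr q) \<and> (\<integral>x. (cmod (w x) / W) powr q \<partial>M) \<le> 1"
      proof (cases "p \<le> 2")
        case True
        have "q \<ge> 2" using p1 True by (simp add: q_def field_simps)
        have Wq: "W powr q = 1 / d"
        proof -
          have "(1 / p - 1) * q = - 1" using q p1 by (simp add: q_def field_simps)
          then have "W powr q = d powr (- 1)" using True d by (simp add: W_def powr_powr min_def)
          then show ?thesis using d by (simp add: powr_minus_divide)
        qed
        have le: "(cmod (w x) / W) powr q \<le> d * (cmod (w x))\<^sup>2" for x
        proof -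
          have "(cmod (w x) / W) powr q = cmod (w x) powr q * d"
            using W by (simp add: powr_divide Wq)
          also have "\<dots> \<le> (cmod (w x)) powr 2 * d"
            using powr_mono'[of 2 q "cmod (w x)"] \<open>q \<ge> 2\<close> w(2)[of x] d by (intro mult_right_mono) auto
          finally show ?thesis by (simp add: mult.commute)
        qed
        have "integrable M (\<lambda>x. (cmod (w x) / W) powr q)"
          by (rule Bochner_Integration.integrable_bound[of _ "\<lambda>x. d * (cmod (w x))\<^sup>2"]) (use w2 le w d in auto)
        moreover have "(\<integral>x. (cmod (w x) / W) powr q \<partial>M) \<le> (\<integral>x. d * (cmod (w x))\<^sup>2 \<partial>M)"
          by (rule integral_mono) (use calculation w2 le in auto)
        ultimately show ?thesis using d by (simp add: field_simps)
      next
        case False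
        have q2: "q / 2 < 1" "q / 2 > 0" using p1 False by (auto simp: q_def field_simps)
        have W2: "W\<^sup>2 = 1 / d"
        proof -
          have "W\<^sup>2 = W powr 2" using W by simp
          also have "\<dots> = d powr (- 1)" using False d by (simp add: W_def powr_powr min_def)
          finally show ?thesis using d by (simp add: powr_minus_divide)
        qed
        \<comment> \<open>Weighted arithmetic-geometric mean of |w|^2 / W^2 and 1 with weights q/2
          and 1 - q/2; integrating it over a probability space replaces the comparison of the q-norm
          with the 2-norm.\<close>
        have le: "(cmod (w x) / W) powr q \<le> (q / 2) * (d * (cmod (w x))\<^sup>2) + (1 - q / 2)" for x
        proof -
          have "(cmod (w x) / W)\<^sup>2 = d * (cmod (w x))\<^sup>2" by (simp add: power_divide W2)
          moreover have "(cmod (w x) / W) powr q \<le> (q / 2) * (cmod (w x) / W)\<^sup>2 + (1 - q / 2)"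
          proof (cases "cmod (w x) = 0")
            case True
            then show ?thesis using q2 by simp
          next
            case False
            then have pos: "cmod (w x) / W > 0" using W by simp
            have "((cmod (w x) / W)\<^sup>2) powr (q / 2) * 1 powr (1 - q / 2) \<le> (q / 2) * (cmod (w x) / W)\<^sup>2 + (1 - q / 2) * 1"
              by (rule Youngs_inequality_0) (use q2 pos in auto)
            moreover have "((cmod (w x) / W)\<^sup>2) powr (q / 2) = (cmod (w x) / W) powr q"
            proof -
              have "((cmod (w x) / W)\<^sup>2) = (cmod (w x) / W) powr 2" using pos by simp
              then show ?thesis by (simp only: powr_powr) simp
            qed
            ultimately show ?thesis by simp
          qed
          ultimately show ?thesis by simp
        qed
        have ir: "integrable M (\<lambda>x. (q / 2) * (d * (cmod (w x))\<^sup>2) + (1 - q / 2))" using w2 by simp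
        have iq: "integrable M (\<lambda>x. (cmod (w x) / W) powr q)"
        proof (rule Bochner_Integration.integrable_bound[OF ir])
          show "AE x in M. norm ((cmod (w x) / W) powr q) \<le> norm ((q / 2) * (d * (cmod (w x))\<^sup>2) + (1 - q / 2))"
          proof (rule AE_I2)
            show "norm ((cmod (w x) / W) powr q) \<le> norm ((q / 2) * (d * (cmod (w x))\<^sup>2) + (1 - q / 2))" for x
              unfolding real_norm_def abs_of_nonneg[OF powr_ge_zero] by (rule order_trans[OF le abs_ge_self])
          qed
        qed (use w in measurable)
        have "(\<integral>x. (cmod (w x) / W) powr q \<partial>M) \<le> (\<integral>x. (q / 2) * (d * (cmod (w x))\<^sup>2) + (1 - q / 2) \<partial>M)"
          by (rule integral_mono[OF iq ir le])
        also have "\<dots> = (q / 2) * (d * (\<integral>x. (cmod (w x))\<^sup>2 \<partial>M)) + (1 - q / 2)"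
          using w2 by (simp add: prob_space)
        also have "\<dots> \<le> (q / 2) * 1 + (1 - q / 2)"
          using d q2 by (intro add_right_mono mult_left_mono) (auto simp: field_simps)
        finally show ?thesis using iq by simp
      qed
      \<comment> \<open>Young's inequality for the factors scaled by \<open>A\<close> and
        \<open>W\<close>, so that both p-th and q-th powers integrate to at most 1.\<close>
      have pt: "cmod (f x) * cmod (w x) \<le> A * W * ((norm (f x) powr p / A powr p) / p + ((cmod (w x) / W) powr q) / q)" for x
      proof -
        have "(cmod (f x) / A) * (cmod (w x) / W) \<le> (cmod (f x) / A) powr p / p + (cmod (w x) / W) powr q / q"
          by (rule Youngs_inequality) (use p1 q A W in auto)
        then have "A * W * ((cmod (f x) / A) * (cmod (w x) / W)) \<le> A * W * ((cmod (f x) / A) powr p / p + (cmod (w x) / W) powr q / q)"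
          using A W by (intro mult_left_mono) auto
        then show ?thesis using A W by (simp add: powr_divide)
      qed
      have ir: "integrable M (\<lambda>x. (norm (f x) powr p / A powr p) / p + ((cmod (w x) / W) powr q) / q)"
        using s fi by (intro Bochner_Integration.integrable_add integrable_divide) auto
      have "(\<integral>x. cmod (f x) * cmod (w x) \<partial>M) \<le>
          (\<integral>x. A * W * ((norm (f x) powr p / A powr p) / p + ((cmod (w x) / W) powr q) / q) \<partial>M)"
        by (rule integral_mono[OF i integrable_mult_right[OF ir] pt])
      also have "\<dots> = A * W * (((\<integral>x. norm (f x) powr p \<partial>M) / A powr p) / p + (\<integral>x. (cmod (w x) / W) powr q \<partial>M) / q)"
        using s fi by simp
      also have "(\<integral>x. norm (f x) powr p \<partial>M) = A powr p" by (simp only: A_def Lp_norm_powr[OF p0])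
      also have "A * W * ((A powr p / A powr p) / p + (\<integral>x. (cmod (w x) / W) powr q \<partial>M) / q) \<le> A * W * (1 / p + 1 / q)"
        using s A W q p0 by (intro mult_left_mono add_mono divide_right_mono) auto
      also have "\<dots> = W * A" using q by simp
      finally show ?thesis by (simp only: W_def A_def)
    qed
  qed
qed

section \<open>Operators agreeing on matrix coefficients\<close>

context haar_lie_group begin

interpretation prob_space \<mu> by (rule prob)

text \<open>After substituting x y^-1 for the integration variable, the homomorphism property
  separates \<open>x\<close> from \<open>y\<close>: convolving with \<open>f\<close> on the right
  mixes only entries of row \<open>k\<close>, with Fourier coefficients of \<open>f\<close> as
  weights.\<close>

lemma conv_rep_left:
  assumes \<xi>: "unitary_rep mul d \<xi>" and kl: "k < d" "l < d" and f: "continuous_on UNIV f"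
  shows "conv (\<lambda>x. \<xi> x $$ (k,l)) f x = (\<Sum>m<d. ip f (\<lambda>x. \<xi> x $$ (l,m)) * \<xi> x $$ (k,m))"
proof -
  note c = rep_cont[OF \<xi>]
  have "conv (\<lambda>x. \<xi> x $$ (k,l)) f x = (\<integral>y. \<xi> (mul x y) $$ (k,l) * f (mul (iv (mul x y)) x) \<partial>\<mu>)"
    unfolding conv_def
    by (rule integral_left[symmetric, of "\<lambda>y. \<xi> y $$ (k,l) * f (mul (iv y) x)"])
       (intro continuous_intros cont_comp[OF f] c kl)
  also have "\<dots> = (\<integral>y. \<xi> (mul x y) $$ (k,l) * f (iv y) \<partial>\<mu>)" by (simp add: inverse_distrib_swap assoc)
  also have "\<dots> = (\<integral>y. \<xi> (mul x (iv y)) $$ (k,l) * f (iv (iv y)) \<partial>\<mu>)"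
    by (rule integral_inv[symmetric, of "\<lambda>y. \<xi> (mul x y) $$ (k,l) * f (iv y)"])
       (intro continuous_intros cont_comp[OF f] cont_comp[OF c[OF kl]])
  also have "\<dots> = (\<integral>y. (\<Sum>m<d. (f y * cnj (\<xi> y $$ (l,m))) * \<xi> x $$ (k,m)) \<partial>\<mu>)"
  proof (rule Bochner_Integration.integral_cong[OF refl])
    fix y
    have "\<xi> (mul x (iv y)) $$ (k,l) = (\<Sum>m<d. \<xi> x $$ (k,m) * cnj (\<xi> y $$ (l,m)))"
      unfolding rep_mul_index[OF \<xi> kl] by (rule sum.cong) (auto simp: rep_iv_index[OF \<xi>] kl)
    then show "\<xi> (mul x (iv y)) $$ (k,l) * f (iv (iv y)) = (\<Sum>m<d. (f y * cnj (\<xi> y $$ (l,m))) * \<xi> x $$ (k,m))"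
      by (simp add: sum_distrib_left sum_distrib_right mult_ac)
  qed
  also have "\<dots> = (\<Sum>m<d. (\<integral>y. (f y * cnj (\<xi> y $$ (l,m))) * \<xi> x $$ (k,m) \<partial>\<mu>))"
    by (rule Bochner_Integration.integral_sum) (auto intro!: cont_integrable continuous_intros f c kl)
  finally show ?thesis by (simp add: ip_def)
qed

text \<open>The vectors \<open>w\<close> for which \<open>x \<mapsto> \<xi>(x) w\<close> is smooth form an invariant subspace; convolving \<open>\<xi>\<close> with a
  smooth \<open>f\<close> shows that the rows of the Fourier coefficient of \<open>f\<close> belong to it.\<close>

lemma coefficient_smooth:
  assumes \<xi>: "unitary_rep mul d \<xi>" "irreducible_rep d \<xi>" and f: "f \<in> smooth_funs n \<A>"
    and lm: "l < d" "m < d" "ip f (\<lambda>x. \<xi> x $$ (l,m)) \<noteq> 0" and ij: "i < d" "j < d"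
  shows "(\<lambda>x. \<xi> x $$ (i,j)) \<in> smooth_funs n \<A>"
proof -
  let ?s = "\<lambda>w k x. \<Sum>m<d. vec_index w m * \<xi> x $$ (k,m)"
  define W where "W = {w \<in> carrier_vec d. \<forall>k<d. ?s w k \<in> smooth_funs n \<A>}"
  define u where "u = vec d (\<lambda>m. ip f (\<lambda>x. \<xi> x $$ (l,m)))"
  have fc: "continuous_on UNIV f" by (rule smooth_cont[OF f])
  have "W = carrier_vec d"
  proof (rule irreducible_repD[OF \<xi>(2)])
    show "W \<subseteq> carrier_vec d" by (auto simp: W_def)
    show "0\<^sub>v d \<in> W" by (auto simp: W_def smooth_const)
    show "v + w \<in> W" if "v \<in> W" "w \<in> W" for v w
    proof -
      have vw: "v \<in> carrier_vec d" "w \<in> carrier_vec d" using that by (auto simp: W_def)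
      have "?s (v + w) k = (\<lambda>x. ?s v k x + ?s w k x)" for k
        unfolding sum.distrib[symmetric] using vw by (intro ext sum.cong) (auto simp: distrib_right)
      then show ?thesis using that by (simp add: W_def smooth_bilinear(2))
    qed
    show "c \<cdot>\<^sub>v v \<in> W" if "v \<in> W" for c v
    proof -
      have vc: "v \<in> carrier_vec d" using that by (auto simp: W_def)
      have "?s (c \<cdot>\<^sub>v v) k = (\<lambda>x. c * ?s v k x)" for k
        unfolding sum_distrib_left using vc by (intro ext sum.cong) (auto simp: mult.assoc)
      then show ?thesis using that smooth_bilinear(1)[OF smooth_const, of _ c] by (simp add: W_def)
    qed
    show "\<xi> b *\<^sub>v w \<in> W" if "w \<in> W" for b w
    proof -
      have wc: "w \<in> carrier_vec d" and ws: "\<And>k. k < d \<Longrightarrow> ?s w k \<in> smooth_funs n \<A>" using that by (auto simp: W_def)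
      have pt: "?s (\<xi> b *\<^sub>v w) k x = ?s w k (mul x b)" if k: "k < d" for k x
      proof -
        have "?s (\<xi> b *\<^sub>v w) k x = (\<Sum>m<d. (\<Sum>l<d. \<xi> b $$ (m,l) * vec_index w l) * \<xi> x $$ (k,m))"
          by (rule sum.cong) (auto simp only: mult_mat_vec_index[OF rep_carrier[OF \<xi>(1)] wc] lessThan_iff)
        also have "\<dots> = (\<Sum>m<d. \<Sum>l<d. vec_index w l * (\<xi> x $$ (k,m) * \<xi> b $$ (m,l)))"
          by (simp add: sum_distrib_right sum_distrib_left mult_ac)
        also have "\<dots> = (\<Sum>l<d. \<Sum>m<d. vec_index w l * (\<xi> x $$ (k,m) * \<xi> b $$ (m,l)))" by (rule sum.swap)
        also have "\<dots> = ?s w k (mul x b)"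
          by (rule sum.cong) (auto simp: rep_mul_index[OF \<xi>(1) k] sum_distrib_left)
        finally show ?thesis .
      qed
      have "?s (\<xi> b *\<^sub>v w) k \<in> smooth_funs n \<A>" if "k < d" for k
        unfolding pt[OF that] by (rule smooth_translate_right[OF ws[OF that]])
      moreover have "\<xi> b *\<^sub>v w \<in> carrier_vec d" by (rule mult_mat_vec_carrier[OF rep_carrier[OF \<xi>(1)] wc])
      ultimately show ?thesis unfolding W_def mem_Collect_eq by (intro conjI allI impI)
    qed
    show "u \<in> W"
    proof -
      have "?s u k = conv (\<lambda>x. \<xi> x $$ (k,l)) f" if "k < d" for k
      proof
        fix x
        show "?s u k x = conv (\<lambda>x. \<xi> x $$ (k,l)) f x"
          unfolding conv_rep_left[OF \<xi>(1) that lm(1) fc] by (rule sum.cong) (auto simp: u_def)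
      qed
      then show ?thesis using conv_smooth(1)[OF rep_cont[OF \<xi>(1) _ lm(1)] f] by (simp add: W_def u_def)
    qed
    have "vec_index u m \<noteq> 0" using lm by (simp add: u_def)
    then show "u \<noteq> 0\<^sub>v d" using lm(2) by auto
  qed
  then have "unit_vec d j \<in> W" by simp
  then have "?s (unit_vec d j) i \<in> smooth_funs n \<A>" using ij by (simp add: W_def)
  moreover have "?s (unit_vec d j) i x = \<xi> x $$ (i,j)" for x
  proof -
    have "?s (unit_vec d j) i x = (\<Sum>m<d. if m = j then \<xi> x $$ (i,m) else 0)"
      using ij by (intro sum.cong) auto
    then show ?thesis using ij by simp
  qed
  ultimately show ?thesis by simp
qed

section \<open>Approximation by convolution squares\<close>

lemma integral_approximate:
  fixes H :: "'g \<Rightarrow> complex"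
  assumes k: "continuous_on UNIV k" "(\<integral>x. k x \<partial>\<mu>) = 1" "(\<integral>x. cmod (k x) \<partial>\<mu>) = 1" and H: "continuous_on UNIV H"
    and close: "\<And>y. k y \<noteq> 0 \<Longrightarrow> cmod (H y - H e) \<le> \<epsilon>"
  shows "cmod ((\<integral>y. k y * H y \<partial>\<mu>) - H e) \<le> \<epsilon>"
proof -
  have "(\<integral>y. k y * H y \<partial>\<mu>) - H e = (\<integral>y. k y * H y \<partial>\<mu>) - (\<integral>y. k y * H e \<partial>\<mu>)" using k(2) by simp
  also have "\<dots> = (\<integral>y. k y * H y - k y * H e \<partial>\<mu>)"
    by (rule Bochner_Integration.integral_diff[symmetric]) (intro cont_integrable continuous_intros k(1) H)+
  also have "\<dots> = (\<integral>y. k y * (H y - H e) \<partial>\<mu>)" by (simp only: right_diff_distrib)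
  also have "cmod \<dots> \<le> (\<integral>y. cmod (k y * (H y - H e)) \<partial>\<mu>)" by (rule integral_norm_bound)
  also have "\<dots> \<le> (\<integral>y. cmod (k y) * \<epsilon> \<partial>\<mu>)"
  proof (rule integral_mono)
    show "integrable \<mu> (\<lambda>y. cmod (k y * (H y - H e)))" "integrable \<mu> (\<lambda>y. cmod (k y) * \<epsilon>)"
      by (intro cont_integrable continuous_intros k(1) H)+
    show "cmod (k y * (H y - H e)) \<le> cmod (k y) * \<epsilon>" for y
      using close[of y] by (cases "k y = 0") (auto simp: norm_mult intro: mult_left_mono)
  qed
  also have "\<dots> = \<epsilon>" using k(3) by simp
  finally show ?thesis .
qed

text \<open>The identity has a countable neighbourhood base, so one sequence of kernels concentrates
  at \<open>e\<close>.\<close>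

lemma approximate_identity_sequence:
  obtains g where "\<forall>m::nat. continuous_on UNIV (g m) \<and> (\<integral>x. conv (g m) (g m) x \<partial>\<mu>) = 1 \<and> (\<integral>x. cmod (conv (g m) (g m) x) \<partial>\<mu>) = 1"
    "\<forall>N. open N \<longrightarrow> e \<in> N \<longrightarrow> (\<forall>\<^sub>F m in sequentially. \<forall>x. conv (g m) (g m) x \<noteq> 0 \<longrightarrow> x \<in> N)"
proof -
  obtain N where N: "\<And>m::nat. open (N m)" "\<And>m. e \<in> N m" "\<And>S. open S \<Longrightarrow> e \<in> S \<Longrightarrow> \<forall>\<^sub>F m in sequentially. N m \<subseteq> S"
    using countable_basis_at_decseq[of e] by blast
  let ?P = "\<lambda>m g. continuous_on UNIV g \<and> (\<forall>x. x \<notin> N m \<longrightarrow> conv g g x = 0) \<and> (\<integral>x. conv g g x \<partial>\<mu>) = 1 \<and>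
      (\<integral>x. cmod (conv g g x) \<partial>\<mu>) = 1"
  have "\<forall>m. \<exists>g. ?P m g"
  proof
    fix m
    obtain g where "continuous_on UNIV g" "\<forall>x. x \<notin> N m \<longrightarrow> conv g g x = 0" "(\<integral>x. conv g g x \<partial>\<mu>) = 1"
      "(\<integral>x. cmod (conv g g x) \<partial>\<mu>) = 1" by (rule approximate_identity[OF N(1,2)])
    then show "\<exists>g. ?P m g" by (intro exI[of _ g] conjI)
  qed
  then obtain g where g: "\<forall>m. ?P m (g m)" unfolding choice_iff ..
  show ?thesis
  proof (rule that[of g])
    show "\<forall>m. continuous_on UNIV (g m) \<and> (\<integral>x. conv (g m) (g m) x \<partial>\<mu>) = 1 \<and> (\<integral>x. cmod (conv (g m) (g m) x) \<partial>\<mu>) = 1"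
      using g by simp
    show "\<forall>S. open S \<longrightarrow> e \<in> S \<longrightarrow> (\<forall>\<^sub>F m in sequentially. \<forall>x. conv (g m) (g m) x \<noteq> 0 \<longrightarrow> x \<in> S)"
    proof (intro allI impI)
      fix S assume "open S" "e \<in> S"
      from N(3)[OF this] show "\<forall>\<^sub>F m in sequentially. \<forall>x. conv (g m) (g m) x \<noteq> 0 \<longrightarrow> x \<in> S"
      proof eventually_elim
        case (elim m)
        have "x \<in> S" if "conv (g m) (g m) x \<noteq> 0" for x
        proof (rule subsetD[OF elim], rule ccontr)
          assume "x \<notin> N m"
          then show False using g that by simp
        qed
        then show ?case by simp
      qed
    qed
  qed
qed

text \<open>Both limits are instances of \<open>main\<close>, where the compact parameter set is a
  compact part of a chart image for the derivatives and the whole group for the values.\<close>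

lemma approximation_limits:
  assumes k: "\<And>m::nat. continuous_on UNIV (k m)" "\<And>m. (\<integral>x. k m x \<partial>\<mu>) = 1" "\<And>m. (\<integral>x. cmod (k m x) \<partial>\<mu>) = 1"
    and supp: "\<And>N. open N \<Longrightarrow> e \<in> N \<Longrightarrow> \<forall>\<^sub>F m in sequentially. \<forall>x. k m x \<noteq> 0 \<longrightarrow> x \<in> N"
    and f: "f \<in> smooth_funs n \<A>"
  shows "smoothly_tends (\<lambda>m. conv (k m) f) f sequentially"
    "\<epsilon> > 0 \<Longrightarrow> \<forall>\<^sub>F m in sequentially. \<forall>x. cmod (conv (k m) f x - f x) \<le> \<epsilon>"
proof -
  have fc: "continuous_on UNIV f" by (rule smooth_cont[OF f])
  have main: "\<forall>\<^sub>F m in sequentially. \<forall>z\<in>C. cmod ((\<integral>y. k m y * H y z \<partial>\<mu>) - H e z) \<le> \<epsilon>"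
    if H: "continuous_on (UNIV \<times> C) (\<lambda>(y,z). H y z)" and C: "compact C" and \<epsilon>: "\<epsilon> > 0"
    for C :: "'c::t2_space set" and H :: "'g \<Rightarrow> 'c \<Rightarrow> complex" and \<epsilon> :: real
  proof -
    obtain N where N: "e \<in> N" "open N" "\<forall>y\<in>N \<inter> UNIV. \<forall>z\<in>C. dist ((\<lambda>(y,z). H y z) (y,z)) ((\<lambda>(y,z). H y z) (e,z)) \<le> \<epsilon>"
      using continuous_on_prod_compactE[OF H C UNIV_I \<epsilon>, of e] .
    from supp[OF N(2,1)] show ?thesis
    proof eventually_elim
      case (elim m)
      show ?case
      proof
        fix z assume z: "z \<in> C"
        have "continuous_on UNIV (\<lambda>y::'g. (y,z))" by (intro continuous_intros)
        from continuous_on_compose2[OF H this] z have Hz: "continuous_on UNIV (\<lambda>y. H y z)" by (simp add: image_subset_iff)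
        show "cmod ((\<integral>y. k m y * H y z \<partial>\<mu>) - H e z) \<le> \<epsilon>"
        proof (rule integral_approximate[OF k Hz])
          fix y assume "k m y \<noteq> 0"
          then have "y \<in> N \<inter> UNIV" using elim by simp
          from bspec[OF bspec[OF N(3) this] z] show "cmod (H y z - H e z) \<le> \<epsilon>" by (simp add: dist_norm)
        qed
      qed
    qed
  qed
  show "smoothly_tends (\<lambda>m. conv (k m) f) f sequentially"
    unfolding smoothly_tends_def
  proof (intro allI impI)
    fix U \<phi> "is" K and \<epsilon> :: real
    assume U: "(U,\<phi>) \<in> \<A>" and "is": "set is \<subseteq> {..<n}" and K: "compact K" "K \<subseteq> \<phi> ` U" and \<epsilon>: "\<epsilon> > 0"
    let ?H = "\<lambda>y. partial_derivs is (\<lambda>z. f (mul (iv y) (inv_into U \<phi> z)))"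
    have He: "?H e = partial_derivs is (\<lambda>z. f (inv_into U \<phi> z))" by simp
    have "continuous_on (UNIV \<times> K) (\<lambda>(y,z). ?H y z)"
      by (rule continuous_on_subset[OF translate_partials_inverse[OF f U "is"]]) (use K(2) in auto)
    from main[OF this K(1) \<epsilon>]
    show "\<forall>\<^sub>F m in sequentially. \<forall>z\<in>K. cmod (partial_derivs is (\<lambda>z. conv (k m) f (inv_into U \<phi> z)) z -
        partial_derivs is (\<lambda>z. f (inv_into U \<phi> z)) z) \<le> \<epsilon>"
    proof eventually_elim
      case (elim m)
      show ?case
      proof
        fix z assume z: "z \<in> K"
        then have z': "z \<in> \<phi> ` U" using K(2) by blast
        show "cmod (partial_derivs is (\<lambda>z. conv (k m) f (inv_into U \<phi> z)) z - partial_derivs is (\<lambda>z. f (inv_into U \<phi> z)) z) \<le> \<epsilon>"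
          using bspec[OF elim z] unfolding conv_smooth(2)[OF k(1) f U "is" z'] He .
      qed
    qed
  qed
  show "\<forall>\<^sub>F m in sequentially. \<forall>x. cmod (conv (k m) f x - f x) \<le> \<epsilon>" if "\<epsilon> > 0"
  proof -
    have "continuous_on (UNIV \<times> UNIV) (\<lambda>(y,x). f (mul (iv y) x))"
      unfolding case_prod_unfold by (intro cont_comp[OF fc] continuous_intros)
    from main[OF this compact_UNIV that] show ?thesis by (simp add: conv_def)
  qed
qed

text \<open>\<open>A\<close> tested against \<psi> is continuous only for Frechet convergence and
  \<open>B\<close> only for uniform convergence, so every approximation is made in both senses. The
  hypothesis \<open>coef\<close> may assume that all coefficients of \<xi> are smooth: the proof
  invokes it only after deriving this from a nonzero Fourier coefficient of a smooth
  function.\<close>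

theorem agree_of_coefficients:
  assumes D: "unitary_dual mul e D" and A: "continuous_linear_operator n \<A> A" and \<psi>: "\<psi> \<in> smooth_funs n \<A>"
    and lin: "\<And>f g a b. continuous_on UNIV f \<Longrightarrow> continuous_on UNIV g \<Longrightarrow> B (\<lambda>x. a * f x + b * g x) = a * B f + b * B g"
    and bd: "\<And>f b. continuous_on UNIV f \<Longrightarrow> (\<And>x. cmod (f x) \<le> b) \<Longrightarrow> cmod (B f) \<le> C * b"
    and coef: "\<And>\<xi> i j. \<xi> \<in> D \<Longrightarrow> i < rep_dim e \<xi> \<Longrightarrow> j < rep_dim e \<xi> \<Longrightarrow>
      (\<And>i j. i < rep_dim e \<xi> \<Longrightarrow> j < rep_dim e \<xi> \<Longrightarrow> (\<lambda>x. \<xi> x $$ (i,j)) \<in> smooth_funs n \<A>) \<Longrightarrow>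
      A (\<lambda>x. \<xi> x $$ (i,j)) \<psi> = B (\<lambda>x. \<xi> x $$ (i,j))"
    and f: "f \<in> smooth_funs n \<A>"
  shows "A f \<psi> = B f"
proof -
  have linA: "A (\<lambda>x. a * f x + b * g x) \<psi> = a * A f \<psi> + b * A g \<psi>" if "f \<in> smooth_funs n \<A>" "g \<in> smooth_funs n \<A>" for f g a b
    using A that \<psi> by (simp add: continuous_linear_operator_def)
  define Q where "Q h \<longleftrightarrow> h \<in> smooth_funs n \<A> \<and> A h \<psi> = B h" for h
  have Qlin: "Q (\<lambda>x. a * f x + b * g x)" if "Q f" "Q g" for f g a b
  proof -
    have s: "f \<in> smooth_funs n \<A>" "g \<in> smooth_funs n \<A>" using that by (auto simp: Q_def)
    have "(\<lambda>x. a * f x + b * g x) \<in> smooth_funs n \<A>"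
      by (intro smooth_bilinear smooth_const s)
    then show ?thesis using that linA[OF s, of a b] lin[OF smooth_cont[OF s(1)] smooth_cont[OF s(2)], of a b] by (simp add: Q_def)
  qed
  have Q0: "Q (\<lambda>x. 0)"
    using linA[OF smooth_const smooth_const, of 0 0 0 0] lin[of "\<lambda>x. 0" "\<lambda>x. 0" 0 0] smooth_const[of 0] by (simp add: Q_def)
  have Qsum: "Q (\<lambda>x. \<Sum>i\<in>I. c i * h i x)" if "\<And>i. i \<in> I \<Longrightarrow> Q (h i)" for I :: "'i set" and c h
    using that
  proof (induction I rule: infinite_finite_induct)
    case (insert i I)
    have "Q (\<lambda>x. c i * h i x + 1 * (\<Sum>i\<in>I. c i * h i x))" using insert by (intro Qlin) auto
    then show ?case using insert by simp
  qed (simp_all add: Q0)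
  have Qpart: "Q (conv (fourier_part h \<xi>) f)" if \<xi>: "\<xi> \<in> D" and f: "f \<in> smooth_funs n \<A>" for h \<xi> f
  proof -
    define d where "d = rep_dim e \<xi>"
    note r = dual_rep(1,2)[OF D \<xi>, folded d_def]
    have fc: "continuous_on UNIV f" by (rule smooth_cont[OF f])
    let ?a = "\<lambda>j m. ip f (\<lambda>x. \<xi> x $$ (j,m))"
    let ?c = "\<lambda>i j. ip h (\<lambda>x. \<xi> x $$ (i,j))"
    have eq: "conv (fourier_part h \<xi>) f = (\<lambda>x. \<Sum>i<d. 1 * (\<Sum>j<d. (of_nat d * ?c i j) * (\<Sum>m<d. ?a j m * \<xi> x $$ (i,m))))"
    proof
      fix x
      have "fourier_part h \<xi> = (\<lambda>x. \<Sum>i<d. \<Sum>j<d. (of_nat d * ?c i j) * \<xi> x $$ (i,j))"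
        by (simp add: fourier_part_def fun_eq_iff d_def sum_distrib_left mult.assoc)
      then have "conv (fourier_part h \<xi>) f x = conv (\<lambda>x. \<Sum>i<d. \<Sum>j<d. (of_nat d * ?c i j) * \<xi> x $$ (i,j)) f x" by simp
      also have "\<dots> = (\<Sum>i<d. conv (\<lambda>x. \<Sum>j<d. (of_nat d * ?c i j) * \<xi> x $$ (i,j)) f x)"
        by (rule conv_sum_left[OF _ fc]) (auto intro!: continuous_intros rep_cont[OF r(1)])
      also have "\<dots> = (\<Sum>i<d. \<Sum>j<d. conv (\<lambda>x. (of_nat d * ?c i j) * \<xi> x $$ (i,j)) f x)"
        by (intro sum.cong refl conv_sum_left[OF _ fc]) (auto intro!: continuous_intros rep_cont[OF r(1)])
      also have "\<dots> = (\<Sum>i<d. \<Sum>j<d. (of_nat d * ?c i j) * (\<Sum>m<d. ?a j m * \<xi> x $$ (i,m)))"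
        unfolding conv_scale_left by (intro sum.cong refl) (simp add: conv_rep_left[OF r(1) _ _ fc])
      finally show "conv (fourier_part h \<xi>) f x = (\<Sum>i<d. 1 * (\<Sum>j<d. (of_nat d * ?c i j) * (\<Sum>m<d. ?a j m * \<xi> x $$ (i,m))))" by simp
    qed
    show ?thesis
    \<comment> \<open>Either \<open>f\<close> has a nonzero Fourier coefficient at \<xi>, which
      forces all coefficients of \<xi> to be smooth, or the whole block of the convolution
      vanishes.\<close>
    proof (cases "\<exists>l<d. \<exists>m<d. ?a l m \<noteq> 0")
      case True
      then obtain l m where lm: "l < d" "m < d" "?a l m \<noteq> 0" by blast
      have sm: "(\<lambda>x. \<xi> x $$ (i,j)) \<in> smooth_funs n \<A>" if "i < d" "j < d" for i j
        by (rule coefficient_smooth[OF r f lm that])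
      have "Q (\<lambda>x. \<xi> x $$ (i,j))" if "i < d" "j < d" for i j
        using coef[OF \<xi>, folded d_def, OF that sm] sm[OF that] by (simp add: Q_def)
      then show ?thesis unfolding eq by (intro Qsum) auto
    next
      case False
      then have "conv (fourier_part h \<xi>) f = (\<lambda>x. 0)" unfolding eq by auto
      then show ?thesis using Q0 by simp
    qed
  qed
  have Bdiff: "cmod (B f - B g) \<le> C * b" if "continuous_on UNIV f" "continuous_on UNIV g" "\<And>x. cmod (f x - g x) \<le> b" for f g b
  proof -
    have "B (\<lambda>x. 1 * f x + (-1) * g x) = 1 * B f + (-1) * B g" by (rule lin[OF that(1,2)])
    then have "B (\<lambda>x. f x - g x) = B f - B g" by simp
    moreover have "cmod (B (\<lambda>x. f x - g x)) \<le> C * b" by (rule bd) (intro continuous_intros that)+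
    ultimately show ?thesis by simp
  qed
  have C: "C \<ge> 0"
  proof -
    have "0 \<le> cmod (B (\<lambda>x. 0))" by simp
    also have "\<dots> \<le> C * 1" by (rule bd) auto
    finally show ?thesis by simp
  qed
  have Btends: "((\<lambda>i. B (h i)) \<longlongrightarrow> B h0) Fl"
    if "\<And>i. continuous_on UNIV (h i)" "continuous_on UNIV h0" "\<And>\<epsilon>. \<epsilon> > 0 \<Longrightarrow> \<forall>\<^sub>F i in Fl. \<forall>x. cmod (h i x - h0 x) \<le> \<epsilon>"
    for h :: "'i \<Rightarrow> 'g \<Rightarrow> complex" and h0 Fl
  proof (rule tendstoI)
    fix \<epsilon> :: real assume \<epsilon>: "\<epsilon> > 0"
    \<comment> \<open>Dividing by C + 1 also covers C = 0 and leaves room for a strict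
      inequality.\<close>
    have "\<epsilon> / (C + 1) > 0" using \<epsilon> C by simp
    from that(3)[OF this] show "\<forall>\<^sub>F i in Fl. dist (B (h i)) (B h0) < \<epsilon>"
    proof eventually_elim
      case (elim i)
      have "cmod (B (h i) - B h0) \<le> C * (\<epsilon> / (C + 1))" by (rule Bdiff[OF that(1,2)]) (use elim in simp)
      also have "\<dots> < \<epsilon>" using \<epsilon> C by (simp add: field_simps)
      finally show ?case by (simp add: dist_norm)
    qed
  qed
  have Qconv: "Q (conv (conv g g) f)" if g: "continuous_on UNIV g" and f: "f \<in> smooth_funs n \<A>" for g f
  proof -
    let ?k = "conv g g"
    have k: "continuous_on UNIV ?k" by (rule conv_cont[OF g g])
    have fc: "continuous_on UNIV f" by (rule smooth_cont[OF f])
    let ?F = "finite_subsets_at_top D"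
    \<comment> \<open>The limit lemmas ask for continuity at every index, so sets \<open>F\<close>
      outside \<open>D\<close> receive the limit itself as a default value.\<close>
    define t where "t F = (if F \<subseteq> D then (\<lambda>x. \<Sum>\<xi>\<in>F. fourier_part ?k \<xi> x) else ?k)" for F
    have ev: "\<forall>\<^sub>F F in ?F. F \<subseteq> D" by (simp add: eventually_finite_subsets_at_top_weakI)
    have tc: "continuous_on UNIV (t F)" for F
      unfolding t_def using k by (auto intro!: continuous_intros fourier_part_cont[OF D])
    have lim: "uniform_limit UNIV t ?k ?F"
    proof (rule uniform_limitI)
      fix \<epsilon> :: real assume "\<epsilon> > 0"
      from uniform_limitD[OF conv_fourier_uniform[OF D g] this] ev
      show "\<forall>\<^sub>F F in ?F. \<forall>x\<in>UNIV. dist (t F x) (?k x) < \<epsilon>" by eventually_elim (simp add: t_def)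
    qed
    have sm: "conv (t F) f \<in> smooth_funs n \<A>" for F by (rule conv_smooth(1)[OF tc f])
    have smk: "conv ?k f \<in> smooth_funs n \<A>" by (rule conv_smooth(1)[OF k f])
    have 1: "((\<lambda>F. A (conv (t F) f) \<psi>) \<longlongrightarrow> A (conv ?k f) \<psi>) ?F"
      by (rule continuous_linear_operator_tendsto[OF A \<psi> sm smk conv_smoothly_tends[OF tc k lim f]])
    have 2: "((\<lambda>F. B (conv (t F) f)) \<longlongrightarrow> B (conv ?k f)) ?F"
    proof (rule Btends[OF conv_cont[OF tc fc] conv_cont[OF k fc]])
      fix \<epsilon> :: real assume \<epsilon>: "\<epsilon> > 0"
      obtain M where M: "M > 0" "\<And>x. cmod (f x) \<le> M" using cont_bound[OF fc] by blast
      have "\<epsilon> / M > 0" using \<epsilon> M(1) by simp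
      from uniform_limitD[OF lim this]
      show "\<forall>\<^sub>F F in ?F. \<forall>x. cmod (conv (t F) f x - conv ?k f x) \<le> \<epsilon>"
      proof eventually_elim
        case (elim F)
        show ?case
        proof
          fix x
          have "conv (t F) f x - conv ?k f x = (\<integral>y. (t F y - ?k y) * f (mul (iv y) x) \<partial>\<mu>)"
            unfolding conv_diff_left[OF tc k fc, symmetric] by (simp only: conv_def)
          also have "cmod \<dots> \<le> \<epsilon> / M * M"
            by (rule integral_norm_le, subst norm_mult, rule mult_mono)
               (use elim M \<epsilon> in \<open>auto simp: dist_norm less_imp_le\<close>)
          finally show "cmod (conv (t F) f x - conv ?k f x) \<le> \<epsilon>" using M(1) by simp
        qed
      qed
    qed
    have "Q (conv (t F) f)" if "F \<subseteq> D" for F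
    proof -
      have "conv (t F) f = (\<lambda>x. \<Sum>\<xi>\<in>F. 1 * conv (fourier_part ?k \<xi>) f x)"
        using that by (auto simp: t_def intro!: ext conv_sum_left fc fourier_part_cont[OF D])
      moreover have "Q (\<lambda>x. \<Sum>\<xi>\<in>F. 1 * conv (fourier_part ?k \<xi>) f x)"
        by (rule Qsum) (use that f in \<open>auto intro: Qpart\<close>)
      ultimately show ?thesis by (simp only:)
    qed
    then have "\<forall>\<^sub>F F in ?F. A (conv (t F) f) \<psi> = B (conv (t F) f)"
      using ev by (auto simp: Q_def elim: eventually_mono)
    from tendsto_cong[OF this] 1 have "((\<lambda>F. B (conv (t F) f)) \<longlongrightarrow> A (conv ?k f) \<psi>) ?F" by simp
    from tendsto_unique[OF finite_subsets_at_top_neq_bot this 2] show ?thesis using smk by (simp add: Q_def)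
  qed
  obtain g where g: "\<forall>m::nat. continuous_on UNIV (g m) \<and> (\<integral>x. conv (g m) (g m) x \<partial>\<mu>) = 1 \<and> (\<integral>x. cmod (conv (g m) (g m) x) \<partial>\<mu>) = 1"
    "\<forall>N. open N \<longrightarrow> e \<in> N \<longrightarrow> (\<forall>\<^sub>F m in sequentially. \<forall>x. conv (g m) (g m) x \<noteq> 0 \<longrightarrow> x \<in> N)"
    by (rule approximate_identity_sequence)
  let ?k = "\<lambda>m. conv (g m) (g m)"
  have k: "continuous_on UNIV (?k m)" "(\<integral>x. ?k m x \<partial>\<mu>) = 1" "(\<integral>x. cmod (?k m x) \<partial>\<mu>) = 1" for m
    using g(1) by (auto intro: conv_cont)
  have supp: "\<forall>\<^sub>F m in sequentially. \<forall>x. ?k m x \<noteq> 0 \<longrightarrow> x \<in> N" if "open N" "e \<in> N" for N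
    using g(2) that by simp
  note ap = approximation_limits[OF k supp f]
  have fc: "continuous_on UNIV f" by (rule smooth_cont[OF f])
  have "(\<lambda>m. A (conv (?k m) f) \<psi>) \<longlonglongrightarrow> A f \<psi>"
    by (rule continuous_linear_operator_tendsto[OF A \<psi> conv_smooth(1)[OF k(1) f] f ap(1)])
  moreover have "(\<lambda>m. B (conv (?k m) f)) \<longlonglongrightarrow> B f"
    by (rule Btends[OF conv_cont[OF k(1) fc] fc ap(2)])
  moreover have "A (conv (?k m) f) \<psi> = B (conv (?k m) f)" for m
    using Qconv[of "g m", OF _ f] g(1) by (simp add: Q_def)
  ultimately show ?thesis using LIMSEQ_unique by simp
qed

end

section \<open>The nuclear expansion\<close>

context haar_lie_group begin

interpretation prob_space \<mu> by (rule prob)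

lemma distribution_add:
  assumes "u \<in> distributions n \<A>" "f \<in> smooth_funs n \<A>" "g \<in> smooth_funs n \<A>"
  shows "u (\<lambda>x. a * f x + b * g x) = a * u f + b * u g"
  using assms by (simp add: distributions_def)

lemma distribution_zero: "u \<in> distributions n \<A> \<Longrightarrow> u (\<lambda>x. 0) = 0"
  using distribution_add[OF _ smooth_const smooth_const, of u 0 0 0 0] by simp

lemma distribution_sum:
  assumes u: "u \<in> distributions n \<A>" and g: "\<And>i. i \<in> I \<Longrightarrow> g i \<in> smooth_funs n \<A>"
  shows "u (\<lambda>x. \<Sum>i\<in>I. g i x) = (\<Sum>i\<in>I. u (g i))"
  using g
proof (induction I rule: infinite_finite_induct)
  case (insert i I)
  have "u (\<lambda>x. 1 * g i x + 1 * (\<Sum>i\<in>I. g i x)) = 1 * u (g i) + 1 * u (\<lambda>x. \<Sum>i\<in>I. g i x)"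
    using insert by (intro distribution_add[OF u] smooth_sum) auto
  then show ?case using insert by simp
qed (simp_all add: distribution_zero[OF u])

text \<open>Multiplying the defining identity of the symbol by \<xi> from the left cancels the
  adjoint by unitarity. As it is an identity of distributions, the factor is moved onto the test
  function, which stays smooth because the coefficients of \<xi> are.\<close>

lemma operator_on_coefficient:
  assumes D: "unitary_dual mul e D" and A: "continuous_linear_operator n \<A> A" and sym: "matrix_symbol \<mu> n \<A> e D A \<sigma>"
    and \<psi>: "\<psi> \<in> smooth_funs n \<A>" and \<xi>: "\<xi> \<in> D" and d: "d = rep_dim e \<xi>" and ij: "i < d" "j < d"
    and sm: "\<And>i j. i < d \<Longrightarrow> j < d \<Longrightarrow> (\<lambda>x. \<xi> x $$ (i,j)) \<in> smooth_funs n \<A>"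
  shows "A (\<lambda>x. \<xi> x $$ (i,j)) \<psi> = (\<integral>x. (\<xi> x * \<sigma> x \<xi>) $$ (i,j) * \<psi> x \<partial>\<mu>)"
proof -
  note r = dual_rep(1)[OF D \<xi>, folded d]
  note rc = rep_carrier[OF r]
  have \<sigma>c: "\<sigma> x \<xi> \<in> carrier_mat d d" for x using sym \<xi> by (simp add: matrix_symbol_def d)
  have \<sigma>i: "integrable \<mu> (\<lambda>x. \<sigma> x \<xi> $$ (l,j))" if "l < d" for l using sym \<xi> that ij by (simp add: matrix_symbol_def d)
  have s: "(\<integral>x. \<sigma> x \<xi> $$ (l,j) * \<phi> x \<partial>\<mu>) = (\<Sum>k<d. A (\<lambda>x. \<xi> x $$ (k,j)) (\<lambda>x. mat_adjoint (\<xi> x) $$ (l,k) * \<phi> x))"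
    if "l < d" "\<phi> \<in> smooth_funs n \<A>" for l \<phi>
    using sym \<xi> that ij by (simp add: matrix_symbol_def d fun_distribution_def mult_distribution_def)
  have Ad: "A (\<lambda>x. \<xi> x $$ (k,j)) \<in> distributions n \<A>" if "k < d" for k
    using A sm[OF that ij(2)] by (simp add: continuous_linear_operator_def)
  have prod: "(\<lambda>x. \<xi> x $$ (i,l) * \<psi> x) \<in> smooth_funs n \<A>" if "l < d" for l
    by (rule smooth_bilinear(1)[OF sm[OF ij(1) that] \<psi>])
  have adj: "(\<lambda>x. mat_adjoint (\<xi> x) $$ (l,k) * (\<xi> x $$ (i,l) * \<psi> x)) = (\<lambda>x. cnj (\<xi> x $$ (k,l)) * (\<xi> x $$ (i,l) * \<psi> x))"
    if "l < d" "k < d" for l k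
    by (simp add: mat_adjoint_index[OF rc that])
  have "(\<integral>x. (\<xi> x * \<sigma> x \<xi>) $$ (i,j) * \<psi> x \<partial>\<mu>) = (\<integral>x. (\<Sum>l<d. \<sigma> x \<xi> $$ (l,j) * (\<xi> x $$ (i,l) * \<psi> x)) \<partial>\<mu>)"
    unfolding mult_mat_index[OF rc \<sigma>c ij] by (simp add: sum_distrib_right sum_distrib_left mult_ac)
  also have "\<dots> = (\<Sum>l<d. (\<integral>x. \<sigma> x \<xi> $$ (l,j) * (\<xi> x $$ (i,l) * \<psi> x) \<partial>\<mu>))"
  proof (rule Bochner_Integration.integral_sum)
    fix l assume l: "l \<in> {..<d}"
    then have pc: "continuous_on UNIV (\<lambda>x. \<xi> x $$ (i,l) * \<psi> x)" by (intro smooth_cont prod) simp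
    obtain M where M: "M > 0" "\<And>x. cmod (\<xi> x $$ (i,l) * \<psi> x) \<le> M" using cont_bound[OF pc] by blast
    have sl: "integrable \<mu> (\<lambda>x. \<sigma> x \<xi> $$ (l,j))" using l by (intro \<sigma>i) simp
    show "integrable \<mu> (\<lambda>x. \<sigma> x \<xi> $$ (l,j) * (\<xi> x $$ (i,l) * \<psi> x))"
    proof (rule Bochner_Integration.integrable_bound)
      show "integrable \<mu> (\<lambda>x. \<sigma> x \<xi> $$ (l,j) * of_real M)" using sl by simp
      show "(\<lambda>x. \<sigma> x \<xi> $$ (l,j) * (\<xi> x $$ (i,l) * \<psi> x)) \<in> borel_measurable \<mu>"
        by (rule borel_measurable_times[OF borel_measurable_integrable[OF sl] cont_measurable[OF pc]])
      show "AE x in \<mu>. norm (\<sigma> x \<xi> $$ (l,j) * (\<xi> x $$ (i,l) * \<psi> x)) \<le> norm (\<sigma> x \<xi> $$ (l,j) * of_real M)"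
      proof (rule AE_I2)
        fix x
        show "norm (\<sigma> x \<xi> $$ (l,j) * (\<xi> x $$ (i,l) * \<psi> x)) \<le> norm (\<sigma> x \<xi> $$ (l,j) * of_real M)"
          unfolding norm_mult[of "\<sigma> x \<xi> $$ (l,j)"] using M by (intro mult_left_mono) auto
      qed
    qed
  qed
  also have "\<dots> = (\<Sum>l<d. \<Sum>k<d. A (\<lambda>x. \<xi> x $$ (k,j)) (\<lambda>x. cnj (\<xi> x $$ (k,l)) * (\<xi> x $$ (i,l) * \<psi> x)))"
    by (intro sum.cong refl) (simp add: s[OF _ prod] adj)
  also have "\<dots> = (\<Sum>k<d. \<Sum>l<d. A (\<lambda>x. \<xi> x $$ (k,j)) (\<lambda>x. cnj (\<xi> x $$ (k,l)) * (\<xi> x $$ (i,l) * \<psi> x)))" by (rule sum.swap)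
  also have "\<dots> = (\<Sum>k<d. if k = i then A (\<lambda>x. \<xi> x $$ (k,j)) \<psi> else 0)"
  proof (rule sum.cong[OF refl])
    fix k assume "k \<in> {..<d}"
    then have k: "k < d" by simp
    have "(\<Sum>l<d. A (\<lambda>x. \<xi> x $$ (k,j)) (\<lambda>x. cnj (\<xi> x $$ (k,l)) * (\<xi> x $$ (i,l) * \<psi> x)))
        = A (\<lambda>x. \<xi> x $$ (k,j)) (\<lambda>x. \<Sum>l<d. cnj (\<xi> x $$ (k,l)) * (\<xi> x $$ (i,l) * \<psi> x))"
      by (rule distribution_sum[OF Ad[OF k], symmetric]) (auto intro!: smooth_bilinear(1) smooth_cnj sm prod k)
    also have "(\<lambda>x. \<Sum>l<d. cnj (\<xi> x $$ (k,l)) * (\<xi> x $$ (i,l) * \<psi> x)) = (\<lambda>x. (if i = k then 1 else 0) * \<psi> x)"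
    proof
      fix x
      have "(\<Sum>l<d. cnj (\<xi> x $$ (k,l)) * (\<xi> x $$ (i,l) * \<psi> x)) = (\<Sum>l<d. \<xi> x $$ (i,l) * cnj (\<xi> x $$ (k,l))) * \<psi> x"
        by (simp add: sum_distrib_left sum_distrib_right mult_ac)
      then show "(\<Sum>l<d. cnj (\<xi> x $$ (k,l)) * (\<xi> x $$ (i,l) * \<psi> x)) = (if i = k then 1 else 0) * \<psi> x"
        by (simp only: rep_rows[OF r ij(1) k])
    qed
    finally show "(\<Sum>l<d. A (\<lambda>x. \<xi> x $$ (k,j)) (\<lambda>x. cnj (\<xi> x $$ (k,l)) * (\<xi> x $$ (i,l) * \<psi> x)))
        = (if k = i then A (\<lambda>x. \<xi> x $$ (k,j)) \<psi> else 0)"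
      using distribution_zero[OF Ad[OF k]] by auto
  qed
  also have "\<dots> = A (\<lambda>x. \<xi> x $$ (i,j)) \<psi>" using ij by simp
  finally show ?thesis by simp
qed

text \<open>Row sums of the transpose are column sums of \<open>B\<close>, and the entry (i,j) of a
  product \<xi> B involves just column \<open>j\<close> of \<open>B\<close>.\<close>

lemma op_norm_inf_transpose:
  assumes "B \<in> carrier_mat d d" "j < d"
  shows "(\<Sum>i<d. cmod (B $$ (i,j))) \<le> op_norm_inf (transpose_mat B)"
    "op_norm_inf (transpose_mat B) = Max ((\<lambda>i. \<Sum>k<d. cmod (B $$ (k,i))) ` {..<d})"
proof -
  show eq: "op_norm_inf (transpose_mat B) = Max ((\<lambda>i. \<Sum>k<d. cmod (B $$ (k,i))) ` {..<d})"
    unfolding op_norm_inf_def using assms by (intro arg_cong[where f=Max] image_cong sum.cong) auto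
  show "(\<Sum>i<d. cmod (B $$ (i,j))) \<le> op_norm_inf (transpose_mat B)"
    unfolding eq using assms(2) by (intro Max_ge) auto
qed

lemma Lp_space_sum:
  assumes p: "p \<ge> 1" and "\<And>i. i \<in> I \<Longrightarrow> f i \<in> Lp_space \<mu> p"
  shows "(\<lambda>x. \<Sum>i\<in>I. f i x) \<in> Lp_space \<mu> p"
  using assms(2)
  by (induction I rule: infinite_finite_induct) (auto intro: zero_in_Lp Lp_space_add[OF p])

text \<open>Entries of a unitary matrix have modulus at most 1, so an entry of the product is
  bounded pointwise by a column sum of the symbol. The third claim serves the representations left
  out of the nuclear series.\<close>

lemma symbol_bounds:
  assumes D: "unitary_dual mul e D" and \<xi>: "\<xi> \<in> D" and d: "d = rep_dim e \<xi>" and p: "p \<ge> 1"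
    and c: "\<And>x. \<sigma> x \<in> carrier_mat d d" and Lp: "\<And>i j. i < d \<Longrightarrow> j < d \<Longrightarrow> (\<lambda>x. \<sigma> x $$ (i,j)) \<in> Lp_space \<mu> p"
    and ij: "i < d" "j < d"
  shows "(\<lambda>x. (\<xi> x * \<sigma> x) $$ (i,j)) \<in> Lp_space \<mu> p"
    "Lp_norm \<mu> p (\<lambda>x. (\<xi> x * \<sigma> x) $$ (i,j)) \<le> Lp_norm \<mu> p (\<lambda>x. op_norm_inf (transpose_mat (\<sigma> x)))"
    "Lp_norm \<mu> p (\<lambda>x. op_norm_inf (transpose_mat (\<sigma> x))) = 0 \<Longrightarrow> AE x in \<mu>. (\<xi> x * \<sigma> x) $$ (i,j) = 0"
proof -
  have p0: "p > 0" using p by simp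
  note r = dual_rep(1)[OF D \<xi>, folded d]
  let ?o = "\<lambda>x. op_norm_inf (transpose_mat (\<sigma> x))"
  have sm: "(\<lambda>x. \<sigma> x $$ (i,j)) \<in> borel_measurable \<mu>" if "i < d" "j < d" for i j using Lp_spaceD(1)[OF Lp[OF that]] .
  have om: "?o \<in> borel_measurable \<mu>"
  proof -
    have "(\<lambda>x. Max ((\<lambda>i. \<Sum>k<d. cmod (\<sigma> x $$ (k,i))) ` {..<d})) \<in> borel_measurable \<mu>"
      by (rule borel_measurable_Max) (auto intro!: borel_measurable_sum borel_measurable_norm[THEN measurable_compose[rotated]] sm)
    then show ?thesis by (simp only: op_norm_inf_transpose(2)[OF c ij(2)])
  qed
  have onn: "?o x \<ge> 0" for x
    by (rule order_trans[OF _ op_norm_inf_transpose(1)[OF c ij(2)]]) (simp add: sum_nonneg)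
  \<comment> \<open>The sum of the moduli of all entries is an integrable majorant of the operator
    norm; without integrability, the seminorm of the latter would carry no information.\<close>
  let ?S = "\<lambda>x. \<Sum>i<d. \<Sum>k<d. complex_of_real (cmod (\<sigma> x $$ (k,i)))"
  have S: "?S \<in> Lp_space \<mu> p"
  proof (intro Lp_space_sum p)
    fix i k assume "i \<in> {..<d}" "k \<in> {..<d}"
    then show "(\<lambda>x. complex_of_real (cmod (\<sigma> x $$ (k,i)))) \<in> Lp_space \<mu> p"
      using Lp_spaceD[OF Lp[of k i]] by (auto simp: Lp_space_def intro: borel_measurable_of_real)
  qed
  have oS: "norm (?o x) \<le> norm (?S x)" for x
  proof -
    have "?o x \<le> (\<Sum>i<d. \<Sum>k<d. cmod (\<sigma> x $$ (k,i)))"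
      unfolding op_norm_inf_transpose(2)[OF c ij(2)]
    proof (rule Max.boundedI)
      fix a assume "a \<in> (\<lambda>i. \<Sum>k<d. cmod (\<sigma> x $$ (k,i))) ` {..<d}"
      then obtain i where i: "i < d" "a = (\<Sum>k<d. cmod (\<sigma> x $$ (k,i)))" by auto
      show "a \<le> (\<Sum>i<d. \<Sum>k<d. cmod (\<sigma> x $$ (k,i)))"
        unfolding i(2) using i(1) by (intro member_le_sum) (auto intro: sum_nonneg)
    qed (use ij in auto)
    also have "\<dots> \<le> norm (?S x)"
    proof -
      have "?S x = complex_of_real (\<Sum>i<d. \<Sum>k<d. cmod (\<sigma> x $$ (k,i)))" by simp
      then show ?thesis by (simp only: norm_of_real abs_ge_self)
    qed
    finally show ?thesis using onn[of x] by simp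
  qed
  have oi: "integrable \<mu> (\<lambda>x. norm (?o x) powr p)"
    by (rule Lp_dominated(1)[OF p0 om Lp_spaceD(2)[OF S] AE_I2[OF oS]])
  have vm: "(\<lambda>x. (\<xi> x * \<sigma> x) $$ (i,j)) \<in> borel_measurable \<mu>"
    unfolding mult_mat_index[OF rep_carrier[OF r] c ij]
    using ij by (intro borel_measurable_sum borel_measurable_times cont_measurable rep_cont[OF r] sm) auto
  have vo: "norm ((\<xi> x * \<sigma> x) $$ (i,j)) \<le> norm (?o x)" for x
  proof -
    have "norm ((\<xi> x * \<sigma> x) $$ (i,j)) \<le> (\<Sum>k<d. cmod (\<xi> x $$ (i,k)) * cmod (\<sigma> x $$ (k,j)))"
      unfolding mult_mat_index[OF rep_carrier[OF r] c ij] by (rule order_trans[OF norm_sum]) (simp add: norm_mult)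
    also have "\<dots> \<le> (\<Sum>k<d. 1 * cmod (\<sigma> x $$ (k,j)))"
      using rep_bound[OF r ij(1)] by (intro sum_mono mult_right_mono) auto
    also have "\<dots> \<le> ?o x" using op_norm_inf_transpose(1)[OF c ij(2)] by simp
    finally show ?thesis using onn[of x] by simp
  qed
  show "(\<lambda>x. (\<xi> x * \<sigma> x) $$ (i,j)) \<in> Lp_space \<mu> p"
    using Lp_dominated(1)[OF p0 vm oi AE_I2[OF vo]] vm by (simp add: Lp_space_def)
  show "Lp_norm \<mu> p (\<lambda>x. (\<xi> x * \<sigma> x) $$ (i,j)) \<le> Lp_norm \<mu> p ?o"
    by (rule Lp_dominated(2)[OF p0 vm oi AE_I2[OF vo]])
  show "AE x in \<mu>. (\<xi> x * \<sigma> x) $$ (i,j) = 0" if "Lp_norm \<mu> p ?o = 0"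
    using Lp_norm_eq_0_AE[OF p0 oi that]
  proof eventually_elim
    case (elim x)
    then show ?case using vo[of x] by simp
  qed
qed

text \<open>Schur orthogonality gives square norm 1 / d to the entry, which is the hypothesis of
  \<open>Hoelder_bounded\<close>.\<close>

lemma coefficient_functional:
  assumes D: "unitary_dual mul e D" and \<xi>: "\<xi> \<in> D" and d: "d = rep_dim e \<xi>" and p: "p \<ge> 1" and ij: "i < d" "j < d"
  shows "(\<lambda>f. ip f (\<lambda>x. \<xi> x $$ (i,j))) \<in> dual_space (Lp_space \<mu> p) (Lp_norm \<mu> p)"
    "f \<in> Lp_space \<mu> p \<Longrightarrow> cmod (ip f (\<lambda>x. \<xi> x $$ (i,j))) \<le> real d powr (1 / min 2 p - 1) * Lp_norm \<mu> p f"
proof -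
  note r = dual_rep(1)[OF D \<xi>, folded d]
  let ?w = "\<lambda>x. \<xi> x $$ (i,j)"
  have w: "?w \<in> borel_measurable \<mu>" by (rule cont_measurable[OF rep_cont[OF r ij]])
  have w1: "cmod (?w x) \<le> 1" for x by (rule rep_bound[OF r ij])
  have d1: "real d \<ge> 1" using dual_rep(3)[OF D \<xi>] d by simp
  have "complex_of_real (sq ?w) = of_real (1 / real d)"
    unfolding ip_self[symmetric] using Schur_orthogonality[OF D \<xi> \<xi>, folded d, OF ij ij] by simp
  then have w2: "(\<integral>x. (cmod (?w x))\<^sup>2 \<partial>\<mu>) \<le> 1 / real d" by (simp only: of_real_eq_iff sq_def)
  note H = Hoelder_bounded[OF p _ w w1 d1 w2]
  have int: "integrable \<mu> (\<lambda>x. f x * cnj (?w x))" if "f \<in> Lp_space \<mu> p" for f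
  proof (rule Bochner_Integration.integrable_bound[OF H(1)[OF that]])
    have "(\<lambda>x. cnj (?w x)) \<in> borel_measurable \<mu>" by (intro cont_measurable continuous_intros rep_cont[OF r ij])
    then show "(\<lambda>x. f x * cnj (?w x)) \<in> borel_measurable \<mu>" by (intro borel_measurable_times Lp_spaceD(1)[OF that])
  qed (simp add: norm_mult)
  show bd: "cmod (ip f ?w) \<le> real d powr (1 / min 2 p - 1) * Lp_norm \<mu> p f" if "f \<in> Lp_space \<mu> p" for f
  proof -
    have "cmod (ip f ?w) \<le> (\<integral>x. cmod (f x * cnj (?w x)) \<partial>\<mu>)" unfolding ip_def by (rule integral_norm_bound)
    also have "\<dots> = (\<integral>x. cmod (f x) * cmod (?w x) \<partial>\<mu>)" by (simp add: norm_mult)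
    also have "\<dots> \<le> real d powr (1 / min 2 p - 1) * Lp_norm \<mu> p f" by (rule H(2)[OF that])
    finally show ?thesis .
  qed
  show "(\<lambda>f. ip f ?w) \<in> dual_space (Lp_space \<mu> p) (Lp_norm \<mu> p)"
    unfolding dual_space_def mem_Collect_eq
  proof (intro conjI ballI allI)
    fix f g a b assume fg: "f \<in> Lp_space \<mu> p" "g \<in> Lp_space \<mu> p"
    have "ip (\<lambda>x. a * f x + b * g x) ?w = (\<integral>x. a * (f x * cnj (?w x)) + b * (g x * cnj (?w x)) \<partial>\<mu>)"
      by (simp add: ip_def distrib_right mult.assoc)
    also have "\<dots> = a * ip f ?w + b * ip g ?w"
      using int[OF fg(1)] int[OF fg(2)] by (simp add: ip_def)
    finally show "ip (\<lambda>x. a * f x + b * g x) ?w = a * ip f ?w + b * ip g ?w" .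
  qed (use bd in blast)
qed

lemma cont_Lp:
  assumes p: "p \<ge> 1" and h: "continuous_on UNIV h" and b: "\<And>x. cmod (h x) \<le> b"
  shows "h \<in> Lp_space \<mu> p" "Lp_norm \<mu> p h \<le> b"
proof -
  have p0: "p > 0" using p by simp
  have b0: "b \<ge> 0" using b[of e] norm_ge_zero order_trans by blast
  have le: "norm (norm (h x) powr p) \<le> b powr p" for x using b p0 by (simp add: powr_mono2)
  have m: "h \<in> borel_measurable \<mu>" by (rule cont_measurable[OF h])
  have i: "integrable \<mu> (\<lambda>x. norm (h x) powr p)"
    by (rule integrable_const_bound[where B="b powr p"]) (use le m in auto)
  then show "h \<in> Lp_space \<mu> p" using m by (simp add: Lp_space_def)
  have "(\<integral>x. norm (h x) powr p \<partial>\<mu>) \<le> b powr p"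
    using integral_norm_le[of "\<lambda>x. norm (h x) powr p", OF le] by simp
  then show "Lp_norm \<mu> p h \<le> b" by (rule Lp_norm_leI[OF p0 _ b0])
qed

text \<open>\<open>Hoelder_bounded\<close> with the constant function 1 for \<open>w\<close> and d =
  1.\<close>

lemma L1_le_Lp:
  assumes p: "p \<ge> 1" and f: "f \<in> Lp_space \<mu> p"
  shows "integrable \<mu> f" "(\<integral>x. cmod (f x) \<partial>\<mu>) \<le> Lp_norm \<mu> p f"
proof -
  note H = Hoelder_bounded[OF p f, of "\<lambda>x. 1" 1]
  have "integrable \<mu> (\<lambda>x. cmod (f x))" using H(1) by simp
  then show "integrable \<mu> f" using Lp_spaceD(1)[OF f] by (simp add: integrable_norm_iff)
  show "(\<integral>x. cmod (f x) \<partial>\<mu>) \<le> Lp_norm \<mu> p f" using H(2) by simp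
qed

end

text \<open>The square of the dimension in the hypothesis pays for the number of index pairs
  belonging to one \<xi>, so the terms over \<xi> sum to at most \<open>w \<xi>\<close>.\<close>

lemma summable_on_coefficient_indices:
  fixes w :: "'x \<Rightarrow> real" and c :: "'x \<times> nat \<times> nat \<Rightarrow> real"
  assumes w: "w summable_on D" "\<And>\<xi>. \<xi> \<in> D \<Longrightarrow> w \<xi> \<ge> 0" and D': "D' \<subseteq> D"
    and c: "\<And>\<xi> i j. \<xi> \<in> D' \<Longrightarrow> i < d \<xi> \<Longrightarrow> j < d \<xi> \<Longrightarrow> c (\<xi>,i,j) \<ge> 0 \<and> real (d \<xi>) ^ 2 * c (\<xi>,i,j) \<le> w \<xi>"
  shows "c summable_on (SIGMA \<xi>:D'. {..<d \<xi>} \<times> {..<d \<xi>})"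
proof (rule nonneg_bdd_above_summable_on)
  let ?I = "SIGMA \<xi>:D'. {..<d \<xi>} \<times> {..<d \<xi>}"
  show c0: "c x \<ge> 0" if "x \<in> ?I" for x
  proof -
    obtain \<xi> i j where x: "x = (\<xi>,i,j)" by (cases x)
    show ?thesis using that c[of \<xi> i j] unfolding x by simp
  qed
  show "bdd_above (sum c ` {F. F \<subseteq> ?I \<and> finite F})"
  proof (rule bdd_aboveI2)
    fix F assume "F \<in> {F. F \<subseteq> ?I \<and> finite F}"
    then have F: "F \<subseteq> ?I" "finite F" by auto
    let ?X = "fst ` F"
    have X: "finite ?X" "?X \<subseteq> D'" using F by auto
    have "sum c F \<le> sum c (SIGMA \<xi>:?X. {..<d \<xi>} \<times> {..<d \<xi>})"
    proof (rule sum_mono2)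
      show "finite (SIGMA \<xi>:?X. {..<d \<xi>} \<times> {..<d \<xi>})" using X by (intro finite_SigmaI) auto
      show "F \<subseteq> (SIGMA \<xi>:?X. {..<d \<xi>} \<times> {..<d \<xi>})" using F by force
      show "0 \<le> c x" if "x \<in> (SIGMA \<xi>:?X. {..<d \<xi>} \<times> {..<d \<xi>}) - F" for x
        using that X(2) by (intro c0) auto
    qed
    also have "\<dots> = (\<Sum>\<xi>\<in>?X. \<Sum>q\<in>{..<d \<xi>} \<times> {..<d \<xi>}. c (\<xi>, q))"
      using X by (subst sum.Sigma) auto
    also have "\<dots> \<le> (\<Sum>\<xi>\<in>?X. w \<xi>)"
    proof (rule sum_mono)
      fix \<xi> assume "\<xi> \<in> ?X"
      then have \<xi>: "\<xi> \<in> D'" using X by auto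
      have "(\<Sum>q\<in>{..<d \<xi>} \<times> {..<d \<xi>}. c (\<xi>, q)) \<le> (\<Sum>q\<in>{..<d \<xi>} \<times> {..<d \<xi>}. w \<xi> / real (d \<xi>) ^ 2)"
      proof (rule sum_mono)
        fix q assume "q \<in> {..<d \<xi>} \<times> {..<d \<xi>}"
        then show "c (\<xi>, q) \<le> w \<xi> / real (d \<xi>) ^ 2"
          using c[OF \<xi>, of "fst q" "snd q"] by (auto simp: field_simps)
      qed
      also have "\<dots> \<le> w \<xi>"
        using w(2)[of \<xi>] \<xi> D' by (auto simp: power2_eq_square)
      finally show "(\<Sum>q\<in>{..<d \<xi>} \<times> {..<d \<xi>}. c (\<xi>, q)) \<le> w \<xi>" .
    qed
    also have "\<dots> \<le> infsum w D"
      by (rule finite_sum_le_infsum[OF w(1) X(1)]) (use X D' w(2) in auto)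
    finally show "sum c F \<le> infsum w D" .
  qed
qed

text \<open>The index set may be finite while nuclear series are indexed by all natural numbers;
  numbers that enumerate nothing contribute 0.\<close>

lemma summable_enumeration:
  fixes c :: "'x \<Rightarrow> real"
  assumes I: "countable I" and c: "c summable_on I" "\<And>x. x \<in> I \<Longrightarrow> c x \<ge> 0"
  shows "summable (\<lambda>k. if k \<in> to_nat_on I ` I then c (from_nat_into I k) else 0)"
proof -
  let ?c = "\<lambda>k. if k \<in> to_nat_on I ` I then c (from_nat_into I k) else 0"
  have "(c \<circ> from_nat_into I) summable_on to_nat_on I ` I"
  proof (subst summable_on_reindex[OF inj_on_to_nat_on[OF I]])
    have "(c \<circ> from_nat_into I \<circ> to_nat_on I) summable_on I \<longleftrightarrow> c summable_on I"
      by (rule summable_on_cong) (simp add: I)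
    then show "(c \<circ> from_nat_into I \<circ> to_nat_on I) summable_on I" using c(1) by simp
  qed
  then have "?c summable_on UNIV"
    by (rule summable_on_cong_neutral[THEN iffD1, rotated -1]) auto
  then show ?thesis by (rule summable_on_imp_summable)
qed

section \<open>Construction of the nuclear extension\<close>

context haar_lie_group begin

interpretation prob_space \<mu> by (rule prob)

lemma nuclear_extension:
  assumes D: "unitary_dual mul e D" and r: "0 < r" "r \<le> 1" and p1: "1 \<le> p1" and p2: "1 \<le> p2"
    and A: "continuous_linear_operator n \<A> A" and sym: "matrix_symbol \<mu> n \<A> e D A \<sigma>"
    and Lp: "\<And>\<xi> i j. \<xi> \<in> D \<Longrightarrow> i < rep_dim e \<xi> \<Longrightarrow> j < rep_dim e \<xi> \<Longrightarrow> (\<lambda>x. \<sigma> x \<xi> $$ (i,j)) \<in> Lp_space \<mu> p2"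
    and S: "(\<lambda>\<xi>. real (rep_dim e \<xi>) powr (2 + r / min 2 p1) *
           Lp_norm \<mu> p2 (\<lambda>x. op_norm_inf (transpose_mat (\<sigma> x \<xi>))) powr r) summable_on D"
  shows "\<exists>T. r_nuclear r (Lp_space \<mu> p1) (Lp_norm \<mu> p1) (Lp_space \<mu> p2) (Lp_norm \<mu> p2) T \<and>
           (\<forall>f\<in>smooth_funs n \<A>. \<forall>\<phi>\<in>smooth_funs n \<A>. A f \<phi> = fun_distribution \<mu> (T f) \<phi>)"
proof -
  define N where "N \<xi> = Lp_norm \<mu> p2 (\<lambda>x. op_norm_inf (transpose_mat (\<sigma> x \<xi>)))" for \<xi>
  define w where "w \<xi> = real (rep_dim e \<xi>) powr (2 + r / min 2 p1) * N \<xi> powr r" for \<xi>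
  \<comment> \<open>Summability forces all but countably many weights to vanish, so restricting to
    nonzero weights makes the index set enumerable. The discarded \<xi> have a null symbol.\<close>
  define D' where "D' = {\<xi>\<in>D. w \<xi> \<noteq> 0}"
  define I where "I = (SIGMA \<xi>:D'. {..<rep_dim e \<xi>} \<times> {..<rep_dim e \<xi>})"
  define K where "K = to_nat_on I ` I"
  define U where "U = (\<lambda>(\<xi>,i,j) f. ip f (\<lambda>x. \<xi> x $$ (i,j)))"
  \<comment> \<open>The dimension factor of Fourier inversion sits in the vectors: on an entry of
    \<xi> in \<open>D'\<close> its own functional takes the value 1 / d_\<xi>, so the series returns
    the same entry of \<xi> \<sigma>.\<close>
  define V where "V = (\<lambda>(\<xi>,i,j) x. of_nat (rep_dim e \<xi>) * (\<xi> x * \<sigma> x \<xi>) $$ (i,j))"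
  define a where "a = (\<lambda>(\<xi>, i::nat, j::nat). real (rep_dim e \<xi>) powr (1 / min 2 p1 - 1))"
  define u where "u k = (if k \<in> K then U (from_nat_into I k) else (\<lambda>f. 0))" for k
  define v where "v k = (if k \<in> K then V (from_nat_into I k) else (\<lambda>x. 0))" for k
  define \<alpha> where "\<alpha> k = (if k \<in> K then a (from_nat_into I k) else 0)" for k
  have p20: "p2 > 0" using p2 by simp
  have ws: "w summable_on D" using S by (simp add: w_def[abs_def] N_def)
  have w0: "w \<xi> \<ge> 0" for \<xi> by (simp add: w_def)
  have "countable D'" unfolding D'_def by (rule summable_countable_real[OF ws])
  then have Ic: "countable I" unfolding I_def by (intro countable_SIGMA) auto
  have \<sigma>c: "\<sigma> x \<xi> \<in> carrier_mat (rep_dim e \<xi>) (rep_dim e \<xi>)" if "\<xi> \<in> D" for \<xi> x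
    using sym that by (simp add: matrix_symbol_def)
  have bounds: "(\<lambda>x. (\<xi> x * \<sigma> x \<xi>) $$ (i,j)) \<in> Lp_space \<mu> p2"
    "Lp_norm \<mu> p2 (\<lambda>x. (\<xi> x * \<sigma> x \<xi>) $$ (i,j)) \<le> N \<xi>"
    "N \<xi> = 0 \<Longrightarrow> AE x in \<mu>. (\<xi> x * \<sigma> x \<xi>) $$ (i,j) = 0"
    if "\<xi> \<in> D" "i < rep_dim e \<xi>" "j < rep_dim e \<xi>" for \<xi> i j
    unfolding N_def
    by (rule symbol_bounds[OF D that(1) refl p2, where \<sigma>="\<lambda>x. \<sigma> x \<xi>", OF \<sigma>c[OF that(1)] Lp[OF that(1)] that(2,3)]; assumption)+
  have I_E: "\<exists>\<xi> i j. x = (\<xi>,i,j) \<and> \<xi> \<in> D \<and> i < rep_dim e \<xi> \<and> j < rep_dim e \<xi>" if "x \<in> I" for x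
    using that by (auto simp: I_def D'_def)
  have K_I: "from_nat_into I k \<in> I" if "k \<in> K" for k
    using that by (metis K_def Ic from_nat_into_to_nat_on imageE)
  have UD: "U x \<in> dual_space (Lp_space \<mu> p1) (Lp_norm \<mu> p1)"
    and UB: "f \<in> Lp_space \<mu> p1 \<Longrightarrow> cmod (U x f) \<le> a x * Lp_norm \<mu> p1 f"
    and VL: "V x \<in> Lp_space \<mu> p2" if x: "x \<in> I" for x f
  proof -
    obtain \<xi> i j where *: "x = (\<xi>,i,j)" "\<xi> \<in> D" "i < rep_dim e \<xi>" "j < rep_dim e \<xi>" using I_E[OF x] by blast
    note c = coefficient_functional[OF D *(2) refl p1 *(3,4)]
    show "U x \<in> dual_space (Lp_space \<mu> p1) (Lp_norm \<mu> p1)" using c(1) by (simp add: * U_def)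
    show "f \<in> Lp_space \<mu> p1 \<Longrightarrow> cmod (U x f) \<le> a x * Lp_norm \<mu> p1 f" using c(2) by (simp add: * U_def a_def)
    show "V x \<in> Lp_space \<mu> p2" unfolding *(1) V_def prod.case by (rule Lp_space_scale[OF p20 bounds(1)[OF *(2-4)]])
  qed
  have "(\<lambda>x. (a x * Lp_norm \<mu> p2 (V x)) powr r) summable_on I"
    unfolding I_def
  proof (rule summable_on_coefficient_indices[OF ws w0])
    show "D' \<subseteq> D" by (auto simp: D'_def)
    fix \<xi> i j assume "\<xi> \<in> D'" and ij: "i < rep_dim e \<xi>" "j < rep_dim e \<xi>"
    then have \<xi>: "\<xi> \<in> D" by (simp add: D'_def)
    let ?d = "real (rep_dim e \<xi>)"
    have d: "?d > 0" using ij by simp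
    have "Lp_norm \<mu> p2 (V (\<xi>,i,j)) = ?d * Lp_norm \<mu> p2 (\<lambda>x. (\<xi> x * \<sigma> x \<xi>) $$ (i,j))"
      unfolding V_def prod.case by (subst Lp_norm_scale[OF p20]) simp
    also have "\<dots> \<le> ?d * N \<xi>" using bounds(2)[OF \<xi> ij] by (intro mult_left_mono) auto
    finally have le: "a (\<xi>,i,j) * Lp_norm \<mu> p2 (V (\<xi>,i,j)) \<le> a (\<xi>,i,j) * (?d * N \<xi>)"
      by (rule mult_left_mono) (simp add: a_def)
    \<comment> \<open>The dimension factor of \<open>V\<close> raises the exponent of the functional
      by one.\<close>
    have eq: "a (\<xi>,i,j) * (?d * N \<xi>) = ?d powr (1 / min 2 p1) * N \<xi>"
      using d by (simp add: a_def powr_diff)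
    have "(a (\<xi>,i,j) * Lp_norm \<mu> p2 (V (\<xi>,i,j))) powr r \<le> (?d powr (1 / min 2 p1) * N \<xi>) powr r"
    proof (rule powr_mono2)
      show "a (\<xi>,i,j) * Lp_norm \<mu> p2 (V (\<xi>,i,j)) \<le> ?d powr (1 / min 2 p1) * N \<xi>" using le by (simp only: eq)
    qed (use r in \<open>auto simp: a_def\<close>)
    also have "\<dots> = ?d powr (r / min 2 p1) * N \<xi> powr r"
      by (simp add: powr_mult powr_powr N_def)
    finally have "?d ^ 2 * (a (\<xi>,i,j) * Lp_norm \<mu> p2 (V (\<xi>,i,j))) powr r \<le> ?d ^ 2 * (?d powr (r / min 2 p1) * N \<xi> powr r)"
      by (rule mult_left_mono) simp
    also have "\<dots> = w \<xi>"
      using d by (simp add: w_def powr_add)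
    finally show "0 \<le> (a (\<xi>,i,j) * Lp_norm \<mu> p2 (V (\<xi>,i,j))) powr r \<and> ?d ^ 2 * (a (\<xi>,i,j) * Lp_norm \<mu> p2 (V (\<xi>,i,j))) powr r \<le> w \<xi>"
      by simp
  qed
  then have "summable (\<lambda>k. if k \<in> K then (a (from_nat_into I k) * Lp_norm \<mu> p2 (V (from_nat_into I k))) powr r else 0)"
    unfolding K_def by (rule summable_enumeration[OF Ic]) simp
  also have "(\<lambda>k. if k \<in> K then (a (from_nat_into I k) * Lp_norm \<mu> p2 (V (from_nat_into I k))) powr r else 0)
      = (\<lambda>k. (\<alpha> k * Lp_norm \<mu> p2 (v k)) powr r)"
    by (auto simp: \<alpha>_def v_def)
  finally have sr: "summable (\<lambda>k. (\<alpha> k * Lp_norm \<mu> p2 (v k)) powr r)" .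
  have u: "u k \<in> dual_space (Lp_space \<mu> p1) (Lp_norm \<mu> p1)" for k
    using UD[OF K_I] by (auto simp: u_def dual_space_def intro!: exI[of _ 0])
  have v: "v k \<in> Lp_space \<mu> p2" for k using VL[OF K_I] by (auto simp: v_def zero_in_Lp)
  have ub: "cmod (u k f) \<le> \<alpha> k * Lp_norm \<mu> p1 f" if "f \<in> Lp_space \<mu> p1" for k f
    using UB[OF K_I that] by (auto simp: u_def \<alpha>_def)
  have \<alpha>0: "\<alpha> k \<ge> 0" for k by (simp add: \<alpha>_def a_def split: prod.split)
  define T where "T = (\<lambda>f y. \<Sum>k. u k f * v k y)"
  have nuclear: "r_nuclear r (Lp_space \<mu> p1) (Lp_norm \<mu> p1) (Lp_space \<mu> p2) (Lp_norm \<mu> p2) T"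
    and T: "f \<in> Lp_space \<mu> p1 \<Longrightarrow> T f \<in> Lp_space \<mu> p2"
      "f \<in> Lp_space \<mu> p1 \<Longrightarrow> (\<lambda>m. Lp_norm \<mu> p2 (\<lambda>y. T f y - (\<Sum>k<m. u k f * v k y))) \<longlonglongrightarrow> 0"
    and s1: "summable (\<lambda>k. \<alpha> k * Lp_norm \<mu> p2 (v k))" for f
    unfolding T_def by (rule r_nuclear_series[OF r p1 p2 u v ub \<alpha>0 sr]; assumption)+
  have agree: "A f \<psi> = fun_distribution \<mu> (T f) \<psi>" if f: "f \<in> smooth_funs n \<A>" and \<psi>: "\<psi> \<in> smooth_funs n \<A>" for f \<psi>
  proof -
    define B where "B h = (\<integral>x. T h x * \<psi> x \<partial>\<mu>)" for h
    define b where "b k = (\<integral>x. v k x * \<psi> x \<partial>\<mu>)" for k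
    have \<psi>c: "continuous_on UNIV \<psi>" by (rule smooth_cont[OF \<psi>])
    obtain M where M: "M > 0" "\<And>x. cmod (\<psi> x) \<le> M" using cont_bound[OF \<psi>c] by blast
    have pair: "integrable \<mu> (\<lambda>x. g x * \<psi> x)" "cmod (\<integral>x. g x * \<psi> x \<partial>\<mu>) \<le> M * Lp_norm \<mu> p2 g"
      if g: "g \<in> Lp_space \<mu> p2" for g
    proof -
      have gi: "integrable \<mu> g" by (rule L1_le_Lp(1)[OF p2 g])
      have le: "cmod (g x * \<psi> x) \<le> M * cmod (g x)" for x
        using M(2)[of x] by (simp add: norm_mult mult.commute mult_right_mono)
      have gM: "integrable \<mu> (\<lambda>x. M * cmod (g x))" using gi by simp
      show "integrable \<mu> (\<lambda>x. g x * \<psi> x)"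
      proof (rule Bochner_Integration.integrable_bound[OF gM])
        show "(\<lambda>x. g x * \<psi> x) \<in> borel_measurable \<mu>"
          by (intro borel_measurable_times borel_measurable_integrable[OF gi] cont_measurable[OF \<psi>c])
      qed (use le M in auto)
      then have "(\<integral>x. cmod (g x * \<psi> x) \<partial>\<mu>) \<le> (\<integral>x. M * cmod (g x) \<partial>\<mu>)"
        by (intro integral_mono integrable_norm gM le)
      then have "cmod (\<integral>x. g x * \<psi> x \<partial>\<mu>) \<le> (\<integral>x. M * cmod (g x) \<partial>\<mu>)"
        using integral_norm_bound[of \<mu> "\<lambda>x. g x * \<psi> x"] by linarith
      also have "\<dots> = M * (\<integral>x. cmod (g x) \<partial>\<mu>)" by simp
      also have "\<dots> \<le> M * Lp_norm \<mu> p2 g" using L1_le_Lp(2)[OF p2 g] M by simp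
      finally show "cmod (\<integral>x. g x * \<psi> x \<partial>\<mu>) \<le> M * Lp_norm \<mu> p2 g" .
    qed
    \<comment> \<open>Pairing with the bounded \<psi> is continuous for the seminorm of exponent
      \<open>p2\<close>, so the series may be paired term by term.\<close>
    have Bsums: "(\<lambda>k. u k h * b k) sums B h" if h: "h \<in> Lp_space \<mu> p1" for h
      unfolding sums_def
    proof (rule LIM_zero_cancel, rule Lim_null_comparison[OF always_eventually])
      let ?S = "\<lambda>m y. \<Sum>k<m. u k h * v k y"
      have SL: "?S m \<in> Lp_space \<mu> p2" for m by (intro Lp_space_sum p2 Lp_space_scale[OF p20 v])
      have dL: "(\<lambda>y. T h y - ?S m y) \<in> Lp_space \<mu> p2" for m
        using Lp_space_add[OF p2 T(1)[OF h] Lp_space_scale[OF p20 SL, of "-1" m]] by simp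
      show "(\<lambda>m. M * Lp_norm \<mu> p2 (\<lambda>y. T h y - ?S m y)) \<longlonglongrightarrow> 0"
        using tendsto_mult_left[OF T(2)[OF h], of M] by simp
      show "\<forall>m. norm ((\<Sum>k<m. u k h * b k) - B h) \<le> M * Lp_norm \<mu> p2 (\<lambda>y. T h y - ?S m y)"
      proof
        fix m
        have "(\<Sum>k<m. u k h * b k) = (\<Sum>k<m. (\<integral>x. u k h * (v k x * \<psi> x) \<partial>\<mu>))"
          by (simp add: b_def)
        also have "\<dots> = (\<integral>x. (\<Sum>k<m. u k h * (v k x * \<psi> x)) \<partial>\<mu>)"
          by (rule Bochner_Integration.integral_sum[symmetric]) (intro integrable_mult_right pair(1) v)
        also have "\<dots> = (\<integral>x. ?S m x * \<psi> x \<partial>\<mu>)" by (simp add: sum_distrib_right mult.assoc)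
        finally have "B h - (\<Sum>k<m. u k h * b k) = (\<integral>x. (T h x - ?S m x) * \<psi> x \<partial>\<mu>)"
          unfolding B_def left_diff_distrib
          by (simp only: Bochner_Integration.integral_diff[OF pair(1)[OF T(1)[OF h]] pair(1)[OF SL]])
        then show "norm ((\<Sum>k<m. u k h * b k) - B h) \<le> M * Lp_norm \<mu> p2 (\<lambda>y. T h y - ?S m y)"
          using pair(2)[OF dL[of m]] by (simp only: norm_minus_commute)
      qed
    qed
    have bk: "cmod (b k) \<le> M * Lp_norm \<mu> p2 (v k)" for k unfolding b_def by (rule pair(2)[OF v])
    have sM: "summable (\<lambda>k. M * (\<alpha> k * Lp_norm \<mu> p2 (v k)) * c)" for c
      by (intro summable_mult summable_mult2 s1)
    have cLp: "h \<in> Lp_space \<mu> p1" if "continuous_on UNIV h" for h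
      using cont_bound[OF that] cont_Lp(1)[OF p1 that] by blast
    have "A f \<psi> = B f"
    proof (rule agree_of_coefficients[OF D A \<psi> _ _ _ f])
      fix f g :: "'g \<Rightarrow> complex" and s t :: complex assume "continuous_on UNIV f" "continuous_on UNIV g"
      then have fg: "f \<in> Lp_space \<mu> p1" "g \<in> Lp_space \<mu> p1" by (simp_all add: cLp)
      then have sfg: "(\<lambda>x. s * f x + t * g x) \<in> Lp_space \<mu> p1"
        using p1 by (intro Lp_space_add Lp_space_scale) auto
      have "u k (\<lambda>x. s * f x + t * g x) = s * u k f + t * u k g" for k
        using u[of k] fg by (simp add: dual_space_def)
      then have "(\<lambda>k. s * (u k f * b k) + t * (u k g * b k)) sums B (\<lambda>x. s * f x + t * g x)"
        using Bsums[OF sfg] by (simp add: distrib_right mult.assoc)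
      moreover have "(\<lambda>k. s * (u k f * b k) + t * (u k g * b k)) sums (s * B f + t * B g)"
        by (intro sums_add sums_mult Bsums fg)
      ultimately show "B (\<lambda>x. s * f x + t * g x) = s * B f + t * B g" by (rule sums_unique2)
    next
      \<comment> \<open>A bound by the supremum norm follows from the nuclear series itself: the
        terms are dominated by the summable products of \<alpha> with the norms of the
        vectors.\<close>
      fix h :: "'g \<Rightarrow> complex" and c :: real assume h: "continuous_on UNIV h" and hc: "\<And>x. cmod (h x) \<le> c"
      have le: "norm (u k h * b k) \<le> M * (\<alpha> k * Lp_norm \<mu> p2 (v k)) * c" for k
      proof -
        have "cmod (u k h) \<le> \<alpha> k * c"
          using ub[OF cLp[OF h], of k] mult_left_mono[OF cont_Lp(2)[OF p1 h hc] \<alpha>0[of k]] by linarith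
        then have "cmod (u k h) * cmod (b k) \<le> (\<alpha> k * c) * (M * Lp_norm \<mu> p2 (v k))"
          using bk[of k] by (intro mult_mono') auto
        then show ?thesis by (simp add: norm_mult mult_ac)
      qed
      have "cmod (B h) \<le> (\<Sum>k. M * (\<alpha> k * Lp_norm \<mu> p2 (v k)) * c)"
        unfolding sums_unique[OF Bsums[OF cLp[OF h]]] by (rule norm_suminf_le[OF le sM])
      also have "\<dots> = (\<Sum>k. M * (\<alpha> k * Lp_norm \<mu> p2 (v k))) * c"
        using sM[of 1] by (simp add: suminf_mult2)
      finally show "cmod (B h) \<le> (\<Sum>k. M * (\<alpha> k * Lp_norm \<mu> p2 (v k))) * c" .
    next
      fix \<xi> i j assume \<xi>: "\<xi> \<in> D" and ij: "i < rep_dim e \<xi>" "j < rep_dim e \<xi>"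
        and sm: "\<And>i j. i < rep_dim e \<xi> \<Longrightarrow> j < rep_dim e \<xi> \<Longrightarrow> (\<lambda>x. \<xi> x $$ (i,j)) \<in> smooth_funs n \<A>"
      let ?h = "\<lambda>x. \<xi> x $$ (i,j)"
      let ?J = "\<integral>x. (\<xi> x * \<sigma> x \<xi>) $$ (i,j) * \<psi> x \<partial>\<mu>"
      \<comment> \<open>By Schur orthogonality an entry of \<xi> is seen by at most one term of the
        series.\<close>
      have uk: "u k ?h = (if k \<in> K \<and> from_nat_into I k = (\<xi>,i,j) then 1 / of_nat (rep_dim e \<xi>) else 0)" for k
      proof (cases "k \<in> K")
        case True
        obtain \<eta> l m where *: "from_nat_into I k = (\<eta>,l,m)" "\<eta> \<in> D" "l < rep_dim e \<eta>" "m < rep_dim e \<eta>"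
          using I_E[OF K_I[OF True]] by blast
        show ?thesis using True Schur_orthogonality[OF D \<xi> *(2) ij *(3,4)] by (auto simp: u_def U_def *)
      qed (simp add: u_def)
      have "B ?h = ?J"
      proof (cases "\<xi> \<in> D'")
        case True
        then have x: "(\<xi>,i,j) \<in> I" using ij by (simp add: I_def)
        let ?k = "to_nat_on I (\<xi>,i,j)"
        have k: "?k \<in> K" "from_nat_into I ?k = (\<xi>,i,j)" using x Ic by (auto simp: K_def)
        have only: "u k ?h * b k = (if k = ?k then ?J else 0)" for k
        proof (cases "k = ?k")
          case True
          have "b ?k = of_nat (rep_dim e \<xi>) * ?J"
            unfolding b_def v_def using k by (simp add: V_def mult.assoc)
          then show ?thesis unfolding True uk using k ij by simp
        next
          case False
          have "from_nat_into I k \<noteq> (\<xi>,i,j)" if "k \<in> K"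
            using that False Ic unfolding K_def by auto
          then show ?thesis using False by (cases "k \<in> K") (simp_all add: uk)
        qed
        have "(\<lambda>k. if k = ?k then ?J else 0) sums B ?h"
          using Bsums[OF cLp[OF smooth_cont[OF sm[OF ij]]]] unfolding only .
        then show ?thesis using sums_single[of ?k "\<lambda>_. ?J"] by (rule sums_unique2)
      next
        \<comment> \<open>The series has no term for \<xi>, so \<open>B\<close> vanishes on its
          coefficients. Consistently, the weight 0 of \<xi> forces its symbol to vanish almost
          everywhere.\<close>
        case False
        then have "from_nat_into I k \<noteq> (\<xi>,i,j)" if "k \<in> K" for k
          using K_I[OF that] by (auto simp: I_def)
        then have z: "u k ?h * b k = 0" for k by (cases "k \<in> K") (simp_all add: uk)
        have "(\<lambda>k. 0) sums B ?h" using Bsums[OF cLp[OF smooth_cont[OF sm[OF ij]]]] unfolding z .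
        then have B0: "B ?h = 0" using sums_zero by (rule sums_unique2)
        have "N \<xi> = 0" using False \<xi> ij by (auto simp: D'_def w_def)
        from bounds(3)[OF \<xi> ij this] have "AE x in \<mu>. (\<xi> x * \<sigma> x \<xi>) $$ (i,j) * \<psi> x = 0"
          by eventually_elim simp
        then have "?J = 0" by (rule integral_eq_zero_AE)
        then show ?thesis using B0 by simp
      qed
      then show "A ?h \<psi> = B ?h"
        by (simp only: operator_on_coefficient[OF D A sym \<psi> \<xi> refl ij sm])
    qed
    then show ?thesis by (simp add: B_def fun_distribution_def)
  qed
  show ?thesis using nuclear agree by blast
qed

end

theorem theorem3p7:
  fixes mul :: "'g::{t2_space, second_countable_topology} \<Rightarrow> 'g \<Rightarrow> 'g"
    and e :: 'g and iv :: "'g \<Rightarrow> 'g"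
    and n :: nat and \<A> :: "'g atlas" and \<mu> :: "'g measure"
    and D :: "('g \<Rightarrow> complex mat) set"
    and A :: "('g \<Rightarrow> complex) \<Rightarrow> ('g \<Rightarrow> complex) \<Rightarrow> complex"
    and \<sigma> :: "'g \<Rightarrow> ('g \<Rightarrow> complex mat) \<Rightarrow> complex mat"
    and r p1 p2 :: real
  assumes "compact_lie_group mul e iv n \<A>"
    and "normalised_haar mul \<mu>"
    and "unitary_dual mul e D"
    and "0 < r" "r \<le> 1"
    and "1 \<le> p1" "1 \<le> p2"
    and "continuous_linear_operator n \<A> A"
    and "matrix_symbol \<mu> n \<A> e D A \<sigma>"
    and "\<And>\<xi> i j. \<xi> \<in> D \<Longrightarrow> i < rep_dim e \<xi> \<Longrightarrow> j < rep_dim e \<xi> \<Longrightarrow>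
           (\<lambda>x. \<sigma> x \<xi> $$ (i,j)) \<in> Lp_space \<mu> p2"
    and "(\<lambda>\<xi>. real (rep_dim e \<xi>) powr (2 + r / min 2 p1) *
           Lp_norm \<mu> p2 (\<lambda>x. op_norm_inf (transpose_mat (\<sigma> x \<xi>))) powr r) summable_on D"
  shows "\<exists>T. r_nuclear r (Lp_space \<mu> p1) (Lp_norm \<mu> p1) (Lp_space \<mu> p2) (Lp_norm \<mu> p2) T \<and>
           (\<forall>f\<in>smooth_funs n \<A>. \<forall>\<phi>\<in>smooth_funs n \<A>. A f \<phi> = fun_distribution \<mu> (T f) \<phi>)"
proof -
  interpret L: compact_lie_group mul e iv n \<A> by (rule assms(1))
  have "haar_group mul e iv \<mu>"
  proof (intro haar_group.intro haar_group_axioms.intro)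
    show "continuous_on UNIV (\<lambda>(x,y). mul x y)" using L.smooth_mul unfolding smooth_map_def by (rule conjunct1)
    show "continuous_on UNIV iv" using L.smooth_iv unfolding smooth_map_def by (rule conjunct1)
    show "sets \<mu> = sets borel" "prob_space \<mu>" "\<And>a. distr \<mu> \<mu> (mul a) = \<mu>"
      using assms(2) by (simp_all add: normalised_haar_def)
  qed (rule L.group_axioms L.compact_UNIV)+
  then interpret haar_lie_group mul e iv \<mu> n \<A>
    by (rule haar_lie_group.intro[OF _ assms(1)])
  show ?thesis by (rule nuclear_extension[OF assms(3-)])
qed

end
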